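(* Let $4\leq N\leq 6$, let $B^N$ be the open unit ball of $\mathbb{R}^N$, and let $W:(-\infty,1]\to[0,\infty)$ be a $C^2$ non-negative convex function with $W(0)=0$. For every $\varepsilon>0$, the radially symmetric vortex solution $U_\varepsilon(x)=f_\varepsilon(|x|)\frac{x}{|x|}$ is the unique minimizer of $$E^{GL}_\varepsilon[U]=\int_{B^N}\Big[\tfrac12|\nabla U|^2+\tfrac{1}{2\varepsilon^2}W(1-|U|^2)\Big]\,dx$$ over the set of gradient fields $\{U=\nabla u\in\mathcal{A}^{GL}\}$, where $\mathcal{A}^{GL}=\{U\in H^1(B^N,\mathbb{R}^N): U(x)=x\text{ on }\partial B^N\}$.
   Context: The profile $f_\varepsilon$ is the unique solution on $(0,1)$ of the boundary value problem $$-f_\varepsilon''-\frac{N-1}{r}f_\varepsilon'+\frac{N-1}{r^2}f_\varepsilon=\frac{1}{\varepsilon^2}f_\varepsilon W'(1-f_\varepsilon^2),\qquad f_\varepsilon(0)=0,\ f_\varepsilon(1)=1.$$ (Existence and uniqueness of $f_\varepsilon$ are known; moreover $f_\varepsilon>0$ and $f_\varepsilon'>0$ in $(0,1)$.) The map $U_\varepsilon\in\mathcal{A}^{GL}$ is a gradient field, $U_\varepsilon=\nabla u_\varepsilon$ with $u_\varepsilon$ radial and $u_\varepsilon'=f_\varepsilon$. Boundary values are understood in the sense of traces. *)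

theory Defs
  imports "HOL-Analysis.Analysis"
begin

section \<open>Test functions\<close>

definition pderiv_at :: "'n::finite \<Rightarrow> (real^'n \<Rightarrow> real) \<Rightarrow> real^'n \<Rightarrow> real" where
  "pderiv_at j \<phi> x = frechet_derivative \<phi> (at x) (axis j 1)"

primrec Ck :: "nat \<Rightarrow> (real^'n::finite \<Rightarrow> real) \<Rightarrow> bool" where
  "Ck 0 \<phi> \<longleftrightarrow> continuous_on UNIV \<phi>"
| "Ck (Suc k) \<phi> \<longleftrightarrow> (\<forall>x. \<phi> differentiable (at x)) \<and> (\<forall>j. Ck k (pderiv_at j \<phi>))"

definition smooth :: "(real^'n::finite \<Rightarrow> real) \<Rightarrow> bool" where
  "smooth \<phi> \<longleftrightarrow> (\<forall>k. Ck k \<phi>)"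

definition test_function :: "(real^'n::finite) set \<Rightarrow> (real^'n \<Rightarrow> real) \<Rightarrow> bool" where
  "test_function \<Omega> \<phi> \<longleftrightarrow>
     smooth \<phi> \<and> compact (closure {x. \<phi> x \<noteq> 0}) \<and> closure {x. \<phi> x \<noteq> 0} \<subseteq> \<Omega>"

section \<open>Weak derivatives and the Sobolev space of order one\<close>

definition locally_integrable :: "(real^'n::finite) set \<Rightarrow> (real^'n \<Rightarrow> real) \<Rightarrow> bool" where
  "locally_integrable \<Omega> u \<longleftrightarrow> (\<forall>K. compact K \<and> K \<subseteq> \<Omega> \<longrightarrow> set_integrable lebesgue K u)"

definition has_weak_pderiv ::
    "(real^'n::finite) set \<Rightarrow> 'n \<Rightarrow> (real^'n \<Rightarrow> real) \<Rightarrow> (real^'n \<Rightarrow> real) \<Rightarrow> bool" where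
  "has_weak_pderiv \<Omega> j u g \<longleftrightarrow> locally_integrable \<Omega> u \<and> locally_integrable \<Omega> g \<and>
     (\<forall>\<phi>. test_function \<Omega> \<phi> \<longrightarrow>
        (LINT x:\<Omega>|lebesgue. u x * pderiv_at j \<phi> x) = - (LINT x:\<Omega>|lebesgue. g x * \<phi> x))"

definition has_weak_gradient ::
    "(real^'n::finite) set \<Rightarrow> (real^'n \<Rightarrow> real) \<Rightarrow> (real^'n \<Rightarrow> real^'n) \<Rightarrow> bool" where
  "has_weak_gradient \<Omega> u U \<longleftrightarrow> (\<forall>j. has_weak_pderiv \<Omega> j u (\<lambda>x. U x $ j))"

definition gradient_field :: "(real^'n::finite) set \<Rightarrow> (real^'n \<Rightarrow> real^'n) \<Rightarrow> bool" where
  "gradient_field \<Omega> U \<longleftrightarrow> (\<exists>u. has_weak_gradient \<Omega> u U)"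

definition has_weak_jacobian ::
    "(real^'n::finite) set \<Rightarrow> (real^'n \<Rightarrow> real^'n) \<Rightarrow> (real^'n \<Rightarrow> real^'n^'n) \<Rightarrow> bool" where
  "has_weak_jacobian \<Omega> U G \<longleftrightarrow> (\<forall>i. has_weak_gradient \<Omega> (\<lambda>x. U x $ i) (\<lambda>x. G x $ i))"

text \<open>The weak Jacobian is determined up to a null set, and it is only used under integrals.\<close>

definition weak_jacobian ::
    "(real^'n::finite) set \<Rightarrow> (real^'n \<Rightarrow> real^'n) \<Rightarrow> real^'n \<Rightarrow> real^'n^'n" where
  "weak_jacobian \<Omega> U = (SOME G. has_weak_jacobian \<Omega> U G)"

definition L2 :: "(real^'n::finite) set \<Rightarrow> (real^'n \<Rightarrow> 'b::euclidean_space) \<Rightarrow> bool" where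
  "L2 \<Omega> u \<longleftrightarrow> u \<in> borel_measurable (lebesgue_on \<Omega>) \<and>
     integrable (lebesgue_on \<Omega>) (\<lambda>x. (norm (u x))\<^sup>2)"

definition H1 :: "(real^'n::finite) set \<Rightarrow> (real^'n \<Rightarrow> real^'n) \<Rightarrow> bool" where
  "H1 \<Omega> U \<longleftrightarrow> L2 \<Omega> U \<and> (\<exists>G. has_weak_jacobian \<Omega> U G \<and> L2 \<Omega> G)"

text \<open>The norm on \<^typ>\<open>real^'n^'n\<close> is the Frobenius norm.\<close>

definition H1_norm_sq :: "(real^'n::finite) set \<Rightarrow> (real^'n \<Rightarrow> real^'n) \<Rightarrow> ennreal" where
  "H1_norm_sq \<Omega> U =
     (\<integral>\<^sup>+x. ennreal ((norm (U x))\<^sup>2 + (norm (weak_jacobian \<Omega> U x))\<^sup>2) \<partial>lebesgue_on \<Omega>)"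

section \<open>Traces on the unit sphere\<close>

text \<open>Surface measure: \<open>\<sigma>(A)\<close> is \<open>N\<close> times the volume of the cone
  \<open>{x \<in> B. x / |x| \<in> A}\<close>. The origin is a null set, so \<open>sgn 0 = 0\<close> does not matter.\<close>

definition sphere_measure :: "(real^'n::finite) measure" where
  "sphere_measure =
     distr (scale_measure (of_nat CARD('n)) (lebesgue_on (ball 0 1))) borel sgn"

text \<open>The trace operator is the continuous extension to \<open>H1\<close>, with values in \<open>L2\<close> of the sphere,
  of the restriction map on functions that are smooth up to the boundary. The following relation
  is the graph of this operator.\<close>

definition has_trace :: "(real^'n::finite \<Rightarrow> real^'n) \<Rightarrow> (real^'n \<Rightarrow> real^'n) \<Rightarrow> bool" where
  "has_trace U g \<longleftrightarrow> H1 (ball 0 1) U \<and> g \<in> borel_measurable borel \<and>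
     (\<exists>\<Phi> :: nat \<Rightarrow> real^'n \<Rightarrow> real^'n.
        (\<forall>k i. smooth (\<lambda>x. \<Phi> k x $ i)) \<and>
        (\<lambda>k. H1_norm_sq (ball 0 1) (\<lambda>x. \<Phi> k x - U x)) \<longlonglongrightarrow> 0 \<and>
        (\<lambda>k. \<integral>\<^sup>+x. ennreal ((norm (\<Phi> k x - g x))\<^sup>2) \<partial>sphere_measure) \<longlonglongrightarrow> 0)"

section \<open>The Ginzburg-Landau problem\<close>

definition A_GL :: "(real^'n::finite \<Rightarrow> real^'n) set" where
  "A_GL = {U. H1 (ball 0 1) U \<and> has_trace U (\<lambda>x. x)}"

text \<open>For \<open>W \<ge> 0\<close> on \<open>(-\<infinity>, 1]\<close> the integrand is non-negative; the energy may be infinite.\<close>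

definition E_GL :: "(real \<Rightarrow> real) \<Rightarrow> real \<Rightarrow> (real^'n::finite \<Rightarrow> real^'n) \<Rightarrow> ennreal" where
  "E_GL W \<epsilon> U =
     (\<integral>\<^sup>+x. ennreal (1/2 * (norm (weak_jacobian (ball 0 1) U x))\<^sup>2
                     + 1 / (2 * \<epsilon>\<^sup>2) * W (1 - (norm (U x))\<^sup>2)) \<partial>lebesgue_on (ball 0 1))"

text \<open>Elements of the class are identified when they agree almost everywhere in the ball.\<close>

definition unique_minimizer ::
    "((real^'n::finite \<Rightarrow> real^'n) \<Rightarrow> ennreal) \<Rightarrow> (real^'n \<Rightarrow> real^'n) set \<Rightarrow> (real^'n \<Rightarrow> real^'n) \<Rightarrow> bool"
  where
  "unique_minimizer E S U \<longleftrightarrow> U \<in> S \<and> (\<forall>V\<in>S. E U \<le> E V) \<and>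
     (\<forall>V\<in>S. E V = E U \<longrightarrow> (AE x in lebesgue_on (ball 0 1). V x = U x))"

text \<open>The boundary value problem for the radial profile in dimension \<open>N\<close>, where \<open>W'\<close> is the
  derivative of the potential.\<close>

definition vortex_profile :: "nat \<Rightarrow> (real \<Rightarrow> real) \<Rightarrow> real \<Rightarrow> (real \<Rightarrow> real) \<Rightarrow> bool" where
  "vortex_profile N W' \<epsilon> f \<longleftrightarrow> continuous_on {0..1} f \<and> f 0 = 0 \<and> f 1 = 1 \<and>
     (\<exists>f' f''. \<forall>r\<in>{0<..<1}.
        (f has_real_derivative f' r) (at r) \<and> (f' has_real_derivative f'' r) (at r) \<and>
        - f'' r - (real N - 1) / r * f' r + (real N - 1) / r\<^sup>2 * f r
          = 1 / \<epsilon>\<^sup>2 * f r * W' (1 - (f r)\<^sup>2))"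

definition vortex :: "(real \<Rightarrow> real) \<Rightarrow> real^'n::finite \<Rightarrow> real^'n" where
  "vortex f x = f (norm x) *\<^sub>R (x /\<^sub>R norm x)"

end

theory Submission
  imports Defs
begin

text \<open>Let \<open>V\<close> be the difference of a competitor and the vortex. By the tangent inequality for the convex
  potential and the Euler-Lagrange equation of the vortex, the energy gap is at least half of
  \<open>\<integral> |DV|\<^sup>2 - c |V|\<^sup>2\<close> with \<open>c = W'(1 - f\<^sup>2) / \<epsilon>\<^sup>2\<close>, so it suffices to bound this quadratic form from below by
  \<open>\<integral> |V|\<^sup>2\<close> on gradient fields with zero boundary values. By mollification \<open>V\<close> may be taken smooth with
  compact support and symmetric Jacobian \<open>A\<close>. Put \<open>n = x / |x|\<close>, \<open>a = V \<bullet> n\<close>, \<open>b = V - a n\<close>, \<open>w = A n\<close>. The divergence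
  theorem for fields singular at the origin allows to add to \<open>|A|\<^sup>2\<close> the divergences of suitable fields, among
  them radial weights times \<open>|V|\<^sup>2\<close> and \<open>|b|\<^sup>2\<close>. What remains is a sum of squares plus one-dimensional Hardy-type
  terms, which the weights \<open>r\<^sup>\<alpha> / f\<close> and \<open>r\<^sup>\<alpha> / (2 - r\<^sup>2)\<close> with \<open>\<alpha> = (N - 2) / 2\<close> control; this uses
  \<open>0 \<le> r f' \<le> f\<close> and \<open>N \<ge> 4\<close>.\<close>

subsection \<open>Smooth functions\<close>

text \<open>Symmetry of \<open>A\<close> gives |A|^2 = T + |w|^2 + |w - m n|^2, where m = w
  \<bullet> n and T is the squared norm of the tangential block of \<open>A\<close>. The radial
  derivative is thus available twice: against all of \<open>V\<close>, and once more against
  \<open>b\<close>. With D the trace of the block, T \<ge> D^2 / (N-1), and the divergence of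
  \<open>Z\<close> / (N-2) - \<open>Y\<close> exchanges this angular part for ((N-1) a^2 + (N-3)
  |b|^2) / r^2. The first Hardy weight involves \<open>f\<close> because \<open>f\<close> itself
  solves the radial equation with potential c - (N-1) / r^2. The balance leaves the coefficients
  \<alpha>^2 / r^2 - 1 of a^2 and (2 \<alpha>^2 - 2) / r^2 + 1 of |b|^2; they are non-negative
  because N \<ge> 4 means \<alpha> \<ge> 1. Two obstacles shape the rest. The boundary condition is
  given only through limits of smooth fields, so the divergence theorem is proved with an estimate
  of the boundary term in place of a surface integral. And the profile is given only by its boundary
  value problem, so 0 < f \<le> 1, monotonicity and r f' \<le> f must be derived from the
  equation.\<close>

lemma smooth_differentiable: "smooth \<phi> \<Longrightarrow> \<phi> differentiable (at x)"
  unfolding smooth_def by (metis Ck.simps(2))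

lemma smooth_pderiv: "smooth \<phi> \<Longrightarrow> smooth (pderiv_at j \<phi>)"
  unfolding smooth_def by (metis Ck.simps(2))

lemma smooth_cont: "smooth \<phi> \<Longrightarrow> continuous_on S \<phi>"
  unfolding smooth_def by (metis Ck.simps(1) continuous_on_subset subset_UNIV)

lemma smooth_borel: "smooth \<phi> \<Longrightarrow> \<phi> \<in> borel_measurable borel"
  by (intro borel_measurable_continuous_onI smooth_cont)

lemma pderiv_atI: "(\<phi> has_derivative \<phi>') (at x) \<Longrightarrow> pderiv_at j \<phi> x = \<phi>' (axis j 1)"
  unfolding pderiv_at_def by (metis frechet_derivative_at)

lemma linear_axis_expand:
  fixes l :: "real^'n::finite \<Rightarrow> real"
  assumes "linear l"
  shows "l h = (\<Sum>j\<in>UNIV. h $ j * l (axis j 1))"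
proof -
  have "l h = l (\<Sum>j\<in>UNIV. h $ j *\<^sub>R axis j 1)" by (metis basis_expansion scalar_mult_eq_scaleR)
  also have "\<dots> = (\<Sum>j\<in>UNIV. h $ j * l (axis j 1))"
    using assms by (simp add: linear_sum linear_cmul)
  finally show ?thesis .
qed

lemma sum_axis: "(\<Sum>i\<in>UNIV. axis j (1::real) $ i * g i) = g (j::'n::finite)"
proof -
  have "(\<Sum>i\<in>UNIV. axis j (1::real) $ i * g i) = (\<Sum>i\<in>UNIV. if i = j then g i else 0)"
    by (intro sum.cong) (auto simp: axis_def)
  then show ?thesis by simp
qed

lemma pderiv_has_derivative:
  fixes \<phi> :: "real^'n::finite \<Rightarrow> real"
  assumes "\<phi> differentiable (at x)"
  shows "(\<phi> has_derivative (\<lambda>h. \<Sum>j\<in>UNIV. h $ j * pderiv_at j \<phi> x)) (at x)"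
proof -
  have d: "(\<phi> has_derivative frechet_derivative \<phi> (at x)) (at x)"
    using assms frechet_derivative_works by blast
  then have "frechet_derivative \<phi> (at x) = (\<lambda>h. \<Sum>j\<in>UNIV. h $ j * pderiv_at j \<phi> x)"
    unfolding pderiv_at_def by (intro ext linear_axis_expand has_derivative_linear)
  then show ?thesis using d by simp
qed

lemma has_derivative_pderiv_compose:
  fixes \<phi> :: "real^'n::finite \<Rightarrow> real"
  assumes "(f has_derivative f') (at t)" "\<phi> differentiable (at (f t))"
  shows "((\<lambda>t. \<phi> (f t)) has_derivative (\<lambda>s. \<Sum>j\<in>UNIV. f' s $ j * pderiv_at j \<phi> (f t))) (at t)"
  using has_derivative_compose[where g = \<phi>, OF assms(1) pderiv_has_derivative[OF assms(2)]] .

lemmas smooth_has_derivative = pderiv_has_derivative[OF smooth_differentiable]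

lemma pderiv_DERIV:
  fixes \<phi> :: "real^'n::finite \<Rightarrow> real"
  assumes "\<phi> differentiable (at (x + t *\<^sub>R axis j 1))"
  shows "((\<lambda>t. \<phi> (x + t *\<^sub>R axis j 1)) has_real_derivative pderiv_at j \<phi> (x + t *\<^sub>R axis j 1)) (at t)"
proof -
  have "((\<lambda>t. \<phi> (x + t *\<^sub>R axis j 1)) has_derivative
     (\<lambda>s. \<Sum>i\<in>UNIV. (s *\<^sub>R axis j 1 :: real^'n) $ i * pderiv_at i \<phi> (x + t *\<^sub>R axis j 1))) (at t)"
    by (rule has_derivative_pderiv_compose[where \<phi> = \<phi>]) (use assms in \<open>auto intro!: derivative_eq_intros\<close>)
  moreover have "(\<lambda>s. \<Sum>i\<in>UNIV. (s *\<^sub>R axis j 1 :: real^'n) $ i * pderiv_at i \<phi> (x + t *\<^sub>R axis j 1))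
     = (*) (pderiv_at j \<phi> (x + t *\<^sub>R axis j 1))"
    by (simp only: fun_eq_iff vector_scaleR_component real_scaleR_def mult.assoc sum_distrib_left[symmetric] sum_axis mult.commute simp_thms)
  ultimately show ?thesis by (simp add: has_field_derivative_def)
qed

text \<open>Smoothness by coinduction: \<open>Ck k\<close> is proved for all members of
  \<open>S\<close> at once, since the induction step passes from a function to its partial
  derivatives.\<close>

lemma smooth_coinduct:
  assumes "\<phi> \<in> S" and "\<And>\<phi> x. \<phi> \<in> S \<Longrightarrow> \<phi> differentiable (at x)"
    and "\<And>\<phi> j. \<phi> \<in> S \<Longrightarrow> pderiv_at j \<phi> \<in> S"
  shows "smooth \<phi>"
proof -
  have "\<forall>\<phi>\<in>S. Ck k \<phi>" for k
  proof (induction k)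
    case 0
    then show ?case
      using assms(2) by (auto intro!: differentiable_imp_continuous_on simp: differentiable_on_def intro: differentiable_at_withinI)
  qed (use assms in auto)
  then show ?thesis using assms(1) by (auto simp: smooth_def)
qed

inductive_set alg :: "(real^'n::finite \<Rightarrow> real) set \<Rightarrow> (real^'n \<Rightarrow> real) set" for G where
  gen: "g \<in> G \<Longrightarrow> g \<in> alg G"
| const: "(\<lambda>x. c) \<in> alg G"
| add: "g \<in> alg G \<Longrightarrow> h \<in> alg G \<Longrightarrow> (\<lambda>x. g x + h x) \<in> alg G"
| mult: "g \<in> alg G \<Longrightarrow> h \<in> alg G \<Longrightarrow> (\<lambda>x. g x * h x) \<in> alg G"

text \<open>Only the generators need derivatives inside the algebra; sum and product rule propagate
  this to all of \<open>alg G\<close>. This covers families such as the bump function below, where a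
  partial derivative is a polynomial in the generators and not itself a generator.\<close>

lemma alg_smooth:
  fixes G :: "(real^'n::finite \<Rightarrow> real) set"
  assumes "\<And>g x. g \<in> G \<Longrightarrow> g differentiable (at x)" "\<And>g j. g \<in> G \<Longrightarrow> pderiv_at j g \<in> alg G"
    and "\<phi> \<in> alg G"
  shows "smooth \<phi>"
proof -
  have *: "(\<forall>x. \<phi> differentiable (at x)) \<and> (\<forall>j. pderiv_at j \<phi> \<in> alg G)" if "\<phi> \<in> alg G" for \<phi>
    using that
  proof induction
    case (const c)
    have "pderiv_at j (\<lambda>x::real^'n. c) = (\<lambda>x. 0)" for j
      by (rule ext, subst pderiv_atI[where \<phi>' = "\<lambda>_. 0"]) auto
    then show ?case by (auto intro: alg.const)
  next
    case (add g h)
    have "pderiv_at j (\<lambda>x. g x + h x) = (\<lambda>x. pderiv_at j g x + pderiv_at j h x)" for j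
    proof
      fix x
      have "((\<lambda>x. g x + h x) has_derivative (\<lambda>z. (\<Sum>i\<in>UNIV. z $ i * pderiv_at i g x) + (\<Sum>i\<in>UNIV. z $ i * pderiv_at i h x))) (at x)"
        using add by (intro has_derivative_add pderiv_has_derivative) auto
      from pderiv_atI[OF this, of j] show "pderiv_at j (\<lambda>x. g x + h x) x = pderiv_at j g x + pderiv_at j h x"
        by (simp add: sum_axis mult.assoc sum_distrib_left[symmetric])
    qed
    then show ?case using add by (auto intro: alg.add)
  next
    case (mult g h)
    have "pderiv_at j (\<lambda>x. g x * h x) = (\<lambda>x. g x * pderiv_at j h x + pderiv_at j g x * h x)" for j
    proof
      fix x
      have "((\<lambda>x. g x * h x) has_derivative (\<lambda>z. g x * (\<Sum>i\<in>UNIV. z $ i * pderiv_at i h x) + (\<Sum>i\<in>UNIV. z $ i * pderiv_at i g x) * h x)) (at x)"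
        using mult by (intro has_derivative_mult pderiv_has_derivative) auto
      from pderiv_atI[OF this, of j] show "pderiv_at j (\<lambda>x. g x * h x) x = g x * pderiv_at j h x + pderiv_at j g x * h x"
        by (simp add: sum_axis mult.assoc sum_distrib_left[symmetric])
    qed
    moreover have "(\<lambda>x. g x * pderiv_at j h x + pderiv_at j g x * h x) \<in> alg G" for j
      by (intro alg.add alg.mult) (use mult in auto)
    ultimately show ?case using mult by (auto intro: differentiable_mult)
  qed (use assms in auto)
  show ?thesis by (rule smooth_coinduct[OF assms(3)]) (use * in auto)
qed

lemma pderiv_diff:
  assumes "g differentiable (at x)" "h differentiable (at x)"
  shows "pderiv_at j (\<lambda>x. g x - h x) x = pderiv_at j g x - pderiv_at j h x"
  using pderiv_atI[OF has_derivative_diff[OF assms[THEN pderiv_has_derivative]], of j]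
  by (simp add: sum_axis mult.assoc sum_distrib_left[symmetric])

lemma smooth_alg: "\<phi> \<in> alg (Collect smooth) \<Longrightarrow> smooth \<phi>"
  by (erule alg_smooth[rotated 2]) (auto intro: smooth_differentiable alg.gen smooth_pderiv)

lemma smooth_const: "smooth (\<lambda>x. c)"
  by (intro smooth_alg alg.const)

lemma smooth_add: "smooth g \<Longrightarrow> smooth h \<Longrightarrow> smooth (\<lambda>x. g x + h x)"
  by (intro smooth_alg alg.add alg.gen) auto

lemma smooth_mult: "smooth g \<Longrightarrow> smooth h \<Longrightarrow> smooth (\<lambda>x. g x * h x)"
  by (intro smooth_alg alg.mult alg.gen) auto

lemma smooth_diff: "smooth g \<Longrightarrow> smooth h \<Longrightarrow> smooth (\<lambda>x. g x - h x)"
  using smooth_add[of g "\<lambda>x. -1 * h x"] smooth_mult[OF smooth_const, of h "-1"] by simp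

lemma pderiv_coord: "pderiv_at j (\<lambda>x::real^'n::finite. x $ i) = (\<lambda>x. if i = j then 1 else 0)"
proof
  fix x :: "real^'n"
  have "((\<lambda>x. x $ i) has_derivative (\<lambda>h. h $ i)) (at x)"
    by (rule bounded_linear_imp_has_derivative) (rule bounded_linear_vec_nth)
  then show "pderiv_at j (\<lambda>x. x $ i) x = (if i = j then 1 else 0)"
    using pderiv_atI[of "\<lambda>x. x $ i" "\<lambda>h. h $ i" x j] by (simp add: axis_def)
qed

lemma differentiable_coord: "(\<lambda>x::real^'n::finite. x $ i) differentiable (at x)"
  by (rule differentiableI[where f' = "\<lambda>h. h $ i"], rule bounded_linear_imp_has_derivative, rule bounded_linear_vec_nth)

lemma smooth_coord: "smooth (\<lambda>x. x $ i)"
  by (rule alg_smooth[where G = "{\<lambda>x. x $ i}"])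
     (auto simp: pderiv_coord intro: differentiable_coord alg.intros)

lemma smooth_affine:
  fixes \<phi> :: "real^'n::finite \<Rightarrow> real"
  assumes "smooth \<phi>"
  shows "smooth (\<lambda>x. \<phi> (t *\<^sub>R x + a))"
    and "pderiv_at j (\<lambda>x. \<phi> (t *\<^sub>R x + a)) x = t * pderiv_at j \<phi> (t *\<^sub>R x + a)"
proof -
  \<comment> \<open>The scalar factor belongs to the family because every derivative contributes a
    factor \<open>t\<close>.\<close>
  define S where "S = {\<lambda>x. s * \<phi> (t *\<^sub>R x + a) | s \<phi>. smooth \<phi>}"
  have d: "((\<lambda>x. s * \<phi> (t *\<^sub>R x + a)) has_derivative
     (\<lambda>h. s * (\<Sum>i\<in>UNIV. (t *\<^sub>R h) $ i * pderiv_at i \<phi> (t *\<^sub>R x + a)))) (at x)"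
    if "smooth \<phi>" for \<phi> :: "real^'n \<Rightarrow> real" and s x
    by (intro has_derivative_mult_right has_derivative_pderiv_compose smooth_differentiable that)
       (auto intro!: derivative_eq_intros)
  have e: "pderiv_at j (\<lambda>x. s * \<phi> (t *\<^sub>R x + a)) x = (s * t) * pderiv_at j \<phi> (t *\<^sub>R x + a)"
    if "smooth \<phi>" for \<phi> s j x
    by (subst pderiv_atI[OF d[OF that]])
       (simp add: sum_axis mult.assoc sum_distrib_left[symmetric])
  show "smooth (\<lambda>x. \<phi> (t *\<^sub>R x + a))"
  proof (rule smooth_coinduct[of _ S])
    show "(\<lambda>x. \<phi> (t *\<^sub>R x + a)) \<in> S"
      using assms unfolding S_def by (auto intro!: exI[of _ 1] exI[of _ \<phi>])
    fix \<psi> x assume "\<psi> \<in> S"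
    then show "\<psi> differentiable (at x)"
      unfolding S_def by (auto intro: differentiableI[OF d])
  next
    fix \<psi> j assume "\<psi> \<in> S"
    then obtain s \<phi> where s: "smooth \<phi>" "\<psi> = (\<lambda>x. s * \<phi> (t *\<^sub>R x + a))" unfolding S_def by auto
    have "pderiv_at j \<psi> = (\<lambda>x. (s * t) * pderiv_at j \<phi> (t *\<^sub>R x + a))"
      unfolding s(2) using e[OF s(1)] by auto
    then show "pderiv_at j \<psi> \<in> S" unfolding S_def using smooth_pderiv[OF s(1)] by blast
  qed
  show "pderiv_at j (\<lambda>x. \<phi> (t *\<^sub>R x + a)) x = t * pderiv_at j \<phi> (t *\<^sub>R x + a)"
    using e[OF assms, of j 1 x] by simp
qed

subsection \<open>Symmetry of second derivatives\<close>

text \<open>The mean value theorem twice: in direction \<open>i\<close> for the difference in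
  direction \<open>j\<close>, then in direction \<open>j\<close> for the derivative that results.
  The left side is symmetric in \<open>i\<close> and \<open>j\<close>, which is what
  \<open>pderiv_commute\<close> exploits.\<close>

lemma mixed_difference:
  fixes \<phi> :: "real^'n::finite \<Rightarrow> real"
  assumes "smooth \<phi>" "s > 0"
  shows "\<exists>p. norm (p - x) \<le> 2 * s \<and>
    \<phi> (x + s *\<^sub>R axis i 1 + s *\<^sub>R axis j 1) - \<phi> (x + s *\<^sub>R axis i 1) - \<phi> (x + s *\<^sub>R axis j 1) + \<phi> x
      = s\<^sup>2 * pderiv_at j (pderiv_at i \<phi>) p"
proof -
  let ?a = "axis i 1 :: real^'n" and ?b = "axis j 1 :: real^'n"
  define g where "g t = \<phi> ((x + s *\<^sub>R ?b) + t *\<^sub>R ?a) - \<phi> (x + t *\<^sub>R ?a)" for t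
  have "\<exists>z>0. z < s \<and> g s - g 0 = (s - 0) *
     (pderiv_at i \<phi> ((x + s *\<^sub>R ?b) + z *\<^sub>R ?a) - pderiv_at i \<phi> (x + z *\<^sub>R ?a))"
    unfolding g_def by (rule MVT2[OF assms(2)]) (intro DERIV_diff pderiv_DERIV smooth_differentiable assms)
  then obtain z where z: "0 < z" "z < s" "g s - g 0 = s *
     (pderiv_at i \<phi> ((x + s *\<^sub>R ?b) + z *\<^sub>R ?a) - pderiv_at i \<phi> (x + z *\<^sub>R ?a))" by auto
  have "\<exists>w>0. w < s \<and> pderiv_at i \<phi> ((x + z *\<^sub>R ?a) + s *\<^sub>R ?b) - pderiv_at i \<phi> ((x + z *\<^sub>R ?a) + 0 *\<^sub>R ?b)
      = (s - 0) * pderiv_at j (pderiv_at i \<phi>) ((x + z *\<^sub>R ?a) + w *\<^sub>R ?b)"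
    by (rule MVT2[OF assms(2)]) (intro pderiv_DERIV smooth_differentiable smooth_pderiv assms)
  then obtain w where w: "0 < w" "w < s" "pderiv_at i \<phi> ((x + z *\<^sub>R ?a) + s *\<^sub>R ?b) - pderiv_at i \<phi> (x + z *\<^sub>R ?a)
      = s * pderiv_at j (pderiv_at i \<phi>) ((x + z *\<^sub>R ?a) + w *\<^sub>R ?b)" by auto
  have "norm (z *\<^sub>R ?a + w *\<^sub>R ?b) \<le> \<bar>z\<bar> + \<bar>w\<bar>"
    by (rule norm_triangle_le) (simp add: norm_axis_1)
  then have "norm (((x + z *\<^sub>R ?a) + w *\<^sub>R ?b) - x) \<le> 2 * s" using z w by (simp add: algebra_simps)
  moreover have "\<phi> (x + s *\<^sub>R ?a + s *\<^sub>R ?b) - \<phi> (x + s *\<^sub>R ?a) - \<phi> (x + s *\<^sub>R ?b) + \<phi> x = g s - g 0"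
    by (simp add: g_def algebra_simps)
  moreover have "\<dots> = s\<^sup>2 * pderiv_at j (pderiv_at i \<phi>) ((x + z *\<^sub>R ?a) + w *\<^sub>R ?b)"
    unfolding z(3) using w(3) by (simp add: algebra_simps power2_eq_square)
  ultimately show ?thesis by metis
qed

lemma pderiv_commute:
  fixes \<phi> :: "real^'n::finite \<Rightarrow> real"
  assumes "smooth \<phi>"
  shows "pderiv_at i (pderiv_at j \<phi>) x = pderiv_at j (pderiv_at i \<phi>) x"
proof -
  let ?s = "\<lambda>n. inverse (real (Suc n))"
  have conv: "(\<lambda>n. pderiv_at k (pderiv_at l \<phi>) (p n)) \<longlonglongrightarrow> pderiv_at k (pderiv_at l \<phi>) x"
    if "\<And>n. norm (p n - x) \<le> 2 * ?s n" for p k l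
  proof -
    have "(\<lambda>n. 2 * ?s n) \<longlonglongrightarrow> 2 * 0" by (intro tendsto_mult tendsto_const LIMSEQ_inverse_real_of_nat)
    then have "(\<lambda>n. p n - x) \<longlonglongrightarrow> 0"
      using that by (intro Lim_null_comparison[of "\<lambda>n. p n - x" "\<lambda>n. 2 * ?s n"]) auto
    then have "p \<longlonglongrightarrow> x" by (simp add: LIM_zero_iff)
    moreover have "continuous (at x) (pderiv_at k (pderiv_at l \<phi>))"
      using smooth_cont[OF smooth_pderiv[OF smooth_pderiv[OF assms]], of UNIV]
      by (simp add: continuous_on_eq_continuous_at)
    ultimately show ?thesis
      using continuous_within_tendsto_compose' by (metis isCont_tendsto_compose)
  qed
  have "\<exists>p. norm (p - x) \<le> 2 * ?s n \<and>
    \<phi> (x + ?s n *\<^sub>R axis k 1 + ?s n *\<^sub>R axis l 1) - \<phi> (x + ?s n *\<^sub>R axis k 1) - \<phi> (x + ?s n *\<^sub>R axis l 1) + \<phi> x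
      = (?s n)\<^sup>2 * pderiv_at l (pderiv_at k \<phi>) p" for n k l
    by (rule mixed_difference[OF assms]) auto
  then obtain p where p: "\<And>n k l. norm (p n k l - x) \<le> 2 * ?s n" "\<And>n k l.
    \<phi> (x + ?s n *\<^sub>R axis k 1 + ?s n *\<^sub>R axis l 1) - \<phi> (x + ?s n *\<^sub>R axis k 1) - \<phi> (x + ?s n *\<^sub>R axis l 1) + \<phi> x
      = (?s n)\<^sup>2 * pderiv_at l (pderiv_at k \<phi>) (p n k l)" by metis
  \<comment> \<open>The same second difference, computed in both orders, gives equal values at two
    points that tend to \<open>x\<close>.\<close>
  have "pderiv_at j (pderiv_at i \<phi>) (p n i j) = pderiv_at i (pderiv_at j \<phi>) (p n j i)" for n
  proof -
    have "(?s n)\<^sup>2 * pderiv_at j (pderiv_at i \<phi>) (p n i j) = (?s n)\<^sup>2 * pderiv_at i (pderiv_at j \<phi>) (p n j i)"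
      unfolding p(2)[symmetric] by (simp add: algebra_simps)
    then show ?thesis by simp
  qed
  then have "(\<lambda>n. pderiv_at i (pderiv_at j \<phi>) (p n j i)) \<longlonglongrightarrow> pderiv_at j (pderiv_at i \<phi>) x"
    using conv[of "\<lambda>n. p n i j" j i] p(1) by simp
  moreover have "(\<lambda>n. pderiv_at i (pderiv_at j \<phi>) (p n j i)) \<longlonglongrightarrow> pderiv_at i (pderiv_at j \<phi>) x"
    using conv[of "\<lambda>n. p n j i" i j] p(1) by simp
  ultimately show ?thesis using LIMSEQ_unique by blast
qed

subsection \<open>A bump function\<close>

text \<open>The functions exp(-1/t) t^(-k), extended by 0. The powers of 1/t make the family closed
  under differentiation up to linear combinations, so that smoothness of exp(-1/(1 - |x|^2)) falls
  under \<open>alg_smooth\<close>.\<close>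

definition expk :: "nat \<Rightarrow> real \<Rightarrow> real" where
  "expk k t = (if t > 0 then exp (- inverse t) * inverse t ^ k else 0)"

lemma expk_tendsto_0: "(expk k \<longlongrightarrow> 0) (at 0)"
proof -
  have "((\<lambda>t. inverse t ^ k / exp (inverse t)) \<longlongrightarrow> 0) (at_right (0::real))"
    by (rule filterlim_compose[OF tendsto_power_div_exp_0 filterlim_inverse_at_top_right])
  moreover have "eventually (\<lambda>t. inverse t ^ k / exp (inverse t) = expk k t) (at_right (0::real))"
    using eventually_at_right_less by eventually_elim (simp add: expk_def exp_minus field_simps)
  ultimately have "(expk k \<longlongrightarrow> 0) (at_right 0)" by (rule Lim_transform_eventually)
  moreover have "(expk k \<longlongrightarrow> 0) (at_left 0)"
  proof (rule tendsto_eventually)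
    show "eventually (\<lambda>t. expk k t = 0) (at_left 0)"
      unfolding eventually_at_filter by (auto simp: expk_def intro!: always_eventually)
  qed
  ultimately show ?thesis by (simp add: filterlim_at_split)
qed

lemma expk_deriv: "(expk k has_real_derivative (- real k * expk (Suc k) t + expk (k + 2) t)) (at t)"
proof (cases t "0::real" rule: linorder_cases)
  case less
  have "((\<lambda>_. 0) has_real_derivative 0) (at t)" by simp
  then have "(expk k has_real_derivative 0) (at t)"
    by (rule has_field_derivative_transform_within_open[of _ _ _ "{..<0}"])
       (use less in \<open>auto simp: expk_def\<close>)
  then show ?thesis using less by (simp add: expk_def)
next
  case greater
  have "((\<lambda>t. exp (- inverse t) * inverse t ^ k) has_real_derivative
      (- real k * (exp (- inverse t) * inverse t ^ Suc k) + exp (- inverse t) * inverse t ^ (k + 2))) (at t)"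
  proof (cases k)
    case 0
    then show ?thesis using greater
      by (auto intro!: derivative_eq_intros simp: power2_eq_square)
  next
    case (Suc m)
    have i: "(inverse has_real_derivative - (inverse t ^ Suc (Suc 0))) (at t)"
      using greater by (intro DERIV_inverse) auto
    show ?thesis unfolding Suc
      by (rule DERIV_cong[OF DERIV_mult[OF DERIV_fun_exp[OF DERIV_minus[OF i]] DERIV_power_Suc[OF i]]])
         (simp add: algebra_simps)
  qed
  then have "(expk k has_real_derivative
      (- real k * (exp (- inverse t) * inverse t ^ Suc k) + exp (- inverse t) * inverse t ^ (k + 2))) (at t)"
    by (rule has_field_derivative_transform_within_open[of _ _ _ "{0<..}"])
       (use greater in \<open>auto simp: expk_def\<close>)
  then show ?thesis using greater by (simp add: expk_def)
next
  case equal
  have "((\<lambda>h. (expk k (0 + h) - expk k 0) / h) \<longlongrightarrow> 0) (at 0)"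
  proof -
    \<comment> \<open>At 0 the difference quotient is itself a member of the family, so its limit is
      already known.\<close>
    have "(\<lambda>h. (expk k (0 + h) - expk k 0) / h) = expk (Suc k)"
      by (auto simp: expk_def fun_eq_iff field_simps)
    then show ?thesis using expk_tendsto_0[of "Suc k"] by simp
  qed
  then show ?thesis using equal by (simp add: DERIV_def expk_def)
qed

lemma bump_has_derivative:
  "((\<lambda>x::real^'n::finite. expk k (1 - x \<bullet> x)) has_derivative
    (\<lambda>h. (- real k * expk (Suc k) (1 - x \<bullet> x) + expk (k + 2) (1 - x \<bullet> x)) * (- 2 * (x \<bullet> h)))) (at x)"
proof -
  have "((\<lambda>x::real^'n. 1 - x \<bullet> x) has_derivative (\<lambda>h. - 2 * (x \<bullet> h))) (at x)"
    by (auto intro!: derivative_eq_intros simp: inner_commute)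
  from has_derivative_compose[where g = "expk k", OF this expk_deriv[unfolded has_field_derivative_def]]
  show ?thesis .
qed

lemma smooth_bump: "smooth (\<lambda>x::real^'n::finite. expk 0 (1 - x \<bullet> x))"
proof (rule alg_smooth)
  let ?G = "range (\<lambda>k (x::real^'n). expk k (1 - x \<bullet> x)) \<union> range (\<lambda>i x. x $ i)"
  show "(\<lambda>x. expk 0 (1 - x \<bullet> x)) \<in> alg ?G" by (intro alg.gen) auto
  fix g :: "real^'n \<Rightarrow> real" and x assume "g \<in> ?G"
  then show "g differentiable (at x)"
    by (auto intro: differentiable_coord differentiableI[OF bump_has_derivative])
next
  let ?G = "range (\<lambda>k (x::real^'n). expk k (1 - x \<bullet> x)) \<union> range (\<lambda>i x. x $ i)"
  fix g :: "real^'n \<Rightarrow> real" and j assume "g \<in> ?G"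
  then consider k where "g = (\<lambda>x. expk k (1 - x \<bullet> x))" | i where "g = (\<lambda>x. x $ i)" by auto
  then show "pderiv_at j g \<in> alg ?G"
  proof cases
    case 1
    have "pderiv_at j g = (\<lambda>x. (- real k * expk (Suc k) (1 - x \<bullet> x) + expk (k + 2) (1 - x \<bullet> x)) * (- 2 * (x $ j)))"
      unfolding 1 by (rule ext, subst pderiv_atI[OF bump_has_derivative]) (simp add: inner_axis)
    also have "\<dots> \<in> alg ?G"
      by (intro alg.mult alg.add alg.const) (auto intro: alg.gen)
    finally show ?thesis .
  next
    case 2
    then show ?thesis by (auto simp: pderiv_coord intro: alg.const)
  qed
qed

subsection \<open>Compactly supported smooth functions and convolution\<close>

definition Cc :: "(real^'n::finite \<Rightarrow> real) \<Rightarrow> bool" where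
  "Cc \<phi> \<longleftrightarrow> smooth \<phi> \<and> (\<exists>R. \<forall>x. R < norm x \<longrightarrow> \<phi> x = 0)"

lemma Cc_iff: "Cc \<phi> \<longleftrightarrow> test_function UNIV \<phi>"
proof
  assume "Cc \<phi>"
  then obtain R where R: "smooth \<phi>" "\<And>x. R < norm x \<Longrightarrow> \<phi> x = 0" by (auto simp: Cc_def)
  have "{x. \<phi> x \<noteq> 0} \<subseteq> cball 0 R" using R(2) by force
  then have "bounded {x. \<phi> x \<noteq> 0}" using bounded_cball bounded_subset by blast
  then show "test_function UNIV \<phi>" using R by (simp add: test_function_def)
next
  assume t: "test_function UNIV \<phi>"
  then have "bounded (closure {x. \<phi> x \<noteq> 0})" by (simp add: test_function_def compact_imp_bounded)
  then have "bounded {x. \<phi> x \<noteq> 0}" using bounded_subset closure_subset by blast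
  then obtain R where "\<And>x. \<phi> x \<noteq> 0 \<Longrightarrow> norm x \<le> R" by (auto simp: bounded_iff)
  then show "Cc \<phi>" using t unfolding Cc_def test_function_def by (metis not_less)
qed

lemma Cc_smooth: "Cc \<phi> \<Longrightarrow> smooth \<phi>" by (simp add: Cc_def)

lemma pderiv_zero_open:
  assumes "open S" "x \<in> S" "\<And>y. y \<in> S \<Longrightarrow> \<phi> y = 0"
  shows "pderiv_at j \<phi> x = 0"
proof -
  have "((\<lambda>_. 0) has_derivative (\<lambda>_. 0)) (at x)" by simp
  then have "(\<phi> has_derivative (\<lambda>_. 0)) (at x)"
    by (rule has_derivative_transform_within_open[OF _ assms(1,2)]) (use assms in auto)
  from pderiv_atI[OF this] show ?thesis by simp
qed

lemma Cc_pderiv: "Cc \<phi> \<Longrightarrow> Cc (pderiv_at j \<phi>)"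
proof -
  assume "Cc \<phi>"
  then obtain R where R: "smooth \<phi>" "\<And>x. R < norm x \<Longrightarrow> \<phi> x = 0" by (auto simp: Cc_def)
  have "pderiv_at j \<phi> x = 0" if "R < norm x" for x
    by (rule pderiv_zero_open[of "{x. R < norm x}"]) (use R that in \<open>auto intro!: open_Collect_less continuous_intros\<close>)
  then show ?thesis unfolding Cc_def using R(1) smooth_pderiv by blast
qed

lemma Cc_bounded: assumes "Cc \<phi>" obtains B where "B \<ge> 0" "\<And>x. \<bar>\<phi> x\<bar> \<le> B"
proof -
  obtain R where R: "smooth \<phi>" "\<And>x. R < norm x \<Longrightarrow> \<phi> x = 0" using assms by (auto simp: Cc_def)
  have "compact (\<phi> ` cball 0 R)" by (intro compact_continuous_image smooth_cont R) auto
  then have "bounded (\<phi> ` cball 0 R)" by (rule compact_imp_bounded)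
  then obtain B where B: "\<And>x. x \<in> cball 0 R \<Longrightarrow> \<bar>\<phi> x\<bar> \<le> B"
    unfolding bounded_iff by (metis imageI real_norm_def)
  have "\<bar>\<phi> x\<bar> \<le> max B 0" for x using B[of x] R(2)[of x] by (cases "norm x \<le> R") auto
  then show thesis using that[of "max B 0"] by auto
qed

lemma Cc_lipschitz:
  fixes \<phi> :: "real^'n::finite \<Rightarrow> real"
  assumes "Cc \<phi>" obtains L where "L \<ge> 0" "\<And>x h. \<bar>\<phi> (x + h) - \<phi> x\<bar> \<le> L * norm h"
proof -
  have "\<exists>B. B \<ge> 0 \<and> (\<forall>x. \<bar>pderiv_at j \<phi> x\<bar> \<le> B)" for j
    using Cc_bounded[OF Cc_pderiv[OF assms]] by metis
  then obtain B where B: "\<And>j. B j \<ge> 0" "\<And>j x. \<bar>pderiv_at j \<phi> x\<bar> \<le> B j" by metis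
  define L where "L = (\<Sum>j\<in>UNIV. B j)"
  have bd: "norm (\<Sum>j\<in>UNIV. h $ j * pderiv_at j \<phi> x) \<le> L * norm h" for x h
  proof -
    have "norm (\<Sum>j\<in>UNIV. h $ j * pderiv_at j \<phi> x) \<le> (\<Sum>j\<in>UNIV. norm h * B j)"
      by (rule sum_norm_le) (auto simp: abs_mult intro!: mult_mono B component_le_norm_cart)
    then show ?thesis by (simp add: L_def sum_distrib_left mult.commute)
  qed
  have "norm (\<phi> (x + h) - \<phi> x) \<le> L * norm (x + h - x)" for x h
    by (rule differentiable_bound[of UNIV \<phi> "\<lambda>x h. \<Sum>j\<in>UNIV. h $ j * pderiv_at j \<phi> x"])
       (auto intro!: onorm_le bd has_derivative_at_withinI smooth_has_derivative Cc_smooth assms)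
  then show thesis using that[of L] B(1) by (simp add: L_def sum_nonneg)
qed

text \<open>The mean value theorem on a segment, for the function minus its linear part, together
  with the Lipschitz bound for the derivatives. The remainder is uniform in \<open>x\<close>; in
  \<open>conv_has_derivative\<close> it bounds the integrand by a multiple of the integrable
  function, so that differentiation passes under the integral.\<close>

lemma Cc_taylor:
  fixes \<phi> :: "real^'n::finite \<Rightarrow> real"
  assumes "Cc \<phi>"
  obtains K where "K \<ge> 0"
    "\<And>x h. \<bar>\<phi> (x + h) - \<phi> x - (\<Sum>j\<in>UNIV. h $ j * pderiv_at j \<phi> x)\<bar> \<le> K * (norm h)\<^sup>2"
proof -
  have "\<exists>L. L \<ge> 0 \<and> (\<forall>x h. \<bar>pderiv_at j \<phi> (x + h) - pderiv_at j \<phi> x\<bar> \<le> L * norm h)" for j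
    using Cc_lipschitz[OF Cc_pderiv[OF assms]] by metis
  then obtain L where L: "\<And>j. L j \<ge> 0" "\<And>j x h. \<bar>pderiv_at j \<phi> (x + h) - pderiv_at j \<phi> x\<bar> \<le> L j * norm h" by metis
  define K where "K = (\<Sum>j\<in>UNIV. L j)"
  have K: "K \<ge> 0" by (simp add: K_def sum_nonneg L)
  have "\<bar>\<phi> (x + h) - \<phi> x - (\<Sum>j\<in>UNIV. h $ j * pderiv_at j \<phi> x)\<bar> \<le> K * (norm h)\<^sup>2" for x h
  proof -
    define D where "D y h = (\<Sum>j\<in>UNIV. h $ j * pderiv_at j \<phi> y)" for y h
    have dd: "((\<lambda>t. \<phi> (x + t *\<^sub>R h) - t * D x h) has_real_derivative D (x + t *\<^sub>R h) h - D x h) (at t)" for t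
    proof -
      have "((\<lambda>t. \<phi> (x + t *\<^sub>R h)) has_derivative (\<lambda>s. \<Sum>j\<in>UNIV. (s *\<^sub>R h) $ j * pderiv_at j \<phi> (x + t *\<^sub>R h))) (at t)"
        by (rule has_derivative_pderiv_compose[where \<phi> = \<phi>])
           (use smooth_differentiable[OF Cc_smooth[OF assms]] in \<open>auto intro!: derivative_eq_intros\<close>)
      then have "((\<lambda>t. \<phi> (x + t *\<^sub>R h)) has_real_derivative D (x + t *\<^sub>R h) h) (at t)"
        unfolding has_field_derivative_def D_def
        by (rule has_derivative_eq_rhs) (auto simp: fun_eq_iff sum_distrib_right sum_distrib_left algebra_simps)
      then show ?thesis by (auto intro!: derivative_eq_intros)
    qed
    have "\<exists>z>0. z < 1 \<and> (\<phi> (x + 1 *\<^sub>R h) - 1 * D x h) - (\<phi> (x + 0 *\<^sub>R h) - 0 * D x h)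
        = (1 - 0) * (D (x + z *\<^sub>R h) h - D x h)"
      by (rule MVT2) (use dd in auto)
    then obtain z where z: "0 < z" "z < 1" "\<phi> (x + h) - \<phi> x - D x h = D (x + z *\<^sub>R h) h - D x h"
      by auto
    have "D (x + z *\<^sub>R h) h - D x h = (\<Sum>j\<in>UNIV. h $ j * (pderiv_at j \<phi> (x + z *\<^sub>R h) - pderiv_at j \<phi> x))"
      by (simp add: D_def sum_subtractf[symmetric] algebra_simps)
    also have "\<bar>\<dots>\<bar> \<le> (\<Sum>j\<in>UNIV. norm h * (L j * norm h))"
    proof (rule order_trans[OF sum_abs], rule sum_mono)
      fix j
      have "\<bar>pderiv_at j \<phi> (x + z *\<^sub>R h) - pderiv_at j \<phi> x\<bar> \<le> L j * norm (z *\<^sub>R h)" by (rule L)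
      also have "\<dots> \<le> L j * norm h" using z L(1)[of j] by (intro mult_left_mono) (auto simp: mult_left_le_one_le)
      finally show "\<bar>h $ j * (pderiv_at j \<phi> (x + z *\<^sub>R h) - pderiv_at j \<phi> x)\<bar> \<le> norm h * (L j * norm h)"
        unfolding abs_mult by (intro mult_mono component_le_norm_cart) auto
    qed
    also have "\<dots> = K * (norm h)\<^sup>2"
      by (simp add: K_def sum_distrib_left sum_distrib_right power2_eq_square mult_ac)
    finally show ?thesis using z(3) unfolding D_def by simp
  qed
  then show thesis using that K by blast
qed

lemma Cc_integrable_mult:
  assumes "Cc \<phi>" "integrable lborel h"
  shows "integrable lborel (\<lambda>y. h y * \<phi> (x - y))"
proof -
  obtain B where B: "B \<ge> 0" "\<And>x. \<bar>\<phi> x\<bar> \<le> B" using Cc_bounded[OF assms(1)] by metis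
  have m: "(\<lambda>y. \<phi> (x - y)) \<in> borel_measurable lborel"
    using measurable_compose[of "\<lambda>y. x - y" borel borel \<phi> borel] smooth_borel[OF Cc_smooth[OF assms(1)]] by simp
  show ?thesis
  proof (rule Bochner_Integration.integrable_bound[of _ "\<lambda>y. B * h y"])
    show "integrable lborel (\<lambda>y. B * h y)" using assms by simp
    show "(\<lambda>y. h y * \<phi> (x - y)) \<in> borel_measurable lborel" using m assms(2) by simp
    show "AE y in lborel. norm (h y * \<phi> (x - y)) \<le> norm (B * h y)"
    proof (rule AE_I2)
      fix y
      have "\<bar>\<phi> (x - y)\<bar> * \<bar>h y\<bar> \<le> B * \<bar>h y\<bar>" by (intro mult_right_mono B) auto
      then show "norm (h y * \<phi> (x - y)) \<le> norm (B * h y)" using B by (simp add: abs_mult mult.commute)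
    qed
  qed
qed

definition conv :: "(real^'n::finite \<Rightarrow> real) \<Rightarrow> (real^'n \<Rightarrow> real) \<Rightarrow> real^'n \<Rightarrow> real" where
  "conv h \<phi> x = (\<integral>y. h y * \<phi> (x - y) \<partial>lborel)"

lemma conv_has_derivative:
  fixes \<phi> :: "real^'n::finite \<Rightarrow> real"
  assumes "Cc \<phi>" "integrable lborel h"
  shows "(conv h \<phi> has_derivative (\<lambda>z. \<Sum>j\<in>UNIV. z $ j * conv h (pderiv_at j \<phi>) x)) (at x)"
proof -
  obtain K where K: "K \<ge> 0"
    "\<And>x h. \<bar>\<phi> (x + h) - \<phi> x - (\<Sum>j\<in>UNIV. h $ j * pderiv_at j \<phi> x)\<bar> \<le> K * (norm h)\<^sup>2"
    using Cc_taylor[OF assms(1)] by metis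
  define I where "I = (\<integral>y. \<bar>h y\<bar> \<partial>lborel)"
  let ?D = "\<lambda>z. \<Sum>j\<in>UNIV. z $ j * conv h (pderiv_at j \<phi>) x"
  note int = Cc_integrable_mult[OF assms] Cc_integrable_mult[OF Cc_pderiv[OF assms(1)] assms(2)]
  have est: "\<bar>conv h \<phi> (x + z) - conv h \<phi> x - ?D z\<bar> \<le> K * I * (norm z)\<^sup>2" for z
  proof -
    have "conv h \<phi> (x + z) - conv h \<phi> x - ?D z =
      (\<integral>y. h y * \<phi> (x + z - y) - h y * \<phi> (x - y) - (\<Sum>j\<in>UNIV. z $ j * (h y * pderiv_at j \<phi> (x - y))) \<partial>lborel)"
      unfolding conv_def using int by (simp add: Bochner_Integration.integral_diff Bochner_Integration.integral_sum)
    also have "\<bar>\<dots>\<bar> \<le> (\<integral>y. K * (norm z)\<^sup>2 * \<bar>h y\<bar> \<partial>lborel)"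
    proof (rule order_trans[OF integral_abs_bound], rule integral_mono)
      fix y
      have "\<bar>h y * \<phi> (x + z - y) - h y * \<phi> (x - y) - (\<Sum>j\<in>UNIV. z $ j * (h y * pderiv_at j \<phi> (x - y)))\<bar>
        = \<bar>h y\<bar> * \<bar>\<phi> ((x - y) + z) - \<phi> (x - y) - (\<Sum>j\<in>UNIV. z $ j * pderiv_at j \<phi> (x - y))\<bar>"
        unfolding abs_mult[symmetric] by (simp add: algebra_simps sum_distrib_left)
      also have "\<dots> \<le> \<bar>h y\<bar> * (K * (norm z)\<^sup>2)" by (intro mult_left_mono K) auto
      finally show "\<bar>h y * \<phi> (x + z - y) - h y * \<phi> (x - y) - (\<Sum>j\<in>UNIV. z $ j * (h y * pderiv_at j \<phi> (x - y)))\<bar>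
        \<le> K * (norm z)\<^sup>2 * \<bar>h y\<bar>" by (simp add: mult_ac)
    qed (use int assms in auto)
    also have "\<dots> = K * I * (norm z)\<^sup>2" using assms by (simp add: I_def)
    finally show ?thesis .
  qed
  have bl: "bounded_linear ?D"
    by (intro bounded_linear_sum bounded_linear_mult_const bounded_linear_vec_nth)
  have "((\<lambda>z. norm (conv h \<phi> (x + z) - conv h \<phi> x - ?D z) / norm z) \<longlongrightarrow> 0) (at 0)"
  proof (rule Lim_null_comparison)
    show "\<forall>\<^sub>F z in at 0. norm (norm (conv h \<phi> (x + z) - conv h \<phi> x - ?D z) / norm z) \<le> K * I * norm z"
      using est by (auto intro!: always_eventually simp: divide_le_eq power2_eq_square mult_ac)
    have "((\<lambda>z::real^'n. K * I * norm z) \<longlongrightarrow> K * I * norm (0::real^'n)) (at 0)"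
      by (intro tendsto_intros)
    then show "((\<lambda>z::real^'n. K * I * norm z) \<longlongrightarrow> 0) (at 0)" by simp
  qed
  with bl show ?thesis by (simp add: has_derivative_at)
qed

lemma pderiv_conv:
  assumes "Cc \<phi>" "integrable lborel h"
  shows "pderiv_at j (conv h \<phi>) x = conv h (pderiv_at j \<phi>) x"
  by (subst pderiv_atI[OF conv_has_derivative[OF assms]])
     (simp add: sum_axis mult.assoc sum_distrib_left[symmetric])

lemma smooth_conv:
  assumes "Cc \<phi>" "integrable lborel h"
  shows "smooth (conv h \<phi>)"
proof (rule smooth_coinduct[of _ "{conv h \<phi> | \<phi>. Cc \<phi>}"])
  fix \<psi> j assume "\<psi> \<in> {conv h \<phi> | \<phi>. Cc \<phi>}"
  then obtain \<phi> where p: "\<psi> = conv h \<phi>" "Cc \<phi>" by auto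
  have "pderiv_at j \<psi> = conv h (pderiv_at j \<phi>)" using pderiv_conv[OF p(2) assms(2)] by (auto simp: p(1))
  then show "pderiv_at j \<psi> \<in> {conv h \<phi> | \<phi>. Cc \<phi>}" using Cc_pderiv[OF p(2)] by auto
qed (use assms in \<open>auto intro: differentiableI[OF conv_has_derivative]\<close>)

subsection \<open>Scaling and translation\<close>

lemma nn_integral_lborel_scale:
  fixes f :: "real^'n::finite \<Rightarrow> ennreal"
  assumes [measurable]: "f \<in> borel_measurable borel" and "c > 0"
  shows "(\<integral>\<^sup>+x. f x \<partial>lborel) = ennreal (c ^ CARD('n)) * (\<integral>\<^sup>+x. f (c *\<^sub>R x) \<partial>lborel)"
  using assms(2)
  by (subst lborel_affine[of c 0]) (auto simp: nn_integral_density nn_integral_distr nn_integral_cmult)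

lemma integral_lborel_scale:
  fixes f :: "real^'n::finite \<Rightarrow> real"
  assumes [measurable]: "f \<in> borel_measurable borel" and "c > 0"
  shows "(\<integral>x. f x \<partial>lborel) = c ^ CARD('n) * (\<integral>x. f (c *\<^sub>R x) \<partial>lborel)"
  using assms(2)
  by (subst lborel_affine[of c 0]) (auto simp: integral_density integral_distr)

lemma integral_lborel_translate:
  fixes f :: "real^'n::finite \<Rightarrow> real"
  assumes "integrable lborel f"
  shows "integrable lborel (\<lambda>x. f (x + a))" "(\<integral>x. f (x + a) \<partial>lborel) = (\<integral>x. f x \<partial>lborel)"
proof -
  have m: "(+) a \<in> measurable lborel borel" by simp
  have f: "f \<in> borel_measurable borel" using assms by simp
  have "integrable (distr lborel borel ((+) a)) f" using assms by (simp add: lborel_distr_plus)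
  then show "integrable lborel (\<lambda>x. f (x + a))" 
    using integrable_distr_eq[OF m f] by (simp add: add.commute)
  show "(\<integral>x. f (x + a) \<partial>lborel) = (\<integral>x. f x \<partial>lborel)"
    using integral_distr[OF m f] by (simp add: lborel_distr_plus add.commute)
qed

subsection \<open>Integrals over the unit ball\<close>

lemma emeasure_ball_finite: "emeasure lborel (ball c r :: (real^'n::finite) set) < top"
  using emeasure_lborel_ball_finite[of c r] by simp

lemma integrable_indicator_ball:
  "integrable lborel (\<lambda>x::real^'n::finite. B * indicator (ball c r) x)" for B :: real
  by (rule integrable_mult_right, rule integrable_real_indicator) (auto simp: emeasure_ball_finite)

lemma ball_borel [simp]: "ball 0 1 \<in> sets lebesgue" by simp

lemma LB_integrable_iff:
  fixes f :: "real^'n::finite \<Rightarrow> 'b::{banach, second_countable_topology}"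
  assumes "(\<lambda>x. indicator (ball 0 1) x *\<^sub>R f x) \<in> borel_measurable borel"
  shows "integrable (lebesgue_on (ball 0 1)) f \<longleftrightarrow> integrable lborel (\<lambda>x. indicator (ball 0 1) x *\<^sub>R f x)"
  using assms by (subst integrable_restrict_space) (auto simp: integrable_completion)

lemma LB_integral:
  fixes f :: "real^'n::finite \<Rightarrow> 'b::{banach, second_countable_topology}"
  assumes "(\<lambda>x. indicator (ball 0 1) x *\<^sub>R f x) \<in> borel_measurable borel"
  shows "(\<integral>x. f x \<partial>lebesgue_on (ball 0 1)) = (\<integral>x. indicator (ball 0 1) x *\<^sub>R f x \<partial>lborel)"
  using assms by (subst integral_restrict_space) (auto simp: integral_completion)

lemma LB_nonzero: "AE x in lebesgue_on (ball 0 1). x \<noteq> (0::real^'n::finite)"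
proof -
  have "AE x in lebesgue. x \<noteq> (0::real^'n)"
    by (intro AE_completion AE_lborel_singleton)
  then show ?thesis by (subst AE_restrict_space_iff) auto
qed

text \<open>The origin is a null set, so claims on the ball need only be checked where fields with a
  point singularity are differentiable.\<close>

lemma LB_I:
  assumes "\<And>x. x \<in> ball 0 1 \<Longrightarrow> x \<noteq> 0 \<Longrightarrow> P x"
  shows "AE x in lebesgue_on (ball 0 1). P (x::real^'n::finite)"
  using LB_nonzero AE_space by eventually_elim (use assms in auto)

lemma finite_measure_LB: "finite_measure (lebesgue_on (ball 0 1 :: (real^'n::finite) set))"
  by (intro finite_measure_lebesgue_on) simp

lemma borel_continuous_off_0:
  fixes F :: "real^'n::finite \<Rightarrow> 'b::real_normed_vector"
  assumes "continuous_on (ball 0 1 - {0}) F"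
  shows "(\<lambda>x. indicator (ball 0 1 - {0}) x *\<^sub>R F x) \<in> borel_measurable borel"
  by (rule borel_measurable_continuous_on_indicator[OF _ assms]) auto

lemma LB_measurable_continuous:
  fixes F :: "real^'n::finite \<Rightarrow> 'b::{real_normed_vector, second_countable_topology}"
  assumes "continuous_on (ball 0 1 - {0}) F"
  shows "F \<in> borel_measurable (lebesgue_on (ball 0 1))"
proof -
  have "(\<lambda>x. indicator (ball 0 1 - {0}) x *\<^sub>R F x + indicator {0} x *\<^sub>R F 0) \<in> borel_measurable borel"
    by (intro borel_measurable_add borel_continuous_off_0[OF assms]) auto
  then have "(\<lambda>x. indicator (ball 0 1 - {0}) x *\<^sub>R F x + indicator {0} x *\<^sub>R F 0) \<in> borel_measurable (lebesgue_on (ball 0 1))"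
    by (intro measurable_restrict_space1 measurable_completion) simp
  then show ?thesis
    by (rule measurable_cong[THEN iffD1, rotated]) (auto simp: indicator_def)
qed

lemma LB_cong_measurable:
  fixes F :: "real^'n::finite \<Rightarrow> 'b::real_normed_vector"
  assumes "(\<lambda>x. indicator (ball 0 1) x *\<^sub>R F x) \<in> borel_measurable borel"
  shows "F \<in> borel_measurable (lebesgue_on (ball 0 1))"
proof -
  have "(\<lambda>x. indicator (ball 0 1) x *\<^sub>R F x) \<in> borel_measurable (lebesgue_on (ball 0 1))"
    using assms by (intro measurable_restrict_space1 measurable_completion) simp
  then show ?thesis
    by (rule measurable_cong[THEN iffD1, rotated]) (auto simp: indicator_def)
qed

subsection \<open>Integrability of the inverse square\<close>

text \<open>Dyadic scaling instead of polar coordinates: with \<open>J k\<close> the integral over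
  2^(-k) \<le> |x| < 1, doubling the part inside radius 1/2 gives J (k+1) \<le> J 1 + (4 / 2^N) J k,
  and 4 / 2^N \<le> 1/2 for N \<ge> 3. Hence every \<open>J k\<close> is at most 2 J 1.\<close>

lemma integrable_inverse_square:
  assumes "3 \<le> CARD('n::finite)"
  shows "integrable lborel (\<lambda>x::real^'n. indicator (ball 0 1) x * (1 / (norm x)\<^sup>2))"
proof -
  define g where "g k x = indicator {x. 1 / 2 ^ k \<le> norm x \<and> norm x < 1} x * ennreal (1 / (norm x)\<^sup>2)" for k :: nat and x :: "real^'n"
  have m[measurable]: "g k \<in> borel_measurable borel" for k unfolding g_def by measurable
  define J where "J k = (\<integral>\<^sup>+x. g k x \<partial>lborel)" for k
  have J1: "J 1 < \<infinity>"
  proof -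
    have "J 1 \<le> (\<integral>\<^sup>+x. ennreal 4 * indicator (ball 0 1 :: (real^'n) set) x \<partial>lborel)"
      unfolding J_def
    proof (rule nn_integral_mono)
      fix x :: "real^'n"
      show "g 1 x \<le> ennreal 4 * indicator (ball 0 1) x"
      proof (cases "1 / 2 \<le> norm x \<and> norm x < 1")
        case True
        then have "(1/2)\<^sup>2 \<le> (norm x)\<^sup>2" by (intro power_mono) auto
        moreover have "norm x > 0" using True by linarith
        ultimately have "1 / (norm x)\<^sup>2 \<le> 4" by (simp add: divide_le_eq power2_eq_square)
        then have "ennreal (1 / (norm x)\<^sup>2) \<le> ennreal 4" by (rule ennreal_leI)
        then show ?thesis using True by (simp add: g_def)
      qed (auto simp: g_def)
    qed
    also have "\<dots> < \<infinity>" 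
      by (subst nn_integral_cmult) (auto simp: ennreal_mult_less_top emeasure_ball_finite intro!: borel_measurable_indicator)
    finally show ?thesis .
  qed
  have step: "J (Suc k) \<le> J 1 + ennreal (1/2) * J k" for k
  proof -
    have "g (Suc k) x \<le> g 1 x + ennreal 4 * g k (2 *\<^sub>R x)" for x
    proof (cases "1 / 2 ^ Suc k \<le> norm x \<and> norm x < 1")
      case True
      show ?thesis
      proof (cases "1 / 2 \<le> norm x")
        case t: True
        then have "g (Suc k) x = g 1 x" using True by (simp add: g_def)
        then show ?thesis by (simp add: add_increasing2)
      next
        case f: False
        have "norm x > 0" using True by (smt (verit) divide_pos_pos zero_less_power)
        then have "g (Suc k) x = ennreal 4 * g k (2 *\<^sub>R x)"
          using True f by (simp add: g_def field_simps power2_eq_square ennreal_mult'[symmetric] del: ennreal_numeral)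
        then show ?thesis by (simp add: add_increasing)
      qed
    qed (auto simp: g_def)
    then have "J (Suc k) \<le> (\<integral>\<^sup>+x. g 1 x + ennreal 4 * g k (2 *\<^sub>R x) \<partial>lborel)"
      unfolding J_def by (intro nn_integral_mono) auto
    also have "\<dots> = J 1 + ennreal 4 * (\<integral>\<^sup>+x. g k (2 *\<^sub>R x) \<partial>lborel)"
      unfolding J_def by (simp add: nn_integral_add nn_integral_cmult)
    also have "ennreal 4 * (\<integral>\<^sup>+x. g k (2 *\<^sub>R x) \<partial>lborel) \<le> ennreal (1/2) * J k"
    proof -
      have "(2::real) ^ 3 \<le> 2 ^ CARD('n)" using assms by (intro power_increasing) auto
      then have "ennreal 4 \<le> ennreal (1/2 * 2 ^ CARD('n))" by (intro ennreal_leI) simp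
      then have "ennreal 4 * (\<integral>\<^sup>+x. g k (2 *\<^sub>R x) \<partial>lborel) \<le> ennreal (1/2 * 2 ^ CARD('n)) * (\<integral>\<^sup>+x. g k (2 *\<^sub>R x) \<partial>lborel)"
        by (rule mult_right_mono) auto
      also have "\<dots> = ennreal (1/2) * (ennreal (2 ^ CARD('n)) * (\<integral>\<^sup>+x. g k (2 *\<^sub>R x) \<partial>lborel))"
        by (subst ennreal_mult) (auto simp only: mult.assoc zero_le_divide_1_iff zero_le_numeral zero_le_power)
      also have "ennreal (2 ^ CARD('n)) * (\<integral>\<^sup>+x. g k (2 *\<^sub>R x) \<partial>lborel) = J k"
        unfolding J_def by (rule nn_integral_lborel_scale[symmetric]) auto
      finally show ?thesis .
    qed
    finally show ?thesis by (simp add: add_left_mono)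
  qed
  obtain j where j: "J 1 = ennreal j" "j \<ge> 0" using J1 by (cases "J 1") auto
  have bd: "J k \<le> ennreal (2 * j)" for k
  proof (induction k)
    case 0
    have "g 0 = (\<lambda>x. 0)" by (auto simp: g_def fun_eq_iff indicator_def)
    then show ?case by (simp add: J_def)
  next
    case (Suc k)
    have "J (Suc k) \<le> J 1 + ennreal (1/2) * J k" by (rule step)
    also have "\<dots> \<le> ennreal j + ennreal (1/2) * ennreal (2 * j)"
      unfolding j(1) by (intro add_left_mono mult_left_mono Suc) auto
    also have "\<dots> = ennreal j + ennreal (1/2 * (2 * j))" using j(2) by (subst ennreal_mult'[symmetric]) auto
    also have "\<dots> = ennreal (2 * j)" using j(2) by (subst ennreal_plus[symmetric]) auto
    finally show ?case .
  qed
  have "(\<integral>\<^sup>+x. ennreal (norm (indicator (ball 0 1) x * (1 / (norm (x::real^'n))\<^sup>2))) \<partial>lborel) \<le> (SUP k. J k)"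
  proof -
    have inc: "incseq g"
    proof (intro incseq_SucI le_funI)
      fix k and x :: "real^'n"
      have "1 / 2 ^ Suc k \<le> 1 / (2::real) ^ k" by (intro divide_left_mono power_increasing) auto
      then show "g k x \<le> g (Suc k) x" by (auto simp: g_def indicator_def)
    qed
    have "(SUP k. J k) = (\<integral>\<^sup>+x. (SUP k. g k x) \<partial>lborel)"
      unfolding J_def by (rule nn_integral_monotone_convergence_SUP[symmetric, OF inc]) auto
    moreover have "ennreal (norm (indicator (ball 0 1) x * (1 / (norm x)\<^sup>2))) \<le> (SUP k. g k x)" for x :: "real^'n"
    proof (cases "x \<in> ball 0 1 \<and> x \<noteq> 0")
      case True
      then obtain k where "(1/2::real) ^ k < norm x" using real_arch_pow_inv[of "norm x" "1/2"] by auto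
      then have "ennreal (norm (indicator (ball 0 1) x * (1 / (norm x)\<^sup>2))) = g k x"
        using True by (simp add: g_def power_one_over)
      then show ?thesis by (metis SUP_upper UNIV_I)
    qed auto
    ultimately show ?thesis by (simp add: nn_integral_mono)
  qed
  also have "\<dots> \<le> ennreal (2 * j)" by (intro SUP_least bd)
  also have "\<dots> < \<infinity>" by simp
  finally have fin: "(\<integral>\<^sup>+x. ennreal (norm (indicator (ball 0 1) x * (1 / (norm (x::real^'n))\<^sup>2))) \<partial>lborel) < \<infinity>" .
  show ?thesis
  proof (rule integrableI_bounded[OF _ fin])
    have "(\<lambda>x::real^'n. indicator (ball 0 1) x * (1 / (norm x)\<^sup>2)) \<in> borel_measurable borel"
      by (intro borel_measurable_times borel_measurable_indicator borel_measurable_divide) auto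
    then show "(\<lambda>x::real^'n. indicator (ball 0 1) x * (1 / (norm x)\<^sup>2)) \<in> borel_measurable lborel" by simp
  qed
qed

lemma LB_integrable_inverse_square:
  assumes "3 \<le> CARD('n::finite)"
  shows "integrable (lebesgue_on (ball 0 1)) (\<lambda>x::real^'n. C / (norm x)\<^sup>2)"
proof -
  have "integrable (lebesgue_on (ball 0 1)) (\<lambda>x::real^'n. 1 / (norm x)\<^sup>2)"
    using integrable_inverse_square[OF assms] by (subst LB_integrable_iff) auto
  from integrable_mult_right[OF this, of C] show ?thesis by simp
qed

subsection \<open>The divergence theorem\<close>

text \<open>Difference quotients in direction \<open>a\<close> have integral zero by translation
  invariance; the mean value theorem bounds them by \<open>M\<close>, and dominated convergence
  hands this on to the derivative. Only a bounded directional derivative is asked for, because the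
  function cut off in \<open>ball_divergence\<close> is not known to be continuously
  differentiable.\<close>

lemma integral_dir_deriv_zero:
  fixes G :: "real^'n::finite \<Rightarrow> real"
  assumes [measurable]: "G \<in> borel_measurable borel"
    and der: "\<And>x. ((\<lambda>t. G (x + t *\<^sub>R a)) has_real_derivative G' x) (at 0)"
    and bound: "\<And>x. \<bar>G' x\<bar> \<le> M" and zero: "\<And>x. 1 \<le> norm x \<Longrightarrow> G x = 0" and a: "norm a = 1"
  shows "integrable lborel G'" "(\<integral>x. G' x \<partial>lborel) = 0"
proof -
  have M: "M \<ge> 0" using bound[of 0] by simp
  have der': "((\<lambda>t. G (x + t *\<^sub>R a)) has_real_derivative G' (x + s *\<^sub>R a)) (at s)" for x s
    using der[of "x + s *\<^sub>R a"] DERIV_shift[of "\<lambda>t. G (x + t *\<^sub>R a)" _ 0 s]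
    by (simp add: algebra_simps)
  have lip: "\<bar>G (x + s *\<^sub>R a) - G x\<bar> \<le> M * s" if s: "s > 0" for x s
  proof -
    have "\<exists>z>0. z < s \<and> G (x + s *\<^sub>R a) - G (x + 0 *\<^sub>R a) = (s - 0) * G' (x + z *\<^sub>R a)"
      by (rule MVT2[OF s]) (use der' in auto)
    then obtain z where z: "G (x + s *\<^sub>R a) - G x = s * G' (x + z *\<^sub>R a)" by auto
    show ?thesis unfolding z abs_mult using s bound[of "x + z *\<^sub>R a"] by (simp add: mult.commute mult_left_mono)
  qed
  have Gb: "\<bar>G x\<bar> \<le> 3 * M" for x
  proof (cases "norm x < 1")
    case True
    \<comment> \<open>A shift by 3 leaves the unit ball, where \<open>G\<close> vanishes, so
      \<open>G\<close> is bounded by 3 \<open>M\<close>.\<close>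
    have "norm (3 *\<^sub>R a) \<le> norm (x + 3 *\<^sub>R a) + norm x"
      by (metis add_diff_cancel_left' norm_triangle_ineq4)
    then have "1 \<le> norm (x + 3 *\<^sub>R a)" using True a by simp
    then show ?thesis using lip[of 3 x] zero by simp
  qed (use zero M in auto)
  note fin = integrable_indicator_ball[of _ 0]
  have Gi: "integrable lborel G"
  proof (rule Bochner_Integration.integrable_bound[OF fin[of "3 * M" 1]])
    show "AE x in lborel. norm (G x) \<le> norm (3 * M * indicator (ball 0 1) x)"
      using Gb zero M by (auto simp: indicator_def intro!: AE_I2 split: if_splits)
  qed simp
  define s :: "nat \<Rightarrow> real" where "s n = inverse (real (Suc n))" for n
  have s: "s n > 0" "s n \<le> 1" for n by (auto simp: s_def inverse_le_1_iff)
  define q where "q n x = (G (x + s n *\<^sub>R a) - G x) / s n" for n x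
  have qm: "q n \<in> borel_measurable borel" for n
  proof -
    have "(\<lambda>x. G (x + s n *\<^sub>R a)) \<in> borel_measurable borel"
      by (rule measurable_compose[OF _ assms(1)]) simp
    then show ?thesis unfolding q_def by simp
  qed
  have q0: "(\<integral>x. q n x \<partial>lborel) = 0" for n
    unfolding q_def using integral_lborel_translate[OF Gi, of "s n *\<^sub>R a"] Gi by simp
  have qlim: "(\<lambda>n. q n x) \<longlonglongrightarrow> G' x" for x
  proof -
    have "((\<lambda>h. (G (x + h *\<^sub>R a) - G x) / h) \<longlongrightarrow> G' x) (at 0)"
      using der[of x] by (simp add: DERIV_def)
    moreover have "filterlim s (at 0) sequentially"
    proof -
      have "s \<longlonglongrightarrow> 0" unfolding s_def by (rule LIMSEQ_inverse_real_of_nat)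
      moreover have "s n \<noteq> 0" for n using s(1)[of n] by simp
      ultimately show ?thesis by (simp add: filterlim_at)
    qed
    ultimately show ?thesis unfolding q_def by (rule filterlim_compose)
  qed
  have [measurable]: "G' \<in> borel_measurable borel"
    by (rule borel_measurable_LIMSEQ_real[OF qlim qm])
  \<comment> \<open>The increments are at most 1, so outside the ball of radius 2 both values of
    \<open>G\<close> vanish; this is the dominating function.\<close>
  have qb: "norm (q n x) \<le> M * indicator (ball 0 2) x" for n x
  proof (cases "norm x < 2")
    case True
    have "\<bar>q n x\<bar> \<le> M" unfolding q_def using lip[OF s(1)[of n], of x] s(1)[of n] by (simp add: divide_le_eq)
    then show ?thesis using True by simp
  next
    case False
    have "norm x - norm (s n *\<^sub>R a) \<le> norm (x + s n *\<^sub>R a)" by (rule norm_diff_ineq)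
    then have "1 \<le> norm (x + s n *\<^sub>R a)" using False a s[of n] by simp
    then show ?thesis using False zero by (simp add: q_def)
  qed
  show "integrable lborel G'"
    by (rule integrable_dominated_convergence[OF _ _ fin[of M 2], of _ q]) (use qlim qm qb in \<open>auto intro!: AE_I2\<close>)
  have "(\<lambda>n. \<integral>x. q n x \<partial>lborel) \<longlonglongrightarrow> (\<integral>x. G' x \<partial>lborel)"
    by (rule integral_dominated_convergence[OF _ _ fin[of M 2]]) (use qlim qm qb in \<open>auto intro!: AE_I2\<close>)
  then show "(\<integral>x. G' x \<partial>lborel) = 0" using q0 by (simp add: LIMSEQ_const_iff)
qed

section \<open>Radial cutoff functions\<close>

definition possq :: "real \<Rightarrow> real" where "possq t = (if t \<le> 0 then 0 else t\<^sup>2)"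

lemma possq_deriv: "(possq has_real_derivative 2 * max 0 t) (at t)"
proof (cases t "0::real" rule: linorder_cases)
  case less
  have "((\<lambda>_. 0) has_real_derivative 0) (at t)" by simp
  then have "(possq has_real_derivative 0) (at t)"
    by (rule has_field_derivative_transform_within_open[of _ _ _ "{..<0}"])
       (use less in \<open>auto simp: possq_def\<close>)
  then show ?thesis using less by simp
next
  case greater
  have "((\<lambda>t. t\<^sup>2) has_real_derivative 2 * t) (at t)"
    by (auto intro!: derivative_eq_intros)
  then have "(possq has_real_derivative 2 * t) (at t)"
    by (rule has_field_derivative_transform_within_open[of _ _ _ "{0<..}"])
       (use greater in \<open>auto simp: possq_def\<close>)
  then show ?thesis using greater by simp
next
  case equal
  have "((\<lambda>h. max 0 h) \<longlongrightarrow> max 0 (0::real)) (at 0)" by (intro tendsto_intros)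
  moreover have "(\<lambda>h. (possq (0 + h) - possq 0) / h) = (\<lambda>h. max 0 h)"
    by (auto simp: possq_def fun_eq_iff power2_eq_square)
  ultimately show ?thesis using equal by (simp add: DERIV_def)
qed

text \<open>A piecewise quadratic C^1 transition from 0 on t \<le> 0 to 1 on t \<ge> 1 with slope at
  most 2. One derivative suffices for \<open>integral_dir_deriv_zero\<close>.\<close>

definition smoothstep :: "real \<Rightarrow> real" where
  "smoothstep t = 2 * possq t - 4 * possq (t - 1/2) + 2 * possq (t - 1)"

definition smoothstep' :: "real \<Rightarrow> real" where
  "smoothstep' t = 4 * max 0 t - 8 * max 0 (t - 1/2) + 4 * max 0 (t - 1)"

lemma smoothstep_deriv: "(smoothstep has_real_derivative smoothstep' t) (at t)"
proof -
  have "((\<lambda>t. possq (t - a)) has_real_derivative 2 * max 0 (t - a)) (at t)" for a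
  proof -
    have "((\<lambda>t. t - a) has_real_derivative 1) (at t)" by (auto intro!: derivative_eq_intros)
    from DERIV_chain2[OF possq_deriv this] show ?thesis by simp
  qed
  from DERIV_add[OF DERIV_diff[OF DERIV_cmult[OF possq_deriv, of 2 t] DERIV_cmult[OF this, of 4 "1/2"]] DERIV_cmult[OF this, of 2 1]]
  show ?thesis unfolding smoothstep_def[abs_def] smoothstep'_def by (simp add: mult.assoc)
qed

lemma smoothstep_le_0:
  assumes "t \<le> 0" shows "smoothstep t = 0" "smoothstep' t = 0"
  using assms by (auto simp add: smoothstep_def smoothstep'_def possq_def)

lemma smoothstep_ge_1:
  assumes "1 \<le> t" shows "smoothstep t = 1" "smoothstep' t = 0"
proof -
  have "possq t = t\<^sup>2" "possq (t - 1/2) = (t - 1/2)\<^sup>2" "possq (t - 1) = (t - 1)\<^sup>2"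
    using assms by (simp_all add: possq_def)
  then show "smoothstep t = 1" unfolding smoothstep_def by (simp only:) (simp add: power2_eq_square field_simps)
  have "max 0 t = t" "max 0 (t - 1/2) = t - 1/2" "max 0 (t - 1) = t - 1" using assms by simp_all
  then show "smoothstep' t = 0" unfolding smoothstep'_def by (simp only:) (simp add: field_simps)
qed

lemma smoothstep'_bounds: "0 \<le> smoothstep' t" "smoothstep' t \<le> 2"
proof -
  have "max 0 t = (if t \<le> 0 then 0 else t)" "max 0 (t - 1/2) = (if t \<le> 1/2 then 0 else t - 1/2)"
    "max 0 (t - 1) = (if t \<le> 1 then 0 else t - 1)" by (simp_all add: max_def)
  note m = this
  show "0 \<le> smoothstep' t" "smoothstep' t \<le> 2"
    unfolding smoothstep'_def m by (cases "t \<le> 0"; cases "t \<le> 1/2"; cases "t \<le> 1"; simp)+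
qed

lemma smoothstep_bounds: "0 \<le> smoothstep t" "smoothstep t \<le> 1"
proof -
  have mono: "smoothstep s \<le> smoothstep t" if "s \<le> t" for s t
    by (rule DERIV_nonneg_imp_nondecreasing[OF that]) (use smoothstep_deriv smoothstep'_bounds in blast)
  show "0 \<le> smoothstep t" using mono[of "min t 0" t] smoothstep_le_0(1)[of "min t 0"] by simp
  show "smoothstep t \<le> 1" using mono[of t "max t 1"] smoothstep_ge_1(1)[of "max t 1"] by simp
qed

text \<open>Zero for |x| \<le> d and for |x| \<ge> 1 - d, one for 2 d \<le> |x| \<le> 1 - 2 d: it
  removes both the singular origin and the boundary sphere. \<open>cutoff'\<close> is its partial
  derivative away from the origin.\<close>

definition cutoff :: "real \<Rightarrow> real^'n::finite \<Rightarrow> real" where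
  "cutoff d x = smoothstep (norm x / d - 1) * smoothstep ((1 - norm x) / d - 1)"

definition cutoff' :: "real \<Rightarrow> 'n \<Rightarrow> real^'n::finite \<Rightarrow> real" where
  "cutoff' d j x = (smoothstep' (norm x / d - 1) * smoothstep ((1 - norm x) / d - 1) / d
     - smoothstep (norm x / d - 1) * smoothstep' ((1 - norm x) / d - 1) / d) * (x $ j / norm x)"

lemma norm_dir_deriv:
  fixes x :: "real^'n::finite"
  assumes "x \<noteq> 0"
  shows "((\<lambda>t. norm (x + t *\<^sub>R axis j 1)) has_real_derivative x $ j / norm x) (at 0)"
proof -
  have f: "((\<lambda>t. x + t *\<^sub>R axis j 1) has_derivative (\<lambda>t. t *\<^sub>R axis j 1)) (at (0::real))"
    by (auto intro!: derivative_eq_intros)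
  have "(norm has_derivative (\<lambda>h. h \<bullet> sgn (x + 0 *\<^sub>R axis j 1))) (at (x + 0 *\<^sub>R axis j 1))"
    using has_derivative_norm[of x] assms by (simp add: inner_commute)
  from has_derivative_compose[where g = norm, OF f this]
  have "((\<lambda>t. norm (x + t *\<^sub>R axis j 1)) has_derivative (\<lambda>t. (t *\<^sub>R axis j 1) \<bullet> sgn (x + 0 *\<^sub>R axis j 1))) (at (0::real))" .
  moreover have "(\<lambda>t. (t *\<^sub>R axis j 1) \<bullet> sgn (x + 0 *\<^sub>R axis j 1)) = (*) (x $ j / norm x)"
    by (simp add: fun_eq_iff sgn_div_norm inner_axis' divide_inverse mult_ac)
  ultimately show ?thesis by (simp add: has_field_derivative_def)
qed

lemma cutoff_dir_deriv:
  fixes x :: "real^'n::finite"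
  assumes "x \<noteq> 0"
  shows "((\<lambda>t. cutoff d (x + t *\<^sub>R axis j 1)) has_real_derivative cutoff' d j x) (at 0)"
proof -
  note n = norm_dir_deriv[OF assms, of j]
  have "((\<lambda>t. norm (x + t *\<^sub>R axis j 1) / d - 1) has_real_derivative x $ j / norm x / d - 0) (at 0)"
    by (intro DERIV_diff DERIV_cdivide n DERIV_const)
  from DERIV_chain2[OF smoothstep_deriv this]
  have 1: "((\<lambda>t. smoothstep (norm (x + t *\<^sub>R axis j 1) / d - 1)) has_real_derivative
     smoothstep' (norm x / d - 1) * (x $ j / norm x / d)) (at 0)" by simp
  have "((\<lambda>t. (1 - norm (x + t *\<^sub>R axis j 1)) / d - 1) has_real_derivative (0 - x $ j / norm x) / d - 0) (at 0)"
    by (intro DERIV_diff DERIV_cdivide n DERIV_const)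
  from DERIV_chain2[OF smoothstep_deriv this]
  have 2: "((\<lambda>t. smoothstep ((1 - norm (x + t *\<^sub>R axis j 1)) / d - 1)) has_real_derivative
     smoothstep' ((1 - norm x) / d - 1) * (- (x $ j / norm x) / d)) (at 0)" by simp
  show ?thesis
    unfolding cutoff_def
    by (rule DERIV_cong[OF DERIV_mult[OF 1 2]]) (simp add: cutoff'_def algebra_simps diff_divide_distrib)
qed

lemma cutoff_bounds: "0 \<le> cutoff d x" "cutoff d x \<le> 1"
  unfolding cutoff_def by (intro mult_nonneg_nonneg mult_le_one smoothstep_bounds)+

lemma cutoff_inner: "d > 0 \<Longrightarrow> norm x \<le> d \<Longrightarrow> cutoff d x = 0" "d > 0 \<Longrightarrow> norm x \<le> d \<Longrightarrow> cutoff' d j x = 0"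
  by (simp_all add: cutoff_def cutoff'_def smoothstep_le_0)

lemma cutoff_outer: "d > 0 \<Longrightarrow> 1 - d \<le> norm x \<Longrightarrow> cutoff d x = 0" "d > 0 \<Longrightarrow> 1 - d \<le> norm x \<Longrightarrow> cutoff' d j x = 0"
  by (simp_all add: cutoff_def cutoff'_def smoothstep_le_0 divide_le_eq)

lemma cutoff_mid:
  assumes "d > 0" "2 * d \<le> norm x" "norm x \<le> 1 - 2 * d"
  shows "cutoff d x = 1" "cutoff' d j x = 0"
  using assms by (simp_all add: cutoff_def cutoff'_def smoothstep_ge_1 le_divide_eq)

lemma cutoff'_bound:
  assumes "d > 0"
  shows "\<bar>cutoff' d j x\<bar> \<le> 2 / d"
proof -
  let ?a = "smoothstep' (norm x / d - 1) * smoothstep ((1 - norm x) / d - 1) / d"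
  let ?b = "smoothstep (norm x / d - 1) * smoothstep' ((1 - norm x) / d - 1) / d"
  have p: "u * v \<le> 2" if "0 \<le> u" "u \<le> 2" "0 \<le> v" "v \<le> 1" for u v :: real
    using mult_mono[of u 2 v 1] that by simp
  have "0 \<le> ?a" "0 \<le> ?b" using assms by (simp_all add: smoothstep_bounds smoothstep'_bounds)
  moreover have "?a \<le> 2 / d" "?b \<le> 2 / d"
    using assms p[of "smoothstep' (norm x / d - 1)" "smoothstep ((1 - norm x) / d - 1)"]
      p[of "smoothstep' ((1 - norm x) / d - 1)" "smoothstep (norm x / d - 1)"]
    by (auto intro!: divide_right_mono simp: smoothstep_bounds smoothstep'_bounds mult.commute)
  ultimately have "\<bar>?a - ?b\<bar> \<le> 2 / d" by linarith
  moreover have "\<bar>x $ j / norm x\<bar> \<le> 1" using component_le_norm_cart[of x j] by (simp add: divide_le_eq_1)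
  ultimately show ?thesis unfolding cutoff'_def abs_mult
    using mult_mono[of "\<bar>?a - ?b\<bar>" "2 / d" "\<bar>x $ j / norm x\<bar>" 1] assms by simp
qed

lemma cutoff_borel [measurable]: "cutoff d \<in> borel_measurable borel" "cutoff' d j \<in> borel_measurable borel"
proof -
  have [measurable]: "smoothstep \<in> borel_measurable borel"
    by (intro borel_measurable_continuous_onI DERIV_continuous_on[of _ _ smoothstep'])
       (use smoothstep_deriv in \<open>auto intro: DERIV_subset\<close>)
  have [measurable]: "smoothstep' \<in> borel_measurable borel"
    unfolding smoothstep'_def[abs_def] by measurable
  show "cutoff d \<in> borel_measurable borel" unfolding cutoff_def[abs_def] by measurable
  show "cutoff' d j \<in> borel_measurable borel" unfolding cutoff'_def[abs_def] by measurable
qed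

section \<open>The divergence theorem with a boundary estimate\<close>

lemma power_diff_le:
  fixes a b :: real
  assumes "0 \<le> b" "b \<le> a" "a \<le> 1"
  shows "a ^ n - b ^ n \<le> real n * (a - b)"
proof (induction n)
  case (Suc n)
  have "a ^ Suc n - b ^ Suc n = a * (a ^ n - b ^ n) + b ^ n * (a - b)" by (simp add: algebra_simps)
  also have "\<dots> \<le> 1 * (a ^ n - b ^ n) + 1 * (a - b)"
    using assms by (intro add_mono mult_right_mono power_le_one) (auto intro: power_mono)
  finally show ?case using Suc by (simp add: algebra_simps)
qed simp

text \<open>For a function homogeneous of degree 0 the integral over the ball of radius
  \<open>s\<close> is \<open>s ^ CARD('n)\<close> times that over the unit ball. A thin shell is
  thus compared with the cone integral that also defines \<open>sphere_measure\<close>, without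
  surface integrals.\<close>

lemma shell_integral:
  fixes h :: "real^'n::finite \<Rightarrow> real"
  assumes [measurable]: "h \<in> borel_measurable borel" and hom: "\<And>c x. c > 0 \<Longrightarrow> h (c *\<^sub>R x) = h x"
    and nn: "\<And>x. 0 \<le> h x" and bd: "\<And>x. h x \<le> B" and d: "0 < d" "d \<le> 1/4"
  shows "(\<integral>x. indicator (ball 0 (1 - d) - ball 0 (1 - 2 * d)) x * h x \<partial>lborel)
     \<le> real CARD('n) * d * (\<integral>x. indicator (ball 0 1) x * h x \<partial>lborel)"
proof -
  have int: "integrable lborel (\<lambda>x. indicator (ball 0 s) x * h x)" for s
    by (rule Bochner_Integration.integrable_bound[OF integrable_indicator_ball[of B 0 s]])
       (use nn bd in \<open>auto simp: indicator_def intro!: AE_I2 split: if_splits\<close>, smt (verit) nn bd)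
  have sc: "(\<integral>x. indicator (ball 0 s) x * h x \<partial>lborel) = s ^ CARD('n) * (\<integral>x. indicator (ball 0 1) x * h x \<partial>lborel)"
    if s: "s > 0" for s
  proof -
    have "(\<integral>x. indicator (ball 0 s) x * h x \<partial>lborel)
       = s ^ CARD('n) * (\<integral>x. indicator (ball 0 s) (s *\<^sub>R x) * h (s *\<^sub>R x) \<partial>lborel)"
      by (rule integral_lborel_scale[OF _ s]) (intro borel_measurable_times borel_measurable_indicator assms(1), simp)
    also have "(\<lambda>x. indicator (ball 0 s) (s *\<^sub>R x) * h (s *\<^sub>R x)) = (\<lambda>x. indicator (ball 0 1) x * h x)"
      using s by (auto simp: fun_eq_iff hom indicator_def)
    finally show ?thesis .
  qed
  have "(\<integral>x. indicator (ball 0 (1 - d) - ball 0 (1 - 2 * d)) x * h x \<partial>lborel)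
     = (\<integral>x. indicator (ball 0 (1 - d)) x * h x - indicator (ball 0 (1 - 2 * d)) x * h x \<partial>lborel)"
    using d by (intro Bochner_Integration.integral_cong) (auto simp: indicator_def)
  also have "\<dots> = (1 - d) ^ CARD('n) * (\<integral>x. indicator (ball 0 1) x * h x \<partial>lborel)
     - (1 - 2 * d) ^ CARD('n) * (\<integral>x. indicator (ball 0 1) x * h x \<partial>lborel)"
    using d sc[of "1 - d"] sc[of "1 - 2 * d"]
    by (subst Bochner_Integration.integral_diff[OF int int]) simp
  also have "\<dots> = ((1 - d) ^ CARD('n) - (1 - 2 * d) ^ CARD('n)) * (\<integral>x. indicator (ball 0 1) x * h x \<partial>lborel)"
    by (simp add: algebra_simps)
  also have "\<dots> \<le> (real CARD('n) * ((1 - d) - (1 - 2 * d))) * (\<integral>x. indicator (ball 0 1) x * h x \<partial>lborel)"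
    using d by (intro mult_right_mono power_diff_le integral_nonneg) (auto simp: nn)
  finally show ?thesis by simp
qed

text \<open>The function times the cutoff has a partial derivative of integral zero. Near the origin
  the derivative of the cutoff contributes at most (2/d) (C/d) on a ball of volume O(d^N), which
  vanishes in the limit since N \<ge> 3. Near the sphere it contributes at most 2/d times |F| on a
  shell of volume O(d), where \<open>F\<close> is close to \<open>F (sgn x)\<close>. An upper bound
  for the boundary term is enough: wherever the theorem is applied, this bound is zero or tends to
  zero.\<close>

lemma ball_divergence:
  fixes F D :: "real^'n::finite \<Rightarrow> real"
  assumes N: "3 \<le> CARD('n)" and cont: "continuous_on (cball 0 1 - {0}) F"
    and der: "\<And>x. x \<in> ball 0 1 - {0} \<Longrightarrow> ((\<lambda>t. F (x + t *\<^sub>R axis j 1)) has_real_derivative D x) (at 0)"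
    and Fb: "\<And>x. x \<in> ball 0 1 - {0} \<Longrightarrow> \<bar>F x\<bar> \<le> C / norm x"
    and Db: "\<And>x. x \<in> ball 0 1 - {0} \<Longrightarrow> \<bar>D x\<bar> \<le> C / (norm x)\<^sup>2"
    and C: "0 \<le> C"
  shows "integrable (lebesgue_on (ball 0 1)) D"
    "\<bar>\<integral>x. D x \<partial>lebesgue_on (ball 0 1)\<bar> \<le> 2 * CARD('n) * (\<integral>x. \<bar>F (sgn x)\<bar> \<partial>lebesgue_on (ball 0 1))"
proof -
  let ?I = "indicator (ball 0 1 - {0}) :: real^'n \<Rightarrow> real"
  have Fm[measurable]: "(\<lambda>x. ?I x * F x) \<in> borel_measurable borel"
  proof -
    have "continuous_on (ball 0 1 - {0}) F" by (rule continuous_on_subset[OF cont]) auto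
    from borel_continuous_off_0[OF this] show ?thesis by simp
  qed
  define G where "G d x = cutoff d x * F x" for d x
  define G' where "G' d x = (if x \<in> ball 0 1 - {0} then cutoff d x * D x + cutoff' d j x * F x else 0)" for d x
  \<comment> \<open>\<open>R\<close> is the error caused by the derivative of the cutoff,
    \<open>T\<close> the part that tends to \<open>D\<close>.\<close>
  define R where "R d x = cutoff' d j x * (?I x * F x)" for d x
  define T where "T d x = ?I x * (cutoff d x * D x)" for d x
  have Rm[measurable]: "R d \<in> borel_measurable borel" for d unfolding R_def by measurable
  have G': "integrable lborel (G' d)" "(\<integral>x. G' d x \<partial>lborel) = 0" if d: "0 < d" "d \<le> 1/4" for d
  proof -
    have "G d x = cutoff d x * (?I x * F x)" for x
      using d cutoff_inner(1)[of d x] cutoff_outer(1)[of d x]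
      by (cases "x \<in> ball 0 1 - {0}") (auto simp: G_def)
    then have "G d = (\<lambda>x. cutoff d x * (?I x * F x))" by blast
    then have Gm: "G d \<in> borel_measurable borel" by simp
    have Gder: "((\<lambda>t. G d (x + t *\<^sub>R axis j 1)) has_real_derivative G' d x) (at 0)" for x
    proof (cases "x \<in> ball 0 1 - {0}")
      case True
      then have "((\<lambda>t. G d (x + t *\<^sub>R axis j 1)) has_real_derivative
         cutoff' d j x * F (x + 0 *\<^sub>R axis j 1) + D x * cutoff d (x + 0 *\<^sub>R axis j 1)) (at 0)"
        unfolding G_def by (intro DERIV_mult cutoff_dir_deriv der) auto
      then show ?thesis using True by (simp add: G'_def algebra_simps)
    next
      case False
      have z: "G d (x + t *\<^sub>R axis j 1) = 0" if "t \<in> ball 0 d" for t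
      proof (cases "x = 0")
        case True
        then show ?thesis using that d by (simp add: G_def cutoff_inner norm_axis_1)
      next
        case f: False
        have "norm x - norm (t *\<^sub>R axis j 1 :: real^'n) \<le> norm (x + t *\<^sub>R axis j 1)" by (rule norm_diff_ineq)
        then have "1 - d \<le> norm (x + t *\<^sub>R axis j 1)" using False f that by (simp add: norm_axis_1)
        then show ?thesis using d by (simp add: G_def cutoff_outer)
      qed
      have "((\<lambda>t. 0) has_real_derivative 0) (at (0::real))" by simp
      then have "((\<lambda>t. G d (x + t *\<^sub>R axis j 1)) has_real_derivative 0) (at 0)"
        by (rule has_field_derivative_transform_within_open[of _ _ _ "ball 0 d"]) (use z d in auto)
      then show ?thesis unfolding G'_def by (simp only: False if_False)
    qed
    have Gb: "\<bar>G' d x\<bar> \<le> 3 * C / d\<^sup>2" for x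
    proof (cases "x \<in> ball 0 1 - {0} \<and> d < norm x")
      case True
      then have x: "x \<in> ball 0 1 - {0}" "d < norm x" by auto
      have 1: "\<bar>D x\<bar> \<le> C / d\<^sup>2"
        using Db[OF x(1)] C d x by (intro order_trans[OF Db[OF x(1)]] divide_left_mono power_mono) auto
      have 2: "\<bar>F x\<bar> \<le> C / d"
        using C d x by (intro order_trans[OF Fb[OF x(1)]] divide_left_mono) auto
      have "\<bar>G' d x\<bar> \<le> \<bar>cutoff d x\<bar> * \<bar>D x\<bar> + \<bar>cutoff' d j x\<bar> * \<bar>F x\<bar>"
        using x(1) by (simp add: G'_def abs_mult[symmetric] abs_triangle_ineq)
      also have "\<dots> \<le> 1 * (C / d\<^sup>2) + (2 / d) * (C / d)"
      proof (rule add_mono)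
        have "\<bar>cutoff d x\<bar> \<le> 1" using cutoff_bounds[of d x] by (simp add: abs_of_nonneg)
        from mult_mono[OF this 1] show "\<bar>cutoff d x\<bar> * \<bar>D x\<bar> \<le> 1 * (C / d\<^sup>2)" by simp
        show "\<bar>cutoff' d j x\<bar> * \<bar>F x\<bar> \<le> (2 / d) * (C / d)"
          by (rule mult_mono[OF cutoff'_bound[OF d(1)] 2]) (use d in simp_all)
      qed
      finally show ?thesis by (simp add: power2_eq_square)
    next
      case False
      then have "G' d x = 0" using d by (auto simp: G'_def cutoff_inner not_less)
      then show ?thesis using C by simp
    qed
    show "integrable lborel (G' d)" "(\<integral>x. G' d x \<partial>lborel) = 0"
      by (rule integral_dir_deriv_zero[OF Gm Gder Gb]; use d in \<open>simp add: G_def cutoff_outer norm_axis_1\<close>)+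
  qed
  have TG: "T d x = G' d x - R d x" for d x
    by (simp add: T_def G'_def R_def indicator_def)
  have Tm[measurable]: "T d \<in> borel_measurable borel" if "0 < d" "d \<le> 1/4" for d
  proof -
    have [measurable]: "G' d \<in> borel_measurable borel" using G'(1)[OF that] by simp
    show ?thesis unfolding TG[abs_def] by measurable
  qed
  \<comment> \<open>The shift by 3 keeps the width at most 1/4, so that 2 d \<le> 1 - 2 d.\<close>
  define \<delta> :: "nat \<Rightarrow> real" where "\<delta> n = inverse (real (Suc (n + 3)))" for n
  have \<delta>: "0 < \<delta> n" "\<delta> n \<le> 1/4" for n by (auto simp: \<delta>_def field_simps)
  have \<delta>0: "\<delta> \<longlonglongrightarrow> 0"
    unfolding \<delta>_def by (rule LIMSEQ_ignore_initial_segment[OF LIMSEQ_inverse_real_of_nat])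
  have lim: "(\<lambda>n. T (\<delta> n) x) \<longlonglongrightarrow> ?I x * D x" for x
  proof (cases "x \<in> ball 0 1 - {0}")
    case True
    then have "min (norm x / 2) ((1 - norm x) / 2) > 0" by auto
    then have "eventually (\<lambda>n. \<delta> n < min (norm x / 2) ((1 - norm x) / 2)) sequentially"
      using \<delta>0 by (intro order_tendstoD) auto
    then have "eventually (\<lambda>n. T (\<delta> n) x = ?I x * D x) sequentially"
    proof eventually_elim
      case (elim n)
      then have "cutoff (\<delta> n) x = 1" using \<delta>(1)[of n] by (intro cutoff_mid) auto
      then show ?case by (simp add: T_def)
    qed
    then show ?thesis by (rule tendsto_eventually)
  qed (simp add: T_def)
  have Dm[measurable]: "(\<lambda>x. ?I x * D x) \<in> borel_measurable borel"
    by (rule borel_measurable_LIMSEQ_real[OF lim Tm[OF \<delta>]])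
  have dom: "integrable lborel (\<lambda>x::real^'n. C * (indicator (ball 0 1) x * (1 / (norm x)\<^sup>2)))"
    by (intro integrable_mult_right integrable_inverse_square N)
  have Tb: "norm (T d x) \<le> C * (indicator (ball 0 1) x * (1 / (norm x)\<^sup>2))" for d x
  proof (cases "x \<in> ball 0 1 - {0}")
    case True
    have "\<bar>cutoff d x\<bar> * \<bar>D x\<bar> \<le> 1 * (C / (norm x)\<^sup>2)"
      using cutoff_bounds[of d x] Db[OF True] by (intro mult_mono) auto
    then show ?thesis using True by (simp add: T_def abs_mult)
  qed (use C in \<open>simp add: T_def\<close>)
  have Tint: "(\<lambda>n. \<integral>x. T (\<delta> n) x \<partial>lborel) \<longlonglongrightarrow> (\<integral>x. ?I x * D x \<partial>lborel)"
    by (rule integral_dominated_convergence[OF _ _ dom]) (use lim Tm[OF \<delta>] Tb in \<open>auto intro!: AE_I2\<close>)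
  have Dint: "integrable lborel (\<lambda>x. ?I x * D x)"
    by (rule integrable_dominated_convergence[OF _ _ dom, of _ "\<lambda>n. T (\<delta> n)"]) (use lim Tm[OF \<delta>] Tb in \<open>auto intro!: AE_I2\<close>)
  have eqD: "AE x in lborel. ?I x * D x = indicator (ball 0 1) x *\<^sub>R D x"
    using AE_lborel_singleton[of "0::real^'n"] by eventually_elim (auto simp: indicator_def)
  \<comment> \<open>The absolute boundary values, extended to be homogeneous of degree 0 as
    \<open>shell_integral\<close> wants them.\<close>
  define h where "h x = indicator (- {0}) x * \<bar>F (sgn x)\<bar>" for x :: "real^'n"
  have cs: "continuous_on (- {0}) (\<lambda>x. F (sgn x))"
  proof (rule continuous_on_compose2[OF cont])
    show "continuous_on (- {0}) (sgn :: real^'n \<Rightarrow> real^'n)"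
      by (intro continuous_on_sgn continuous_on_id) simp
    show "sgn ` (- {0}) \<subseteq> cball 0 1 - {0 :: real^'n}" by (auto simp: norm_sgn sgn_zero_iff)
  qed
  have hm[measurable]: "h \<in> borel_measurable borel"
  proof -
    from cs have "(\<lambda>x. indicator (- {0}) x *\<^sub>R F (sgn x)) \<in> borel_measurable borel"
      by (intro borel_measurable_continuous_on_indicator) auto
    from borel_measurable_abs[OF this] show ?thesis unfolding h_def by (simp add: abs_mult)
  qed
  have "compact (F ` sphere 0 1)"
    by (intro compact_continuous_image continuous_on_subset[OF cont]) auto
  then have "bounded (F ` sphere 0 1)" by (rule compact_imp_bounded)
  then obtain B where B: "\<And>x. norm x = 1 \<Longrightarrow> \<bar>F x\<bar> \<le> B"
    unfolding bounded_iff by (metis imageI real_norm_def mem_sphere_0)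
  have B0: "B \<ge> 0" using B[of "axis j 1"] by (simp add: norm_axis_1)
  have hB: "0 \<le> h x" "h x \<le> B" for x using B[of "sgn x"] B0 by (auto simp: h_def indicator_def norm_sgn)
  define V :: real where "V = (\<integral>x. indicator (ball 0 1 :: (real^'n) set) x \<partial>lborel)"
  have V: "V \<ge> 0" by (simp add: V_def)
  define S where "S = (\<integral>x. indicator (ball 0 1) x * h x \<partial>lborel)"
  have hint: "integrable lborel (\<lambda>x. indicator (ball 0 1) x * h x)"
    by (rule Bochner_Integration.integrable_bound[OF integrable_indicator_ball[of B 0 1]])
       (use hB B0 in \<open>auto simp: indicator_def intro!: AE_I2\<close>)
  \<comment> \<open>The first summand comes from the ball of radius 2 d, where the bound 2 C / d^2
    meets a volume of at most 8 d^3 V; the second comes from the outer shell.\<close>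
  have Rest: "\<bar>\<integral>x. T d x \<partial>lborel\<bar> \<le> 16 * C * d * V + 2 * CARD('n) * (S + e * V)"
    if d: "0 < d" "d \<le> 1/4" and e: "e > 0" and u: "\<And>x. 1 - 2 * d \<le> norm x \<Longrightarrow> norm x < 1 \<Longrightarrow> \<bar>F x\<bar> \<le> h x + e" for d e
  proof -
    let ?b = "\<lambda>x. (2 * C / d\<^sup>2) * indicator (ball 0 (2 * d)) x
         + (2 / d) * (indicator (ball 0 (1 - d) - ball 0 (1 - 2 * d)) x * (h x + e))"
    have shb: "integrable lborel (\<lambda>x. indicator (ball 0 (1 - d) - ball 0 (1 - 2 * d)) x * (h x + e))"
      by (rule Bochner_Integration.integrable_bound[OF integrable_indicator_ball[of "B + e" 0 1]])
         (use hB B0 e d in \<open>auto simp: indicator_def intro!: AE_I2\<close>)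
    have bi: "integrable lborel ?b"
      by (intro Bochner_Integration.integrable_add integrable_indicator_ball integrable_mult_right shb)
    have bpos: "0 \<le> (2 * C / d\<^sup>2) * indicator (ball 0 (2 * d)) x"
      "0 \<le> (2 / d) * (indicator (ball 0 (1 - d) - ball 0 (1 - 2 * d)) x * (h x + e))" for x
      using C d hB(1)[of x] e by (intro mult_nonneg_nonneg divide_nonneg_nonneg; simp)+
    have Rb: "\<bar>R d x\<bar> \<le> ?b x" for x
    proof (cases "x \<in> ball 0 1 - {0} \<and> d < norm x \<and> norm x < 1 - d")
      case False
      have "norm x \<le> d \<or> 1 - d \<le> norm x"
      proof (rule ccontr)
        assume ng: "\<not> ?thesis"
        have n: "d < norm x" "norm x < 1 - d" using ng by (simp_all only: de_Morgan_disj not_le)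
        have "norm x < 1" using n d by linarith
        moreover have "x \<noteq> 0" using n(1) d(1) by force
        ultimately have "x \<in> ball 0 1 - {0}" by (simp only: mem_ball_0 Diff_iff singleton_iff simp_thms)
        with False n show False by blast
      qed
      then have "cutoff' d j x = 0"
        using cutoff_inner(2)[OF d(1)] cutoff_outer(2)[OF d(1)] by blast
      then have "R d x = 0" by (simp only: R_def mult_zero_left)
      then show ?thesis using bpos[of x] by linarith
    next
      case True
      then have x: "x \<in> ball 0 1 - {0}" "d < norm x" "norm x < 1 - d" by blast+
      have c: "\<bar>cutoff' d j x\<bar> \<le> 2 / d" using d by (intro cutoff'_bound)
      consider "norm x < 2 * d" | "2 * d \<le> norm x" "norm x \<le> 1 - 2 * d" | "1 - 2 * d \<le> norm x" by linarith
      then show ?thesis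
      proof cases
        case 1
        have "\<bar>F x\<bar> \<le> C / d" using C d x by (intro order_trans[OF Fb[OF x(1)]] divide_left_mono) auto
        then have "\<bar>cutoff' d j x\<bar> * \<bar>F x\<bar> \<le> (2 / d) * (C / d)" by (rule mult_mono[OF c]) (use d in simp_all)
        then have "\<bar>R d x\<bar> \<le> 2 * C / d\<^sup>2" using x(1) by (simp add: R_def abs_mult power2_eq_square)
        then have "\<bar>R d x\<bar> \<le> (2 * C / d\<^sup>2) * indicator (ball 0 (2 * d)) x" using 1 by simp
        then show ?thesis using bpos(2)[of x] by linarith
      next
        case 2
        then have "cutoff' d j x = 0" by (rule cutoff_mid(2)[OF d(1)])
        then have "R d x = 0" by (simp only: R_def mult_zero_left)
        then show ?thesis using bpos[of x] by linarith
      next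
        case 3
        have "\<bar>cutoff' d j x\<bar> * \<bar>F x\<bar> \<le> (2 / d) * (h x + e)"
          by (rule mult_mono[OF c u[OF 3]]) (use d x in simp_all)
        then have "\<bar>R d x\<bar> \<le> (2 / d) * (h x + e)" using x(1) by (simp add: R_def abs_mult)
        then have "\<bar>R d x\<bar> \<le> (2 / d) * (indicator (ball 0 (1 - d) - ball 0 (1 - 2 * d)) x * (h x + e))"
          using 3 x by simp
        then show ?thesis using bpos(1)[of x] by linarith
      qed
    qed
    have Ri: "integrable lborel (R d)"
      by (rule Bochner_Integration.integrable_bound[OF bi]) (use Rb in \<open>auto intro!: AE_I2 intro: order_trans[OF _ abs_ge_self]\<close>)
    have "(\<integral>x. T d x \<partial>lborel) = - (\<integral>x. R d x \<partial>lborel)"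
      unfolding TG using G'[OF d] Ri by simp
    then have "\<bar>\<integral>x. T d x \<partial>lborel\<bar> = \<bar>\<integral>x. R d x \<partial>lborel\<bar>" by simp
    also have "\<dots> \<le> (\<integral>x. ?b x \<partial>lborel)"
      by (rule order_trans[OF integral_abs_bound integral_mono[OF integrable_abs[OF Ri] bi Rb]])
    also have "\<dots> = (2 * C / d\<^sup>2) * (\<integral>x. indicator (ball 0 (2 * d) :: (real^'n) set) x \<partial>lborel)
        + (2 / d) * (\<integral>x. indicator (ball 0 (1 - d) - ball 0 (1 - 2 * d)) x * (h x + e) \<partial>lborel)"
      by (subst Bochner_Integration.integral_add[OF integrable_indicator_ball integrable_mult_right[OF shb]]) simp
    also have "\<dots> \<le> (2 * C / d\<^sup>2) * (8 * d ^ 3 * V) + (2 / d) * (real CARD('n) * d * (S + e * V))"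
    proof (intro add_mono mult_left_mono)
      have "(\<integral>x. indicator (ball 0 (2 * d) :: (real^'n) set) x \<partial>lborel)
          = (2 * d) ^ CARD('n) * (\<integral>x. indicator (ball 0 (2 * d) :: (real^'n) set) ((2 * d) *\<^sub>R x) \<partial>lborel)"
        using d by (intro integral_lborel_scale borel_measurable_indicator) auto
      also have "(\<lambda>x::real^'n. indicator (ball 0 (2 * d)) ((2 * d) *\<^sub>R x) :: real) = indicator (ball 0 1)"
        using d by (auto simp: fun_eq_iff indicator_def)
      also have "(2 * d) ^ CARD('n) * (\<integral>x. indicator (ball 0 1 :: (real^'n) set) x \<partial>lborel) \<le> (2 * d) ^ 3 * V"
        using d N V unfolding V_def[symmetric] by (intro mult_right_mono power_decreasing) auto
      finally show "(\<integral>x. indicator (ball 0 (2 * d) :: (real^'n) set) x \<partial>lborel) \<le> 8 * d ^ 3 * V"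
        by (simp add: power_mult_distrib)
      have "(\<integral>x. indicator (ball 0 (1 - d) - ball 0 (1 - 2 * d)) x * (h x + e) \<partial>lborel)
         \<le> real CARD('n) * d * (\<integral>x. indicator (ball 0 1) x * (h x + e) \<partial>lborel)"
      proof (rule shell_integral[of _ "B + e"])
        show "h (c *\<^sub>R x) + e = h x + e" if "c > 0" for c x
          using that by (cases "x = 0") (simp_all add: h_def sgn_scaleR)
        show "0 \<le> h x + e" "h x + e \<le> B + e" for x using hB[of x] e by simp_all
      qed (use d in simp_all)
      also have "(\<integral>x. indicator (ball 0 1) x * (h x + e) \<partial>lborel) = S + e * V"
      proof -
        have "(\<integral>x. indicator (ball 0 1) x * (h x + e) \<partial>lborel)
          = (\<integral>x. indicator (ball 0 1) x * h x + e * indicator (ball 0 1) x \<partial>lborel)"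
          by (simp add: algebra_simps)
        also have "\<dots> = S + e * V"
          unfolding S_def V_def by (subst Bochner_Integration.integral_add[OF hint integrable_indicator_ball]) simp
        finally show ?thesis .
      qed
      finally show "(\<integral>x. indicator (ball 0 (1 - d) - ball 0 (1 - 2 * d)) x * (h x + e) \<partial>lborel)
         \<le> real CARD('n) * d * (S + e * V)" .
    qed (use C d in auto)
    also have "\<dots> = 16 * C * d * V + 2 * CARD('n) * (S + e * V)"
      using d by (simp add: power2_eq_square power3_eq_cube field_simps)
    finally show ?thesis .
  qed
  have est: "\<bar>\<integral>x. ?I x * D x \<partial>lborel\<bar> \<le> 2 * CARD('n) * (S + e * V)" if e: "e > 0" for e
  proof -
    have "uniformly_continuous_on (cball 0 1 - ball 0 (1/2)) F"
      by (intro compact_uniformly_continuous continuous_on_subset[OF cont] compact_diff) auto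
    then obtain r where r: "r > 0" "\<And>x y. x \<in> cball 0 1 - ball 0 (1/2) \<Longrightarrow> y \<in> cball 0 1 - ball 0 (1/2) \<Longrightarrow>
        dist y x < r \<Longrightarrow> dist (F y) (F x) < e"
      using e unfolding uniformly_continuous_on_def by metis
    have u: "\<bar>F x\<bar> \<le> h x + e" if d: "0 < d" "d \<le> 1/4" "2 * d < r" and x: "1 - 2 * d \<le> norm x" "norm x < 1" for d x
    proof -
      have x0: "x \<noteq> 0" using x d by auto
      have "dist x (sgn x) = \<bar>norm x - 1\<bar>"
      proof -
        have "x - sgn x = (norm x - 1) *\<^sub>R sgn x"
          using x0 by (simp add: sgn_div_norm algebra_simps)
        then show ?thesis using x0 by (simp add: dist_norm norm_sgn)
      qed
      also have "\<dots> < r" using x d by simp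
      finally have r': "dist x (sgn x) < r" .
      have "dist (F x) (F (sgn x)) < e"
        by (rule r(2)[OF _ _ r']) (use x d x0 in \<open>simp_all add: norm_sgn\<close>)
      then have "\<bar>F x - F (sgn x)\<bar> < e" unfolding dist_real_def .
      moreover have "h x = \<bar>F (sgn x)\<bar>" using x0 by (simp add: h_def)
      ultimately show ?thesis by linarith
    qed
    have "eventually (\<lambda>n. \<delta> n < r / 2) sequentially" using \<delta>0 r by (intro order_tendstoD) auto
    then have ev: "eventually (\<lambda>n. \<bar>\<integral>x. T (\<delta> n) x \<partial>lborel\<bar> \<le> 16 * C * \<delta> n * V + 2 * CARD('n) * (S + e * V)) sequentially"
    proof eventually_elim
      case (elim n)
      then have dn: "2 * \<delta> n < r" by simp
      show ?case by (rule Rest[OF \<delta>[of n] e u[OF \<delta>[of n] dn]])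
    qed
    have lim2: "(\<lambda>n. 16 * C * \<delta> n * V + 2 * CARD('n) * (S + e * V)) \<longlonglongrightarrow> 16 * C * 0 * V + 2 * CARD('n) * (S + e * V)"
      by (intro tendsto_intros \<delta>0)
    have "\<bar>\<integral>x. ?I x * D x \<partial>lborel\<bar> \<le> 16 * C * 0 * V + 2 * CARD('n) * (S + e * V)"
      by (rule tendsto_le[OF sequentially_bot lim2 tendsto_rabs[OF Tint] ev])
    then show ?thesis by (simp only: mult_zero_right mult_zero_left add_0)
  qed
  have hIm: "(\<lambda>x. indicator (ball 0 1) x *\<^sub>R h x) \<in> borel_measurable borel"
    by (rule borel_measurable_scaleR[OF borel_measurable_indicator hm]) simp
  have SLB: "S = (\<integral>x. \<bar>F (sgn x)\<bar> \<partial>lebesgue_on (ball 0 1))"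
  proof -
    have "(\<integral>x. \<bar>F (sgn x)\<bar> \<partial>lebesgue_on (ball 0 1)) = (\<integral>x. h x \<partial>lebesgue_on (ball 0 1))"
    proof (rule integral_cong_AE)
      show "(\<lambda>x. \<bar>F (sgn x)\<bar>) \<in> borel_measurable (lebesgue_on (ball 0 1))"
        by (intro LB_measurable_continuous continuous_on_rabs continuous_on_subset[OF cs]) simp
      show "h \<in> borel_measurable (lebesgue_on (ball 0 1))"
        by (rule LB_cong_measurable[OF hIm])
      show "AE x in lebesgue_on (ball 0 1). \<bar>F (sgn x)\<bar> = h x" by (rule LB_I) (simp add: h_def)
    qed
    also have "\<dots> = S" unfolding S_def LB_integral[OF hIm] by simp
    finally show ?thesis by simp
  qed
  have "(\<lambda>x. indicator (ball 0 1) x *\<^sub>R D x) = (\<lambda>x. ?I x * D x + indicator {0} x *\<^sub>R D 0)"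
    by (auto simp: fun_eq_iff indicator_def)
  moreover have "(\<lambda>x. ?I x * D x + indicator {0} x *\<^sub>R D 0) \<in> borel_measurable borel"
    by (intro borel_measurable_add Dm borel_measurable_scaleR borel_measurable_indicator borel_measurable_const) simp
  ultimately have Dm2: "(\<lambda>x. indicator (ball 0 1) x *\<^sub>R D x) \<in> borel_measurable borel" by (simp only:)
  have Dm3: "(\<lambda>x. indicator (ball 0 1) x *\<^sub>R D x) \<in> borel_measurable lborel"
    "(\<lambda>x. ?I x * D x) \<in> borel_measurable lborel"
    using Dm2 Dm by (simp_all only: measurable_lborel2)
  have "integrable lborel (\<lambda>x. indicator (ball 0 1) x *\<^sub>R D x)"
    by (rule integrable_cong_AE_imp[OF Dint Dm3(1) eqD])
  then show "integrable (lebesgue_on (ball 0 1)) D" unfolding LB_integrable_iff[OF Dm2] .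
  have eq2: "(\<integral>x. D x \<partial>lebesgue_on (ball 0 1)) = (\<integral>x. ?I x * D x \<partial>lborel)"
    unfolding LB_integral[OF Dm2]
  proof (rule integral_cong_AE)
    show "AE x in lborel. indicator (ball 0 1) x *\<^sub>R D x = ?I x * D x"
      using eqD by eventually_elim (rule sym)
  qed (rule Dm3)+
  show "\<bar>\<integral>x. D x \<partial>lebesgue_on (ball 0 1)\<bar> \<le> 2 * CARD('n) * (\<integral>x. \<bar>F (sgn x)\<bar> \<partial>lebesgue_on (ball 0 1))"
    unfolding eq2 SLB[symmetric]
  proof (rule field_le_epsilon)
    fix e :: real assume e: "e > 0"
    have V1: "0 < V + 1" using V by linarith
    define e' where "e' = e / (2 * CARD('n) * (V + 1))"
    have "0 < e'" unfolding e'_def by (rule divide_pos_pos[OF e]) (rule mult_pos_pos[OF _ V1], simp)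
    then have "\<bar>\<integral>x. ?I x * D x \<partial>lborel\<bar> \<le> 2 * CARD('n) * (S + e' * V)" by (rule est)
    also have "\<dots> = 2 * CARD('n) * S + e * (V / (V + 1))"
    proof -
      have "2 * CARD('n) * e' = e / (V + 1)" by (simp add: e'_def)
      then show ?thesis by (simp only: distrib_left mult.assoc[symmetric]) simp
    qed
    also have "\<dots> \<le> 2 * CARD('n) * S + e * 1" using e V1 by (intro add_left_mono mult_left_mono) simp_all
    also have "\<dots> = 2 * CARD('n) * S + e" by simp
    finally show "\<bar>\<integral>x. ?I x * D x \<partial>lborel\<bar> \<le> 2 * CARD('n) * S + e" .
  qed
qed

subsection \<open>Differentiable fields with a point singularity\<close>

text \<open>A singularity of order \<open>k\<close> at the origin, with one more order for the
  derivative. The derivative is an explicit argument so that divergences can be computed from it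
  algebraically. Orders add under products, and order 1 is the strongest singularity that
  \<open>ball_divergence\<close> admits.\<close>

definition sing :: "nat \<Rightarrow> (real^'n::finite \<Rightarrow> 'b::real_normed_vector) \<Rightarrow> (real^'n \<Rightarrow> real^'n \<Rightarrow> 'b) \<Rightarrow> bool" where
  "sing k F F' \<longleftrightarrow> (\<exists>C\<ge>0. \<forall>x\<in>ball 0 1 - {0}. (F has_derivative F' x) (at x) \<and>
     norm (F x) \<le> C / norm x ^ k \<and> (\<forall>h. norm (F' x h) \<le> C / norm x ^ Suc k * norm h))"

lemma singI:
  assumes "C \<ge> 0" "\<And>x. x \<in> ball 0 1 - {0} \<Longrightarrow> (F has_derivative F' x) (at x)"
    "\<And>x. x \<in> ball 0 1 - {0} \<Longrightarrow> norm (F x) \<le> C / norm x ^ k"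
    "\<And>x h. x \<in> ball 0 1 - {0} \<Longrightarrow> norm (F' x h) \<le> C / norm x ^ Suc k * norm h"
  shows "sing k F F'"
  using assms unfolding sing_def by blast

lemma singE:
  assumes "sing k F F'"
  obtains C where "C \<ge> 0" "\<And>x. x \<in> ball 0 1 - {0} \<Longrightarrow> (F has_derivative F' x) (at x)"
    "\<And>x. x \<in> ball 0 1 - {0} \<Longrightarrow> norm (F x) \<le> C / norm x ^ k"
    "\<And>x h. x \<in> ball 0 1 - {0} \<Longrightarrow> norm (F' x h) \<le> C / norm x ^ Suc k * norm h"
  using assms unfolding sing_def by blast

lemma sing_deriv: "sing k F F' \<Longrightarrow> x \<in> ball 0 1 - {0} \<Longrightarrow> (F has_derivative F' x) (at x)"
  unfolding sing_def by blast

lemma sing_cont: "sing k F F' \<Longrightarrow> continuous_on (ball 0 1 - {0}) F"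
  by (rule has_derivative_continuous_on[where f' = F'], rule has_derivative_at_withinI, rule sing_deriv)

lemma sing_mono:
  fixes F :: "real^'n::finite \<Rightarrow> 'b::real_normed_vector"
  assumes "sing k F F'" "k \<le> l" shows "sing l F F'"
proof -
  from assms(1) obtain C where C: "C \<ge> 0" "\<And>x. x \<in> ball 0 1 - {0} \<Longrightarrow> (F has_derivative F' x) (at x)"
    "\<And>x. x \<in> ball 0 1 - {0} \<Longrightarrow> norm (F x) \<le> C / norm x ^ k"
    "\<And>x h. x \<in> ball 0 1 - {0} \<Longrightarrow> norm (F' x h) \<le> C / norm x ^ Suc k * norm h" by (rule singE) blast
  have p: "C / norm x ^ i \<le> C / norm x ^ j" if "x \<in> ball 0 1 - {0}" "i \<le> j" for x :: "real^'n" and i j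
    using that C(1) by (intro divide_left_mono power_decreasing) auto
  show ?thesis
  proof (rule singI[OF C(1,2)])
    fix x :: "real^'n" assume x: "x \<in> ball 0 1 - {0}"
    show "norm (F x) \<le> C / norm x ^ l" by (rule order_trans[OF C(3)[OF x] p[OF x assms(2)]])
    show "norm (F' x h) \<le> C / norm x ^ Suc l * norm h" for h
      by (rule order_trans[OF C(4)[OF x] mult_right_mono[OF p[OF x]]]) (use assms(2) in auto)
  qed
qed

text \<open>One rule for scalar multiples, inner products and matrix times vector; the factor 2 in
  the constant covers both terms of the product rule.\<close>

lemma sing_bilinear:
  fixes F :: "real^'n::finite \<Rightarrow> 'b::real_normed_vector" and G :: "real^'n \<Rightarrow> 'c::real_normed_vector"
  assumes bb: "bounded_bilinear b" and F: "sing k F F'" and G: "sing l G G'"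
  shows "sing (k + l) (\<lambda>x. b (F x) (G x)) (\<lambda>x h. b (F x) (G' x h) + b (F' x h) (G x))"
proof -
  from F obtain C where C: "C \<ge> 0" "\<And>x. x \<in> ball 0 1 - {0} \<Longrightarrow> (F has_derivative F' x) (at x)"
    "\<And>x. x \<in> ball 0 1 - {0} \<Longrightarrow> norm (F x) \<le> C / norm x ^ k"
    "\<And>x h. x \<in> ball 0 1 - {0} \<Longrightarrow> norm (F' x h) \<le> C / norm x ^ Suc k * norm h" by (rule singE) blast
  from G obtain D where D: "D \<ge> 0" "\<And>x. x \<in> ball 0 1 - {0} \<Longrightarrow> (G has_derivative G' x) (at x)"
    "\<And>x. x \<in> ball 0 1 - {0} \<Longrightarrow> norm (G x) \<le> D / norm x ^ l"
    "\<And>x h. x \<in> ball 0 1 - {0} \<Longrightarrow> norm (G' x h) \<le> D / norm x ^ Suc l * norm h" by (rule singE) blast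
  obtain K where K: "K > 0" "\<And>u v. norm (b u v) \<le> norm u * norm v * K"
    using bounded_bilinear.pos_bounded[OF bb] by metis
  show ?thesis
  proof (rule singI[where C = "2 * C * D * K"])
    show "2 * C * D * K \<ge> 0" using C D K by simp
    fix x :: "real^'n" assume x: "x \<in> ball 0 1 - {0}"
    show "((\<lambda>x. b (F x) (G x)) has_derivative (\<lambda>h. b (F x) (G' x h) + b (F' x h) (G x))) (at x)"
      by (rule bounded_bilinear.FDERIV[OF bb C(2)[OF x] D(2)[OF x]])
    have x0: "norm x > 0" using x by auto
    have "norm (b (F x) (G x)) \<le> (C / norm x ^ k) * (D / norm x ^ l) * K"
      using C(3)[OF x] D(3)[OF x] K C(1) D(1) by (intro order_trans[OF K(2)] mult_mono) auto
    also have "\<dots> = C * D * K / norm x ^ (k + l)" by (simp add: power_add)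
    also have "\<dots> \<le> 2 * C * D * K / norm x ^ (k + l)" using C D K x0 by (intro divide_right_mono) auto
    finally show "norm (b (F x) (G x)) \<le> 2 * C * D * K / norm x ^ (k + l)" .
    fix h
    have "norm (b (F x) (G' x h)) \<le> (C / norm x ^ k) * (D / norm x ^ Suc l * norm h) * K"
      using C(3)[OF x] D(4)[OF x] K C(1) D(1) by (intro order_trans[OF K(2)] mult_mono) auto
    moreover have "norm (b (F' x h) (G x)) \<le> (C / norm x ^ Suc k * norm h) * (D / norm x ^ l) * K"
      using C(4)[OF x] D(3)[OF x] K C(1) D(1) by (intro order_trans[OF K(2)] mult_mono) auto
    ultimately have "norm (b (F x) (G' x h) + b (F' x h) (G x)) \<le>
       (C / norm x ^ k) * (D / norm x ^ Suc l * norm h) * K + (C / norm x ^ Suc k * norm h) * (D / norm x ^ l) * K"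
      by (meson add_mono norm_triangle_ineq order_trans)
    also have "\<dots> = 2 * C * D * K / norm x ^ Suc (k + l) * norm h"
      using x0 by (simp add: power_add field_simps)
    finally show "norm (b (F x) (G' x h) + b (F' x h) (G x)) \<le> 2 * C * D * K / norm x ^ Suc (k + l) * norm h" .
  qed
qed

lemma sing_add:
  fixes F :: "real^'n::finite \<Rightarrow> 'b::real_normed_vector"
  assumes F: "sing k F F'" and G: "sing k G G'"
  shows "sing k (\<lambda>x. F x + G x) (\<lambda>x h. F' x h + G' x h)"
proof -
  from F obtain C where C: "C \<ge> 0" "\<And>x. x \<in> ball 0 1 - {0} \<Longrightarrow> (F has_derivative F' x) (at x)"
    "\<And>x. x \<in> ball 0 1 - {0} \<Longrightarrow> norm (F x) \<le> C / norm x ^ k"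
    "\<And>x h. x \<in> ball 0 1 - {0} \<Longrightarrow> norm (F' x h) \<le> C / norm x ^ Suc k * norm h" by (rule singE) blast
  from G obtain D where D: "D \<ge> 0" "\<And>x. x \<in> ball 0 1 - {0} \<Longrightarrow> (G has_derivative G' x) (at x)"
    "\<And>x. x \<in> ball 0 1 - {0} \<Longrightarrow> norm (G x) \<le> D / norm x ^ k"
    "\<And>x h. x \<in> ball 0 1 - {0} \<Longrightarrow> norm (G' x h) \<le> D / norm x ^ Suc k * norm h" by (rule singE) blast
  show ?thesis
  proof (rule singI[where C = "C + D"])
    fix x :: "real^'n" assume x: "x \<in> ball 0 1 - {0}"
    show "norm (F x + G x) \<le> (C + D) / norm x ^ k"
      unfolding add_divide_distrib by (rule norm_triangle_le) (intro add_mono C(3) D(3) x)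
    show "norm (F' x h + G' x h) \<le> (C + D) / norm x ^ Suc k * norm h" for h
      unfolding add_divide_distrib distrib_right by (rule norm_triangle_le) (intro add_mono C(4) D(4) x)
  qed (use C D in \<open>auto intro!: has_derivative_add\<close>)
qed

lemma sing_linear:
  fixes F :: "real^'n::finite \<Rightarrow> 'b::real_normed_vector"
  assumes bl: "bounded_linear f" and F: "sing k F F'"
  shows "sing k (\<lambda>x. f (F x)) (\<lambda>x h. f (F' x h))"
proof -
  from F obtain C where C: "C \<ge> 0" "\<And>x. x \<in> ball 0 1 - {0} \<Longrightarrow> (F has_derivative F' x) (at x)"
    "\<And>x. x \<in> ball 0 1 - {0} \<Longrightarrow> norm (F x) \<le> C / norm x ^ k"
    "\<And>x h. x \<in> ball 0 1 - {0} \<Longrightarrow> norm (F' x h) \<le> C / norm x ^ Suc k * norm h" by (rule singE) blast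
  obtain K where K: "K > 0" "\<And>u. norm (f u) \<le> norm u * K"
    using bounded_linear.pos_bounded[OF bl] by metis
  show ?thesis
  proof (rule singI[where C = "C * K"])
    fix x :: "real^'n" assume x: "x \<in> ball 0 1 - {0}"
    show "((\<lambda>x. f (F x)) has_derivative (\<lambda>h. f (F' x h))) (at x)"
      by (rule bounded_linear.has_derivative[OF bl C(2)[OF x]])
    have "norm (f (F x)) \<le> (C / norm x ^ k) * K"
      using C(3)[OF x] K(1) by (intro order_trans[OF K(2)] mult_right_mono) auto
    then show "norm (f (F x)) \<le> C * K / norm x ^ k" by simp
    fix h
    have "norm (f (F' x h)) \<le> (C / norm x ^ Suc k * norm h) * K"
      using C(4)[OF x] K(1) by (intro order_trans[OF K(2)] mult_right_mono) auto
    then show "norm (f (F' x h)) \<le> C * K / norm x ^ Suc k * norm h" by (simp add: mult_ac)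
  qed (use C K in auto)
qed

lemmas sing_scaleR = sing_bilinear[OF bounded_bilinear_scaleR]
  and sing_inner = sing_bilinear[OF bounded_bilinear_inner]
  and sing_mult = sing_bilinear[OF bounded_bilinear_mult]

lemma sing_diff:
  fixes F :: "real^'n::finite \<Rightarrow> 'b::real_normed_vector"
  assumes F: "sing k F F'" and G: "sing k G G'"
  shows "sing k (\<lambda>x. F x - G x) (\<lambda>x h. F' x h - G' x h)"
  using sing_add[OF F sing_linear[OF bounded_linear_minus[OF bounded_linear_ident] G]]
  by (simp only: add_uminus_conv_diff)

lemma sing_ball_divergence:
  fixes F :: "real^'n::finite \<Rightarrow> real"
  assumes N: "3 \<le> CARD('n)" and F: "sing 1 F F'" and cont: "continuous_on (cball 0 1 - {0}) F"
  shows "integrable (lebesgue_on (ball 0 1)) (\<lambda>x. F' x (axis j 1))"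
    "\<bar>\<integral>x. F' x (axis j 1) \<partial>lebesgue_on (ball 0 1)\<bar> \<le> 2 * CARD('n) * (\<integral>x. \<bar>F (sgn x)\<bar> \<partial>lebesgue_on (ball 0 1))"
proof -
  from F obtain C where C: "C \<ge> 0" "\<And>x. x \<in> ball 0 1 - {0} \<Longrightarrow> (F has_derivative F' x) (at x)"
    "\<And>x. x \<in> ball 0 1 - {0} \<Longrightarrow> norm (F x) \<le> C / norm x ^ 1"
    "\<And>x h. x \<in> ball 0 1 - {0} \<Longrightarrow> norm (F' x h) \<le> C / norm x ^ Suc 1 * norm h" by (rule singE) blast
  have der: "((\<lambda>t. F (x + t *\<^sub>R axis j 1)) has_real_derivative F' x (axis j 1)) (at 0)"
    if x: "x \<in> ball 0 1 - {0}" for x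
  proof -
    have f: "((\<lambda>t. x + t *\<^sub>R axis j 1) has_derivative (\<lambda>t. t *\<^sub>R axis j 1)) (at (0::real))"
      by (auto intro!: derivative_eq_intros)
    have g: "(F has_derivative F' x) (at (x + 0 *\<^sub>R axis j 1))" using C(2)[OF x] by simp
    have "linear (F' x)" using C(2)[OF x] has_derivative_linear by blast
    then have eq: "(\<lambda>t. F' x (t *\<^sub>R axis j 1)) = (*) (F' x (axis j 1))"
      by (simp add: fun_eq_iff linear_cmul)
    show ?thesis using has_derivative_compose[where g = F, OF f g]
      unfolding has_field_derivative_def eq .
  qed
  have b: "\<bar>F' x (axis j 1)\<bar> \<le> C / (norm x)\<^sup>2" if x: "x \<in> ball 0 1 - {0}" for x
    using C(4)[OF x, of "axis j 1"] by (simp add: norm_axis_1 power2_eq_square)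
  show "integrable (lebesgue_on (ball 0 1)) (\<lambda>x. F' x (axis j 1))"
    "\<bar>\<integral>x. F' x (axis j 1) \<partial>lebesgue_on (ball 0 1)\<bar> \<le> 2 * CARD('n) * (\<integral>x. \<bar>F (sgn x)\<bar> \<partial>lebesgue_on (ball 0 1))"
    by (rule ball_divergence[OF N cont der _ b C(1)]; use C(3) in simp)+
qed

text \<open>\<open>sing\<close> says nothing on the sphere. Vanishing for \<rho> < |x| supplies
  continuity up to the boundary and makes the boundary bound zero.\<close>

lemma sing_divergence_zero:
  fixes F :: "real^'n::finite \<Rightarrow> real^'n"
  assumes N: "3 \<le> CARD('n)" and F: "sing 1 F F'" and \<rho>: "\<rho> < 1" "\<And>x. \<rho> < norm x \<Longrightarrow> F x = 0"
  shows "integrable (lebesgue_on (ball 0 1)) (\<lambda>x. \<Sum>j\<in>UNIV. F' x (axis j 1) $ j)"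
    "(\<integral>x. (\<Sum>j\<in>UNIV. F' x (axis j 1) $ j) \<partial>lebesgue_on (ball 0 1)) = 0"
proof -
  have s: "sing 1 (\<lambda>x. F x $ j) (\<lambda>x h. F' x h $ j)" for j
    by (rule sing_linear[OF bounded_linear_vec_nth F])
  have c: "continuous_on (cball 0 1 - {0}) (\<lambda>x. F x $ j)" for j
  proof -
    have "continuous_on ((ball 0 1 - {0}) \<union> {x. \<rho> < norm x}) F"
    proof (rule continuous_on_open_Un)
      show "continuous_on (ball 0 1 - {0}) F" by (rule sing_cont[OF F])
      show "continuous_on {x. \<rho> < norm x} F"
        by (rule continuous_on_eq[of _ "\<lambda>_. 0"]) (auto simp: \<rho>)
    qed (auto intro!: open_Collect_less continuous_intros)
    then have "continuous_on (cball 0 1 - {0}) F"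
      by (rule continuous_on_subset) (use \<rho>(1) in auto)
    then show ?thesis by (intro continuous_intros)
  qed
  have z: "F (sgn x) = 0" if "x \<noteq> 0" for x using that \<rho> by (simp add: norm_sgn)
  have i: "integrable (lebesgue_on (ball 0 1)) (\<lambda>x. F' x (axis j 1) $ j)" for j
    by (rule sing_ball_divergence(1)[OF N s c])
  have "(\<integral>x. \<bar>F (sgn x) $ j\<bar> \<partial>lebesgue_on (ball 0 1)) = 0" for j
    by (rule integral_eq_zero_AE, rule LB_I) (simp add: z)
  then have "(\<integral>x. F' x (axis j 1) $ j \<partial>lebesgue_on (ball 0 1)) = 0" for j
    using sing_ball_divergence(2)[OF N s c, of j j] by simp
  then show "(\<integral>x. (\<Sum>j\<in>UNIV. F' x (axis j 1) $ j) \<partial>lebesgue_on (ball 0 1)) = 0"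
    by (subst Bochner_Integration.integral_sum) (auto intro: i)
  show "integrable (lebesgue_on (ball 0 1)) (\<lambda>x. \<Sum>j\<in>UNIV. F' x (axis j 1) $ j)"
    by (intro Bochner_Integration.integrable_sum i)
qed

subsection \<open>Mollifiers\<close>

definition bump :: "real^'n::finite \<Rightarrow> real" where "bump x = expk 0 (1 - x \<bullet> x)"

lemma bump_nonneg: "0 \<le> bump x" by (simp add: bump_def expk_def)

lemma bump_zero: "1 \<le> norm x \<Longrightarrow> bump x = 0"
proof -
  assume "1 \<le> norm x"
  then have "1 \<le> x \<bullet> x" by (simp add: norm_eq_sqrt_inner)
  then show ?thesis by (simp add: bump_def expk_def)
qed

lemma smooth_bump': "smooth (bump :: real^'n::finite \<Rightarrow> real)"
  using smooth_bump unfolding bump_def[abs_def] .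

lemma Cc_integrable:
  assumes "Cc \<phi>" shows "integrable lborel \<phi>"
proof -
  obtain R where R: "smooth \<phi>" "\<And>x. R < norm x \<Longrightarrow> \<phi> x = 0" using assms by (auto simp: Cc_def)
  obtain B where B: "B \<ge> 0" "\<And>x. \<bar>\<phi> x\<bar> \<le> B" using Cc_bounded[OF assms] by blast
  show ?thesis
  proof (rule Bochner_Integration.integrable_bound[OF integrable_indicator_ball[of B 0 "R + 1"]])
    show "\<phi> \<in> borel_measurable lborel" using smooth_borel[OF R(1)] by simp
    show "AE x in lborel. norm (\<phi> x) \<le> norm (B * indicator (ball 0 (R + 1)) x)"
    proof (rule AE_I2)
      fix x show "norm (\<phi> x) \<le> norm (B * indicator (ball 0 (R + 1)) x)"
        using B(1) B(2)[of x] R(2)[of x] by (cases "R < norm x") simp_all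
    qed
  qed
qed

lemma Cc_bump: "Cc bump"
  unfolding Cc_def using smooth_bump' by (intro conjI exI[of _ 1]) (auto intro: bump_zero)

lemma bump_integral_pos: "0 < (\<integral>x. bump x \<partial>(lborel :: (real^'n::finite) measure))"
proof -
  have i: "integrable lborel (bump :: real^'n \<Rightarrow> real)" by (rule Cc_integrable[OF Cc_bump])
  have "(\<integral>x. bump x \<partial>(lborel :: (real^'n) measure)) \<noteq> 0"
  proof
    assume "(\<integral>x. bump x \<partial>(lborel :: (real^'n) measure)) = 0"
    then have "AE x in lborel. bump (x :: real^'n) = 0"
      using integral_nonneg_eq_0_iff_AE[OF i AE_I2[OF bump_nonneg]] by simp
    then have "AE x in lborel. x \<notin> (ball 0 1 :: (real^'n) set)"
    proof eventually_elim
      case (elim x)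
      show ?case
      proof
        assume "x \<in> ball 0 1"
        then have "norm x ^ 2 < 1" by (simp add: power_less_one_iff)
        then have "x \<bullet> x < 1" by (simp add: dot_square_norm)
        then have "bump x > 0" by (simp add: bump_def expk_def)
        then show False using elim by simp
      qed
    qed
    then have "(ball 0 1 :: (real^'n) set) \<in> null_sets lborel" by (subst AE_iff_null_sets) simp_all
    then have "emeasure lborel (ball 0 1 :: (real^'n) set) = 0" by (rule null_setsD1)
    then show False using content_ball_gt_0_iff[of "0::real^'n" 1] by (simp add: measure_def)
  qed
  moreover have "0 \<le> (\<integral>x. bump x \<partial>(lborel :: (real^'n) measure))"
    by (simp add: bump_nonneg)
  ultimately show ?thesis by linarith
qed

definition moll :: "real \<Rightarrow> real^'n::finite \<Rightarrow> real" where
  "moll d x = bump (inverse d *\<^sub>R x) / (d ^ CARD('n) * (\<integral>x. bump x \<partial>(lborel :: (real^'n) measure)))"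

lemma smooth_moll: "smooth (moll d)"
proof -
  have "smooth (\<lambda>x. inverse (d ^ CARD('n) * (\<integral>x. bump x \<partial>(lborel :: (real^'n) measure))) * bump (inverse d *\<^sub>R (x::real^'n) + 0))"
    by (intro smooth_mult smooth_const smooth_affine smooth_bump')
  then show ?thesis by (simp add: moll_def[abs_def] divide_inverse mult.commute)
qed

lemma moll_zero: "0 < d \<Longrightarrow> d \<le> norm x \<Longrightarrow> moll d x = 0"
  unfolding moll_def by (subst bump_zero) (auto simp: field_simps)

lemma Cc_moll: "0 < d \<Longrightarrow> Cc (moll d)"
  unfolding Cc_def using smooth_moll by (intro conjI exI[of _ d]) (auto intro: moll_zero)

lemma moll_nonneg: "0 < d \<Longrightarrow> 0 \<le> moll d (x::real^'n::finite)"
  unfolding moll_def using bump_integral_pos[where 'n = 'n] by (intro divide_nonneg_nonneg bump_nonneg) simp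

lemma moll_borel [measurable]: "moll d \<in> borel_measurable borel"
  by (rule smooth_borel[OF smooth_moll])

lemma moll_integral:
  assumes d: "0 < d"
  shows "(\<integral>x. moll d x \<partial>(lborel :: (real^'n::finite) measure)) = 1"
proof -
  let ?I = "\<integral>x. bump x \<partial>(lborel :: (real^'n) measure)"
  have b: "bump \<in> borel_measurable borel" by (rule smooth_borel[OF smooth_bump'])
  have "(\<integral>x. moll d x \<partial>(lborel :: (real^'n) measure)) = d ^ CARD('n) * (\<integral>x. moll d (d *\<^sub>R x) \<partial>(lborel :: (real^'n) measure))"
    using d by (intro integral_lborel_scale moll_borel)
  also have "(\<lambda>x. moll d (d *\<^sub>R x)) = (\<lambda>x::real^'n. bump x / (d ^ CARD('n) * ?I))"
    using d by (simp add: moll_def fun_eq_iff)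
  also have "d ^ CARD('n) * (\<integral>x. bump x / (d ^ CARD('n) * ?I) \<partial>(lborel :: (real^'n) measure)) = 1"
    using d bump_integral_pos[where 'n = 'n] by simp
  finally show ?thesis .
qed

lemma lborel_reflect_integral:
  fixes f :: "real^'n::finite \<Rightarrow> real"
  assumes f: "f \<in> borel_measurable borel"
  shows "(\<integral>y. f (x - y) \<partial>lborel) = (\<integral>y. f y \<partial>lborel)"
proof -
  have "lborel = distr lborel borel (\<lambda>y. x - y)"
    using lborel_affine[of "-1" x] by (simp add: density_1)
  then have "(\<integral>y. f y \<partial>lborel) = (\<integral>y. f y \<partial>distr lborel borel (\<lambda>y. x - y))" by simp
  also have "\<dots> = (\<integral>y. f (x - y) \<partial>lborel)"
    by (rule integral_distr) (use f in simp_all)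
  finally show ?thesis by simp
qed

lemma lborel_reflect_nn_integral:
  fixes f :: "real^'n::finite \<Rightarrow> ennreal"
  assumes f: "f \<in> borel_measurable borel"
  shows "(\<integral>\<^sup>+y. f (y - x) \<partial>lborel) = (\<integral>\<^sup>+y. f y \<partial>lborel)"
proof -
  have "(\<integral>\<^sup>+y. f y \<partial>lborel) = (\<integral>\<^sup>+y. f y \<partial>distr lborel borel ((+) (- x)))"
    by (simp add: lborel_distr_plus)
  also have "\<dots> = (\<integral>\<^sup>+y. f (y - x) \<partial>lborel)"
    using f by (simp add: nn_integral_distr)
  finally show ?thesis by simp
qed

lemma moll_integral_shift:
  assumes d: "0 < d"
  shows "(\<integral>y. moll d (x - y) \<partial>(lborel :: (real^'n::finite) measure)) = 1"
    "integrable lborel (\<lambda>y. moll d (x - y))"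
proof -
  show 1: "(\<integral>y. moll d (x - y) \<partial>(lborel :: (real^'n) measure)) = 1"
    by (subst lborel_reflect_integral[OF moll_borel]) (rule moll_integral[OF d])
  show "integrable lborel (\<lambda>y. moll d (x - y))"
    by (rule ccontr) (use 1 not_integrable_integral_eq[of lborel "\<lambda>y. moll d (x - y)"] in simp)
qed

lemma conv_const_diff:
  assumes d: "0 < d" and h: "integrable lborel h"
  shows "conv h (moll d) x - c = (\<integral>y. (h y - c) * moll d (x - y) \<partial>lborel)"
proof -
  have "(\<integral>y. (h y - c) * moll d (x - y) \<partial>lborel) = (\<integral>y. h y * moll d (x - y) - c * moll d (x - y) \<partial>lborel)"
    by (simp add: algebra_simps)
  also have "\<dots> = conv h (moll d) x - c"
    unfolding conv_def
    by (subst Bochner_Integration.integral_diff[OF Cc_integrable_mult[OF Cc_moll[OF d] h] integrable_mult_right[OF moll_integral_shift(2)[OF d]]])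
       (simp add: moll_integral_shift(1)[OF d])
  finally show ?thesis by simp
qed

lemma conv_zero:
  assumes "0 < d" "\<And>y. R \<le> norm y \<Longrightarrow> h y = 0" "R + d \<le> norm x"
  shows "conv h (moll d) x = 0"
proof -
  have "h y * moll d (x - y) = 0" for y
  proof (cases "R \<le> norm y")
    case False
    have "norm x - norm y \<le> norm (x - y)" by (rule norm_triangle_ineq2)
    then have "d \<le> norm (x - y)" using False assms(3) by linarith
    then have "moll d (x - y) = 0" by (rule moll_zero[OF assms(1)])
    then show ?thesis by simp
  qed (use assms in simp)
  then have "(\<lambda>y. h y * moll d (x - y)) = (\<lambda>y. 0)" by (rule ext)
  then show ?thesis unfolding conv_def by simp
qed

text \<open>The kernel is a probability density supported in a ball of radius \<open>d\<close>, so
  the convolution is an average of nearby values.\<close>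

lemma conv_close:
  assumes d: "0 < d" and h: "integrable lborel h" and c: "\<And>y. norm (x - y) < d \<Longrightarrow> \<bar>h y - c\<bar> \<le> e" and e: "0 \<le> e"
  shows "\<bar>conv h (moll d) x - c\<bar> \<le> e"
proof -
  have "\<bar>conv h (moll d) x - c\<bar> \<le> (\<integral>y. e * moll d (x - y) \<partial>lborel)"
    unfolding conv_const_diff[OF d h]
  proof (rule order_trans[OF integral_abs_bound integral_mono])
    have "(\<lambda>y. (h y - c) * moll d (x - y)) = (\<lambda>y. h y * moll d (x - y) - c * moll d (x - y))"
      by (simp add: algebra_simps)
    then show "integrable lborel (\<lambda>y. \<bar>(h y - c) * moll d (x - y)\<bar>)"
      using Bochner_Integration.integrable_diff[OF Cc_integrable_mult[OF Cc_moll[OF d] h] integrable_mult_right[OF moll_integral_shift(2)[OF d]]]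
      by (intro integrable_abs) simp
    show "integrable lborel (\<lambda>y. e * moll d (x - y))"
      by (rule integrable_mult_right[OF moll_integral_shift(2)[OF d]])
    fix y
    show "\<bar>(h y - c) * moll d (x - y)\<bar> \<le> e * moll d (x - y)"
    proof (cases "norm (x - y) < d")
      case True
      then show ?thesis using c[OF True] moll_nonneg[OF d, of "x - y"] by (simp add: abs_mult mult_right_mono)
    next
      case False
      then show ?thesis using moll_zero[OF d, of "x - y"] by simp
    qed
  qed
  also have "\<dots> = e" by (simp add: moll_integral_shift(1)[OF d])
  finally show ?thesis .
qed

text \<open>Jensen's inequality for the probability density \<open>moll d\<close>, in the form that
  the variance around the mean \<open>a\<close> is non-negative.\<close>

lemma conv_sq_le:
  assumes d: "0 < d" and h: "integrable lborel h" and h2: "integrable lborel (\<lambda>x. (h x)\<^sup>2)"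
  shows "(conv h (moll d) x)\<^sup>2 \<le> (\<integral>y. (h y)\<^sup>2 * moll d (x - y) \<partial>lborel)"
proof -
  define a where "a = conv h (moll d) x"
  note i1 = Cc_integrable_mult[OF Cc_moll[OF d] h, of x]
  note i2 = Cc_integrable_mult[OF Cc_moll[OF d] h2, of x]
  note i3 = moll_integral_shift(2)[OF d, of x]
  have "0 \<le> (\<integral>y. (h y - a)\<^sup>2 * moll d (x - y) \<partial>lborel)"
    by (rule integral_nonneg_AE, rule AE_I2) (simp add: moll_nonneg[OF d])
  also have "\<dots> = (\<integral>y. ((h y)\<^sup>2 * moll d (x - y) - (2 * a) * (h y * moll d (x - y))) + a\<^sup>2 * moll d (x - y) \<partial>lborel)"
    by (simp add: power2_eq_square algebra_simps)
  also have "\<dots> = (\<integral>y. (h y)\<^sup>2 * moll d (x - y) \<partial>lborel) - 2 * a * a + a\<^sup>2"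
    by (subst Bochner_Integration.integral_add[OF Bochner_Integration.integrable_diff[OF i2 integrable_mult_right[OF i1]] integrable_mult_right[OF i3]],
        subst Bochner_Integration.integral_diff[OF i2 integrable_mult_right[OF i1]])
       (simp add: moll_integral_shift(1)[OF d] a_def conv_def)
  finally show ?thesis unfolding a_def[symmetric] by (simp add: power2_eq_square)
qed

text \<open>Jensen's inequality at each point, then Tonelli and the total mass 1 of the
  kernel.\<close>

lemma conv_L2_contract:
  fixes h :: "real^'n::finite \<Rightarrow> real"
  assumes d: "0 < d" and h: "integrable lborel h" and h2: "integrable lborel (\<lambda>x. (h x)\<^sup>2)"
  shows "(\<integral>\<^sup>+x. ennreal ((conv h (moll d) x)\<^sup>2) \<partial>lborel) \<le> (\<integral>\<^sup>+x. ennreal ((h x)\<^sup>2) \<partial>lborel)"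
proof -
  have hm[measurable]: "h \<in> borel_measurable borel" using h by simp
  have "(\<integral>\<^sup>+x. ennreal ((conv h (moll d) x)\<^sup>2) \<partial>lborel)
     \<le> (\<integral>\<^sup>+x. (\<integral>\<^sup>+y. ennreal ((h y)\<^sup>2) * ennreal (moll d (x - y)) \<partial>lborel) \<partial>lborel)"
  proof (rule nn_integral_mono)
    fix x :: "real^'n"
    have "ennreal ((conv h (moll d) x)\<^sup>2) \<le> ennreal (\<integral>y. (h y)\<^sup>2 * moll d (x - y) \<partial>lborel)"
      by (rule ennreal_leI[OF conv_sq_le[OF assms]])
    also have "\<dots> = (\<integral>\<^sup>+y. ennreal ((h y)\<^sup>2 * moll d (x - y)) \<partial>lborel)"
      by (rule nn_integral_eq_integral[symmetric, OF Cc_integrable_mult[OF Cc_moll[OF d] h2, of x]])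
         (rule AE_I2, simp add: moll_nonneg[OF d])
    also have "\<dots> = (\<integral>\<^sup>+y. ennreal ((h y)\<^sup>2) * ennreal (moll d (x - y)) \<partial>lborel)"
      by (intro nn_integral_cong ennreal_mult) (simp_all add: moll_nonneg[OF d])
    finally show "ennreal ((conv h (moll d) x)\<^sup>2) \<le> (\<integral>\<^sup>+y. ennreal ((h y)\<^sup>2) * ennreal (moll d (x - y)) \<partial>lborel)" .
  qed
  also have "\<dots> = (\<integral>\<^sup>+y. (\<integral>\<^sup>+x. ennreal ((h y)\<^sup>2) * ennreal (moll d (x - y)) \<partial>lborel) \<partial>lborel)"
  proof (rule lborel_pair.Fubini')
    have "(\<lambda>p::(real^'n) \<times> (real^'n). ennreal ((h (fst p))\<^sup>2) * ennreal (moll d (snd p - fst p))) \<in> borel_measurable (borel \<Otimes>\<^sub>M borel)"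
      by measurable
    then show "(\<lambda>(y, x). ennreal ((h y)\<^sup>2) * ennreal (moll d (x - y))) \<in> borel_measurable (lborel \<Otimes>\<^sub>M lborel)"
      by (simp add: case_prod_beta' cong: measurable_cong_sets sets_pair_measure_cong)
  qed
  also have "\<dots> = (\<integral>\<^sup>+y. ennreal ((h y)\<^sup>2) * (\<integral>\<^sup>+x. ennreal (moll d (x - y)) \<partial>lborel) \<partial>lborel)"
    by (intro nn_integral_cong nn_integral_cmult) measurable
  also have "\<dots> = (\<integral>\<^sup>+y. ennreal ((h y)\<^sup>2) * 1 \<partial>lborel)"
  proof -
    have "(\<integral>\<^sup>+x. ennreal (moll d (x - y)) \<partial>lborel) = 1" for y :: "real^'n"
    proof -
      have "(\<integral>\<^sup>+x. ennreal (moll d (x - y)) \<partial>lborel) = (\<integral>\<^sup>+x. ennreal (moll d x) \<partial>(lborel :: (real^'n) measure))"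
        by (rule lborel_reflect_nn_integral) simp
      also have "\<dots> = ennreal (\<integral>x. moll d x \<partial>(lborel :: (real^'n) measure))"
        by (rule nn_integral_eq_integral[OF Cc_integrable[OF Cc_moll[OF d]] AE_I2[OF moll_nonneg[OF d]]])
      finally show ?thesis by (simp add: moll_integral[OF d])
    qed
    then show ?thesis by simp
  qed
  finally show ?thesis by simp
qed

section \<open>Approximation by continuous functions of compact support\<close>

lemma uniformly_continuous_compact_support:
  fixes \<psi> :: "real^'n::finite \<Rightarrow> real"
  assumes c: "continuous_on UNIV \<psi>" and z: "\<And>x. R \<le> norm x \<Longrightarrow> \<psi> x = 0" and e: "0 < e"
  obtains r where "r > 0" "\<And>x y. dist x y < r \<Longrightarrow> \<bar>\<psi> x - \<psi> y\<bar> < e"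
proof -
  have "uniformly_continuous_on (cball 0 (R + 1)) \<psi>"
    by (rule compact_uniformly_continuous[OF continuous_on_subset[OF c]]) auto
  then obtain r where r: "r > 0" "\<And>x y. x \<in> cball 0 (R + 1) \<Longrightarrow> y \<in> cball 0 (R + 1) \<Longrightarrow> dist y x < r \<Longrightarrow> dist (\<psi> y) (\<psi> x) < e"
    using e unfolding uniformly_continuous_on_def by metis
  \<comment> \<open>With distance below 1, as soon as one of the points has norm less than
    \<open>R\<close> both lie in the compact ball of radius R + 1.\<close>
  have "\<bar>\<psi> x - \<psi> y\<bar> < e" if xy: "dist x y < min r 1" for x y
  proof (cases "R \<le> norm x \<and> R \<le> norm y")
    case True
    then show ?thesis using z e by simp
  next
    case False
    have "\<bar>norm x - norm y\<bar> \<le> norm (x - y)" by (rule norm_triangle_ineq3)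
    then have "norm x \<le> R + 1" "norm y \<le> R + 1" using False xy by (auto simp: dist_norm)
    then show ?thesis using r(2)[of y x] xy by (simp add: dist_real_def)
  qed
  then show thesis using that[of "min r 1"] r(1) by simp
qed

lemma continuous_compact_support_integrable:
  fixes \<psi> :: "real^'n::finite \<Rightarrow> real"
  assumes c: "continuous_on UNIV \<psi>" and z: "\<And>x. R \<le> norm x \<Longrightarrow> \<psi> x = 0"
  shows "integrable lborel \<psi>"
proof -
  have "bounded (\<psi> ` cball 0 R)"
    by (intro compact_imp_bounded compact_continuous_image continuous_on_subset[OF c]) auto
  then obtain B where B: "\<And>x. norm x \<le> R \<Longrightarrow> \<bar>\<psi> x\<bar> \<le> B"
    unfolding bounded_iff by (metis imageI real_norm_def mem_cball_0)
  show ?thesis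
  proof (rule Bochner_Integration.integrable_bound[OF integrable_indicator_ball[of B 0 R]])
    show "\<psi> \<in> borel_measurable lborel" using borel_measurable_continuous_onI[OF c] by simp
    show "AE x in lborel. norm (\<psi> x) \<le> norm (B * indicator (ball 0 R) x)"
    proof (rule AE_I2)
      fix x show "norm (\<psi> x) \<le> norm (B * indicator (ball 0 R) x)"
        using B[of x] z[of x] by (cases "R \<le> norm x") simp_all
    qed
  qed
qed

text \<open>A measurable function is almost everywhere a limit of continuous ones. Clipping these to
  [-C, C] and multiplying by a cutoff that is 1 on the unit ball keeps the limit, because
  \<open>h\<close> obeys the same bound and vanishes outside.\<close>

lemma bounded_continuous_approx:
  fixes h :: "real^'n::finite \<Rightarrow> real"
  assumes h: "h \<in> borel_measurable borel" and b: "\<And>x. \<bar>h x\<bar> \<le> C" and z: "\<And>x. 1 \<le> norm x \<Longrightarrow> h x = 0"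
  obtains \<psi> :: "nat \<Rightarrow> real^'n \<Rightarrow> real" where "\<And>m. continuous_on UNIV (\<psi> m)" "\<And>m x. \<bar>\<psi> m x\<bar> \<le> C"
    "\<And>m x. 2 \<le> norm x \<Longrightarrow> \<psi> m x = 0" "AE x in lborel. (\<lambda>m. \<psi> m x) \<longlonglongrightarrow> h x"
proof -
  have C: "0 \<le> C" using b[of 0] by linarith
  have "h measurable_on UNIV"
    using measurable_completion[of h lborel borel] h by (intro lebesgue_measurable_imp_measurable_on) simp_all
  then obtain Z g where Z: "negligible Z" "\<And>m. continuous_on UNIV (g m)" "\<And>x. x \<notin> Z \<Longrightarrow> (\<lambda>m. g m x) \<longlonglongrightarrow> h x"
    unfolding measurable_on_def by auto
  define \<psi> where "\<psi> m x = max 0 (min 1 (2 - norm x)) * max (- C) (min C (g m x))" for m x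
  show thesis
  proof (rule that[of \<psi>])
    show "continuous_on UNIV (\<psi> m)" for m
      unfolding \<psi>_def by (intro continuous_intros Z(2))
    show "\<bar>\<psi> m x\<bar> \<le> C" for m x
    proof -
      have "\<bar>max (- C) (min C (g m x))\<bar> \<le> C" using C by (intro abs_leI) auto
      moreover have "\<bar>max 0 (min 1 (2 - norm x))\<bar> \<le> 1" by (simp add: max_def min_def)
      ultimately have "\<bar>\<psi> m x\<bar> \<le> 1 * C" unfolding \<psi>_def abs_mult by (intro mult_mono) simp_all
      then show ?thesis by simp
    qed
    show "\<psi> m x = 0" if "2 \<le> norm x" for m x using that by (simp add: \<psi>_def)
    have lim: "(\<lambda>m. \<psi> m x) \<longlonglongrightarrow> h x" if x: "x \<notin> Z" for x
    proof -
      have "(\<lambda>m. \<psi> m x) \<longlonglongrightarrow> max 0 (min 1 (2 - norm x)) * max (- C) (min C (h x))"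
        unfolding \<psi>_def by (intro tendsto_intros Z(3) x)
      moreover have "max 0 (min 1 (2 - norm x)) * max (- C) (min C (h x)) = h x"
        using b[of x] z[of x] by (cases "norm x \<le> 1") (simp_all add: abs_le_iff)
      ultimately show ?thesis by simp
    qed
    have "AE x in lebesgue. (\<lambda>m. \<psi> m x) \<longlonglongrightarrow> h x"
      by (rule AE_I'[of Z]) (use Z(1) lim in \<open>auto simp: negligible_iff_null_sets\<close>)
    then show "AE x in lborel. (\<lambda>m. \<psi> m x) \<longlonglongrightarrow> h x" by (simp add: AE_completion_iff)
  qed
qed

text \<open>Truncate at height \<open>n\<close>, then approximate the truncated function. Each error
  is below e/4, and (u + v)^2 \<le> 2 u^2 + 2 v^2 brings the sum below e.\<close>

lemma L2_continuous_approx: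
  fixes h :: "real^'n::finite \<Rightarrow> real"
  assumes h: "h \<in> borel_measurable borel" and h2: "integrable lborel (\<lambda>x. (h x)\<^sup>2)"
    and z: "\<And>x. 1 \<le> norm x \<Longrightarrow> h x = 0" and e: "0 < e"
  obtains \<psi> :: "real^'n \<Rightarrow> real" where "continuous_on UNIV \<psi>" "\<And>x. 2 \<le> norm x \<Longrightarrow> \<psi> x = 0"
    "integrable lborel (\<lambda>x. (h x - \<psi> x)\<^sup>2)" "(\<integral>x. (h x - \<psi> x)\<^sup>2 \<partial>lborel) < e"
proof -
  define t where "t n x = max (- real n) (min (real n) (h x))" for n x
  have tm[measurable]: "t n \<in> borel_measurable borel" for n unfolding t_def using h by measurable
  have t1: "(h x - t n x)\<^sup>2 \<le> (h x)\<^sup>2" for n x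
  proof -
    have "\<bar>h x - t n x\<bar> \<le> \<bar>h x\<bar>" by (auto simp: t_def max_def min_def)
    then show ?thesis by (simp only: abs_le_square_iff)
  qed
  have "(\<lambda>n. \<integral>x. (h x - t n x)\<^sup>2 \<partial>lborel) \<longlonglongrightarrow> (\<integral>x. (0::real) \<partial>(lborel :: (real^'n) measure))"
  proof (rule integral_dominated_convergence[OF _ _ h2])
    show "AE x in lborel. (\<lambda>n. (h x - t n x)\<^sup>2) \<longlonglongrightarrow> 0"
    proof (rule AE_I2)
      fix x
      have "eventually (\<lambda>n. \<bar>h x\<bar> \<le> real n) sequentially"
      proof (rule eventually_sequentiallyI)
        fix n assume "nat \<lceil>\<bar>h x\<bar>\<rceil> \<le> n"
        then have "real (nat \<lceil>\<bar>h x\<bar>\<rceil>) \<le> real n" by (rule of_nat_mono)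
        then show "\<bar>h x\<bar> \<le> real n" using real_nat_ceiling_ge[of "\<bar>h x\<bar>"] by linarith
      qed
      then have "eventually (\<lambda>n. (h x - t n x)\<^sup>2 = 0) sequentially"
      proof eventually_elim
        case (elim n)
        then have "- real n \<le> h x" "h x \<le> real n" by linarith+
        then have "t n x = h x" unfolding t_def by simp
        then show ?case by simp
      qed
      then show "(\<lambda>n. (h x - t n x)\<^sup>2) \<longlonglongrightarrow> 0" by (rule tendsto_eventually)
    qed
    show "AE x in lborel. norm ((h x - t n x)\<^sup>2) \<le> (h x)\<^sup>2" for n using t1 by simp
  qed (use h in measurable)
  then have "(\<lambda>n. \<integral>x. (h x - t n x)\<^sup>2 \<partial>lborel) \<longlonglongrightarrow> 0" by simp
  then have "eventually (\<lambda>n. (\<integral>x. (h x - t n x)\<^sup>2 \<partial>lborel) < e / 4) sequentially"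
    by (rule order_tendstoD(2)) (use e in simp)
  then obtain n where n: "(\<integral>x. (h x - t n x)\<^sup>2 \<partial>lborel) < e / 4" by (auto simp: eventually_sequentially)
  have ti: "integrable lborel (\<lambda>x. (h x - t n x)\<^sup>2)"
    by (rule Bochner_Integration.integrable_bound[OF h2]) (use h t1 in simp_all)
  have tb: "\<bar>t n x\<bar> \<le> real n" for x
    unfolding t_def by (intro abs_leI) auto
  have tz: "1 \<le> norm x \<Longrightarrow> t n x = 0" for x
    using z[of x] by (simp add: t_def)
  obtain \<psi> :: "nat \<Rightarrow> real^'n \<Rightarrow> real" where \<psi>: "\<And>m. continuous_on UNIV (\<psi> m)" "\<And>m x. \<bar>\<psi> m x\<bar> \<le> real n"
    "\<And>m x. 2 \<le> norm x \<Longrightarrow> \<psi> m x = 0" "AE x in lborel. (\<lambda>m. \<psi> m x) \<longlonglongrightarrow> t n x"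
    using bounded_continuous_approx[OF tm tb tz] by blast
  have \<psi>m[measurable]: "\<psi> m \<in> borel_measurable borel" for m using \<psi>(1) by (rule borel_measurable_continuous_onI)
  have pb: "norm ((t n x - \<psi> m x)\<^sup>2) \<le> (2 * real n)\<^sup>2 * indicator (ball 0 2) x" for m x
  proof (cases "2 \<le> norm x")
    case False
    have "\<bar>t n x - \<psi> m x\<bar> \<le> 2 * real n" using tb[of x] \<psi>(2)[of m x] by linarith
    then have "\<bar>t n x - \<psi> m x\<bar> \<le> \<bar>2 * real n\<bar>" by simp
    then have "(t n x - \<psi> m x)\<^sup>2 \<le> (2 * real n)\<^sup>2" by (simp only: abs_le_square_iff)
    then show ?thesis using False by simp
  qed (use tz \<psi>(3) in simp)
  have "(\<lambda>m. \<integral>x. (t n x - \<psi> m x)\<^sup>2 \<partial>lborel) \<longlonglongrightarrow> (\<integral>x. (0::real) \<partial>(lborel :: (real^'n) measure))"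
  proof (rule integral_dominated_convergence[OF _ _ integrable_indicator_ball[of "(2 * real n)\<^sup>2" 0 2]])
    show "AE x in lborel. (\<lambda>m. (t n x - \<psi> m x)\<^sup>2) \<longlonglongrightarrow> 0"
      using \<psi>(4)
    proof eventually_elim
      case (elim x)
      have "(\<lambda>m. (t n x - \<psi> m x)\<^sup>2) \<longlonglongrightarrow> (t n x - t n x)\<^sup>2" by (intro tendsto_intros elim)
      then show ?case by simp
    qed
    show "AE x in lborel. norm ((t n x - \<psi> m x)\<^sup>2) \<le> (2 * real n)\<^sup>2 * indicator (ball 0 2) x" for m using pb by simp
  qed measurable
  then have "(\<lambda>m. \<integral>x. (t n x - \<psi> m x)\<^sup>2 \<partial>lborel) \<longlonglongrightarrow> 0" by simp
  then have "eventually (\<lambda>m. (\<integral>x. (t n x - \<psi> m x)\<^sup>2 \<partial>lborel) < e / 4) sequentially"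
    by (rule order_tendstoD(2)) (use e in simp)
  then obtain m where m: "(\<integral>x. (t n x - \<psi> m x)\<^sup>2 \<partial>lborel) < e / 4" by (auto simp: eventually_sequentially)
  have pi: "integrable lborel (\<lambda>x. (t n x - \<psi> m x)\<^sup>2)"
  proof (rule Bochner_Integration.integrable_bound[OF integrable_indicator_ball[of "(2 * real n)\<^sup>2" 0 2]])
    show "AE x in lborel. norm ((t n x - \<psi> m x)\<^sup>2) \<le> norm ((2 * real n)\<^sup>2 * indicator (ball 0 2) x)"
      using order_trans[OF pb abs_ge_self] by simp
  qed measurable
  have le: "(h x - \<psi> m x)\<^sup>2 \<le> 2 * (h x - t n x)\<^sup>2 + 2 * (t n x - \<psi> m x)\<^sup>2" for x
  proof -
    have "2 * (h x - t n x)\<^sup>2 + 2 * (t n x - \<psi> m x)\<^sup>2 - (h x - \<psi> m x)\<^sup>2 = ((h x - t n x) - (t n x - \<psi> m x))\<^sup>2"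
      by (simp add: power2_eq_square algebra_simps)
    then show ?thesis by (smt (verit) zero_le_power2)
  qed
  have bi: "integrable lborel (\<lambda>x. 2 * (h x - t n x)\<^sup>2 + 2 * (t n x - \<psi> m x)\<^sup>2)"
    by (intro Bochner_Integration.integrable_add integrable_mult_right ti pi)
  have i: "integrable lborel (\<lambda>x. (h x - \<psi> m x)\<^sup>2)"
  proof (rule Bochner_Integration.integrable_bound[OF bi])
    show "AE x in lborel. norm ((h x - \<psi> m x)\<^sup>2) \<le> norm (2 * (h x - t n x)\<^sup>2 + 2 * (t n x - \<psi> m x)\<^sup>2)"
      using le by (intro AE_I2) (simp add: abs_of_nonneg)
  qed (use h in measurable)
  have "(\<integral>x. (h x - \<psi> m x)\<^sup>2 \<partial>lborel) \<le> (\<integral>x. 2 * (h x - t n x)\<^sup>2 + 2 * (t n x - \<psi> m x)\<^sup>2 \<partial>lborel)"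
    by (rule integral_mono[OF i bi le])
  also have "\<dots> = 2 * (\<integral>x. (h x - t n x)\<^sup>2 \<partial>lborel) + 2 * (\<integral>x. (t n x - \<psi> m x)\<^sup>2 \<partial>lborel)"
    by (subst Bochner_Integration.integral_add[OF integrable_mult_right[OF ti] integrable_mult_right[OF pi]]) simp
  also have "\<dots> < e" using n m by simp
  finally show thesis using that[of "\<psi> m"] \<psi> i by blast
qed

subsection \<open>Approximation in the energy space\<close>

definition mdel :: "nat \<Rightarrow> real" where "mdel k = 1 / (real k + 1)"

text \<open>The dilation moves the support of a field on the closed ball into its interior.\<close>

definition mol :: "nat \<Rightarrow> (real^'n::finite \<Rightarrow> real) \<Rightarrow> real^'n \<Rightarrow> real" where
  "mol k h x = conv h (moll (mdel k)) ((1 + 2 * mdel k) *\<^sub>R x)"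

lemma mdel: "0 < mdel k" "mdel k \<le> 1" by (simp_all add: mdel_def)

lemma mdel_lim: "mdel \<longlonglongrightarrow> 0"
  using LIMSEQ_inverse_real_of_nat by (simp add: mdel_def[abs_def] inverse_eq_divide add.commute)

text \<open>Mollification widens the support from radius 1 to 1 + \<open>mdel k\<close>; the
  dilation by 1 + 2 \<open>mdel k\<close> brings it back to this radius below 1.\<close>

definition mrho :: "nat \<Rightarrow> real" where "mrho k = (1 + mdel k) / (1 + 2 * mdel k)"

lemma mrho: "0 < mrho k" "mrho k < 1"
  using mdel(1)[of k] by (simp_all add: mrho_def)

lemma mol_zero:
  assumes "\<And>y. 1 \<le> norm y \<Longrightarrow> h y = 0" "mrho k \<le> norm x"
  shows "mol k h x = 0"
  unfolding mol_def
proof (rule conv_zero[OF mdel(1) assms(1)])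
  have "1 + mdel k \<le> (1 + 2 * mdel k) * norm x"
    using assms(2) mdel(1)[of k] by (simp add: mrho_def divide_le_eq mult.commute)
  then show "1 + mdel k \<le> norm ((1 + 2 * mdel k) *\<^sub>R x)" using mdel(1)[of k] by simp
qed

lemma mol_Cc:
  assumes "integrable lborel h" "\<And>y. 1 \<le> norm y \<Longrightarrow> h y = 0"
  shows "Cc (mol k h)"
proof -
  have "smooth (\<lambda>x. conv h (moll (mdel k)) ((1 + 2 * mdel k) *\<^sub>R x + 0))"
    by (intro smooth_affine smooth_conv Cc_moll mdel assms)
  then have "smooth (mol k h)" by (simp add: mol_def[abs_def])
  moreover have "mol k h x = 0" if "mrho k < norm x" for x
    by (rule mol_zero[OF _ less_imp_le[OF that]]) (rule assms(2))
  ultimately show ?thesis unfolding Cc_def by blast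
qed

text \<open>The weak derivative on the whole space. The test functions need not vanish on the unit
  sphere, so for functions that are zero outside the ball this encodes zero boundary values as
  well.\<close>

definition weak_pd :: "'n::finite \<Rightarrow> (real^'n \<Rightarrow> real) \<Rightarrow> (real^'n \<Rightarrow> real) \<Rightarrow> bool" where
  "weak_pd j v g \<longleftrightarrow> (\<forall>\<phi>. Cc \<phi> \<longrightarrow> (\<integral>x. v x * pderiv_at j \<phi> x \<partial>lborel) = - (\<integral>x. g x * \<phi> x \<partial>lborel))"

lemma Cc_reflect:
  assumes "Cc \<phi>" shows "Cc (\<lambda>y. \<phi> (z - y))" "pderiv_at j (\<lambda>y. \<phi> (z - y)) y = - pderiv_at j \<phi> (z - y)"
proof -
  have e: "(\<lambda>y. \<phi> (z - y)) = (\<lambda>y. \<phi> ((-1) *\<^sub>R y + z))" by (simp add: fun_eq_iff)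
  obtain R where R: "\<And>x. R < norm x \<Longrightarrow> \<phi> x = 0" using assms by (auto simp: Cc_def)
  have "\<phi> (z - y) = 0" if "R + norm z < norm y" for y
    by (rule R) (use that norm_triangle_ineq2[of y z] in \<open>simp add: norm_minus_commute\<close>)
  then show "Cc (\<lambda>y. \<phi> (z - y))"
    unfolding Cc_def using smooth_affine(1)[OF Cc_smooth[OF assms], of "-1" z] by (auto simp: e[symmetric])
  show "pderiv_at j (\<lambda>y. \<phi> (z - y)) y = - pderiv_at j \<phi> (z - y)"
    unfolding e using smooth_affine(2)[OF Cc_smooth[OF assms], of j "-1" z y] by simp
qed

text \<open>The reflected and translated kernel is a test function, so the derivative moves from the
  kernel to \<open>v\<close>; the dilation contributes the factor.\<close>

lemma mol_pderiv:
  assumes v: "integrable lborel v" and w: "weak_pd j v g"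
  shows "pderiv_at j (mol k v) x = (1 + 2 * mdel k) * mol k g x"
proof -
  have "pderiv_at j (\<lambda>x. conv v (moll (mdel k)) ((1 + 2 * mdel k) *\<^sub>R x + 0)) x
     = (1 + 2 * mdel k) * pderiv_at j (conv v (moll (mdel k))) ((1 + 2 * mdel k) *\<^sub>R x + 0)"
    by (rule smooth_affine(2)[OF smooth_conv[OF Cc_moll[OF mdel(1)] v]])
  moreover have "pderiv_at j (conv v (moll (mdel k))) z = conv g (moll (mdel k)) z" for z
  proof -
    note C = Cc_moll[OF mdel(1)[of k]]
    have "(\<integral>y. v y * pderiv_at j (\<lambda>y. moll (mdel k) (z - y)) y \<partial>lborel) = - (\<integral>y. g y * moll (mdel k) (z - y) \<partial>lborel)"
      using w Cc_reflect(1)[OF C] unfolding weak_pd_def by blast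
    then show ?thesis
      by (simp add: pderiv_conv[OF C v] conv_def Cc_reflect(2)[OF C])
  qed
  ultimately show ?thesis by (simp add: mol_def[abs_def])
qed

text \<open>After \<open>conv_L2_contract\<close> only the dilation is left, and a dilation by a
  factor of at least 1 can only decrease the integral.\<close>

lemma mol_L2_contract:
  fixes h :: "real^'n::finite \<Rightarrow> real"
  assumes h: "integrable lborel h" and h2: "integrable lborel (\<lambda>x. (h x)\<^sup>2)"
  shows "(\<integral>\<^sup>+x. ennreal ((mol k h x)\<^sup>2) \<partial>lborel) \<le> (\<integral>\<^sup>+x. ennreal ((h x)\<^sup>2) \<partial>lborel)"
proof -
  let ?c = "conv h (moll (mdel k))" and ?t = "1 + 2 * mdel k"
  have [measurable]: "?c \<in> borel_measurable borel"
    by (rule smooth_borel[OF smooth_conv[OF Cc_moll[OF mdel(1)] h]])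
  have t: "1 \<le> ?t" using mdel(1)[of k] by simp
  have "1 * (\<integral>\<^sup>+x. ennreal ((?c (?t *\<^sub>R x))\<^sup>2) \<partial>lborel) \<le> ennreal (?t ^ CARD('n)) * (\<integral>\<^sup>+x. ennreal ((?c (?t *\<^sub>R x))\<^sup>2) \<partial>lborel)"
    using ennreal_leI[OF one_le_power[OF t, of "CARD('n)"]] by (intro mult_right_mono) simp_all
  also have "\<dots> = (\<integral>\<^sup>+x. ennreal ((?c x)\<^sup>2) \<partial>lborel)"
    using t by (intro nn_integral_lborel_scale[symmetric]) simp_all
  also have "\<dots> \<le> (\<integral>\<^sup>+x. ennreal ((h x)\<^sup>2) \<partial>lborel)"
    by (rule conv_L2_contract[OF mdel(1) h h2])
  finally show ?thesis by (simp add: mol_def)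
qed

lemma mol_uniform:
  fixes \<psi> :: "real^'n::finite \<Rightarrow> real"
  assumes c: "continuous_on UNIV \<psi>" and z: "\<And>x. R \<le> norm x \<Longrightarrow> \<psi> x = 0" and e: "0 < e" and R: "0 < R"
  shows "eventually (\<lambda>k. \<forall>x. \<bar>mol k \<psi> x - \<psi> x\<bar> \<le> e) sequentially"
proof -
  note i = continuous_compact_support_integrable[OF c z]
  obtain r where r: "r > 0" "\<And>x y. dist x y < r \<Longrightarrow> \<bar>\<psi> x - \<psi> y\<bar> < e / 2"
    using uniformly_continuous_compact_support[OF c z, of R "e / 2"] e by auto
  \<comment> \<open>Both the radius \<open>mdel k\<close> of the kernel and the displacement by the
    dilation, at most 2 \<open>mdel k\<close> R on the support, must stay below
    \<open>r\<close>.\<close>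
  have "eventually (\<lambda>k. mdel k < r / (2 * R + 1)) sequentially"
    using mdel_lim r(1) R by (intro order_tendstoD(2)[of _ 0]) simp_all
  then show ?thesis
  proof eventually_elim
    case (elim k)
    then have k: "mdel k * (2 * R + 1) < r" using R by (simp add: less_divide_eq)
    have kr: "mdel k < r" "2 * mdel k * R < r"
    proof -
      have "0 \<le> 2 * mdel k * R" using mdel(1)[of k] R by simp
      then show "mdel k < r" "2 * mdel k * R < r" using k mdel(1)[of k] by (simp_all add: algebra_simps)
    qed
    show ?case
    proof
      fix x :: "real^'n"
      let ?y = "(1 + 2 * mdel k) *\<^sub>R x"
      have 1: "\<bar>mol k \<psi> x - \<psi> ?y\<bar> \<le> e / 2"
        unfolding mol_def
      proof (rule conv_close[OF mdel(1) i])
        fix y assume "norm (?y - y) < mdel k"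
        then have "dist y ?y < r" using kr(1) by (simp add: dist_norm norm_minus_commute)
        then show "\<bar>\<psi> y - \<psi> ?y\<bar> \<le> e / 2" using r(2) by (simp add: less_imp_le)
      qed (use e in simp_all)
      have 2: "\<bar>\<psi> ?y - \<psi> x\<bar> \<le> e / 2"
      proof (cases "R \<le> norm x")
        case True
        have "norm x \<le> norm ?y" using mdel(1)[of k] by (simp add: mult_le_cancel_right1)
        then show ?thesis using z[OF True] z[of ?y] True e by simp
      next
        case False
        have "dist ?y x = 2 * mdel k * norm x" using mdel(1)[of k] by (simp add: dist_norm algebra_simps)
        also have "\<dots> \<le> 2 * mdel k * R" using False mdel(1)[of k] by (intro mult_left_mono) simp_all
        finally show ?thesis using r(2)[of ?y x] kr(2) by simp
      qed
      show "\<bar>mol k \<psi> x - \<psi> x\<bar> \<le> e" using 1 2 by linarith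
    qed
  qed
qed

lemma integrable_of_L2:
  fixes h :: "real^'n::finite \<Rightarrow> real"
  assumes h: "h \<in> borel_measurable borel" and h2: "integrable lborel (\<lambda>x. (h x)\<^sup>2)" and z: "\<And>x. R \<le> norm x \<Longrightarrow> h x = 0"
  shows "integrable lborel h"
proof (rule Bochner_Integration.integrable_bound)
  show "integrable lborel (\<lambda>x. (h x)\<^sup>2 + 1 * indicator (ball 0 R) x)"
    by (intro Bochner_Integration.integrable_add h2 integrable_indicator_ball)
  show "AE x in lborel. norm (h x) \<le> norm ((h x)\<^sup>2 + 1 * indicator (ball 0 R) x)"
  proof (rule AE_I2)
    fix x
    have "\<bar>h x\<bar> \<le> (h x)\<^sup>2 + 1"
      using zero_le_power2[of "\<bar>h x\<bar> - 1"] by (simp add: power2_eq_square algebra_simps)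
    then show "norm (h x) \<le> norm ((h x)\<^sup>2 + 1 * indicator (ball 0 R) x)"
      using z[of x] by (cases "R \<le> norm x") simp_all
  qed
qed (use h in simp)

lemma mol_L2_tendsto:
  fixes h :: "real^'n::finite \<Rightarrow> real"
  assumes h: "h \<in> borel_measurable borel" and h2: "integrable lborel (\<lambda>x. (h x)\<^sup>2)" and z: "\<And>x. 1 \<le> norm x \<Longrightarrow> h x = 0"
  shows "(\<lambda>k. \<integral>\<^sup>+x. ennreal ((mol k h x - h x)\<^sup>2) \<partial>lborel) \<longlonglongrightarrow> 0"
proof (rule order_tendstoI)
  fix a :: ennreal assume a: "0 < a"
  obtain e :: real where e: "0 < e" "ennreal e < a"
  proof (cases "a = top")
    case True
    then show thesis using that[of 1] by simp
  next
    case False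
    then obtain r where "a = ennreal r" "0 \<le> r" by (cases a) auto
    then show thesis using that[of "r / 2"] a by (simp add: ennreal_less_iff)
  qed
  \<comment> \<open>The error is split into three terms with a factor 3 each: contraction of h -
    \<psi>, uniform approximation of \<psi>, and h - \<psi> itself. Each contributes 3 e /
    12.\<close>
  obtain \<psi> :: "real^'n \<Rightarrow> real" where \<psi>: "continuous_on UNIV \<psi>" "\<And>x. 2 \<le> norm x \<Longrightarrow> \<psi> x = 0"
    "integrable lborel (\<lambda>x. (h x - \<psi> x)\<^sup>2)" "(\<integral>x. (h x - \<psi> x)\<^sup>2 \<partial>lborel) < e / 12"
    using L2_continuous_approx[OF h h2 z, of "e / 12"] e by auto
  have \<psi>m[measurable]: "\<psi> \<in> borel_measurable borel" using \<psi>(1) by (rule borel_measurable_continuous_onI)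
  note hm[measurable] = h
  have hi: "integrable lborel h" by (rule integrable_of_L2[OF h h2 z])
  have \<psi>i: "integrable lborel \<psi>" by (rule continuous_compact_support_integrable[OF \<psi>(1,2)])
  have d: "integrable lborel (\<lambda>x. h x - \<psi> x)" using hi \<psi>i by simp
  define V where "V = (\<integral>x. indicator (ball 0 2 :: (real^'n) set) x \<partial>lborel) + (1 :: real)"
  have "0 \<le> (\<integral>x. indicator (ball 0 2 :: (real^'n) set) x \<partial>lborel :: real)" by simp
  then have V: "V > 0" by (simp only: V_def)
  define \<eta> where "\<eta> = sqrt (e / (12 * V))"
  have \<eta>: "0 < \<eta>" "\<eta>\<^sup>2 = e / (12 * V)" using e V by (simp_all add: \<eta>_def)
  have "eventually (\<lambda>k. \<forall>x. \<bar>mol k \<psi> x - \<psi> x\<bar> \<le> \<eta>) sequentially"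
    by (rule mol_uniform[OF \<psi>(1,2) \<eta>(1) zero_less_numeral])
  then show "eventually (\<lambda>k. (\<integral>\<^sup>+x. ennreal ((mol k h x - h x)\<^sup>2) \<partial>lborel) < a) sequentially"
  proof eventually_elim
    case (elim k)
    have mz: "mol k \<psi> x = 0" if "2 \<le> norm x" for x
      unfolding mol_def
    proof (rule conv_zero[OF mdel(1) \<psi>(2)])
      have "2 * (1 + 2 * mdel k) \<le> norm x * (1 + 2 * mdel k)" using that mdel(1)[of k] by (intro mult_right_mono) simp_all
      then show "2 + mdel k \<le> norm ((1 + 2 * mdel k) *\<^sub>R x)" using mdel(1)[of k] by (simp add: mult.commute)
    qed
    have lin: "mol k h x = mol k (\<lambda>x. h x - \<psi> x) x + mol k \<psi> x" for x
      unfolding mol_def conv_def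
      by (subst Bochner_Integration.integral_add[symmetric, OF Cc_integrable_mult[OF Cc_moll[OF mdel(1)] d] Cc_integrable_mult[OF Cc_moll[OF mdel(1)] \<psi>i]])
         (simp add: algebra_simps)
    have pw: "(mol k h x - h x)\<^sup>2 \<le> 3 * (mol k (\<lambda>x. h x - \<psi> x) x)\<^sup>2 + 3 * (\<eta>\<^sup>2 * indicator (ball 0 2) x) + 3 * (h x - \<psi> x)\<^sup>2" for x
    proof -
      have sq: "(u + v - w)\<^sup>2 \<le> 3 * u\<^sup>2 + 3 * v\<^sup>2 + 3 * w\<^sup>2" for u v w :: real
      proof -
        have "3 * u\<^sup>2 + 3 * v\<^sup>2 + 3 * w\<^sup>2 - (u + v - w)\<^sup>2 = (u - v)\<^sup>2 + (u + w)\<^sup>2 + (v + w)\<^sup>2"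
          by (simp add: power2_eq_square algebra_simps)
        then show ?thesis by (smt (verit) zero_le_power2)
      qed
      have "(mol k \<psi> x - \<psi> x)\<^sup>2 \<le> \<eta>\<^sup>2 * indicator (ball 0 2) x"
      proof (cases "2 \<le> norm x")
        case False
        have "\<bar>mol k \<psi> x - \<psi> x\<bar> \<le> \<bar>\<eta>\<bar>" using elim \<eta>(1) by simp
        then have "(mol k \<psi> x - \<psi> x)\<^sup>2 \<le> \<eta>\<^sup>2" by (simp only: abs_le_square_iff)
        then show ?thesis using False by simp
      qed (use mz \<psi>(2) in simp)
      moreover have "(mol k h x - h x)\<^sup>2 \<le> 3 * (mol k (\<lambda>x. h x - \<psi> x) x)\<^sup>2 + 3 * (mol k \<psi> x - \<psi> x)\<^sup>2 + 3 * (h x - \<psi> x)\<^sup>2"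
      proof -
        have "mol k h x - h x = mol k (\<lambda>x. h x - \<psi> x) x + (mol k \<psi> x - \<psi> x) - (h x - \<psi> x)"
          unfolding lin by simp
        then show ?thesis by (simp only: sq)
      qed
      ultimately show ?thesis by linarith
    qed
    have mm[measurable]: "mol k (\<lambda>x. h x - \<psi> x) \<in> borel_measurable borel"
      unfolding mol_def[abs_def]
      by (rule measurable_compose[OF _ smooth_borel[OF smooth_conv[OF Cc_moll[OF mdel(1)] d]]]) simp
    have fin: "(\<integral>\<^sup>+x. ennreal ((h x - \<psi> x)\<^sup>2) \<partial>lborel) \<le> ennreal (e / 12)"
      using \<psi>(4) by (subst nn_integral_eq_integral[OF \<psi>(3)]) (simp_all add: ennreal_leI)
    have fin2: "(\<integral>\<^sup>+x. ennreal ((mol k (\<lambda>x. h x - \<psi> x) x)\<^sup>2) \<partial>lborel) \<le> ennreal (e / 12)"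
      by (rule order_trans[OF mol_L2_contract[OF d \<psi>(3)] fin])
    have fin3: "(\<integral>\<^sup>+x. ennreal (\<eta>\<^sup>2 * indicator (ball 0 2) x) \<partial>(lborel :: (real^'n) measure)) \<le> ennreal (e / 12)"
    proof -
      have "(\<integral>\<^sup>+x. ennreal (\<eta>\<^sup>2 * indicator (ball 0 2) x) \<partial>(lborel :: (real^'n) measure))
          = ennreal (\<integral>x. \<eta>\<^sup>2 * indicator (ball 0 2 :: (real^'n) set) x \<partial>lborel)"
        by (rule nn_integral_eq_integral[OF integrable_indicator_ball]) (simp add: indicator_def)
      also have "(\<integral>x. \<eta>\<^sup>2 * indicator (ball 0 2 :: (real^'n) set) x \<partial>lborel) = \<eta>\<^sup>2 * (V - 1)"
        by (simp add: V_def)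
      also have "\<eta>\<^sup>2 * (V - 1) \<le> \<eta>\<^sup>2 * V" by (intro mult_left_mono) simp_all
      also have "\<eta>\<^sup>2 * V = e / 12" using V by (simp add: \<eta>(2))
      finally show ?thesis by (simp add: ennreal_leI)
    qed
    have "(\<integral>\<^sup>+x. ennreal ((mol k h x - h x)\<^sup>2) \<partial>lborel)
      \<le> (\<integral>\<^sup>+x. ennreal 3 * ennreal ((mol k (\<lambda>x. h x - \<psi> x) x)\<^sup>2) + ennreal 3 * ennreal (\<eta>\<^sup>2 * indicator (ball 0 2) x)
           + ennreal 3 * ennreal ((h x - \<psi> x)\<^sup>2) \<partial>lborel)"
    proof (rule nn_integral_mono)
      fix x
      have "ennreal ((mol k h x - h x)\<^sup>2) \<le> ennreal (3 * (mol k (\<lambda>x. h x - \<psi> x) x)\<^sup>2 + 3 * (\<eta>\<^sup>2 * indicator (ball 0 2) x) + 3 * (h x - \<psi> x)\<^sup>2)"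
        by (rule ennreal_leI[OF pw])
      also have "\<dots> = ennreal 3 * ennreal ((mol k (\<lambda>x. h x - \<psi> x) x)\<^sup>2) + ennreal 3 * ennreal (\<eta>\<^sup>2 * indicator (ball 0 2) x)
           + ennreal 3 * ennreal ((h x - \<psi> x)\<^sup>2)"
        by (simp only: ennreal_plus ennreal_mult'' zero_le_power2 mult_nonneg_nonneg zero_le_numeral add_nonneg_nonneg indicator_pos_le)
      finally show "ennreal ((mol k h x - h x)\<^sup>2) \<le> ennreal 3 * ennreal ((mol k (\<lambda>x. h x - \<psi> x) x)\<^sup>2) + ennreal 3 * ennreal (\<eta>\<^sup>2 * indicator (ball 0 2) x)
           + ennreal 3 * ennreal ((h x - \<psi> x)\<^sup>2)" .
    qed
    also have "\<dots> = ennreal 3 * (\<integral>\<^sup>+x. ennreal ((mol k (\<lambda>x. h x - \<psi> x) x)\<^sup>2) \<partial>lborel)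
        + ennreal 3 * (\<integral>\<^sup>+x. ennreal (\<eta>\<^sup>2 * indicator (ball 0 2) x) \<partial>(lborel :: (real^'n) measure))
        + ennreal 3 * (\<integral>\<^sup>+x. ennreal ((h x - \<psi> x)\<^sup>2) \<partial>lborel)"
    proof -
      have m1: "(\<lambda>x. ennreal ((mol k (\<lambda>x. h x - \<psi> x) x)\<^sup>2)) \<in> borel_measurable lborel" by simp
      have "(\<lambda>x::real^'n. \<eta>\<^sup>2 * indicator (ball 0 2) x) \<in> borel_measurable borel"
        by (intro borel_measurable_times borel_measurable_const borel_measurable_indicator) simp
      then have m2: "(\<lambda>x::real^'n. ennreal (\<eta>\<^sup>2 * indicator (ball 0 2) x)) \<in> borel_measurable lborel" by simp
      have m3: "(\<lambda>x. ennreal ((h x - \<psi> x)\<^sup>2)) \<in> borel_measurable lborel" by simp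
      note c = borel_measurable_times_ennreal[OF borel_measurable_const]
      show ?thesis
        by (simp only: nn_integral_add[OF borel_measurable_add[OF c[OF m1] c[OF m2]] c[OF m3]]
            nn_integral_add[OF c[OF m1] c[OF m2]] nn_integral_cmult[OF m1] nn_integral_cmult[OF m2] nn_integral_cmult[OF m3])
    qed
    also have "\<dots> \<le> ennreal 3 * ennreal (e / 12) + ennreal 3 * ennreal (e / 12) + ennreal 3 * ennreal (e / 12)"
      by (intro add_mono mult_left_mono fin fin2 fin3) simp_all
    also have "\<dots> = ennreal (3 * (e / 12) + 3 * (e / 12) + 3 * (e / 12))"
    proof -
      have y: "0 \<le> e / 12" using e(1) by simp
      have y3: "0 \<le> 3 * (e / 12)" using e(1) by simp
      show ?thesis
        by (simp only: ennreal_plus[OF add_nonneg_nonneg[OF y3 y3] y3] ennreal_plus[OF y3 y3] ennreal_mult[OF zero_le_numeral y])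
    qed
    also have "\<dots> \<le> ennreal e" using e(1) by (intro ennreal_leI) simp
    finally show ?case using e(2) by (rule le_less_trans)
  qed
qed simp

subsection \<open>Basic singular fields\<close>

text \<open>The derivative of x / |x|: tangential projection divided by the norm.\<close>

definition dsgn :: "real^'n::finite \<Rightarrow> real^'n \<Rightarrow> real^'n" where
  "dsgn x h = inverse (norm x) *\<^sub>R (h - (sgn x \<bullet> h) *\<^sub>R sgn x)"

lemma has_derivative_norm':
  fixes x :: "real^'n::finite"
  assumes "x \<noteq> 0"
  shows "(norm has_derivative (\<lambda>h. sgn x \<bullet> h)) (at x)"
  using has_derivative_norm[OF assms] by (simp add: inner_commute)

text \<open>The bridge from one variable to the ball: derivatives and bounds on the open interval
  (0, 1) are all that is known about the profile and the weights built from it.\<close>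

lemma sing_radial:
  fixes s s' :: "real \<Rightarrow> real"
  assumes d: "\<And>r. 0 < r \<Longrightarrow> r < 1 \<Longrightarrow> (s has_real_derivative s' r) (at r)"
    and b: "\<And>r. 0 < r \<Longrightarrow> r < 1 \<Longrightarrow> \<bar>s r\<bar> \<le> C / r ^ k" "\<And>r. 0 < r \<Longrightarrow> r < 1 \<Longrightarrow> \<bar>s' r\<bar> \<le> C / r ^ Suc k"
    and C: "0 \<le> C"
  shows "sing k (\<lambda>x::real^'n::finite. s (norm x)) (\<lambda>x h. s' (norm x) * (sgn x \<bullet> h))"
proof (rule singI[OF C])
  fix x :: "real^'n" assume x: "x \<in> ball 0 1 - {0}"
  then have x0: "x \<noteq> 0" "0 < norm x" "norm x < 1" by auto
  from has_derivative_compose[where g = s, OF has_derivative_norm'[OF x0(1)] d[OF x0(2,3), unfolded has_field_derivative_def]]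
  show "((\<lambda>x. s (norm x)) has_derivative (\<lambda>h. s' (norm x) * (sgn x \<bullet> h))) (at x)" .
  show "norm (s (norm x)) \<le> C / norm x ^ k" using b(1)[OF x0(2,3)] by simp
  fix h
  have "\<bar>sgn x \<bullet> h\<bar> \<le> norm h" using Cauchy_Schwarz_ineq2[of "sgn x" h] x0 by (simp add: norm_sgn)
  from mult_mono[OF b(2)[OF x0(2,3)] this]
  show "norm (s' (norm x) * (sgn x \<bullet> h)) \<le> C / norm x ^ Suc k * norm h" using C by (simp add: abs_mult)
qed

lemma sing_inverse_norm:
  "sing 1 (\<lambda>x::real^'n::finite. inverse (norm x)) (\<lambda>x h. - (inverse (norm x) ^ 2) * (sgn x \<bullet> h))"
  by (rule sing_radial[of inverse "\<lambda>r. - (inverse r ^ 2)" 1])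
     (auto intro!: DERIV_inverse[THEN DERIV_cong] simp: divide_inverse power_inverse numeral_2_eq_2)

lemma sing_sgn: "sing 0 (sgn :: real^'n::finite \<Rightarrow> real^'n) dsgn"
proof (rule singI[of 2])
  fix x :: "real^'n" assume x: "x \<in> ball 0 1 - {0}"
  then have x0: "x \<noteq> 0" "0 < norm x" "norm x < 1" by auto
  have "((\<lambda>x. inverse (norm x) *\<^sub>R x) has_derivative
     (\<lambda>h. inverse (norm x) *\<^sub>R h + (- (inverse (norm x) ^ 2) * (sgn x \<bullet> h)) *\<^sub>R x)) (at x)"
    by (rule has_derivative_scaleR[OF sing_deriv[OF sing_inverse_norm x] has_derivative_ident])
  moreover have "(\<lambda>h. inverse (norm x) *\<^sub>R h + (- (inverse (norm x) ^ 2) * (sgn x \<bullet> h)) *\<^sub>R x) = dsgn x"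
    by (simp add: fun_eq_iff dsgn_def sgn_div_norm power2_eq_square algebra_simps)
  moreover have "(\<lambda>x::real^'n. inverse (norm x) *\<^sub>R x) = sgn" by (simp add: fun_eq_iff sgn_div_norm)
  ultimately show "(sgn has_derivative dsgn x) (at x)" by simp
  show "norm (sgn x) \<le> 2 / norm x ^ 0" using x0 by (simp add: norm_sgn)
  fix h
  have "norm (h - (sgn x \<bullet> h) *\<^sub>R sgn x) \<le> norm h + \<bar>sgn x \<bullet> h\<bar> * norm (sgn x)"
    using norm_triangle_ineq4[of h "(sgn x \<bullet> h) *\<^sub>R sgn x"] by simp
  also have "\<dots> \<le> 2 * norm h" using Cauchy_Schwarz_ineq2[of "sgn x" h] x0 by (simp add: norm_sgn)
  finally have "norm (h - (sgn x \<bullet> h) *\<^sub>R sgn x) \<le> 2 * norm h" .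
  then show "norm (dsgn x h) \<le> 2 / norm x ^ Suc 0 * norm h"
    using x0 by (simp add: dsgn_def divide_inverse mult.commute mult_left_mono)
qed simp

lemma sing_bounded:
  fixes F :: "real^'n::finite \<Rightarrow> 'b::real_normed_vector"
  assumes "\<And>x. x \<in> ball 0 1 \<Longrightarrow> (F has_derivative F' x) (at x)" "\<And>x. x \<in> ball 0 1 \<Longrightarrow> norm (F x) \<le> C"
    "\<And>x h. x \<in> ball 0 1 \<Longrightarrow> norm (F' x h) \<le> C * norm h"
  shows "sing 0 F F'"
proof (rule singI[of C])
  show C: "C \<ge> 0" using order_trans[OF norm_ge_zero assms(2)[of 0]] by simp
  fix x :: "real^'n" assume x: "x \<in> ball 0 1 - {0}"
  then have x0: "0 < norm x" "norm x < 1" by auto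
  have "C * norm h \<le> C / norm x * norm h" for h :: "real^'n"
    using C x0 by (intro mult_right_mono) (simp_all add: le_divide_eq mult_left_le)
  then show "norm (F' x h) \<le> C / norm x ^ Suc 0 * norm h" for h using assms(3)[of x h] x order_trans by fastforce
qed (use assms in simp_all)

lemma sing_smooth:
  fixes \<phi> :: "real^'n::finite \<Rightarrow> real"
  assumes "smooth \<phi>"
  shows "sing 0 \<phi> (\<lambda>x h. \<Sum>j\<in>UNIV. h $ j * pderiv_at j \<phi> x)"
proof -
  have bd: "\<exists>B. B \<ge> 0 \<and> (\<forall>x\<in>ball 0 1. \<bar>\<psi> x\<bar> \<le> B)" if "smooth \<psi>" for \<psi> :: "real^'n \<Rightarrow> real"
  proof -
    have "bounded (\<psi> ` cball 0 1)" by (intro compact_imp_bounded compact_continuous_image smooth_cont that) auto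
    then obtain B where B: "\<And>x. x \<in> cball 0 1 \<Longrightarrow> \<bar>\<psi> x\<bar> \<le> B"
      unfolding bounded_iff by (metis imageI real_norm_def)
    moreover have "0 \<le> B" using order_trans[OF abs_ge_zero B[of 0]] by simp
    ultimately show ?thesis by (intro exI[of _ B]) auto
  qed
  have "\<exists>B. B \<ge> 0 \<and> (\<forall>x\<in>ball 0 1. \<bar>pderiv_at j \<phi> x\<bar> \<le> B)" for j
    by (rule bd[OF smooth_pderiv[OF assms]])
  then obtain B where B: "\<And>j. B j \<ge> 0" "\<And>j x. x \<in> ball 0 1 \<Longrightarrow> \<bar>pderiv_at j \<phi> x\<bar> \<le> B j" by metis
  obtain B0 where B0: "B0 \<ge> 0" "\<And>x. x \<in> ball 0 1 \<Longrightarrow> \<bar>\<phi> x\<bar> \<le> B0" using bd[OF assms] by blast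
  show ?thesis
  proof (rule sing_bounded[of _ _ "B0 + (\<Sum>j\<in>UNIV. B j)"])
    fix x h :: "real^'n" assume x: "x \<in> ball 0 1"
    show "(\<phi> has_derivative (\<lambda>h. \<Sum>j\<in>UNIV. h $ j * pderiv_at j \<phi> x)) (at x)"
      by (rule smooth_has_derivative[OF assms])
    have s: "0 \<le> (\<Sum>j\<in>UNIV. B j)" by (intro sum_nonneg B)
    then show "norm (\<phi> x) \<le> B0 + (\<Sum>j\<in>UNIV. B j)" using B0(2)[OF x] by simp
    have "norm (\<Sum>j\<in>UNIV. h $ j * pderiv_at j \<phi> x) \<le> (\<Sum>j\<in>UNIV. norm h * B j)"
      by (rule sum_norm_le) (use x in \<open>auto simp: abs_mult intro!: mult_mono B component_le_norm_cart\<close>)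
    also have "\<dots> = (\<Sum>j\<in>UNIV. B j) * norm h" by (subst sum_distrib_left[symmetric]) (rule mult.commute)
    also have "\<dots> \<le> (B0 + (\<Sum>j\<in>UNIV. B j)) * norm h" using B0(1) by (intro mult_right_mono) simp_all
    finally show "norm (\<Sum>j\<in>UNIV. h $ j * pderiv_at j \<phi> x) \<le> (B0 + (\<Sum>j\<in>UNIV. B j)) * norm h" .
  qed
qed

lemmas sing_Cc = sing_smooth[OF Cc_smooth]

lemma sing_sum:
  fixes F :: "'i \<Rightarrow> real^'n::finite \<Rightarrow> 'b::real_normed_vector"
  assumes "finite I" "\<And>i. i \<in> I \<Longrightarrow> sing k (F i) (F' i)"
  shows "sing k (\<lambda>x. \<Sum>i\<in>I. F i x) (\<lambda>x h. \<Sum>i\<in>I. F' i x h)"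
  using assms
proof (induction I rule: finite_induct)
  case empty
  show ?case by (rule singI[of 0]) simp_all
next
  case (insert i I)
  then show ?case by (simp add: sing_add)
qed

lemma bounded_linear_axis: "bounded_linear (axis i :: 'b::real_normed_vector \<Rightarrow> 'b^'n::finite)"
proof (rule bounded_linear_intro[of _ 1])
  fix x y :: 'b and r :: real
  show "axis i (x + y) = axis i x + axis i y" "axis i (r *\<^sub>R x) = r *\<^sub>R axis i x"
    by (simp_all add: vec_eq_iff axis_def)
  have "norm (axis i x :: 'b^'n) \<le> (\<Sum>j\<in>UNIV. norm (axis i x $ j))" unfolding norm_vec_def by (rule L2_set_le_sum) simp
  also have "\<dots> = norm x" by (simp add: axis_def if_distrib[of norm] cong: if_cong)
  finally show "norm (axis i x :: 'b^'n) \<le> norm x * 1" by simp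
qed

lemma sing_vec:
  fixes F :: "real^'n::finite \<Rightarrow> 'b::real_normed_vector^'m::finite"
  assumes "\<And>i. sing k (\<lambda>x. F x $ i) (\<lambda>x h. F' x h $ i)"
  shows "sing k F F'"
proof -
  have e: "y = (\<Sum>i\<in>UNIV. axis i (y $ i))" for y :: "'b^'m"
    by (simp add: vec_eq_iff axis_def if_distrib cong: if_cong)
  have "sing k (\<lambda>x. \<Sum>i\<in>UNIV. axis i (F x $ i)) (\<lambda>x h. \<Sum>i\<in>UNIV. axis i (F' x h $ i))"
    by (intro sing_sum sing_linear[OF bounded_linear_axis] assms) simp
  then show ?thesis by (simp only: e[symmetric])
qed

subsection \<open>Matrix algebra\<close>

definition outer :: "real^'n::finite \<Rightarrow> real^'n \<Rightarrow> real^'n^'n" where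
  "outer u v = (\<chi> i j. u $ i * v $ j)"

lemma inner_matrix: "(A :: real^'n::finite^'n) \<bullet> B = (\<Sum>i\<in>UNIV. \<Sum>j\<in>UNIV. A $ i $ j * B $ i $ j)"
  by (simp add: inner_vec_def)

lemma inner_outer: "A \<bullet> outer u v = u \<bullet> (A *v v)" "outer u v \<bullet> A = u \<bullet> (A *v v)"
  by (simp_all add: inner_matrix outer_def inner_vec_def[of u] matrix_vector_mult_def sum_distrib_left mult_ac)

lemma outer_mult_vec: "outer u v *v z = (v \<bullet> z) *\<^sub>R u"
  by (simp add: vec_eq_iff outer_def matrix_vector_mult_def inner_vec_def sum_distrib_left sum_distrib_right mult_ac)

lemma inner_mat_1: "A \<bullet> mat 1 = trace A" "mat 1 \<bullet> A = trace (A :: real^'n::finite^'n)"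
  by (simp_all add: inner_matrix mat_def trace_def if_distrib if_distribR cong: if_cong)

lemma trace_outer: "trace (outer u v) = u \<bullet> v"
  by (simp add: trace_def outer_def inner_vec_def)

lemma symmetric_inner:
  fixes A :: "real^'n::finite^'n"
  assumes "transpose A = A"
  shows "u \<bullet> (A *v v) = (A *v u) \<bullet> v"
  by (metis assms dot_lmul_matrix transpose_matrix_vector)

text \<open>Cauchy-Schwarz for the trace of the tangential block P A P with P = I - n n^T, a
  symmetric form on a space of dimension N - 1: its squared norm is the bracket on the right and its
  trace is \<open>D\<close>. \<open>B\<close> is the trace-free part of this block.\<close>

lemma trace_sq_le:
  fixes A :: "real^'n::finite^'n" and n :: "real^'n"
  assumes sym: "transpose A = A" and n: "n \<bullet> n = 1" and N: "2 \<le> CARD('n)"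
  defines "w \<equiv> A *v n"
  defines "m \<equiv> n \<bullet> w"
  defines "D \<equiv> trace A - m"
  shows "D\<^sup>2 \<le> (real CARD('n) - 1) * (A \<bullet> A - 2 * (w \<bullet> w) + m\<^sup>2)"
proof -
  define l where "l = D / (real CARD('n) - 1)"
  have N1: "real CARD('n) - 1 > 0" using N by simp
  have lD: "D = l * (real CARD('n) - 1)" using N1 by (simp add: l_def)
  define B where "B = A - outer w n - outer n w + (m + l) *\<^sub>R outer n n - l *\<^sub>R mat 1"
  have nw: "w \<bullet> n = m" by (simp add: m_def inner_commute)
  have nAw: "n \<bullet> (A *v w) = w \<bullet> w" using symmetric_inner[OF sym, of n w] by (simp add: w_def)
  have tr: "trace (mat 1 :: real^'n^'n) = real CARD('n)" by (simp add: trace_def mat_def)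
  have "0 \<le> B \<bullet> B" by simp
  also have "B \<bullet> B = A \<bullet> A - 2 * (w \<bullet> w) + m\<^sup>2 - 2 * l * (trace A - m) + l\<^sup>2 * (real CARD('n) - 1)"
    unfolding B_def
    by (simp only: inner_diff_left inner_diff_right inner_add_left inner_add_right inner_scaleR_left inner_scaleR_right)
       (simp add: inner_outer inner_mat_1 outer_mult_vec trace_outer nw m_def[symmetric] nAw w_def[symmetric] n tr
          algebra_simps power2_eq_square)
  also have "trace A - m = D" by (simp add: D_def)
  finally have "0 \<le> A \<bullet> A - 2 * (w \<bullet> w) + m\<^sup>2 - l\<^sup>2 * (real CARD('n) - 1)"
    by (simp add: lD power2_eq_square algebra_simps)
  then have "(real CARD('n) - 1) * (l\<^sup>2 * (real CARD('n) - 1)) \<le> (real CARD('n) - 1) * (A \<bullet> A - 2 * (w \<bullet> w) + m\<^sup>2)"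
    using N1 by (intro mult_left_mono) simp_all
  then show ?thesis by (simp add: lD power2_eq_square algebra_simps)
qed

subsection \<open>The divergence of derivatives\<close>

text \<open>The divergence as the trace of a derivative that is given as a function of the
  direction; the product rules for \<open>sing\<close> produce derivatives in this form.\<close>

definition dv :: "(real^'n::finite \<Rightarrow> real^'n) \<Rightarrow> real" where
  "dv L = (\<Sum>j\<in>UNIV. L (axis j 1) $ j)"

lemma dv_add: "dv (\<lambda>h. L h + M h) = dv L + dv M"
  by (simp add: dv_def sum.distrib)

lemma dv_diff: "dv (\<lambda>h. L h - M h) = dv L - dv M"
  by (simp add: dv_def sum_subtractf)

lemma dv_scaleR: "dv (\<lambda>h. c *\<^sub>R L h) = c * dv L"
  by (simp add: dv_def sum_distrib_left)

lemma dv_rank1: "linear l \<Longrightarrow> dv (\<lambda>h. l h *\<^sub>R G) = l G"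
  unfolding dv_def by (subst linear_axis_expand[of l G]) (simp_all add: mult.commute)

lemma dv_matrix: "dv (\<lambda>h. A *v h) = trace A"
  by (simp add: dv_def trace_def matrix_vector_mult_basis column_def)

lemma dv_dsgn:
  fixes x :: "real^'n::finite"
  assumes "x \<noteq> 0"
  shows "dv (dsgn x) = (real CARD('n) - 1) / norm x"
proof -
  have "dv (\<lambda>h. h :: real^'n) = real CARD('n)" by (simp add: dv_def)
  moreover have "dv (\<lambda>h. (sgn x \<bullet> h) *\<^sub>R sgn x) = sgn x \<bullet> sgn x"
    by (rule dv_rank1) (intro bounded_linear.linear bounded_linear_inner_right)
  moreover have "sgn x \<bullet> sgn x = 1" using assms by (simp add: dot_square_norm norm_sgn)
  ultimately show ?thesis unfolding dsgn_def[abs_def] by (simp add: dv_scaleR dv_diff divide_inverse mult.commute)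
qed

lemma bounded_bilinear_matrix_vector:
  "bounded_bilinear (\<lambda>(A::real^'n::finite^'n) v. A *v v)"
proof -
  have "bilinear (\<lambda>(A::real^'n^'n) v. A *v v)"
    unfolding bilinear_def
    by (intro conjI allI linearI)
       (simp_all add: matrix_vector_mult_add_rdistrib matrix_vector_right_distrib matrix_vector_mult_def
          vec_eq_iff sum_distrib_left sum.distrib algebra_simps)
  then show ?thesis by (simp only: bilinear_conv_bounded_bilinear)
qed

lemma bounded_linear_trace: "bounded_linear (trace :: real^'n::finite^'n \<Rightarrow> real)"
proof -
  have "linear (trace :: real^'n^'n \<Rightarrow> real)"
    by (rule linearI) (simp_all add: trace_def sum.distrib sum_distrib_left)
  then show ?thesis by (simp only: linear_conv_bounded_linear)
qed

subsection \<open>The divergence identities for curl-free fields\<close>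

text \<open>In the notation of the header, \<open>a\<close>, \<open>b\<close> are the radial and tangential parts of the field \<open>V\<close>
  and \<open>w = A n\<close> is its radial derivative.\<close>

locale curl_free =
  fixes V :: "real^'n::finite \<Rightarrow> real^'n" and A :: "real^'n \<Rightarrow> real^'n^'n" and \<rho> :: real
  assumes V_Cc: "\<And>i. Cc (\<lambda>x. V x $ i)"
    and A_def: "\<And>x i j. A x $ i $ j = pderiv_at j (\<lambda>x. V x $ i) x"
    and A_sym: "\<And>x i j. A x $ i $ j = A x $ j $ i"
    and rho: "\<rho> < 1" and V_zero: "\<And>x. \<rho> < norm x \<Longrightarrow> V x = 0"
begin

definition dA :: "real^'n \<Rightarrow> real^'n \<Rightarrow> real^'n^'n" where
  "dA x h = (\<chi> i j. \<Sum>k\<in>UNIV. h $ k * pderiv_at k (pderiv_at j (\<lambda>x. V x $ i)) x)"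

lemma sing_V: "sing 0 V (\<lambda>x h. A x *v h)"
proof (rule sing_vec)
  fix i
  have "(\<lambda>x h. (A x *v h) $ i) = (\<lambda>x h. \<Sum>j\<in>UNIV. h $ j * pderiv_at j (\<lambda>x. V x $ i) x)"
    by (simp add: fun_eq_iff matrix_vector_mult_def A_def mult.commute)
  then show "sing 0 (\<lambda>x. V x $ i) (\<lambda>x h. (A x *v h) $ i)" using sing_Cc[OF V_Cc[of i]] by simp
qed

lemma sing_A: "sing 0 A dA"
proof (rule sing_vec, rule sing_vec)
  fix i j
  have "(\<lambda>x. A x $ i $ j) = pderiv_at j (\<lambda>x. V x $ i)" by (simp add: fun_eq_iff A_def)
  then show "sing 0 (\<lambda>x. A x $ i $ j) (\<lambda>x h. dA x h $ i $ j)"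
    using sing_Cc[OF Cc_pderiv[OF V_Cc[of i]], of j] by (simp add: dA_def)
qed

lemma transpose_A: "transpose (A x) = A x"
  by (simp add: vec_eq_iff transpose_def A_sym[of x])

text \<open>The second derivatives of each component commute. This is what makes the second-order
  terms in \<open>dv_dZ\<close> cancel.\<close>

lemma dA_apply_commute: "dA x h *v k = dA x k *v h"
proof (rule vec_eq_iff[THEN iffD2], rule allI)
  fix i
  have "(dA x h *v k) $ i = (\<Sum>j\<in>UNIV. \<Sum>l\<in>UNIV. h $ l * k $ j * pderiv_at l (pderiv_at j (\<lambda>x. V x $ i)) x)"
    by (simp add: matrix_vector_mult_def dA_def sum_distrib_right sum_distrib_left mult_ac)
  also have "\<dots> = (\<Sum>l\<in>UNIV. \<Sum>j\<in>UNIV. h $ l * k $ j * pderiv_at l (pderiv_at j (\<lambda>x. V x $ i)) x)"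
    by (rule sum.swap)
  also have "\<dots> = (\<Sum>l\<in>UNIV. \<Sum>j\<in>UNIV. h $ l * k $ j * pderiv_at j (pderiv_at l (\<lambda>x. V x $ i)) x)"
    by (subst pderiv_commute[OF Cc_smooth[OF V_Cc]]) (rule refl)
  also have "\<dots> = (dA x k *v h) $ i"
    by (simp add: matrix_vector_mult_def dA_def sum_distrib_right sum_distrib_left mult_ac)
  finally show "(dA x h *v k) $ i = (dA x k *v h) $ i" .
qed

text \<open>The right side is the derivative of the divergence of \<open>V\<close> in direction
  \<open>y\<close>; exchanging the two slots of the second derivative turns one into the
  other.\<close>

lemma dv_dA: "dv (\<lambda>h. dA x h *v y) = trace (dA x y)"
proof -
  have "dv (\<lambda>h. dA x h *v y) = dv (\<lambda>h. dA x y *v h)"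
    by (simp only: dA_apply_commute[of x _ y])
  then show ?thesis by (simp add: dv_matrix)
qed

lemma A_inner: "u \<bullet> (A x *v v) = (A x *v u) \<bullet> v"
  by (rule symmetric_inner[OF transpose_A])

section \<open>Radial and tangential parts of the field and of its Jacobian\<close>

definition a :: "real^'n \<Rightarrow> real" where "a x = V x \<bullet> sgn x"
definition da :: "real^'n \<Rightarrow> real^'n \<Rightarrow> real" where "da x h = V x \<bullet> dsgn x h + (A x *v h) \<bullet> sgn x"
definition b :: "real^'n \<Rightarrow> real^'n" where "b x = V x - a x *\<^sub>R sgn x"
definition db :: "real^'n \<Rightarrow> real^'n \<Rightarrow> real^'n" where
  "db x h = A x *v h - (a x *\<^sub>R dsgn x h + da x h *\<^sub>R sgn x)"
definition w :: "real^'n \<Rightarrow> real^'n" where "w x = A x *v sgn x"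
definition dw :: "real^'n \<Rightarrow> real^'n \<Rightarrow> real^'n" where "dw x h = A x *v dsgn x h + dA x h *v sgn x"
text \<open>The trace of the tangential block of \<open>A\<close>, that is, the divergence of
  \<open>V\<close> without the radial part.\<close>

definition D :: "real^'n \<Rightarrow> real" where "D x = trace (A x) - sgn x \<bullet> w x"
definition dD :: "real^'n \<Rightarrow> real^'n \<Rightarrow> real" where
  "dD x h = trace (dA x h) - (sgn x \<bullet> dw x h + dsgn x h \<bullet> w x)"

lemma sing_a: "sing 0 a da"
  using sing_inner[OF sing_V sing_sgn] by (simp add: a_def[abs_def] da_def[abs_def])

lemma sing_b: "sing 0 b db"
  using sing_diff[OF sing_V] sing_scaleR[OF sing_a sing_sgn] by (simp add: b_def[abs_def] db_def[abs_def])

lemma sing_w: "sing 0 w dw"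
  using sing_bilinear[OF bounded_bilinear_matrix_vector sing_A sing_sgn]
  by (simp add: w_def[abs_def] dw_def[abs_def])

lemma sing_D: "sing 0 D dD"
  using sing_diff[OF sing_linear[OF bounded_linear_trace sing_A]] sing_inner[OF sing_sgn sing_w]
  by (simp add: D_def[abs_def] dD_def[abs_def])

definition Ab :: "real^'n \<Rightarrow> real^'n" where "Ab x = A x *v b x"
definition dAb :: "real^'n \<Rightarrow> real^'n \<Rightarrow> real^'n" where "dAb x h = A x *v db x h + dA x h *v b x"
definition p :: "real^'n \<Rightarrow> real" where "p x = sgn x \<bullet> Ab x"
definition dp :: "real^'n \<Rightarrow> real^'n \<Rightarrow> real" where "dp x h = sgn x \<bullet> dAb x h + dsgn x h \<bullet> Ab x"

lemma sing_Ab: "sing 0 Ab dAb"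
  using sing_bilinear[OF bounded_bilinear_matrix_vector sing_A sing_b]
  by (simp add: Ab_def[abs_def] dAb_def[abs_def])

lemma sing_p: "sing 0 p dp"
  using sing_inner[OF sing_sgn sing_Ab] by (simp add: p_def[abs_def] dp_def[abs_def])

text \<open>Modelled on the field A V - (div V) V, whose divergence is |A|^2 - (div V)^2 when
  \<open>V\<close> is curl-free, but with the tangential block of \<open>A\<close> and the
  tangential part \<open>b\<close> of \<open>V\<close>. As for the model, the second derivatives of
  \<open>V\<close> drop out of its divergence.\<close>

definition Z :: "real^'n \<Rightarrow> real^'n" where "Z x = Ab x - p x *\<^sub>R sgn x - D x *\<^sub>R b x"
definition dZ :: "real^'n \<Rightarrow> real^'n \<Rightarrow> real^'n" where
  "dZ x h = dAb x h - (p x *\<^sub>R dsgn x h + dp x h *\<^sub>R sgn x) - (D x *\<^sub>R db x h + dD x h *\<^sub>R b x)"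

lemma sing_Z: "sing 0 Z dZ"
  using sing_diff[OF sing_diff[OF sing_Ab]] sing_scaleR[OF sing_p sing_sgn] sing_scaleR[OF sing_D sing_b]
  by (simp add: Z_def[abs_def] dZ_def[abs_def])

context
  fixes x :: "real^'n" assumes xB: "x \<in> ball 0 1 - {0}"
begin

lemma x0: "x \<noteq> 0" using xB by simp

lemma n1: "sgn x \<bullet> sgn x = 1" using x0 by (simp add: dot_square_norm norm_sgn)

lemma bn: "b x \<bullet> sgn x = 0" by (simp add: b_def inner_diff_left a_def n1)

lemma nb: "sgn x \<bullet> b x = 0" using bn by (simp add: inner_commute)

lemma V_decomp: "V x = a x *\<^sub>R sgn x + b x" by (simp add: b_def)

lemma V_norm: "V x \<bullet> V x = (a x)\<^sup>2 + b x \<bullet> b x"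
  unfolding V_decomp by (simp add: inner_add_left inner_add_right bn nb n1 power2_eq_square)

lemma dsgn_n: "dsgn x (sgn x) = 0" by (simp add: dsgn_def n1)

lemma dsgn_b: "dsgn x (b x) = inverse (norm x) *\<^sub>R b x" by (simp add: dsgn_def nb)

text \<open>The gradient of \<open>a\<close> is w + b / r; the symmetry of \<open>A\<close> moves
  the matrix from the direction \<open>h\<close> to the normal.\<close>

lemma da_eq: "da x h = h \<bullet> (w x + inverse (norm x) *\<^sub>R b x)"
proof -
  have 1: "(A x *v h) \<bullet> sgn x = h \<bullet> w x" unfolding w_def by (rule A_inner[symmetric])
  have 2: "V x \<bullet> dsgn x h = inverse (norm x) * (b x \<bullet> h)"
    unfolding V_decomp dsgn_def by (simp add: inner_add_left inner_diff_right bn nb n1 inner_commute[of h])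
  show ?thesis unfolding da_def 1 2 by (simp add: inner_add_right inner_commute[of h "b x"])
qed

lemma linear_da: "linear (da x)"
  by (rule has_derivative_linear[OF sing_deriv[OF sing_a xB]])

lemma da_n: "da x (sgn x) = sgn x \<bullet> w x"
  by (simp add: da_eq inner_add_right nb)

lemma da_b: "da x (b x) = b x \<bullet> w x + inverse (norm x) * (b x \<bullet> b x)"
  by (simp add: da_eq inner_add_right)

lemma db_n: "db x (sgn x) = w x - (sgn x \<bullet> w x) *\<^sub>R sgn x"
  by (simp add: db_def dsgn_n da_n w_def)

lemma dv_db: "dv (db x) = D x - (real CARD('n) - 1) / norm x * a x"
  unfolding db_def[abs_def]
  by (simp add: dv_diff dv_add dv_scaleR dv_matrix dv_dsgn[OF x0] dv_rank1[OF linear_da] da_n D_def)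

lemma dv_A_db: "dv (\<lambda>h. A x *v db x h) =
    A x \<bullet> A x - a x * (inverse (norm x) * D x) - (w x \<bullet> w x + inverse (norm x) * (b x \<bullet> w x))"
proof -
  have 1: "dv (\<lambda>h. A x *v (A x *v h)) = A x \<bullet> A x"
    by (simp add: dv_matrix matrix_vector_mul_assoc) 
       (simp add: trace_def matrix_matrix_mult_def inner_matrix A_sym[of x])
  have 2: "dv (\<lambda>h. A x *v dsgn x h) = inverse (norm x) * D x"
  proof -
    have "(\<lambda>h. A x *v dsgn x h) = (\<lambda>h. inverse (norm x) *\<^sub>R (A x *v h - (sgn x \<bullet> h) *\<^sub>R w x))"
      by (simp add: fun_eq_iff dsgn_def w_def bounded_bilinear.scaleR_right[OF bounded_bilinear_matrix_vector]
            bounded_bilinear.diff_right[OF bounded_bilinear_matrix_vector])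
    moreover have "dv (\<lambda>h. (sgn x \<bullet> h) *\<^sub>R w x) = sgn x \<bullet> w x"
      by (rule dv_rank1) (intro bounded_linear.linear bounded_linear_inner_right)
    ultimately show ?thesis by (simp add: dv_scaleR dv_diff dv_matrix D_def)
  qed
  have 3: "dv (\<lambda>h. da x h *\<^sub>R w x) = w x \<bullet> w x + inverse (norm x) * (b x \<bullet> w x)"
    by (subst dv_rank1[OF linear_da]) (simp add: da_eq inner_add_right inner_commute)
  have "(\<lambda>h. A x *v db x h) = (\<lambda>h. A x *v (A x *v h) - (a x *\<^sub>R (A x *v dsgn x h) + da x h *\<^sub>R w x))"
    by (simp add: fun_eq_iff db_def w_def bounded_bilinear.scaleR_right[OF bounded_bilinear_matrix_vector]
          bounded_bilinear.diff_right[OF bounded_bilinear_matrix_vector]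
          bounded_bilinear.add_right[OF bounded_bilinear_matrix_vector])
  then show ?thesis by (simp add: dv_diff dv_add dv_scaleR 1 2 3)
qed

lemma dv_dAb: "dv (dAb x) = A x \<bullet> A x - a x * (inverse (norm x) * D x)
    - (w x \<bullet> w x + inverse (norm x) * (b x \<bullet> w x)) + trace (dA x (b x))"
  unfolding dAb_def[abs_def] by (simp add: dv_add dv_A_db dv_dA)

lemma p_eq: "p x = b x \<bullet> w x"
  unfolding p_def Ab_def w_def by (subst A_inner) (rule inner_commute)

lemma dp_n: "dp x (sgn x) = w x \<bullet> w x - (sgn x \<bullet> w x)\<^sup>2 + sgn x \<bullet> (dA x (sgn x) *v b x)"
proof -
  have "sgn x \<bullet> (A x *v (w x - (sgn x \<bullet> w x) *\<^sub>R sgn x)) = w x \<bullet> (w x - (sgn x \<bullet> w x) *\<^sub>R sgn x)"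
    by (subst A_inner) (simp add: w_def)
  also have "\<dots> = w x \<bullet> w x - (sgn x \<bullet> w x)\<^sup>2"
    by (simp add: inner_diff_right power2_eq_square inner_commute)
  finally show ?thesis by (simp add: dp_def dAb_def dsgn_n db_n inner_add_right)
qed

lemma dp_linear: "linear (dp x)" by (rule has_derivative_linear[OF sing_deriv[OF sing_p xB]])

lemma dD_linear: "linear (dD x)" by (rule has_derivative_linear[OF sing_deriv[OF sing_D xB]])

lemma dD_b: "dD x (b x) = trace (dA x (b x)) - 2 * inverse (norm x) * (b x \<bullet> w x)
    - sgn x \<bullet> (dA x (sgn x) *v b x)"
proof -
  have 1: "sgn x \<bullet> (A x *v (inverse (norm x) *\<^sub>R b x)) = inverse (norm x) * (b x \<bullet> w x)"
    by (subst A_inner) (simp add: w_def inner_commute)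
  have 2: "sgn x \<bullet> (dA x (b x) *v sgn x) = sgn x \<bullet> (dA x (sgn x) *v b x)"
    by (simp only: dA_apply_commute[of x "b x" "sgn x"])
  show ?thesis by (simp add: dD_def dw_def dsgn_b inner_add_right 1 2)
qed

text \<open>The second-order terms \<open>trace (dA x (b x))\<close> and
  \<open>sgn x \<bullet> (dA x (sgn x) *v b x)\<close> cancel between the contributions of
  \<open>Ab\<close>, \<open>p\<close> and \<open>D\<close>. There remain the squared norm of the
  tangential block minus its squared trace, and a term of lower order that stems from the curvature
  of the spheres.\<close>

lemma dv_dZ: "dv (dZ x) = A x \<bullet> A x - 2 * (w x \<bullet> w x) + (sgn x \<bullet> w x)\<^sup>2 - (D x)\<^sup>2
    + (real CARD('n) - 2) / norm x * (a x * D x - b x \<bullet> w x)"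
proof -
  let ?i = "inverse (norm x)"
  have "dv (dZ x) = dv (dAb x) - (p x * dv (dsgn x) + dp x (sgn x)) - (D x * dv (db x) + dD x (b x))"
    unfolding dZ_def[abs_def]
    by (simp only: dv_diff dv_add dv_scaleR dv_rank1[OF dp_linear] dv_rank1[OF dD_linear])
  also have "\<dots> = (A x \<bullet> A x - a x * (?i * D x) - (w x \<bullet> w x + ?i * (b x \<bullet> w x)) + trace (dA x (b x)))
     - ((b x \<bullet> w x) * ((real CARD('n) - 1) * ?i) + (w x \<bullet> w x - (sgn x \<bullet> w x)\<^sup>2 + sgn x \<bullet> (dA x (sgn x) *v b x)))
     - (D x * (D x - (real CARD('n) - 1) * ?i * a x) + (trace (dA x (b x)) - 2 * ?i * (b x \<bullet> w x)
        - sgn x \<bullet> (dA x (sgn x) *v b x)))"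
    by (simp only: dv_dAb p_eq dv_dsgn[OF x0] dp_n dv_db dD_b divide_inverse)
  also have "\<dots> = A x \<bullet> A x - 2 * (w x \<bullet> w x) + (sgn x \<bullet> w x)\<^sup>2 - (D x)\<^sup>2
    + (real CARD('n) - 2) * ?i * (a x * D x - b x \<bullet> w x)"
    by (simp add: power2_eq_square algebra_simps)
  finally show ?thesis by (simp only: divide_inverse)
qed

end

text \<open>Its divergence contains the same mixed term (a D - b \<bullet> w) / r as that of
  \<open>Z\<close> / (N - 2). Subtracting it removes this term, which has no sign, and leaves ((N -
  1) a^2 + (N - 3) |b|^2) / r^2.\<close>

definition Y :: "real^'n \<Rightarrow> real^'n" where
  "Y x = (a x * inverse (norm x)) *\<^sub>R b x - ((b x \<bullet> b x) * inverse (norm x)) *\<^sub>R sgn x"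

definition dY1 :: "real^'n \<Rightarrow> real^'n \<Rightarrow> real" where
  "dY1 x h = a x * (- (inverse (norm x) ^ 2) * (sgn x \<bullet> h)) + da x h * inverse (norm x)"

definition dY2 :: "real^'n \<Rightarrow> real^'n \<Rightarrow> real" where
  "dY2 x h = (b x \<bullet> b x) * (- (inverse (norm x) ^ 2) * (sgn x \<bullet> h)) + (b x \<bullet> db x h + db x h \<bullet> b x) * inverse (norm x)"

definition dY :: "real^'n \<Rightarrow> real^'n \<Rightarrow> real^'n" where
  "dY x h = ((a x * inverse (norm x)) *\<^sub>R db x h + dY1 x h *\<^sub>R b x)
     - (((b x \<bullet> b x) * inverse (norm x)) *\<^sub>R dsgn x h + dY2 x h *\<^sub>R sgn x)"

lemma sing_Y1: "sing 1 (\<lambda>x. a x * inverse (norm x)) dY1"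
  using sing_mult[OF sing_a sing_inverse_norm] by (simp only: dY1_def[abs_def] add_0)

lemma sing_Y2: "sing 1 (\<lambda>x. (b x \<bullet> b x) * inverse (norm x)) dY2"
  using sing_mult[OF sing_inner[OF sing_b sing_b] sing_inverse_norm] by (simp only: dY2_def[abs_def] add_0)

lemma sing_Y: "sing 1 Y dY"
  using sing_diff[OF sing_scaleR[OF sing_Y1 sing_b] sing_scaleR[OF sing_Y2 sing_sgn]]
  by (simp only: Y_def[abs_def] dY_def[abs_def] add_0_right)

lemma dv_product: "linear l \<Longrightarrow> dv (\<lambda>h. c *\<^sub>R L h + l h *\<^sub>R G) = c * dv L + l G"
  by (simp only: dv_add dv_scaleR dv_rank1)

lemma dv_dY:
  assumes x: "x \<in> ball 0 1 - {0}"
  shows "dv (dY x) = inverse (norm x) * (a x * D x - b x \<bullet> w x)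
     - (inverse (norm x))\<^sup>2 * ((real CARD('n) - 1) * (a x)\<^sup>2 + (real CARD('n) - 3) * (b x \<bullet> b x))"
proof -
  let ?i = "inverse (norm x)"
  note l1 = has_derivative_linear[OF sing_deriv[OF sing_Y1 x]]
  note l2 = has_derivative_linear[OF sing_deriv[OF sing_Y2 x]]
  have bs: "b x \<bullet> db x (sgn x) = b x \<bullet> w x"
    by (simp add: db_n[OF x] inner_diff_right bn[OF x])
  have "dv (dY x) = (a x * ?i * dv (db x) + dY1 x (b x)) - ((b x \<bullet> b x) * ?i * dv (dsgn x) + dY2 x (sgn x))"
    unfolding dY_def[abs_def] by (simp only: dv_diff dv_product[OF l1] dv_product[OF l2])
  also have "dY1 x (b x) = (b x \<bullet> w x + ?i * (b x \<bullet> b x)) * ?i"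
    by (simp add: dY1_def nb[OF x] da_b[OF x])
  also have "dY2 x (sgn x) = - (?i\<^sup>2) * (b x \<bullet> b x) + 2 * (b x \<bullet> w x) * ?i"
    by (simp add: dY2_def n1[OF x] bs inner_commute[of "db x (sgn x)"])
  also have "dv (db x) = D x - (real CARD('n) - 1) * ?i * a x" by (simp only: dv_db[OF x] divide_inverse)
  also have "dv (dsgn x) = (real CARD('n) - 1) * ?i" by (simp only: dv_dsgn[OF x0[OF x]] divide_inverse)
  finally show ?thesis by (simp add: power2_eq_square algebra_simps)
qed

text \<open>The Hardy field: |w|^2 plus its divergence is |w + s V|^2 + (s' + (N - 1) s / r - s^2)
  |V|^2, the origin of the Riccati expressions in \<open>core_inequality\<close>. \<open>T\<close>
  does the same for \<open>b\<close> and the tangential part of \<open>w\<close>.\<close>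

definition S :: "(real \<Rightarrow> real) \<Rightarrow> real^'n \<Rightarrow> real^'n" where
  "S s x = (s (norm x) * (V x \<bullet> V x)) *\<^sub>R sgn x"

definition dS1 :: "(real \<Rightarrow> real) \<Rightarrow> (real \<Rightarrow> real) \<Rightarrow> real^'n \<Rightarrow> real^'n \<Rightarrow> real" where
  "dS1 s s' x h = s (norm x) * (V x \<bullet> (A x *v h) + (A x *v h) \<bullet> V x) + (s' (norm x) * (sgn x \<bullet> h)) * (V x \<bullet> V x)"

definition dS :: "(real \<Rightarrow> real) \<Rightarrow> (real \<Rightarrow> real) \<Rightarrow> real^'n \<Rightarrow> real^'n \<Rightarrow> real^'n" where
  "dS s s' x h = (s (norm x) * (V x \<bullet> V x)) *\<^sub>R dsgn x h + dS1 s s' x h *\<^sub>R sgn x"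

definition T :: "(real \<Rightarrow> real) \<Rightarrow> real^'n \<Rightarrow> real^'n" where
  "T s x = (s (norm x) * (b x \<bullet> b x)) *\<^sub>R sgn x"

definition dT1 :: "(real \<Rightarrow> real) \<Rightarrow> (real \<Rightarrow> real) \<Rightarrow> real^'n \<Rightarrow> real^'n \<Rightarrow> real" where
  "dT1 s s' x h = s (norm x) * (b x \<bullet> db x h + db x h \<bullet> b x) + (s' (norm x) * (sgn x \<bullet> h)) * (b x \<bullet> b x)"

definition dT :: "(real \<Rightarrow> real) \<Rightarrow> (real \<Rightarrow> real) \<Rightarrow> real^'n \<Rightarrow> real^'n \<Rightarrow> real^'n" where
  "dT s s' x h = (s (norm x) * (b x \<bullet> b x)) *\<^sub>R dsgn x h + dT1 s s' x h *\<^sub>R sgn x"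

context
  fixes s s' :: "real \<Rightarrow> real"
  assumes ss: "sing 1 (\<lambda>x::real^'n. s (norm x)) (\<lambda>x h. s' (norm x) * (sgn x \<bullet> h))"
begin

lemma sing_S1: "sing 1 (\<lambda>x. s (norm x) * (V x \<bullet> V x)) (dS1 s s')"
  using sing_mult[OF ss sing_inner[OF sing_V sing_V]] by (simp only: dS1_def[abs_def] add_0_right)

lemma sing_S: "sing 1 (S s) (dS s s')"
  using sing_scaleR[OF sing_S1 sing_sgn] by (simp only: S_def[abs_def] dS_def[abs_def] add_0_right)

lemma sing_T1: "sing 1 (\<lambda>x. s (norm x) * (b x \<bullet> b x)) (dT1 s s')"
  using sing_mult[OF ss sing_inner[OF sing_b sing_b]] by (simp only: dT1_def[abs_def] add_0_right)

lemma sing_T: "sing 1 (T s) (dT s s')"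
  using sing_scaleR[OF sing_T1 sing_sgn] by (simp only: T_def[abs_def] dT_def[abs_def] add_0_right)

lemma dv_dS:
  assumes x: "x \<in> ball 0 1 - {0}"
  shows "dv (dS s s' x) = (s' (norm x) + (real CARD('n) - 1) * s (norm x) / norm x) * (V x \<bullet> V x)
    + 2 * s (norm x) * (V x \<bullet> w x)"
proof -
  have "dv (dS s s' x) = s (norm x) * (V x \<bullet> V x) * dv (dsgn x) + dS1 s s' x (sgn x)"
    unfolding dS_def[abs_def] by (rule dv_product[OF has_derivative_linear[OF sing_deriv[OF sing_S1 x]]])
  also have "dS1 s s' x (sgn x) = 2 * s (norm x) * (V x \<bullet> w x) + s' (norm x) * (V x \<bullet> V x)"
    by (simp add: dS1_def n1[OF x] w_def[symmetric] inner_commute[of "w x"])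
  finally show ?thesis by (simp add: dv_dsgn[OF x0[OF x]] algebra_simps)
qed

lemma dv_dT:
  assumes x: "x \<in> ball 0 1 - {0}"
  shows "dv (dT s s' x) = (s' (norm x) + (real CARD('n) - 1) * s (norm x) / norm x) * (b x \<bullet> b x)
    + 2 * s (norm x) * (b x \<bullet> w x)"
proof -
  have bs: "b x \<bullet> db x (sgn x) = b x \<bullet> w x"
    by (simp add: db_n[OF x] inner_diff_right bn[OF x])
  have "dv (dT s s' x) = s (norm x) * (b x \<bullet> b x) * dv (dsgn x) + dT1 s s' x (sgn x)"
    unfolding dT_def[abs_def] by (rule dv_product[OF has_derivative_linear[OF sing_deriv[OF sing_T1 x]]])
  also have "dT1 s s' x (sgn x) = 2 * s (norm x) * (b x \<bullet> w x) + s' (norm x) * (b x \<bullet> b x)"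
    by (simp add: dT1_def n1[OF x] bs inner_commute[of "db x (sgn x)"])
  finally show ?thesis by (simp add: dv_dsgn[OF x0[OF x]] algebra_simps)
qed

end

end

text \<open>The pointwise inequality as algebra, with \<open>i\<close> for 1/r. It is the sum of the
  trace inequality \<open>3\<close> in the form T + (T - D^2) / (N - 2) \<ge> 0, the completed
  squares \<open>1\<close> and \<open>2\<close>, the Riccati bounds \<open>K1\<close> and
  \<open>K2\<close>, and a remainder (al i^2 - 1) a^2 + ((2 al - 2) i^2 + 1) bb. The remainder is
  non-negative because N \<ge> 4 makes al \<ge> 1, and i \<ge> 1 in the unit ball.\<close>

lemma scalar_combination:
  fixes N AA ww m D a bb bw Vw VV s1 s1' s2 s2' cc i :: real
  assumes N: "4 \<le> N" and i: "1 \<le> i" and VV: "VV = a\<^sup>2 + bb" and bb: "0 \<le> bb"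
    and 1: "0 \<le> ww + 2 * s1 * Vw + s1\<^sup>2 * VV" and 2: "0 \<le> (ww - m\<^sup>2) + 2 * s2 * bw + s2\<^sup>2 * bb"
    and 3: "D\<^sup>2 \<le> (N - 1) * (AA - 2 * ww + m\<^sup>2)"
    and K1: "((N - 2) / 2)\<^sup>2 * i\<^sup>2 + cc - (N - 1) * i\<^sup>2 \<le> s1' + (N - 1) * s1 * i - s1\<^sup>2"
    and K2: "((N - 2) / 2)\<^sup>2 * i\<^sup>2 + 2 \<le> s2' + (N - 1) * s2 * i - s2\<^sup>2"
  shows "0 \<le> AA - cc * VV - VV + (((s1' + (N - 1) * s1 * i) * VV + 2 * s1 * Vw) + ((s2' + (N - 1) * s2 * i) * bb + 2 * s2 * bw)
    + inverse (N - 2) * (AA - 2 * ww + m\<^sup>2 - D\<^sup>2 + (N - 2) * i * (a * D - bw))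
    - (i * (a * D - bw) - i\<^sup>2 * ((N - 1) * a\<^sup>2 + (N - 3) * bb)))"
proof -
  \<comment> \<open>This \<open>al\<close> is the square of the exponent \<alpha> of the overview,
    not the exponent itself.\<close>
  define al where "al = ((N - 2) / 2)\<^sup>2"
  define T where "T = AA - 2 * ww + m\<^sup>2"
  have al: "1 \<le> al" unfolding al_def using N by (intro one_le_power) simp
  have N2: "0 < N - 2" using N by simp
  have VV0: "0 \<le> VV" using VV bb by simp
  have i2: "1 \<le> i\<^sup>2" using i by (intro one_le_power)
  have e: "inverse (N - 2) * (T - D\<^sup>2 + (N - 2) * i * (a * D - bw)) = inverse (N - 2) * (T - D\<^sup>2) + i * (a * D - bw)"
    using N2 by (simp add: field_simps)
  have t: "0 \<le> T + inverse (N - 2) * (T - D\<^sup>2)"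
  proof -
    have "T + inverse (N - 2) * (T - D\<^sup>2) = inverse (N - 2) * ((N - 1) * T - D\<^sup>2)" using N2 by (simp add: field_simps)
    then show ?thesis using 3 N2 by (simp add: T_def)
  qed
  have k1: "(al * i\<^sup>2 + cc - (N - 1) * i\<^sup>2) * VV \<le> (s1' + (N - 1) * s1 * i - s1\<^sup>2) * VV"
    using K1 VV0 unfolding al_def by (rule mult_right_mono)
  have k2: "(al * i\<^sup>2 + 2) * bb \<le> (s2' + (N - 1) * s2 * i - s2\<^sup>2) * bb"
    using K2 bb unfolding al_def by (rule mult_right_mono)
  have "1 * 1 \<le> al * i\<^sup>2" using al i2 by (intro mult_mono) simp_all
  then have q1: "0 \<le> (al * i\<^sup>2 - 1) * a\<^sup>2" by (intro mult_nonneg_nonneg) simp_all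
  have q2: "0 \<le> (2 * al - 2) * (i\<^sup>2 * bb)" using al bb by (intro mult_nonneg_nonneg) simp_all
  have "0 \<le> (T + inverse (N - 2) * (T - D\<^sup>2)) + (ww + 2 * s1 * Vw + s1\<^sup>2 * VV) + ((ww - m\<^sup>2) + 2 * s2 * bw + s2\<^sup>2 * bb)
     + ((s1' + (N - 1) * s1 * i - s1\<^sup>2) * VV - (al * i\<^sup>2 + cc - (N - 1) * i\<^sup>2) * VV)
     + ((s2' + (N - 1) * s2 * i - s2\<^sup>2) * bb - (al * i\<^sup>2 + 2) * bb)
     + (al * i\<^sup>2 - 1) * a\<^sup>2 + (2 * al - 2) * (i\<^sup>2 * bb) + bb"
    using t 1 2 k1 k2 q1 q2 bb by linarith
  also have "\<dots> = AA - cc * VV - VV + (((s1' + (N - 1) * s1 * i) * VV + 2 * s1 * Vw) + ((s2' + (N - 1) * s2 * i) * bb + 2 * s2 * bw)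
    + (inverse (N - 2) * (T - D\<^sup>2) + i * (a * D - bw))
    - (i * (a * D - bw) - i\<^sup>2 * ((N - 1) * a\<^sup>2 + (N - 3) * bb)))"
    unfolding T_def VV by (simp add: algebra_simps)
  finally show ?thesis by (simp only: e[symmetric]) (simp only: T_def)
qed

lemma LB_integrable_bounded:
  fixes F :: "real^'n::finite \<Rightarrow> real"
  assumes "continuous_on (ball 0 1 - {0}) F" "\<And>x. x \<in> ball 0 1 - {0} \<Longrightarrow> \<bar>F x\<bar> \<le> C"
  shows "integrable (lebesgue_on (ball 0 1)) F"
proof -
  interpret finite_measure "lebesgue_on (ball 0 1 :: (real^'n) set)" by (rule finite_measure_LB)
  show ?thesis
    by (rule integrable_const_bound[of _ C])
       (auto intro!: LB_I LB_measurable_continuous assms)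
qed

lemma sing0_bound:
  assumes "sing 0 F F'" obtains C where "\<And>x. x \<in> ball 0 1 - {0} \<Longrightarrow> norm (F x) \<le> C"
  using singE[OF assms] by (metis div_by_1 power_0)

context curl_free
begin

text \<open>The integrand becomes non-negative at every point after adding the divergence of
  \<open>F\<close>, whose integral is zero. The term \<open>- V x \<bullet> V x\<close> is the gap
  that later yields uniqueness.\<close>

lemma core_inequality:
  fixes c s1 s1' s2 s2' :: "real \<Rightarrow> real"
  assumes N: "4 \<le> CARD('n)" and c: "continuous_on {0..1} c"
    and s1: "sing 1 (\<lambda>x::real^'n. s1 (norm x)) (\<lambda>x h. s1' (norm x) * (sgn x \<bullet> h))"
    and s2: "sing 1 (\<lambda>x::real^'n. s2 (norm x)) (\<lambda>x h. s2' (norm x) * (sgn x \<bullet> h))"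
    and K1: "\<And>r. 0 < r \<Longrightarrow> r < 1 \<Longrightarrow> ((real CARD('n) - 2) / 2)\<^sup>2 * (inverse r)\<^sup>2 + c r - (real CARD('n) - 1) * (inverse r)\<^sup>2
       \<le> s1' r + (real CARD('n) - 1) * s1 r * inverse r - (s1 r)\<^sup>2"
    and K2: "\<And>r. 0 < r \<Longrightarrow> r < 1 \<Longrightarrow> ((real CARD('n) - 2) / 2)\<^sup>2 * (inverse r)\<^sup>2 + 2
       \<le> s2' r + (real CARD('n) - 1) * s2 r * inverse r - (s2 r)\<^sup>2"
  shows "integrable (lebesgue_on (ball 0 1)) (\<lambda>x. A x \<bullet> A x - c (norm x) * (V x \<bullet> V x) - V x \<bullet> V x)"
    "0 \<le> (\<integral>x. A x \<bullet> A x - c (norm x) * (V x \<bullet> V x) - V x \<bullet> V x \<partial>lebesgue_on (ball 0 1))"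
proof -
  let ?N = "real CARD('n)"
  have VV: "sing 0 (\<lambda>x. V x \<bullet> V x) (\<lambda>x h. V x \<bullet> (A x *v h) + (A x *v h) \<bullet> V x)"
    using sing_inner[OF sing_V sing_V] by (simp only: add_0)
  have AA: "sing 0 (\<lambda>x. A x \<bullet> A x) (\<lambda>x h. A x \<bullet> dA x h + dA x h \<bullet> A x)"
    using sing_inner[OF sing_A sing_A] by (simp only: add_0)
  obtain C1 where C1: "\<And>x. x \<in> ball 0 1 - {0} \<Longrightarrow> norm (V x \<bullet> V x) \<le> C1" using sing0_bound[OF VV] by blast
  obtain C2 where C2: "\<And>x. x \<in> ball 0 1 - {0} \<Longrightarrow> norm (A x \<bullet> A x) \<le> C2" using sing0_bound[OF AA] by blast
  have "bounded (c ` {0..1})" by (intro compact_imp_bounded compact_continuous_image c) simp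
  then obtain C where C: "\<And>r. r \<in> {0..1} \<Longrightarrow> \<bar>c r\<bar> \<le> C" unfolding bounded_iff by (metis imageI real_norm_def)
  have cc: "continuous_on (ball 0 1 - {0}) (\<lambda>x::real^'n. c (norm x))"
    by (rule continuous_on_compose2[OF c continuous_on_norm_id]) auto
  have i1: "integrable (lebesgue_on (ball 0 1)) (\<lambda>x. A x \<bullet> A x)"
    by (rule LB_integrable_bounded[where C = C2, OF sing_cont[OF AA]]) (use C2 in simp)
  have i2: "integrable (lebesgue_on (ball 0 1)) (\<lambda>x. V x \<bullet> V x)"
    by (rule LB_integrable_bounded[where C = C1, OF sing_cont[OF VV]]) (use C1 in simp)
  have i3: "integrable (lebesgue_on (ball 0 1)) (\<lambda>x. c (norm x) * (V x \<bullet> V x))"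
  proof (rule LB_integrable_bounded[OF continuous_on_mult[OF cc sing_cont[OF VV]]])
    fix x :: "real^'n" assume x: "x \<in> ball 0 1 - {0}"
    then have "\<bar>c (norm x)\<bar> \<le> C" by (intro C) simp
    from mult_mono[OF this C1[OF x]] show "\<bar>c (norm x) * (V x \<bullet> V x)\<bar> \<le> C * C1"
      using order_trans[OF abs_ge_zero \<open>\<bar>c (norm x)\<bar> \<le> C\<close>] by (simp add: abs_mult)
  qed
  show int: "integrable (lebesgue_on (ball 0 1)) (\<lambda>x. A x \<bullet> A x - c (norm x) * (V x \<bullet> V x) - V x \<bullet> V x)"
    by (intro Bochner_Integration.integrable_diff i1 i2 i3)
  \<comment> \<open>The factor 1 / (N - 2) matches the mixed term of \<open>Z\<close> with that of
    \<open>Y\<close>.\<close>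
  define F where "F x = S s1 x + T s2 x + inverse (?N - 2) *\<^sub>R Z x - Y x" for x
  define dF where "dF x h = dS s1 s1' x h + dT s2 s2' x h + inverse (?N - 2) *\<^sub>R dZ x h - dY x h" for x h
  have sF: "sing 1 F dF"
    unfolding F_def[abs_def] dF_def[abs_def]
    by (intro sing_diff sing_add sing_S[OF s1] sing_T[OF s2] sing_Y sing_linear[OF bounded_linear_scaleR_right]
        sing_mono[OF sing_Z]) simp
  have zF: "F x = 0" if "\<rho> < norm x" for x
    using V_zero[OF that] by (simp add: F_def S_def T_def Z_def Y_def b_def a_def Ab_def p_def)
  note div = sing_divergence_zero[OF _ sF rho zF, folded dv_def]
  have N3: "3 \<le> CARD('n)" using N by simp
  have pw: "0 \<le> (A x \<bullet> A x - c (norm x) * (V x \<bullet> V x) - V x \<bullet> V x) + dv (dF x)" if x: "x \<in> ball 0 1 - {0}" for x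
  proof -
    have r: "0 < norm x" "norm x < 1" using x by auto
    have "dv (dF x) = dv (dS s1 s1' x) + dv (dT s2 s2' x) + inverse (?N - 2) * dv (dZ x) - dv (dY x)"
      unfolding dF_def[abs_def] by (simp only: dv_add dv_diff dv_scaleR)
    also have "\<dots> = ((s1' (norm x) + (?N - 1) * s1 (norm x) * inverse (norm x)) * (V x \<bullet> V x) + 2 * s1 (norm x) * (V x \<bullet> w x))
      + ((s2' (norm x) + (?N - 1) * s2 (norm x) * inverse (norm x)) * (b x \<bullet> b x) + 2 * s2 (norm x) * (b x \<bullet> w x))
      + inverse (?N - 2) * (A x \<bullet> A x - 2 * (w x \<bullet> w x) + (sgn x \<bullet> w x)\<^sup>2 - (D x)\<^sup>2 + (?N - 2) * inverse (norm x) * (a x * D x - b x \<bullet> w x))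
      - (inverse (norm x) * (a x * D x - b x \<bullet> w x) - (inverse (norm x))\<^sup>2 * ((?N - 1) * (a x)\<^sup>2 + (?N - 3) * (b x \<bullet> b x)))"
      by (simp only: dv_dS[OF s1 x] dv_dT[OF s2 x] dv_dZ[OF x] dv_dY[OF x] divide_inverse)
    finally have e: "dv (dF x) = \<dots>" .
    show ?thesis unfolding e
    proof (rule scalar_combination)
      show "4 \<le> ?N" using N by simp
      show "1 \<le> inverse (norm x)" using r by (simp add: one_le_inverse_iff)
      show "V x \<bullet> V x = (a x)\<^sup>2 + b x \<bullet> b x" by (rule V_norm[OF x])
      show "0 \<le> b x \<bullet> b x" by simp
      have "0 \<le> (w x + s1 (norm x) *\<^sub>R V x) \<bullet> (w x + s1 (norm x) *\<^sub>R V x)" by simp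
      then show "0 \<le> w x \<bullet> w x + 2 * s1 (norm x) * (V x \<bullet> w x) + (s1 (norm x))\<^sup>2 * (V x \<bullet> V x)"
        by (simp add: inner_add_left inner_add_right inner_commute[of "w x" "V x"] power2_eq_square algebra_simps)
      have "0 \<le> (w x - (sgn x \<bullet> w x) *\<^sub>R sgn x + s2 (norm x) *\<^sub>R b x) \<bullet> (w x - (sgn x \<bullet> w x) *\<^sub>R sgn x + s2 (norm x) *\<^sub>R b x)" by simp
      then show "0 \<le> (w x \<bullet> w x - (sgn x \<bullet> w x)\<^sup>2) + 2 * s2 (norm x) * (b x \<bullet> w x) + (s2 (norm x))\<^sup>2 * (b x \<bullet> b x)"
        by (simp add: inner_add_left inner_add_right inner_diff_left inner_diff_right bn[OF x] nb[OF x] n1[OF x]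
            inner_commute[of "w x" "b x"] inner_commute[of "w x" "sgn x"] power2_eq_square algebra_simps)
      have n: "sgn x \<bullet> sgn x = 1" by (rule n1[OF x])
      show "(D x)\<^sup>2 \<le> (?N - 1) * (A x \<bullet> A x - 2 * (w x \<bullet> w x) + (sgn x \<bullet> w x)\<^sup>2)"
        unfolding D_def w_def using N by (intro trace_sq_le transpose_A n) simp
      show "((?N - 2) / 2)\<^sup>2 * (inverse (norm x))\<^sup>2 + c (norm x) - (?N - 1) * (inverse (norm x))\<^sup>2
       \<le> s1' (norm x) + (?N - 1) * s1 (norm x) * inverse (norm x) - (s1 (norm x))\<^sup>2" by (rule K1[OF r])
      show "((?N - 2) / 2)\<^sup>2 * (inverse (norm x))\<^sup>2 + 2
       \<le> s2' (norm x) + (?N - 1) * s2 (norm x) * inverse (norm x) - (s2 (norm x))\<^sup>2" by (rule K2[OF r])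
    qed
  qed
  have "0 \<le> (\<integral>x. (A x \<bullet> A x - c (norm x) * (V x \<bullet> V x) - V x \<bullet> V x) + dv (dF x) \<partial>lebesgue_on (ball 0 1))"
    by (rule integral_nonneg_AE, rule LB_I) (use pw in simp)
  also have "\<dots> = (\<integral>x. A x \<bullet> A x - c (norm x) * (V x \<bullet> V x) - V x \<bullet> V x \<partial>lebesgue_on (ball 0 1))"
  proof -
    have "(\<integral>x. dv (dF x) \<partial>lebesgue_on (ball 0 1)) = 0" by (rule div(2)[OF N3])
    then show ?thesis by (simp only: Bochner_Integration.integral_add[OF int div(1)[OF N3]] add_0_right)
  qed
  finally show "0 \<le> (\<integral>x. A x \<bullet> A x - c (norm x) * (V x \<bullet> V x) - V x \<bullet> V x \<partial>lebesgue_on (ball 0 1))" .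
qed

end

subsection \<open>The radial profile\<close>

locale vortex_ode =
  fixes N :: nat and W W' W'' f f' f'' :: "real \<Rightarrow> real" and \<epsilon> :: real
  assumes N: "4 \<le> N"
    and W_nonneg: "\<And>t. t \<le> 1 \<Longrightarrow> 0 \<le> W t"
    and W_0: "W 0 = 0"
    and W_convex: "convex_on {..1} W"
    and W_deriv: "\<And>t. t \<le> 1 \<Longrightarrow> (W has_real_derivative W' t) (at t within {..1})"
    and W'_deriv: "\<And>t. t \<le> 1 \<Longrightarrow> (W' has_real_derivative W'' t) (at t within {..1})"
    and eps: "0 < \<epsilon>"
    and f_cont: "continuous_on {0..1} f" and f_0: "f 0 = 0" and f_1: "f 1 = 1"
    and f_deriv: "\<And>r. 0 < r \<Longrightarrow> r < 1 \<Longrightarrow> (f has_real_derivative f' r) (at r)"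
    and f'_deriv: "\<And>r. 0 < r \<Longrightarrow> r < 1 \<Longrightarrow> (f' has_real_derivative f'' r) (at r)"
    and f_eq: "\<And>r. 0 < r \<Longrightarrow> r < 1 \<Longrightarrow>
        - f'' r - (real N - 1) / r * f' r + (real N - 1) / r\<^sup>2 * f r
          = 1 / \<epsilon>\<^sup>2 * f r * W' (1 - (f r)\<^sup>2)"
begin

section \<open>The convex potential and the coefficient of the profile equation\<close>

definition c :: "real \<Rightarrow> real" where "c r = W' (1 - (f r)\<^sup>2) / \<epsilon>\<^sup>2"

lemma f''_eq:
  assumes "0 < r" "r < 1"
  shows "f'' r = - ((real N - 1) / r * f' r) + (real N - 1) / r\<^sup>2 * f r - c r * f r"
proof -
  have "c r * f r = 1 / \<epsilon>\<^sup>2 * f r * W' (1 - (f r)\<^sup>2)" by (simp add: c_def)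
  then show ?thesis using f_eq[OF assms] by linarith
qed

text \<open>The base point has to be interior to the half-line on which \<open>W\<close> is convex,
  hence y < 1. It will be y = 1 - f^2, so this is where f > 0 enters the energy comparison.\<close>

lemma W_tangent:
  assumes "x \<le> 1" "y < 1"
  shows "W y + W' y * (x - y) \<le> W x"
proof -
  have "interior {..1::real} = {..<1}" by simp
  then have "W x - W y \<ge> W' y * (x - y)"
    using assms
    by (intro convex_on_imp_above_tangent[OF W_convex _ _ _ W_deriv[of y]]) (auto)
  then show ?thesis by simp
qed

text \<open>0 is a minimum of \<open>W\<close>, so W'(0) = 0. For t < 0 the sign comes from the
  tangent at t, evaluated at 0 where \<open>W\<close> vanishes.\<close>

lemma W'_nonpos: "t \<le> 0 \<Longrightarrow> W' t \<le> 0"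
proof -
  assume t: "t \<le> 0"
  show ?thesis
  proof (cases "t = 0")
    case True
    have "W' 0 * (1/2) \<le> W (1/2)" "W' 0 * s \<le> W s" if "s \<le> 1" for s
      using W_tangent[of "1/2" 0] W_tangent[of s 0] W_0 that by auto
    have "(W has_real_derivative W' 0) (at 0)"
      using W_deriv[of 0] at_within_interior[of 0 "{..1::real}"] by simp
    then have "W' 0 = 0"
      by (rule DERIV_local_min[where d = 1]) (use W_nonneg W_0 in auto)
    then show ?thesis using True by simp
  next
    case False
    have "W t + W' t * (0 - t) \<le> W 0" using W_tangent[of 0 t] t by simp
    then have "W' t * (- t) \<le> 0" using W_nonneg[of t] t W_0 by simp
    then show ?thesis using False t by (simp add: mult_le_0_iff zero_le_mult_iff)
  qed
qed

lemma W'_nonneg: assumes "0 \<le> t" "t < 1" shows "0 \<le> W' t"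
proof (cases "t = 0")
  case True
  have "(W has_real_derivative W' 0) (at 0)"
    using W_deriv[of 0] at_within_interior[of 0 "{..1::real}"] by simp
  then have "W' 0 = 0"
    by (rule DERIV_local_min[where d = 1]) (use W_nonneg W_0 in auto)
  then show ?thesis using True by simp
next
  case False
  have "W t + W' t * (0 - t) \<le> W 0" using W_tangent[of 0 t] assms by simp
  then have "W' t * t \<ge> 0" using W_nonneg[of t] assms W_0 by simp
  then show ?thesis using False assms by (simp add: zero_le_mult_iff)
qed

text \<open>s is a convex combination of 0 and t, and \<open>W\<close> vanishes at 0 and is
  non-negative at t.\<close>

lemma W_mono: assumes "0 \<le> s" "s \<le> t" "t \<le> 1" shows "W s \<le> W t"
proof (cases "t = 0")
  case False
  have "W ((1 - s/t) *\<^sub>R 0 + (s/t) *\<^sub>R t) \<le> (1 - s/t) * W 0 + (s/t) * W t"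
    using assms False by (intro convex_onD[OF W_convex]) auto
  then have "W s \<le> (s/t) * W t" using False W_0 by simp
  also have "\<dots> \<le> 1 * W t" using assms False W_nonneg[of t]
    by (intro mult_right_mono) (auto simp: divide_le_eq)
  finally show ?thesis by simp
qed (use assms in auto)

lemma W'_cont: "continuous_on {..1} W'"
  using W'_deriv by (intro DERIV_continuous_on) auto

lemma W_cont: "continuous_on {..1} W"
  using W_deriv by (intro DERIV_continuous_on) auto

lemma c_cont: "continuous_on {0..1} c"
  unfolding c_def using eps
  by (intro continuous_intros continuous_on_compose2[OF W'_cont] f_cont) auto

lemma c_bounded: obtains C where "C \<ge> 0" "\<And>r. 0 \<le> r \<Longrightarrow> r \<le> 1 \<Longrightarrow> \<bar>c r\<bar> \<le> C"
proof -
  have "compact (c ` {0..1})" by (intro compact_continuous_image c_cont) auto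
  then have "bounded (c ` {0..1})" by (rule compact_imp_bounded)
  then obtain C where "\<And>y. y \<in> c ` {0..1} \<Longrightarrow> norm y \<le> C" by (auto simp: bounded_iff)
  then have "\<And>r. 0 \<le> r \<Longrightarrow> r \<le> 1 \<Longrightarrow> \<bar>c r\<bar> \<le> C" by force
  note C = this
  have "C \<ge> 0" using C[of 0] by auto
  then show thesis using that C by blast
qed

text \<open>Maximum principle, for f and - f at once. Where s f has an interior maximum above 1, the
  argument 1 - f^2 is negative, so c \<le> 0 and the equation forces s f'' > 0.\<close>

lemma f_bound_aux:
  assumes s: "s = 1 \<or> s = - 1" and x: "0 \<le> x" "x \<le> 1"
  shows "s * f x \<le> 1"
proof (rule ccontr)
  assume ng: "\<not> s * f x \<le> 1"
  have "continuous_on {0..1} (\<lambda>x. s * f x)" by (intro continuous_intros f_cont)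
  then obtain r where r: "r \<in> {0..1}" "\<And>y. y \<in> {0..1} \<Longrightarrow> s * f y \<le> s * f r"
    using continuous_attains_sup[of "{0..1::real}" "\<lambda>x. s * f x"] by auto
  have gt: "s * f r > 1" using r(2)[of x] x ng by simp
  have r01: "0 < r" "r < 1" using r(1) gt f_0 f_1 s by (auto simp: less_le)
  have d: "((\<lambda>x. s * f x) has_real_derivative s * f' z) (at z)" if "0 < z" "z < 1" for z
    by (rule DERIV_cmult[OF f_deriv[OF that]])
  have d': "((\<lambda>x. s * f' x) has_real_derivative s * f'' z) (at z)" if "0 < z" "z < 1" for z
    by (rule DERIV_cmult[OF f'_deriv[OF that]])
  have "s * f' r = 0"
    by (rule DERIV_local_max[OF d[OF r01], where d = "min r (1 - r)"])
       (use r01 r(2) in \<open>auto simp: abs_if split: if_splits\<close>)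
  then have f'0: "f' r = 0" using s by auto
  have sq: "(f r)\<^sup>2 > 1" 
  proof -
    have "1 < (s * f r)\<^sup>2" using gt by (intro one_less_power) auto
    then show ?thesis using s by (auto simp: power_mult_distrib)
  qed
  then have "c r \<le> 0" unfolding c_def using W'_nonpos[of "1 - (f r)\<^sup>2"] by (simp add: divide_le_0_iff)
  have "s * f'' r = (real N - 1) / r\<^sup>2 * (s * f r) - c r * (s * f r)"
    unfolding f''_eq[OF r01] f'0 by (simp add: algebra_simps)
  moreover have "(real N - 1) / r\<^sup>2 * (s * f r) > 0" using gt N r01 by simp
  moreover have "c r * (s * f r) \<le> 0" using \<open>c r \<le> 0\<close> gt by (simp add: mult_le_0_iff)
  ultimately have "s * f'' r > 0" by linarith
  from DERIV_pos_inc_right[OF d'[OF r01] this] obtain e where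
    e: "e > 0" "\<And>h. 0 < h \<Longrightarrow> h < e \<Longrightarrow> s * f' r < s * f' (r + h)" by auto
  define h where "h = min (e/2) ((1 - r)/2)"
  have h: "0 < h" "h < e" "r + h < 1" using e r01 by (auto simp: h_def min_def field_simps)
  have "\<exists>z. r < z \<and> z < r + h \<and> s * f (r + h) - s * f r = (r + h - r) * (s * f' z)"
    by (rule MVT2) (use h r01 d in auto)
  then obtain z where z: "r < z" "z < r + h" "s * f (r + h) - s * f r = h * (s * f' z)" by auto
  have "s * f' z > 0" using e(2)[of "z - r"] z h f'0 by simp
  then have "s * f (r + h) > s * f r" using z h by (metis diff_gt_0_iff_gt mult_pos_pos)
  moreover have "s * f (r + h) \<le> s * f r" using r(2)[of "r+h"] h r01 by auto
  ultimately show False by simp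
qed

section \<open>Monotonicity and positivity of the profile\<close>

lemma f_sq_le_1: assumes "0 \<le> x" "x \<le> 1" shows "(f x)\<^sup>2 \<le> 1"
  using f_bound_aux[of 1 x] f_bound_aux[of "-1" x] assms by (auto simp: abs_square_le_1)

lemma deriv_W_comp:
  assumes "0 < r" "r < 1"
  shows "((\<lambda>r. W (1 - (f r)\<^sup>2)) has_real_derivative (- 2 * \<epsilon>\<^sup>2 * c r * f r * f' r)) (at r)"
proof -
  have 1: "((\<lambda>r. 1 - (f r)\<^sup>2) has_real_derivative (- 2 * f r * f' r)) (at r)"
    by (auto intro!: derivative_eq_intros f_deriv assms)
  have 2: "(W has_real_derivative W' (1 - (f r)\<^sup>2)) (at (1 - (f r)\<^sup>2) within (\<lambda>r. 1 - (f r)\<^sup>2) ` UNIV)"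
    by (rule has_field_derivative_subset[OF W_deriv]) auto
  have "(W \<circ> (\<lambda>r. 1 - (f r)\<^sup>2) has_real_derivative W' (1 - (f r)\<^sup>2) * (- 2 * f r * f' r)) (at r)"
    by (rule DERIV_image_chain[OF 2 1])
  then show ?thesis using eps by (simp add: o_def c_def field_simps)
qed

text \<open>If \<open>f\<^sup>2\<close> had an interior maximum \<open>m\<^sup>2\<close>, the energy \<open>e\<close> below, which is dissipated in the
  logarithmic time \<open>ln r\<close>, could not come back to its initial value when \<open>f\<^sup>2\<close> reaches \<open>m\<^sup>2\<close>
  again.\<close>

lemma f_sq_mono:
  assumes "0 \<le> p" "p \<le> q" "q \<le> 1"
  shows "(f p)\<^sup>2 \<le> (f q)\<^sup>2"
proof (rule ccontr)
  assume neg: "\<not> (f p)\<^sup>2 \<le> (f q)\<^sup>2"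
  have cont2: "continuous_on {0..1} (\<lambda>x. (f x)\<^sup>2)" by (intro continuous_intros f_cont)
  obtain r1 where r1: "r1 \<in> {0..q}" "\<And>y. y \<in> {0..q} \<Longrightarrow> (f y)\<^sup>2 \<le> (f r1)\<^sup>2"
    using continuous_attains_sup[of "{0..q}" "\<lambda>x. (f x)\<^sup>2"] continuous_on_subset[OF cont2, of "{0..q}"] assms by auto
  define m where "m = f r1"
  have mq: "m\<^sup>2 > (f q)\<^sup>2" using r1(2)[of p] assms neg by (auto simp: m_def)
  have r1q: "0 < r1" "r1 < q" using r1(1) mq f_0 by (auto simp: m_def less_le)
  have m1: "m\<^sup>2 \<le> 1" using f_sq_le_1[of r1] r1 assms by (auto simp: m_def)
  have r1_1: "r1 < 1" using r1q assms by simp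
  have "f' r1 = 0"
  proof -
    have "((\<lambda>x. (f x)\<^sup>2) has_real_derivative 2 * f r1 * f' r1) (at r1)"
      by (auto intro!: derivative_eq_intros f_deriv r1q r1_1)
    then have "2 * f r1 * f' r1 = 0"
      by (rule DERIV_local_max[where d = "min r1 (q - r1)"])
         (use r1q r1(2) in \<open>auto simp: abs_if split: if_splits\<close>)
    moreover have "f r1 \<noteq> 0" using mq by (auto simp: m_def)
    ultimately show ?thesis by simp
  qed
  \<comment> \<open>The radii beyond \<open>q\<close> at which f^2 has climbed back to m^2. They
    exist because m^2 \<le> 1 = f(1)^2, and \<open>r2\<close> below is the first of them.\<close>
  define S where "S = {x \<in> {q..1}. (f x)\<^sup>2 = m\<^sup>2}"
  have "S \<noteq> {}"
  proof -
    have "\<exists>x. q \<le> x \<and> x \<le> 1 \<and> (f x)\<^sup>2 = m\<^sup>2"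
      using mq m1 f_1 assms continuous_on_subset[OF cont2, of "{q..1}"]
      by (intro IVT') auto
    then show ?thesis by (auto simp: S_def)
  qed
  have "closed S"
  proof -
    have "continuous_on {q..1} (\<lambda>x. (f x)\<^sup>2)" using assms by (auto intro: continuous_on_subset[OF cont2])
    then show ?thesis
      using continuous_closed_preimage_constant[of "{q..1}" "\<lambda>x. (f x)\<^sup>2" "m\<^sup>2"] by (simp add: S_def)
  qed
  have bb: "bdd_below S" by (auto simp: S_def intro: bdd_belowI[of _ q])
  define r2 where "r2 = Inf S"
  have r2S: "r2 \<in> S" unfolding r2_def using \<open>S \<noteq> {}\<close> bb \<open>closed S\<close> by (rule closed_contains_Inf)
  have r2: "q < r2" "r2 \<le> 1" "(f r2)\<^sup>2 = m\<^sup>2" using r2S mq by (auto simp: S_def less_le)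
  \<comment> \<open>Beyond \<open>q\<close> a value above m^2 would force a return to m^2 earlier
    than \<open>r2\<close>.\<close>
  have le: "(f x)\<^sup>2 \<le> m\<^sup>2" if "r1 \<le> x" "x \<le> r2" for x
  proof (cases "x \<le> q")
    case True then show ?thesis using r1 r1q that by (auto simp: m_def)
  next
    case False
    show ?thesis
    proof (rule ccontr)
      assume ng: "\<not> (f x)\<^sup>2 \<le> m\<^sup>2"
      then have "\<exists>y. q \<le> y \<and> y \<le> x \<and> (f y)\<^sup>2 = m\<^sup>2"
        using mq False that assms r2 continuous_on_subset[OF cont2, of "{q..x}"] by (intro IVT') auto
      then obtain y where y: "q \<le> y" "y \<le> x" "(f y)\<^sup>2 = m\<^sup>2" by auto
      then have "y \<in> S" using that r2 by (auto simp: S_def)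
      then have "r2 \<le> y" unfolding r2_def using bb by (intro cInf_lower)
      then have "x = r2" using y that by auto
      then show False using ng r2 by simp
    qed
  qed
  define G where "G y = - W (1 - y\<^sup>2) / (2 * \<epsilon>\<^sup>2)" for y
  \<comment> \<open>\<open>e r\<close> is the energy of the state (f, r f') minus that of the state
    at rest at m, both at radius \<open>r\<close>. It vanishes at \<open>r1\<close>, and its
    derivative is non-positive as long as f^2 \<le> m^2.\<close>
  define e where "e r = (r * f' r)\<^sup>2 / 2 - (real N - 1) * (f r)\<^sup>2 / 2 + r\<^sup>2 * G (f r)
      + (real N - 1) * m\<^sup>2 / 2 - r\<^sup>2 * G m" for r
  have de: "(e has_real_derivative (- (real N - 2) * r * (f' r)\<^sup>2 + 2 * r * (G (f r) - G m))) (at r)"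
    if "0 < r" "r < 1" for r
  proof -
    have dG: "((\<lambda>r. G (f r)) has_real_derivative c r * f r * f' r) (at r)"
    proof -
      have "((\<lambda>r. (- 1 / (2 * \<epsilon>\<^sup>2)) * W (1 - (f r)\<^sup>2)) has_real_derivative
          (- 1 / (2 * \<epsilon>\<^sup>2)) * (- 2 * \<epsilon>\<^sup>2 * c r * f r * f' r)) (at r)"
        by (rule DERIV_cmult[OF deriv_W_comp[OF that]])
      moreover have "(- 1 / (2 * \<epsilon>\<^sup>2)) * (- 2 * \<epsilon>\<^sup>2 * c r * f r * f' r) = c r * f r * f' r"
        using eps by simp
      moreover have "(\<lambda>r. G (f r)) = (\<lambda>r. (- 1 / (2 * \<epsilon>\<^sup>2)) * W (1 - (f r)\<^sup>2))"
        by (simp add: G_def fun_eq_iff)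
      ultimately show ?thesis by simp
    qed
    have "(e has_real_derivative
        (r * f' r) * (f' r + r * f'' r) - (real N - 1) * f r * f' r
         + (2 * r * G (f r) + r\<^sup>2 * (c r * f r * f' r)) - 2 * r * G m) (at r)"
      unfolding e_def
      apply (rule derivative_eq_intros dG f_deriv f'_deriv that refl | simp)+
      done
    moreover have "(r * f' r) * (f' r + r * f'' r) - (real N - 1) * f r * f' r
         + (2 * r * G (f r) + r\<^sup>2 * (c r * f r * f' r)) - 2 * r * G m
        = (- (real N - 2) * r * (f' r)\<^sup>2 + 2 * r * (G (f r) - G m))"
      unfolding f''_eq[OF that] using that by (simp add: field_simps power2_eq_square)
    ultimately show ?thesis by simp
  qed
  have GG: "G (f r) \<le> G m" if "r1 \<le> r" "r \<le> r2" for r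
  proof -
    have "W (1 - m\<^sup>2) \<le> W (1 - (f r)\<^sup>2)" using le[OF that] m1 by (intro W_mono) auto
    then show ?thesis unfolding G_def using eps by (simp add: divide_right_mono)
  qed
  have e_mono: "e y \<le> e x" if "r1 \<le> x" "x \<le> y" "y < r2" for x y
  proof (rule DERIV_nonpos_imp_nonincreasing[OF that(2)])
    fix z assume z: "x \<le> z" "z \<le> y"
    have z01: "0 < z" "z < 1" using z that r1q r2 by auto
    have "- (real N - 2) * z * (f' z)\<^sup>2 + 2 * z * (G (f z) - G m) \<le> 0"
    proof -
      have "2 * z * (G (f z) - G m) \<le> 0" using GG[of z] z that z01 by (simp add: mult_le_0_iff)
      moreover have "(real N - 2) * z * (f' z)\<^sup>2 \<ge> 0" using N z01 by simp
      ultimately show ?thesis unfolding mult_minus_left by linarith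
    qed
    then show "\<exists>d. DERIV e z :> d \<and> d \<le> 0" using de[OF z01] by blast
  qed
  have e_r1: "e r1 = 0" using \<open>f' r1 = 0\<close> by (simp add: e_def m_def)
  have e_nonneg: "0 \<le> e x" if x: "r1 \<le> x" "x < r2" for x
  proof -
    define h where "h r = - (real N - 1) * (f r)\<^sup>2 / 2 + r\<^sup>2 * G (f r)
      + (real N - 1) * m\<^sup>2 / 2 - r\<^sup>2 * G m" for r
    have hc: "continuous_on {0..1} h" unfolding h_def G_def using eps
      by (intro continuous_intros continuous_on_compose2[OF W_cont] f_cont) auto
    have h2: "h r2 = 0" using r2 by (simp add: h_def G_def algebra_simps add_divide_distrib diff_divide_distrib)
    have "((\<lambda>y. h y) \<longlongrightarrow> h r2) (at r2 within {x..<r2})"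
    proof (rule tendsto_within_subset)
      show "(h \<longlongrightarrow> h r2) (at r2 within {0..1})"
        using hc r2 r1q assms unfolding continuous_on_def by auto
      show "{x..<r2} \<subseteq> {0..1}" using x r1q r2 by auto
    qed
    moreover have "at r2 within {x..<r2} \<noteq> bot"
      using x by (simp add: trivial_limit_within islimpt_in_closure closure_atLeastLessThan)
    moreover have "eventually (\<lambda>y. h y \<le> e x) (at r2 within {x..<r2})"
      unfolding eventually_at_filter
    proof (intro always_eventually allI impI)
      fix y assume "y \<noteq> r2" and y: "y \<in> {x..<r2}"
      have "h y \<le> e y" unfolding h_def e_def mult_minus_left minus_divide_left[symmetric] by simp
      also have "e y \<le> e x" using e_mono[of x y] x y by simp
      finally show "h y \<le> e x" .
    qed
    ultimately have "h r2 \<le> e x" using tendsto_upperbound by blast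
    then show ?thesis using h2 by simp
  qed
  \<comment> \<open>Non-negative and non-increasing from 0, so \<open>e\<close> is constant. Its
    dissipation then vanishes, hence f' = 0, which contradicts f(q)^2 < m^2.\<close>
  have e0: "e x = 0" if "r1 \<le> x" "x < r2" for x
    using e_nonneg[OF that] e_mono[of r1 x] e_r1 that by simp
  have f'0: "f' x = 0" if x: "r1 < x" "x < r2" for x
  proof -
    have x01: "0 < x" "x < 1" using x r1q r2 by auto
    have "eventually (\<lambda>y. y \<in> {r1<..<r2}) (nhds x)" using x by (intro eventually_nhds_in_open) auto
    then have "eventually (\<lambda>y. e y = (\<lambda>_. 0) y) (nhds x)" by eventually_elim (auto intro: e0)
    then have "((\<lambda>_. 0) has_real_derivative (- (real N - 2) * x * (f' x)\<^sup>2 + 2 * x * (G (f x) - G m))) (at x)"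
      using de[OF x01] by (subst (asm) DERIV_cong_ev[OF refl _ refl]) 
    then have "- (real N - 2) * x * (f' x)\<^sup>2 + 2 * x * (G (f x) - G m) = 0"
      using DERIV_unique[OF _ DERIV_const] by blast
    moreover have "2 * x * (G (f x) - G m) \<le> 0" using GG[of x] x x01 by (simp add: mult_le_0_iff)
    moreover have "(real N - 2) * x * (f' x)\<^sup>2 \<ge> 0" using N x01 by simp
    ultimately have "(real N - 2) * x * (f' x)\<^sup>2 = 0" by linarith
    then show ?thesis using N x01 by auto
  qed
  have "\<exists>z. r1 < z \<and> z < q \<and> f q - f r1 = (q - r1) * f' z"
    by (rule MVT2) (use r1q r2 in \<open>auto intro!: f_deriv\<close>)
  then obtain z where z: "r1 < z" "z < q" "f q - f r1 = (q - r1) * f' z" by auto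
  then have "f q = f r1" using z f'0[of z] r2 by simp
  then show False using mq by (simp add: m_def)
qed

text \<open>At an interior zero followed by positive values f' vanishes as well, and a solution with
  f = f' = 0 at a regular point has to vanish. Quantitatively, mean value estimates for r^(N-1) f'
  and for f give f(r) \<le> (r - s)^2 L f(r), impossible for r close to s. The constant
  \<open>L\<close> has s in its denominator, which is why s = 0 escapes.\<close>

lemma f_zero_initial:
  assumes s: "0 \<le> s" "s < 1" "f s = 0" and pos: "\<And>x. s < x \<Longrightarrow> x \<le> 1 \<Longrightarrow> 0 < f x"
  shows "s = 0"
proof (rule ccontr)
  assume "s \<noteq> 0"
  then have s0: "s > 0" using s by simp
  have f_nn: "0 \<le> f x" if "0 \<le> x" "x \<le> 1" for x
    using pos[of x] f_sq_mono[of x s] s that by (cases "s < x") (auto simp: s(3))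
  have f_mono: "f x \<le> f y" if "0 \<le> x" "x \<le> y" "y \<le> 1" for x y
    using f_sq_mono[of x y] f_nn[of x] f_nn[of y] that by (auto intro: power2_le_imp_le)
  have "f' s = 0"
    by (rule DERIV_local_min[OF f_deriv[OF s0 s(2)], where d = "min s (1 - s)"])
       (use s0 s f_nn in \<open>auto simp: abs_if split: if_splits\<close>)
  obtain C where C: "C \<ge> 0" "\<And>r. 0 \<le> r \<Longrightarrow> r \<le> 1 \<Longrightarrow> \<bar>c r\<bar> \<le> C" using c_bounded by blast
  define h where "h r = r ^ (N - 1) * f' r" for r
  define K where "K = (real N - 1) + C"
  have K0: "K \<ge> 0" using N C by (simp add: K_def)
  have dh: "(h has_real_derivative r ^ (N - 1) * (((real N - 1) / r\<^sup>2 - c r) * f r)) (at r)"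
    if "0 < r" "r < 1" for r
  proof -
    have "(h has_real_derivative real (N - 1) * r ^ (N - 1 - 1) * f' r + r ^ (N - 1) * f'' r) (at r)"
      unfolding h_def
      by (auto intro!: derivative_eq_intros f'_deriv that)
    moreover have "r ^ (N - 1) = r * r ^ (N - 1 - 1)" using N by (cases N; cases "N - 1") auto
    then have "real (N - 1) * r ^ (N - 1 - 1) * f' r + r ^ (N - 1) * f'' r
       = r ^ (N - 1) * (((real N - 1) / r\<^sup>2 - c r) * f r)"
      unfolding f''_eq[OF that] using that N by (simp add: field_simps of_nat_diff power2_eq_square)
    ultimately show ?thesis by simp
  qed
  define L where "L = K / (s\<^sup>2 * s ^ (N - 1))"
  have L0: "L \<ge> 0" using K0 s0 by (simp add: L_def)
  have fest: "f r \<le> (r - s)\<^sup>2 * L * f r" if r: "s < r" "r < 1" for r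
  proof -
    have h_est: "h x \<le> (r - s) * (K / s\<^sup>2 * f r)" if x: "s < x" "x \<le> r" for x
    proof -
      have "\<exists>z>s. z < x \<and> h x - h s = (x - s) * (z ^ (N - 1) * (((real N - 1) / z\<^sup>2 - c z) * f z))"
        by (rule MVT2[OF x(1)]) (use dh s0 s x r in auto)
      then obtain z where z: "s < z" "z < x"
        "h x = (x - s) * (z ^ (N - 1) * (((real N - 1) / z\<^sup>2 - c z) * f z))"
        using \<open>f' s = 0\<close> by (auto simp: h_def)
      have z1: "0 < z" "z < 1" using z x r s0 by auto
      have "(real N - 1) / z\<^sup>2 \<le> (real N - 1) / s\<^sup>2"
        using z s0 N by (intro divide_left_mono power_mono) auto
      moreover have "- c z \<le> C / s\<^sup>2"
      proof -
        have "- c z \<le> C" using C(2)[of z] z1 by auto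
        also have "C \<le> C / s\<^sup>2" using C(1) s0 s power_le_one[of s 2]
          by (simp add: le_divide_eq mult_left_le)
        finally show ?thesis .
      qed
      ultimately have 1: "(real N - 1) / z\<^sup>2 - c z \<le> K / s\<^sup>2" by (simp add: K_def add_divide_distrib)
      have "((real N - 1) / z\<^sup>2 - c z) * f z \<le> K / s\<^sup>2 * f z"
        using 1 f_nn[of z] z1 by (intro mult_right_mono) auto
      also have "\<dots> \<le> K / s\<^sup>2 * f r" using f_mono[of z r] z1 z x r K0 by (intro mult_left_mono) auto
      finally have 2: "((real N - 1) / z\<^sup>2 - c z) * f z \<le> K / s\<^sup>2 * f r" .
      have "z ^ (N - 1) * (((real N - 1) / z\<^sup>2 - c z) * f z) \<le> z ^ (N - 1) * (K / s\<^sup>2 * f r)"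
        using 2 z1 by (intro mult_left_mono) auto
      also have "\<dots> \<le> 1 * (K / s\<^sup>2 * f r)" using K0 f_nn[of r] r s0 z1
        by (intro mult_right_mono power_le_one) auto
      finally have "h x \<le> (x - s) * (K / s\<^sup>2 * f r)" unfolding z(3) using x by (intro mult_left_mono) auto
      also have "\<dots> \<le> (r - s) * (K / s\<^sup>2 * f r)" using x K0 f_nn[of r] r s0 by (intro mult_right_mono) auto
      finally show ?thesis .
    qed
    have "\<exists>z>s. z < r \<and> f r - f s = (r - s) * f' z"
      by (rule MVT2[OF r(1)]) (use f_deriv s0 s r in auto)
    then obtain z where z: "s < z" "z < r" "f r = (r - s) * f' z" using s(3) by auto
    have "f' z = h z / z ^ (N - 1)" using z s0 by (simp add: h_def)
    also have "\<dots> \<le> (r - s) * (K / s\<^sup>2 * f r) / z ^ (N - 1)"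
      using h_est[of z] z s0 by (intro divide_right_mono) auto
    also have "\<dots> \<le> (r - s) * (K / s\<^sup>2 * f r) / s ^ (N - 1)"
      using z s0 r K0 f_nn[of r] by (intro divide_left_mono power_mono mult_nonneg_nonneg) auto
    finally have "f' z \<le> (r - s) * L * f r" by (simp add: L_def)
    then have "(r - s) * f' z \<le> (r - s) * ((r - s) * L * f r)"
      using r by (intro mult_left_mono) auto
    then have "f r \<le> (r - s) * ((r - s) * L * f r)" by (simp only: z(3)[symmetric])
    then show ?thesis by (simp add: power2_eq_square mult.assoc)
  qed
  \<comment> \<open>Small enough for d^2 L < 1, while s + d stays below 1.\<close>
  define d where "d = min ((1 - s) / 2) (1 / (L + 1))"
  have d: "0 < d" "d < 1 - s" "d * L < 1" "d \<le> 1"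
  proof -
    show "0 < d" "d < 1 - s" using s L0 by (auto simp: d_def min_def field_simps)
    show "d \<le> 1" using s s0 by (simp add: d_def min_def)
    have "d * L \<le> 1 / (L + 1) * L" using L0 by (intro mult_right_mono) (auto simp: d_def)
    also have "\<dots> < 1" using L0 by (simp add: divide_less_eq)
    finally show "d * L < 1" .
  qed
  have fd: "f (s + d) > 0" using pos[of "s + d"] d by simp
  have "d\<^sup>2 * L < 1"
  proof -
    have "d\<^sup>2 * L = d * (d * L)" by (simp add: power2_eq_square)
    also have "\<dots> \<le> 1 * (d * L)" using d L0 by (intro mult_right_mono) auto
    finally show ?thesis using d by simp
  qed
  moreover have "1 * f (s + d) \<le> (d\<^sup>2 * L) * f (s + d)" using fest[of "s + d"] d by simp
  ultimately show False using fd by (metis mult_le_cancel_right not_less)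
qed

text \<open>Let \<open>s\<close> be the last zero. Beyond it f cannot be negative, because f(1) = 1,
  so \<open>f_zero_initial\<close> gives s = 0.\<close>

lemma f_pos: assumes "0 < x" "x \<le> 1" shows "0 < f x"
proof -
  define Z where "Z = {x \<in> {0..1}. f x = 0}"
  have cl: "closed Z" unfolding Z_def
    using continuous_closed_preimage_constant[OF f_cont] by simp
  have Z0: "0 \<in> Z" by (simp add: Z_def f_0)
  have bd: "bdd_above Z" by (auto simp: Z_def intro: bdd_aboveI[of _ 1])
  define s where "s = Sup Z"
  have sZ: "s \<in> Z" unfolding s_def using Z0 bd cl by (intro closed_contains_Sup) auto
  have s: "0 \<le> s" "s < 1" "f s = 0" using sZ f_1 by (auto simp: Z_def less_le)
  have nz: "f x \<noteq> 0" if "s < x" "x \<le> 1" for x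
  proof
    assume "f x = 0"
    then have "x \<in> Z" using that s by (auto simp: Z_def)
    then have "x \<le> s" unfolding s_def using bd by (rule cSup_upper)
    then show False using that by simp
  qed
  have pos: "0 < f x" if "s < x" "x \<le> 1" for x
  proof (rule ccontr)
    assume "\<not> 0 < f x"
    then have "\<exists>y. x \<le> y \<and> y \<le> 1 \<and> f y = 0"
      using that s f_1 by (intro IVT') (auto intro: continuous_on_subset[OF f_cont])
    then show False using nz that by auto
  qed
  have "s = 0" by (rule f_zero_initial[OF s pos])
  then show ?thesis using pos assms by simp
qed

lemma f_nonneg: "0 \<le> x \<Longrightarrow> x \<le> 1 \<Longrightarrow> 0 \<le> f x"
  using f_pos[of x] f_0 by (cases "x = 0") auto

lemma f_le_1: "0 \<le> x \<Longrightarrow> x \<le> 1 \<Longrightarrow> f x \<le> 1"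
  using f_bound_aux[of 1 x] by simp

lemma f_mono: "0 \<le> x \<Longrightarrow> x \<le> y \<Longrightarrow> y \<le> 1 \<Longrightarrow> f x \<le> f y"
  using f_sq_mono[of x y] f_nonneg[of x] f_nonneg[of y] by (auto intro: power2_le_imp_le)

lemma c_nonneg: assumes "0 < r" "r \<le> 1" shows "0 \<le> c r"
  using W'_nonneg[of "1 - (f r)\<^sup>2"] f_sq_le_1[of r] f_pos[of r] assms
  by (simp add: c_def divide_nonneg_nonneg)

lemma f'_nonneg: assumes r: "0 < r" "r < 1" shows "0 \<le> f' r"
proof (rule ccontr)
  assume "\<not> 0 \<le> f' r"
  then have "f' r < 0" by simp
  from DERIV_neg_dec_right[OF f_deriv[OF r] this] obtain e where
    e: "e > 0" "\<And>h. 0 < h \<Longrightarrow> h < e \<Longrightarrow> f r > f (r + h)" by auto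
  define h where "h = min (e/2) ((1 - r)/2)"
  have h: "0 < h" "h < e" "r + h < 1" using e r by (auto simp: h_def min_def field_simps)
  show False using e(2)[of h] h f_mono[of r "r + h"] r by auto
qed

text \<open>The function r^(N-1) (r f' - f) has derivative - c r^N f \<le> 0, so a positive value
  persists down to the origin. There it is refuted without any knowledge of f' at 0: the mean value
  theorem on [p/2, p] yields a point z with z f'(z) \<le> 2 f(p), which is small.\<close>

lemma r_f'_le_f: assumes r: "0 < r" "r < 1" shows "r * f' r \<le> f r"
proof (rule ccontr)
  assume ng: "\<not> r * f' r \<le> f r"
  define g where "g r = r ^ (N - 1) * (r * f' r - f r)" for r
  have g0: "g r > 0" using ng r by (simp add: g_def)
  have dg: "(g has_real_derivative - (c x * x ^ N * f x)) (at x)" if x: "0 < x" "x < 1" for x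
  proof -
    have "(g has_real_derivative real (N - 1) * x ^ (N - 1 - 1) * (x * f' x - f x) + x ^ (N - 1) * (x * f'' x)) (at x)"
      unfolding g_def
      by (auto intro!: derivative_eq_intros f'_deriv f_deriv that simp: algebra_simps)
    moreover have p: "x ^ (N - 1) = x * x ^ (N - 1 - 1)" "x ^ N = x * (x * x ^ (N - 1 - 1))"
      using N by (cases N; cases "N - 1"; simp)+
    have "real (N - 1) * x ^ (N - 1 - 1) * (x * f' x - f x) + x ^ (N - 1) * (x * f'' x)
       = - (c x * x ^ N * f x)"
      unfolding f''_eq[OF that] p using that N by (simp add: field_simps of_nat_diff power2_eq_square)
    ultimately show ?thesis by simp
  qed
  have g_mono: "g r \<le> g x" if "0 < x" "x \<le> r" for x
  proof (rule DERIV_nonpos_imp_nonincreasing[OF that(2)])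
    fix z assume z: "x \<le> z" "z \<le> r"
    then have z1: "0 < z" "z < 1" using that r by auto
    then show "\<exists>d. DERIV g z :> d \<and> d \<le> 0"
      using dg[OF z1] c_nonneg[of z] f_nonneg[of z] by (intro exI conjI) auto
  qed
  have "(f \<longlongrightarrow> 0) (at 0 within {0..1})" using f_cont f_0 by (force simp: continuous_on_def)
  then have "eventually (\<lambda>x. f x < g r / 2) (at 0 within {0..1})"
    using g0 by (intro order_tendstoD) auto
  then obtain d where d: "d > 0" "\<And>x. x \<in> {0..1} \<Longrightarrow> x \<noteq> 0 \<Longrightarrow> dist x 0 < d \<Longrightarrow> f x < g r / 2"
    by (auto simp: eventually_at)
  define p where "p = min r (d / 2)"
  have p: "0 < p" "p \<le> r" "p < 1" "f p < g r / 2" using d r by (auto simp: p_def intro!: d(2))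
  have "\<exists>z>p/2. z < p \<and> f p - f (p/2) = (p - p/2) * f' z"
    by (rule MVT2) (use p in \<open>auto intro!: f_deriv\<close>)
  then obtain z where z: "p / 2 < z" "z < p" "f p - f (p/2) = p / 2 * f' z" by auto
  have z1: "0 < z" "z < 1" using z p by auto
  have "z * f' z \<le> p * f' z" using z f'_nonneg[OF z1] by (intro mult_right_mono) auto
  also have "\<dots> \<le> 2 * f p" using z(3) f_nonneg[of "p/2"] p by simp
  finally have "z * f' z \<le> 2 * f p" .
  then have "z * f' z - f z \<le> 2 * f p" using f_nonneg[of z] z1 by simp
  then have "g z \<le> z ^ (N - 1) * (2 * f p)" unfolding g_def using z1 by (intro mult_left_mono) auto
  also have "\<dots> \<le> 1 * (2 * f p)" using z1 f_nonneg[of p] p by (intro mult_right_mono power_le_one) auto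
  also have "\<dots> < g r" using p by simp
  finally show False using g_mono[of z] z1 z p by simp
qed

lemma f'_le: assumes r: "0 < r" "r < 1" shows "f' r \<le> 1 / r"
  using r_f'_le_f[OF r] f_le_1[of r] r by (simp add: field_simps)

end

subsection \<open>Weak derivatives on the unit ball\<close>

abbreviation LB :: "(real^'n::finite) measure" where "LB \<equiv> lebesgue_on (ball 0 1)"

lemma set_LB: "(LINT x:ball 0 1|lebesgue. f x) = (\<integral>x. f x \<partial>(LB :: (real^'n::finite) measure))"
  for f :: "real^'n \<Rightarrow> real"
  unfolding set_lebesgue_integral_def by (subst integral_restrict_space) simp_all

lemma test_ballE:
  assumes "test_function (ball 0 1) \<phi>"
  obtains \<rho> where "Cc \<phi>" "0 < \<rho>" "\<rho> < 1" "\<And>x. \<rho> \<le> norm x \<Longrightarrow> \<phi> x = 0"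
proof -
  let ?S = "closure {x. \<phi> x \<noteq> 0}"
  have S: "smooth \<phi>" "compact ?S" "?S \<subseteq> ball 0 1" using assms by (simp_all add: test_function_def)
  have C: "Cc \<phi>" unfolding Cc_iff using S by (simp add: test_function_def)
  have sub: "{x. \<phi> x \<noteq> 0} \<subseteq> ?S" by (rule closure_subset)
  show thesis
  proof (cases "?S = {}")
    case True
    then have "\<phi> x = 0" for x using sub by blast
    then show thesis using that[OF C, of "1/2"] by simp
  next
    case False
    have "continuous_on ?S norm" by (intro continuous_intros)
    then obtain y where y: "y \<in> ?S" "\<And>x. x \<in> ?S \<Longrightarrow> norm x \<le> norm y"
      using continuous_attains_sup[OF S(2) False] by blast
    have y1: "norm y < 1" using y(1) S(3) by auto
    have "\<phi> x = 0" if "(1 + norm y) / 2 \<le> norm x" for x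
    proof (rule ccontr)
      assume "\<phi> x \<noteq> 0"
      then have "x \<in> ?S" using sub by blast
      then show False using y(2)[of x] that y1 by fastforce
    qed
    moreover have "0 < (1 + norm y) / 2" by (simp add: add_pos_nonneg)
    moreover have "(1 + norm y) / 2 < 1" using y1 by simp
    ultimately show thesis using that[OF C] by blast
  qed
qed

lemma test_ballI:
  assumes "Cc \<phi>" "\<rho> < 1" "\<And>x. \<rho> < norm x \<Longrightarrow> \<phi> x = 0"
  shows "test_function (ball 0 1) \<phi>"
proof -
  have "{x. \<phi> x \<noteq> 0} \<subseteq> cball 0 \<rho>" using assms(3) by force
  then have "closure {x. \<phi> x \<noteq> 0} \<subseteq> cball 0 \<rho>" by (rule closure_minimal) simp
  then have "closure {x. \<phi> x \<noteq> 0} \<subseteq> ball 0 1" using assms(2) by fastforce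
  moreover have "compact (closure {x. \<phi> x \<noteq> 0})" using assms(1) unfolding Cc_iff test_function_def by blast
  ultimately show ?thesis using Cc_smooth[OF assms(1)] by (simp add: test_function_def)
qed

lemma test_pderiv:
  fixes \<phi> :: "real^'n::finite \<Rightarrow> real"
  assumes "test_function (ball 0 1) \<phi>"
  shows "test_function (ball 0 1) (pderiv_at j \<phi>)"
proof -
  from assms obtain \<rho> where r: "Cc \<phi>" "0 < \<rho>" "\<rho> < 1" "\<And>x. \<rho> \<le> norm x \<Longrightarrow> \<phi> x = 0" by (rule test_ballE) blast
  show ?thesis
  proof (rule test_ballI[OF Cc_pderiv[OF r(1)] r(3)])
    fix x :: "real^'n" assume x: "\<rho> < norm x"
    show "pderiv_at j \<phi> x = 0"
      by (rule pderiv_zero_open[of "{x. \<rho> < norm x}"])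
         (use r x in \<open>auto intro!: open_Collect_less continuous_intros\<close>)
  qed
qed

lemma LB_integrable_set:
  fixes u :: "real^'n::finite \<Rightarrow> real"
  shows "integrable LB u \<longleftrightarrow> set_integrable lebesgue (ball 0 1) u"
  unfolding set_integrable_def by (subst integrable_restrict_space) simp_all

lemma integrable_LB_of_lebesgue:
  fixes u :: "real^'n::finite \<Rightarrow> real"
  assumes "integrable lebesgue u" shows "integrable LB u"
  unfolding LB_integrable_set set_integrable_def
  by (rule integrable_mult_indicator[OF _ assms]) simp

lemma locally_integrable_LB:
  fixes u :: "real^'n::finite \<Rightarrow> real"
  assumes "integrable LB u" shows "locally_integrable (ball 0 1) u"
  unfolding locally_integrable_def
proof (intro allI impI)
  fix K :: "(real^'n) set" assume K: "compact K \<and> K \<subseteq> ball 0 1"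
  then have "K \<in> sets lebesgue" by (intro fmeasurableD lmeasurable_compact) simp
  then show "set_integrable lebesgue K u"
    using assms K unfolding LB_integrable_set by (intro set_integrable_subset[of lebesgue "ball 0 1" u K]) auto
qed

lemma locally_integrable_cball:
  fixes u :: "real^'n::finite \<Rightarrow> real"
  assumes "locally_integrable (ball 0 1) u" "\<rho> < 1"
  shows "integrable lebesgue (\<lambda>x. indicator (cball 0 \<rho>) x * u x)"
proof -
  have "compact (cball 0 \<rho> :: (real^'n) set)" "cball 0 \<rho> \<subseteq> (ball 0 1 :: (real^'n) set)" using assms(2) by auto
  then have "set_integrable lebesgue (cball 0 \<rho>) u" using assms(1) unfolding locally_integrable_def by blast
  then show ?thesis by (simp add: set_integrable_def)
qed

lemma bounded_mult_integrable:
  fixes u v :: "'a \<Rightarrow> real"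
  assumes "integrable M u" "v \<in> borel_measurable M" "\<And>x. \<bar>v x\<bar> \<le> B"
  shows "integrable M (\<lambda>x. u x * v x)"
proof (rule Bochner_Integration.integrable_bound)
  show "integrable M (\<lambda>x. B * u x)" using assms(1) by simp
  show "AE x in M. norm (u x * v x) \<le> norm (B * u x)"
  proof (rule AE_I2)
    fix x
    have "\<bar>v x\<bar> * \<bar>u x\<bar> \<le> \<bar>B\<bar> * \<bar>u x\<bar>"
      by (rule mult_right_mono[OF order_trans[OF assms(3) abs_ge_self]]) simp
    then show "norm (u x * v x) \<le> norm (B * u x)" by (simp add: abs_mult mult.commute)
  qed
  show "(\<lambda>x. u x * v x) \<in> borel_measurable M" using assms(1,2) by simp
qed

lemma smooth_lebesgue: "smooth \<phi> \<Longrightarrow> \<phi> \<in> borel_measurable lebesgue"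
  using measurable_completion[of \<phi> lborel borel] smooth_borel[of \<phi>] by simp

lemma smooth_LB: "smooth \<phi> \<Longrightarrow> \<phi> \<in> borel_measurable LB"
  by (rule measurable_restrict_space1[OF smooth_lebesgue])

lemma borel_LB: "\<phi> \<in> borel_measurable borel \<Longrightarrow> \<phi> \<in> borel_measurable LB"
  by (rule measurable_restrict_space1, rule measurable_completion) simp

lemma locally_integrable_test:
  fixes u :: "real^'n::finite \<Rightarrow> real"
  assumes u: "locally_integrable (ball 0 1) u" and p: "test_function (ball 0 1) \<phi>"
  shows "integrable LB (\<lambda>x. u x * \<phi> x)"
proof -
  obtain \<rho> where r: "Cc \<phi>" "0 < \<rho>" "\<rho> < 1" "\<And>x. \<rho> \<le> norm x \<Longrightarrow> \<phi> x = 0" using test_ballE[OF p] by blast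
  obtain B where B: "B \<ge> 0" "\<And>x. \<bar>\<phi> x\<bar> \<le> B" by (rule Cc_bounded[OF r(1)]) blast
  have "integrable lebesgue (\<lambda>x. (indicator (cball 0 \<rho>) x * u x) * \<phi> x)"
    by (rule bounded_mult_integrable[OF locally_integrable_cball[OF u r(3)] smooth_lebesgue[OF Cc_smooth[OF r(1)]] B(2)])
  moreover have "(indicator (cball 0 \<rho>) x * u x) * \<phi> x = u x * \<phi> x" for x
    using r(4)[of x] by (cases "norm x \<le> \<rho>") simp_all
  ultimately have "integrable lebesgue (\<lambda>x. u x * \<phi> x)" by simp
  then show ?thesis by (rule integrable_LB_of_lebesgue)
qed

lemma weak_pderiv_iff:
  "has_weak_pderiv (ball 0 1) j u g \<longleftrightarrow> locally_integrable (ball 0 1) u \<and> locally_integrable (ball 0 1) g \<and>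
    (\<forall>\<phi>. test_function (ball 0 1) \<phi> \<longrightarrow> (\<integral>x. u x * pderiv_at j \<phi> x \<partial>LB) = - (\<integral>x. g x * \<phi> x \<partial>LB))"
  unfolding has_weak_pderiv_def set_LB ..

lemma locally_integrable_diff:
  "locally_integrable S u \<Longrightarrow> locally_integrable S v \<Longrightarrow> locally_integrable S (\<lambda>x. u x - v x)"
  unfolding locally_integrable_def by (blast intro: set_integral_diff(1))

lemma weak_pderiv_diff:
  fixes u v g h :: "real^'n::finite \<Rightarrow> real"
  assumes "has_weak_pderiv (ball 0 1) j u g" "has_weak_pderiv (ball 0 1) j v h"
  shows "has_weak_pderiv (ball 0 1) j (\<lambda>x. u x - v x) (\<lambda>x. g x - h x)"
proof -
  note a = assms[unfolded weak_pderiv_iff]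
  show ?thesis
    unfolding weak_pderiv_iff
  proof (intro conjI allI impI locally_integrable_diff)
    fix \<phi> :: "real^'n \<Rightarrow> real" assume p: "test_function (ball 0 1) \<phi>"
    have i: "integrable LB (\<lambda>x. u x * pderiv_at j \<phi> x)" "integrable LB (\<lambda>x. v x * pderiv_at j \<phi> x)"
      "integrable LB (\<lambda>x. g x * \<phi> x)" "integrable LB (\<lambda>x. h x * \<phi> x)"
      using a p test_pderiv[OF p] by (simp_all add: locally_integrable_test)
    show "(\<integral>x. (u x - v x) * pderiv_at j \<phi> x \<partial>LB) = - (\<integral>x. (g x - h x) * \<phi> x \<partial>LB)"
      using a p i by (simp add: left_diff_distrib)
  qed (use a in auto)
qed

section \<open>The fundamental lemma of the calculus of variations\<close>

lemma ae_LB_lborel: "(AE x in lborel. P x) \<Longrightarrow> AE x in LB. P (x :: real^'n::finite)"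
proof -
  assume "AE x in lborel. P x"
  then have "AE x in lebesgue. P x" by (rule AE_completion)
  then show ?thesis by (subst AE_restrict_space_iff) (auto elim: eventually_mono)
qed

lemma LB_zero_ext:
  fixes f :: "real^'n::finite \<Rightarrow> real"
  assumes f: "f \<in> borel_measurable borel" and z: "\<And>x. 1 \<le> norm x \<Longrightarrow> f x = 0"
  shows "(\<integral>x. f x \<partial>LB) = (\<integral>x. f x \<partial>lborel)" "integrable LB f \<longleftrightarrow> integrable lborel f"
proof -
  have e: "(\<lambda>x. indicator (ball 0 1) x *\<^sub>R f x) = f"
  proof
    fix x show "indicator (ball 0 1) x *\<^sub>R f x = f x" using z[of x] by (cases "norm x < 1") simp_all
  qed
  show "(\<integral>x. f x \<partial>LB) = (\<integral>x. f x \<partial>lborel)" using LB_integral[of f] f by (simp only: e)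
  show "integrable LB f \<longleftrightarrow> integrable lborel f" using LB_integrable_iff[of f] f by (simp only: e)
qed

text \<open>Mollifying \<psi> gives test functions that are uniformly close to it and still vanish
  beyond \<open>\<rho>'\<close>, so orthogonality passes from smooth to continuous
  functions.\<close>

lemma continuous_pairing_zero:
  fixes g :: "real^'n::finite \<Rightarrow> real"
  assumes g: "integrable lborel g" and r: "\<rho> < \<rho>'" "\<rho>' < 1" "0 < \<rho>"
    and z: "\<And>\<phi>. Cc \<phi> \<Longrightarrow> (\<And>x. \<rho>' \<le> norm x \<Longrightarrow> \<phi> x = 0) \<Longrightarrow> (\<integral>x. g x * \<phi> x \<partial>lborel) = 0"
    and c: "continuous_on UNIV \<psi>" and \<psi>z: "\<And>x. \<rho> \<le> norm x \<Longrightarrow> \<psi> x = 0"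
  shows "(\<integral>x. g x * \<psi> x \<partial>lborel) = 0"
proof -
  note pi = continuous_compact_support_integrable[OF c \<psi>z]
  define I where "I = (\<integral>x. \<bar>g x\<bar> \<partial>lborel)"
  have I: "0 \<le> I" by (simp add: I_def)
  have "\<bar>\<integral>x. g x * \<psi> x \<partial>lborel\<bar> \<le> 0 + e" if e: "0 < e" for e
  proof -
    have I1: "0 < I + 1" using I by linarith
    define e' where "e' = e / (I + 1)"
    have e': "0 < e'" using e I1 by (simp add: e'_def)
    obtain s where s: "s > 0" "\<And>x y. dist x y < s \<Longrightarrow> \<bar>\<psi> x - \<psi> y\<bar> < e'"
      using uniformly_continuous_compact_support[OF c \<psi>z e'] by blast
    define d where "d = min s (\<rho>' - \<rho>)"
    have d: "0 < d" "d \<le> s" "d \<le> \<rho>' - \<rho>" using s r by (simp_all add: d_def)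
    let ?\<phi> = "conv \<psi> (moll d)"
    have pz: "?\<phi> x = 0" if "\<rho>' \<le> norm x" for x
    proof (rule conv_zero[OF d(1)])
      show "\<psi> y = 0" if "\<rho> \<le> norm y" for y by (rule \<psi>z[OF that])
      show "\<rho> + d \<le> norm x" using that d by linarith
    qed
    have C: "Cc ?\<phi>" unfolding Cc_def using smooth_conv[OF Cc_moll[OF d(1)] pi] pz by (blast intro: less_imp_le)
    have cl: "\<bar>?\<phi> x - \<psi> x\<bar> \<le> e'" for x
    proof (rule conv_close[OF d(1) pi _ less_imp_le[OF e']])
      fix y assume "norm (x - y) < d"
      then have "dist y x < s" using d(2) by (simp add: dist_norm norm_minus_commute)
      then show "\<bar>\<psi> y - \<psi> x\<bar> \<le> e'" using s(2)[of y x] by simp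
    qed
    obtain B where B: "\<And>x. \<bar>?\<phi> x\<bar> \<le> B" by (rule Cc_bounded[OF C]) blast
    have i1: "integrable lborel (\<lambda>x. g x * ?\<phi> x)"
      by (rule bounded_mult_integrable[OF g _ B]) (use smooth_borel[OF Cc_smooth[OF C]] in simp)
    have i3: "integrable lborel (\<lambda>x. g x * (\<psi> x - ?\<phi> x))"
    proof (rule bounded_mult_integrable[OF g])
      show "(\<lambda>x. \<psi> x - ?\<phi> x) \<in> borel_measurable lborel"
        using smooth_borel[OF Cc_smooth[OF C]] borel_measurable_continuous_onI[OF c] by simp
      show "\<bar>\<psi> x - ?\<phi> x\<bar> \<le> e'" for x using cl[of x] by linarith
    qed
    have "(\<integral>x. g x * \<psi> x \<partial>lborel) = (\<integral>x. g x * ?\<phi> x + g x * (\<psi> x - ?\<phi> x) \<partial>lborel)"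
      by (simp add: algebra_simps)
    also have "\<dots> = (\<integral>x. g x * (\<psi> x - ?\<phi> x) \<partial>lborel)"
      using z[OF C pz] by (simp add: Bochner_Integration.integral_add[OF i1 i3])
    finally have "\<bar>\<integral>x. g x * \<psi> x \<partial>lborel\<bar> = \<bar>\<integral>x. g x * (\<psi> x - ?\<phi> x) \<partial>lborel\<bar>" by simp
    also have "\<dots> \<le> (\<integral>x. e' * \<bar>g x\<bar> \<partial>lborel)"
    proof (rule order_trans[OF integral_abs_bound integral_mono])
      fix x
      have "\<bar>\<psi> x - ?\<phi> x\<bar> \<le> e'" using cl[of x] by linarith
      then have "\<bar>g x\<bar> * \<bar>\<psi> x - ?\<phi> x\<bar> \<le> \<bar>g x\<bar> * e'" by (rule mult_left_mono) simp
      then show "\<bar>g x * (\<psi> x - ?\<phi> x)\<bar> \<le> e' * \<bar>g x\<bar>" by (simp add: abs_mult mult.commute)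
    qed (use i3 g in simp_all)
    also have "\<dots> = e * (I / (I + 1))" using g by (simp add: I_def e'_def)
    also have "\<dots> \<le> e * 1" using e I I1 by (intro mult_left_mono) simp_all
    finally show ?thesis by simp
  qed
  then have "\<bar>\<integral>x. g x * \<psi> x \<partial>lborel\<bar> \<le> 0" by (rule field_le_epsilon)
  then show ?thesis by simp
qed

text \<open>On a smaller ball \<open>g\<close> is tested with continuous approximations of its own
  sign, times a cutoff \<eta>; dominated convergence turns the pairing into the integral of |g|
  \<eta>. Balls of radius 1 - 1/(m+2) then exhaust the unit ball.\<close>

lemma fundamental_lemma:
  fixes g :: "real^'n::finite \<Rightarrow> real"
  assumes g: "locally_integrable (ball 0 1) g"
    and z: "\<And>\<phi>. test_function (ball 0 1) \<phi> \<Longrightarrow> (\<integral>x. g x * \<phi> x \<partial>LB) = 0"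
  shows "AE x in LB. g x = 0"
proof -
  have main: "AE x in LB. norm x \<le> \<rho> \<longrightarrow> g x = 0" if r: "0 < \<rho>" "\<rho> < 1" for \<rho>
  proof -
    \<comment> \<open>Two intermediate radii: the cutoff lives inside \<open>\<rho>1\<close>, its
      mollifications inside \<open>\<rho>2\<close>, and \<open>g\<close> is integrable up to
      \<open>\<rho>2\<close> < 1.\<close>
    define \<rho>1 where "\<rho>1 = (\<rho> + 1) / 2"
    define \<rho>2 where "\<rho>2 = (\<rho>1 + 1) / 2"
    have rr: "\<rho> < \<rho>1" "\<rho>1 < \<rho>2" "\<rho>2 < 1" "0 < \<rho>1" using r by (simp_all add: \<rho>1_def \<rho>2_def)
    define g1 where "g1 x = indicator (cball 0 \<rho>2) x * g x" for x
    have g1: "integrable lebesgue g1" unfolding g1_def[abs_def] by (rule locally_integrable_cball[OF g rr(3)])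
    then have "g1 \<in> borel_measurable lebesgue" by simp
    then obtain g2 where g2m: "g2 \<in> borel_measurable lborel" "AE x in lborel. g1 x = g2 x"
      using completion_ex_borel_measurable_real by blast
    have ae: "AE x in lebesgue. g1 x = g2 x" by (rule AE_completion[OF g2m(2)])
    have g2l: "g2 \<in> borel_measurable lebesgue" using g2m(1) by (rule measurable_completion)
    have "integrable lebesgue g2" by (rule integrable_cong_AE_imp[OF g1 g2l ae])
    then have g2: "integrable lborel g2" using integrable_completion[OF g2m(1)] by simp
    have g2z: "(\<integral>x. g2 x * \<phi> x \<partial>lborel) = 0" if C: "Cc \<phi>" and pz: "\<And>x. \<rho>2 \<le> norm x \<Longrightarrow> \<phi> x = 0" for \<phi>
    proof -
      have t: "test_function (ball 0 1) \<phi>" by (rule test_ballI[OF C rr(3)]) (use pz in simp)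
      have pm: "\<phi> \<in> borel_measurable lebesgue" by (rule smooth_lebesgue[OF Cc_smooth[OF C]])
      have pl: "(\<lambda>x. g2 x * \<phi> x) \<in> borel_measurable lborel"
        using g2m(1) smooth_borel[OF Cc_smooth[OF C]] by simp
      have "(\<integral>x. g2 x * \<phi> x \<partial>lborel) = (\<integral>x. g2 x * \<phi> x \<partial>lebesgue)" using integral_completion[OF pl] by simp
      also have "\<dots> = (\<integral>x. g1 x * \<phi> x \<partial>lebesgue)"
      proof (rule integral_cong_AE)
        show "AE x in lebesgue. g2 x * \<phi> x = g1 x * \<phi> x" using ae by eventually_elim simp
      qed (use pm g1 g2l in simp_all)
      also have "\<dots> = (\<integral>x. indicator (ball 0 1) x *\<^sub>R (g x * \<phi> x) \<partial>lebesgue)"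
      proof (rule Bochner_Integration.integral_cong[OF refl])
        fix x
        show "g1 x * \<phi> x = indicator (ball 0 1) x *\<^sub>R (g x * \<phi> x)"
          using pz[of x] rr by (cases "norm x \<le> \<rho>2") (simp_all add: g1_def)
      qed
      also have "\<dots> = (\<integral>x. g x * \<phi> x \<partial>LB)" by (subst integral_restrict_space) simp_all
      also have "\<dots> = 0" by (rule z[OF t])
      finally show ?thesis .
    qed
    define h where "h x = sgn (g2 x) * indicator (ball 0 1) x" for x
    have hm: "h \<in> borel_measurable borel"
      unfolding h_def[abs_def] using g2m(1) by (intro borel_measurable_times borel_measurable_indicator) simp_all
    have hb: "\<bar>h x\<bar> \<le> 1" for x by (simp add: h_def abs_mult abs_sgn_eq indicator_def)
    have hz: "h x = 0" if "1 \<le> norm x" for x using that by (simp add: h_def)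
    obtain \<psi> :: "nat \<Rightarrow> real^'n \<Rightarrow> real" where \<psi>: "\<And>m. continuous_on UNIV (\<psi> m)" "\<And>m x. \<bar>\<psi> m x\<bar> \<le> 1"
      "\<And>m x. 2 \<le> norm x \<Longrightarrow> \<psi> m x = 0" "AE x in lborel. (\<lambda>m. \<psi> m x) \<longlonglongrightarrow> h x"
    proof (rule bounded_continuous_approx[OF hm hb hz])
      fix \<psi> :: "nat \<Rightarrow> real^'n \<Rightarrow> real"
      assume "\<And>m. continuous_on UNIV (\<psi> m)" "\<And>m x. \<bar>\<psi> m x\<bar> \<le> 1"
        "\<And>m x. 2 \<le> norm x \<Longrightarrow> \<psi> m x = 0" "AE x in lborel. (\<lambda>m. \<psi> m x) \<longlonglongrightarrow> h x"
      then show thesis by (rule that)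
    qed
    define \<eta> where "\<eta> x = max 0 (min 1 ((\<rho>1 - norm x) / (\<rho>1 - \<rho>)))" for x :: "real^'n"
    have \<eta>c: "continuous_on UNIV \<eta>" unfolding \<eta>_def[abs_def] using rr by (intro continuous_intros) simp
    have \<eta>b: "0 \<le> \<eta> x" "\<eta> x \<le> 1" for x by (simp_all add: \<eta>_def)
    have \<eta>z: "\<eta> x = 0" if "\<rho>1 \<le> norm x" for x using that rr by (simp add: \<eta>_def divide_nonpos_pos)
    have \<eta>1: "\<eta> x = 1" if "norm x \<le> \<rho>" for x using that rr by (simp add: \<eta>_def)
    have p0: "(\<integral>x. g2 x * (\<eta> x * \<psi> m x) \<partial>lborel) = 0" for m
      by (rule continuous_pairing_zero[OF g2 rr(2,3,4) g2z])
         (use \<eta>c \<psi>(1) \<eta>z in \<open>auto intro: continuous_on_mult\<close>)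
    have \<eta>m: "\<eta> \<in> borel_measurable borel" by (rule borel_measurable_continuous_onI[OF \<eta>c])
    have \<psi>m: "\<psi> m \<in> borel_measurable borel" for m by (rule borel_measurable_continuous_onI[OF \<psi>(1)])
    have "(\<lambda>m. \<integral>x. g2 x * (\<eta> x * \<psi> m x) \<partial>lborel) \<longlonglongrightarrow> (\<integral>x. g2 x * (\<eta> x * h x) \<partial>lborel)"
    proof (rule integral_dominated_convergence)
      show "integrable lborel (\<lambda>x. \<bar>g2 x\<bar>)" using g2 by simp
      show "AE x in lborel. (\<lambda>m. g2 x * (\<eta> x * \<psi> m x)) \<longlonglongrightarrow> g2 x * (\<eta> x * h x)"
        using \<psi>(4) by eventually_elim (intro tendsto_intros)
      show "AE x in lborel. norm (g2 x * (\<eta> x * \<psi> m x)) \<le> \<bar>g2 x\<bar>" for m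
      proof (rule AE_I2)
        fix x
        have "\<bar>\<eta> x\<bar> * \<bar>\<psi> m x\<bar> \<le> 1 * 1" using \<eta>b[of x] \<psi>(2)[of m x] by (intro mult_mono) simp_all
        then have "\<bar>g2 x\<bar> * (\<bar>\<eta> x\<bar> * \<bar>\<psi> m x\<bar>) \<le> \<bar>g2 x\<bar> * 1" by (intro mult_left_mono) simp_all
        then show "norm (g2 x * (\<eta> x * \<psi> m x)) \<le> \<bar>g2 x\<bar>" by (simp add: abs_mult)
      qed
    qed (use g2m(1) \<eta>m \<psi>m hm in simp_all)
    then have i0: "(\<integral>x. g2 x * (\<eta> x * h x) \<partial>lborel) = 0" using p0 by (simp add: LIMSEQ_const_iff)
    have nn: "0 \<le> g2 x * (\<eta> x * h x)" for x
    proof -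
      have "g2 x * h x = \<bar>g2 x\<bar> * indicator (ball 0 1) x" by (simp add: h_def abs_sgn)
      then have "g2 x * (\<eta> x * h x) = \<eta> x * (\<bar>g2 x\<bar> * indicator (ball 0 1) x)"
        by (simp only: mult.left_commute[of "g2 x" "\<eta> x" "h x"])
      then show ?thesis using \<eta>b[of x] by (simp only: mult_nonneg_nonneg abs_ge_zero indicator_pos_le)
    qed
    have int: "integrable lborel (\<lambda>x. g2 x * (\<eta> x * h x))"
    proof (rule bounded_mult_integrable[OF g2])
      show "\<bar>\<eta> x * h x\<bar> \<le> 1" for x
        using mult_mono[of "\<bar>\<eta> x\<bar>" 1 "\<bar>h x\<bar>" 1] \<eta>b[of x] hb[of x] by (simp add: abs_mult)
    qed (use \<eta>m hm in simp)
    have "AE x in lborel. g2 x * (\<eta> x * h x) = 0"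
      using integral_nonneg_eq_0_iff_AE[OF int AE_I2[OF nn]] i0 by simp
    then have "AE x in lborel. norm x \<le> \<rho> \<longrightarrow> g x = 0"
      using g2m(2)
    proof eventually_elim
      case (elim x)
      show ?case
      proof
        assume x: "norm x \<le> \<rho>"
        then have "norm x < 1" "norm x \<le> \<rho>2" using r rr by linarith+
        then have "g2 x * sgn (g2 x) = 0" "g1 x = g x" using elim(1) \<eta>1[OF x] by (simp_all add: h_def g1_def)
        then show "g x = 0" using elim(2) by (simp add: sgn_zero_iff)
      qed
    qed
    then show ?thesis by (rule ae_LB_lborel)
  qed
  have "AE x in LB. \<forall>m::nat. norm x \<le> 1 - 1 / (real m + 2) \<longrightarrow> g x = 0"
    unfolding AE_all_countable
  proof
    fix m :: nat
    show "AE x in LB. norm x \<le> 1 - 1 / (real m + 2) \<longrightarrow> g x = 0" by (rule main) (simp_all add: field_simps)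
  qed
  then show ?thesis
    using AE_space
  proof eventually_elim
    case (elim x)
    then have "norm x < 1" by simp
    then obtain m :: nat where "inverse (real (Suc m)) < 1 - norm x" using reals_Archimedean[of "1 - norm x"] by auto
    moreover have "1 / (real m + 2) \<le> inverse (real (Suc m))" by (simp add: field_simps)
    ultimately have "norm x \<le> 1 - 1 / (real m + 2)" by linarith
    then show ?case using elim(1) by blast
  qed
qed

lemma weak_pderiv_unique:
  assumes "has_weak_pderiv (ball 0 1) j u g" "has_weak_pderiv (ball 0 1) j u h"
  shows "AE x in LB. g x = h x"
proof -
  have d: "has_weak_pderiv (ball 0 1) j (\<lambda>x. u x - u x) (\<lambda>x. g x - h x)" by (rule weak_pderiv_diff[OF assms])
  have "AE x in LB. g x - h x = 0"
    by (rule fundamental_lemma) (use d in \<open>auto simp: weak_pderiv_iff\<close>)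
  then show ?thesis by eventually_elim simp
qed

text \<open>Frees energy and norms from the choice operator: by uniqueness of weak derivatives they
  can be computed with whichever weak Jacobian is at hand.\<close>

lemma weak_jacobian_AE:
  fixes U :: "real^'n::finite \<Rightarrow> real^'n"
  assumes "has_weak_jacobian (ball 0 1) U G"
  shows "has_weak_jacobian (ball 0 1) U (weak_jacobian (ball 0 1) U)" "AE x in LB. weak_jacobian (ball 0 1) U x = G x"
proof -
  show w: "has_weak_jacobian (ball 0 1) U (weak_jacobian (ball 0 1) U)"
    unfolding weak_jacobian_def by (rule someI[of _ G]) (rule assms)
  have "AE x in LB. weak_jacobian (ball 0 1) U x $ i $ j = G x $ i $ j" for i j
    by (rule weak_pderiv_unique[of j "\<lambda>x. U x $ i"])
       (use w assms in \<open>simp_all add: has_weak_jacobian_def has_weak_gradient_def\<close>)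
  then have "AE x in LB. \<forall>i j. weak_jacobian (ball 0 1) U x $ i $ j = G x $ i $ j"
    by (simp add: AE_all_countable)
  then show "AE x in LB. weak_jacobian (ball 0 1) U x = G x" by eventually_elim (simp add: vec_eq_iff)
qed

text \<open>Nothing concentrates at the origin: the product with a test function is again
  \<open>sing\<close>, and its partial derivative integrates to zero, which is integration by
  parts.\<close>

lemma weak_pderiv_sing:
  fixes F :: "real^'n::finite \<Rightarrow> real"
  assumes N: "3 \<le> CARD('n)" and F: "sing 0 F F'" and cont: "continuous_on (cball 0 1 - {0}) F"
  shows "has_weak_pderiv (ball 0 1) j F (\<lambda>x. F' x (axis j 1))" "integrable LB F" "integrable LB (\<lambda>x. F' x (axis j 1))"
proof -
  obtain C where C: "\<And>x. x \<in> ball 0 1 - {0} \<Longrightarrow> norm (F x) \<le> C" using sing0_bound[OF F] by blast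
  show i1: "integrable LB F"
    by (rule LB_integrable_bounded[where C = C, OF sing_cont[OF F]]) (use C in simp)
  have ibp: "integrable LB (\<lambda>x. F x * pderiv_at j \<phi> x + F' x (axis j 1) * \<phi> x)"
    "(\<integral>x. F x * pderiv_at j \<phi> x + F' x (axis j 1) * \<phi> x \<partial>LB) = 0"
    if p: "test_function (ball 0 1) \<phi>" for \<phi>
  proof -
    obtain \<rho> where r: "Cc \<phi>" "0 < \<rho>" "\<rho> < 1" "\<And>x. \<rho> \<le> norm x \<Longrightarrow> \<phi> x = 0" using test_ballE[OF p] by blast
    let ?P = "\<lambda>x h. F x * (\<Sum>j\<in>UNIV. h $ j * pderiv_at j \<phi> x) + F' x h * \<phi> x"
    have "sing 0 (\<lambda>x. F x * \<phi> x) ?P" using sing_mult[OF F sing_Cc[OF r(1)]] by (simp only: add_0)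
    then have s1: "sing 1 (\<lambda>x. F x * \<phi> x) ?P" by (rule sing_mono) simp
    have e: "?P x (axis j 1) = F x * pderiv_at j \<phi> x + F' x (axis j 1) * \<phi> x" for x by (simp add: sum_axis)
    have c: "continuous_on (cball 0 1 - {0}) (\<lambda>x. F x * \<phi> x)"
    proof -
      have "continuous_on ((ball 0 1 - {0}) \<union> {x. \<rho> < norm x}) (\<lambda>x. F x * \<phi> x)"
      proof (rule continuous_on_open_Un)
        show "continuous_on (ball 0 1 - {0}) (\<lambda>x. F x * \<phi> x)" by (rule sing_cont[OF s1])
        show "continuous_on {x. \<rho> < norm x} (\<lambda>x. F x * \<phi> x)"
          by (rule continuous_on_eq[of _ "\<lambda>_. 0"]) (auto simp: r)
      qed (auto intro!: open_Collect_less continuous_intros)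
      then show ?thesis by (rule continuous_on_subset) (use r(3) in auto)
    qed
    note d = sing_ball_divergence[OF N s1 c, of j, unfolded e]
    show "integrable LB (\<lambda>x. F x * pderiv_at j \<phi> x + F' x (axis j 1) * \<phi> x)" by (rule d(1))
    have "(\<integral>x. \<bar>F (sgn x) * \<phi> (sgn x)\<bar> \<partial>(LB :: (real^'n) measure)) = 0"
      by (rule integral_eq_zero_AE, rule LB_I) (use r(3,4) in \<open>simp add: norm_sgn\<close>)
    then show "(\<integral>x. F x * pderiv_at j \<phi> x + F' x (axis j 1) * \<phi> x \<partial>LB) = 0" using d(2) by simp
  qed
  show i2: "integrable LB (\<lambda>x. F' x (axis j 1))"
    by (rule sing_ball_divergence(1)[OF N sing_mono[OF F] cont]) simp
  show "has_weak_pderiv (ball 0 1) j F (\<lambda>x. F' x (axis j 1))"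
    unfolding weak_pderiv_iff
  proof (intro conjI allI impI locally_integrable_LB i1 i2)
    fix \<phi> :: "real^'n \<Rightarrow> real" assume p: "test_function (ball 0 1) \<phi>"
    note l = locally_integrable_test[OF locally_integrable_LB[OF i1] test_pderiv[OF p]]
      locally_integrable_test[OF locally_integrable_LB[OF i2] p]
    show "(\<integral>x. F x * pderiv_at j \<phi> x \<partial>LB) = - (\<integral>x. F' x (axis j 1) * \<phi> x \<partial>LB)"
      using ibp(2)[OF p] by (simp add: Bochner_Integration.integral_add[OF l])
  qed
qed

subsection \<open>Fields with boundary value zero\<close>

text \<open>The space usually called H^1_0, for one component: the extension by zero has a square
  integrable weak gradient on the whole space. Fixed Borel representatives make convolution and
  integration with respect to \<open>lborel\<close> available.\<close>

definition h10 :: "(real^'n::finite \<Rightarrow> real) \<Rightarrow> ('n \<Rightarrow> real^'n \<Rightarrow> real) \<Rightarrow> bool" where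
  "h10 v g \<longleftrightarrow> v \<in> borel_measurable borel \<and> (\<forall>x. 1 \<le> norm x \<longrightarrow> v x = 0) \<and> integrable lborel (\<lambda>x. (v x)\<^sup>2) \<and>
     (\<forall>j. g j \<in> borel_measurable borel \<and> (\<forall>x. 1 \<le> norm x \<longrightarrow> g j x = 0) \<and> integrable lborel (\<lambda>x. (g j x)\<^sup>2) \<and> weak_pd j v (g j))"

lemma h10D:
  assumes "h10 v g"
  shows "v \<in> borel_measurable borel" "\<And>x. 1 \<le> norm x \<Longrightarrow> v x = 0" "integrable lborel (\<lambda>x. (v x)\<^sup>2)"
    "g j \<in> borel_measurable borel" "\<And>x. 1 \<le> norm x \<Longrightarrow> g j x = 0" "integrable lborel (\<lambda>x. (g j x)\<^sup>2)" "weak_pd j v (g j)"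
    "integrable lborel v" "integrable lborel (g j)"
proof -
  show a: "v \<in> borel_measurable borel" "\<And>x. 1 \<le> norm x \<Longrightarrow> v x = 0" "integrable lborel (\<lambda>x. (v x)\<^sup>2)"
    "g j \<in> borel_measurable borel" "\<And>x. 1 \<le> norm x \<Longrightarrow> g j x = 0" "integrable lborel (\<lambda>x. (g j x)\<^sup>2)" "weak_pd j v (g j)"
    using assms unfolding h10_def by blast+
  show "integrable lborel v" by (rule integrable_of_L2[OF a(1,3,2)])
  show "integrable lborel (g j)" by (rule integrable_of_L2[OF a(4,6,5)])
qed

lemma integrable_sq_diff:
  fixes u v :: "'a \<Rightarrow> real"
  assumes "u \<in> borel_measurable M" "v \<in> borel_measurable M" "integrable M (\<lambda>x. (u x)\<^sup>2)" "integrable M (\<lambda>x. (v x)\<^sup>2)"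
  shows "integrable M (\<lambda>x. (u x - v x)\<^sup>2)"
proof (rule Bochner_Integration.integrable_bound)
  show "integrable M (\<lambda>x. 2 * (u x)\<^sup>2 + 2 * (v x)\<^sup>2)" using assms by simp
  show "AE x in M. norm ((u x - v x)\<^sup>2) \<le> norm (2 * (u x)\<^sup>2 + 2 * (v x)\<^sup>2)"
  proof (rule AE_I2)
    fix x
    have "0 \<le> (u x + v x)\<^sup>2" by simp
    then have "(u x - v x)\<^sup>2 \<le> 2 * (u x)\<^sup>2 + 2 * (v x)\<^sup>2" by (simp add: power2_eq_square algebra_simps)
    then show "norm ((u x - v x)\<^sup>2) \<le> norm (2 * (u x)\<^sup>2 + 2 * (v x)\<^sup>2)" by simp
  qed
qed (use assms in simp)

lemma h10_diff:
  assumes u: "h10 u f" and v: "h10 v g"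
  shows "h10 (\<lambda>x. u x - v x) (\<lambda>j x. f j x - g j x)"
proof -
  note U = h10D[OF u] and V = h10D[OF v]
  have w: "weak_pd j (\<lambda>x. u x - v x) (\<lambda>x. f j x - g j x)" for j
    unfolding weak_pd_def
  proof (intro allI impI)
    fix \<phi> :: "real^'a \<Rightarrow> real" assume C: "Cc \<phi>"
    obtain B where B: "\<And>x. \<bar>\<phi> x\<bar> \<le> B" by (rule Cc_bounded[OF C]) blast
    obtain B' where B': "\<And>x. \<bar>pderiv_at j \<phi> x\<bar> \<le> B'" by (rule Cc_bounded[OF Cc_pderiv[OF C]]) blast
    have m: "\<phi> \<in> borel_measurable lborel" "pderiv_at j \<phi> \<in> borel_measurable lborel"
      using smooth_borel[OF Cc_smooth[OF C]] smooth_borel[OF Cc_smooth[OF Cc_pderiv[OF C]]] by simp_all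
    note i = bounded_mult_integrable[OF U(8) m(2) B'] bounded_mult_integrable[OF V(8) m(2) B']
      bounded_mult_integrable[OF U(9) m(1) B] bounded_mult_integrable[OF V(9) m(1) B]
    show "(\<integral>x. (u x - v x) * pderiv_at j \<phi> x \<partial>lborel) = - (\<integral>x. (f j x - g j x) * \<phi> x \<partial>lborel)"
      using U(7)[of j] V(7)[of j] C i unfolding weak_pd_def
      by (simp add: left_diff_distrib Bochner_Integration.integral_diff)
  qed
  show ?thesis
    unfolding h10_def
  proof (intro conjI allI impI w)
    have b: "w \<in> borel_measurable lborel" if "w \<in> borel_measurable borel" for w :: "real^'a \<Rightarrow> real" using that by simp
    show "integrable lborel (\<lambda>x. (u x - v x)\<^sup>2)" by (rule integrable_sq_diff[OF b[OF U(1)] b[OF V(1)] U(3) V(3)])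
    show "integrable lborel (\<lambda>x. (f j x - g j x)\<^sup>2)" for j
      by (rule integrable_sq_diff[OF b[OF U(4)] b[OF V(4)] U(6) V(6)])
    show "(\<lambda>x. u x - v x) \<in> borel_measurable borel" by (rule borel_measurable_diff[OF U(1) V(1)])
    show "(\<lambda>x. f j x - g j x) \<in> borel_measurable borel" for j by (rule borel_measurable_diff[OF U(4) V(4)])
    fix x :: "real^'a" and j assume x: "1 \<le> norm x"
    show "u x - v x = 0" by (simp only: U(2)[OF x] V(2)[OF x] diff_self)
    show "f j x - g j x = 0" by (simp only: U(5)[OF x] V(5)[OF x] diff_self)
  qed
qed

lemma nn_LB_le_lborel:
  fixes f :: "real^'n::finite \<Rightarrow> ennreal"
  assumes "f \<in> borel_measurable borel"
  shows "(\<integral>\<^sup>+x. f x \<partial>LB) \<le> (\<integral>\<^sup>+x. f x \<partial>lborel)"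
proof -
  have "(\<integral>\<^sup>+x. f x \<partial>LB) = (\<integral>\<^sup>+x. f x * indicator (ball 0 1) x \<partial>lebesgue)"
    by (rule nn_integral_restrict_space) simp
  also have "\<dots> \<le> (\<integral>\<^sup>+x. f x \<partial>lebesgue)" by (rule nn_integral_mono) (simp add: indicator_def)
  also have "\<dots> = (\<integral>\<^sup>+x. f x \<partial>lborel)" by (rule nn_integral_completion)
  finally show ?thesis .
qed

lemma mol_borel:
  fixes h :: "real^'n::finite \<Rightarrow> real"
  assumes "integrable lborel h" shows "mol k h \<in> borel_measurable borel"
proof -
  have c: "conv h (moll (mdel k)) \<in> borel_measurable borel"
    by (rule smooth_borel[OF smooth_conv[OF Cc_moll[OF mdel(1)] assms]])
  have m: "(\<lambda>x::real^'n. (1 + 2 * mdel k) *\<^sub>R x) \<in> borel_measurable borel" by simp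
  show ?thesis unfolding mol_def[abs_def] by (rule measurable_compose[OF m c])
qed

lemma mol_pderiv_tendsto:
  fixes v :: "real^'n::finite \<Rightarrow> real"
  assumes h: "h10 v g"
  shows "(\<lambda>k. \<integral>\<^sup>+x. ennreal ((mol k v x - v x)\<^sup>2) \<partial>LB) \<longlonglongrightarrow> 0"
    "(\<lambda>k. \<integral>\<^sup>+x. ennreal ((pderiv_at j (mol k v) x - g j x)\<^sup>2) \<partial>LB) \<longlonglongrightarrow> 0"
proof -
  note H = h10D[OF h]
  have m: "(\<lambda>x. ennreal ((mol k w x - w x)\<^sup>2)) \<in> borel_measurable borel" if "integrable lborel w" for w :: "real^'n \<Rightarrow> real" and k
    using mol_borel[OF that, of k] that by simp
  show "(\<lambda>k. \<integral>\<^sup>+x. ennreal ((mol k v x - v x)\<^sup>2) \<partial>LB) \<longlonglongrightarrow> 0"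
    by (rule tendsto_sandwich[OF _ _ tendsto_const mol_L2_tendsto[OF H(1,3,2)]])
       (auto intro!: always_eventually nn_LB_le_lborel m H(8))
  let ?M = "\<lambda>k. \<integral>\<^sup>+x. ennreal ((mol k (g j) x - g j x)\<^sup>2) \<partial>(lborel :: (real^'n) measure)"
  let ?G = "\<integral>\<^sup>+x. ennreal ((g j x)\<^sup>2) \<partial>(lborel :: (real^'n) measure)"
  have G: "?G = ennreal (\<integral>x. (g j x)\<^sup>2 \<partial>lborel)" by (rule nn_integral_eq_integral[OF H(6)]) simp
  \<comment> \<open>With t = 1 + 2 \<open>mdel k\<close> \<le> 3 and m the mollified derivative, t m
    - g = t (m - g) + 2 \<open>mdel k\<close> g; squaring gives the constants 18 = 2 * 9 and 8 = 2 *
    4.\<close>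
  have b: "(\<integral>\<^sup>+x. ennreal ((pderiv_at j (mol k v) x - g j x)\<^sup>2) \<partial>LB) \<le> ennreal 18 * ?M k + ennreal (8 * (mdel k)\<^sup>2) * ?G" for k
  proof -
    let ?t = "1 + 2 * mdel k"
    have e: "(pderiv_at j (mol k v) x - g j x)\<^sup>2 \<le> 18 * (mol k (g j) x - g j x)\<^sup>2 + 8 * (mdel k)\<^sup>2 * (g j x)\<^sup>2" for x
    proof -
      define A where "A = mol k (g j) x - g j x"
      have "pderiv_at j (mol k v) x - g j x = ?t * A + 2 * mdel k * g j x"
        unfolding mol_pderiv[OF H(8,7)] A_def by (simp add: algebra_simps)
      moreover have "(?t * A + 2 * mdel k * g j x)\<^sup>2 \<le> 2 * (?t * A)\<^sup>2 + 2 * (2 * mdel k * g j x)\<^sup>2"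
        using zero_le_power2[of "?t * A - 2 * mdel k * g j x"] by (simp add: power2_eq_square algebra_simps)
      moreover have "(?t * A)\<^sup>2 \<le> 9 * A\<^sup>2"
      proof -
        have "?t\<^sup>2 \<le> 3\<^sup>2" using mdel[of k] by (intro power_mono) simp_all
        then show ?thesis by (simp add: power_mult_distrib mult_right_mono)
      qed
      moreover have "(2 * mdel k * g j x)\<^sup>2 = 4 * ((mdel k)\<^sup>2 * (g j x)\<^sup>2)" by (simp add: power_mult_distrib)
      ultimately have "(pderiv_at j (mol k v) x - g j x)\<^sup>2 \<le> 18 * A\<^sup>2 + 8 * ((mdel k)\<^sup>2 * (g j x)\<^sup>2)" by simp
      then show ?thesis by (simp add: A_def mult.assoc)
    qed
    have m2: "(\<lambda>x. ennreal ((pderiv_at j (mol k v) x - g j x)\<^sup>2)) \<in> borel_measurable borel"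
      using smooth_borel[OF Cc_smooth[OF Cc_pderiv[OF mol_Cc[OF H(8,2)]]]] H(4) by simp
    have "(\<integral>\<^sup>+x. ennreal ((pderiv_at j (mol k v) x - g j x)\<^sup>2) \<partial>LB) \<le> (\<integral>\<^sup>+x. ennreal ((pderiv_at j (mol k v) x - g j x)\<^sup>2) \<partial>lborel)"
      by (rule nn_LB_le_lborel[OF m2])
    also have "\<dots> \<le> (\<integral>\<^sup>+x. ennreal 18 * ennreal ((mol k (g j) x - g j x)\<^sup>2) + ennreal (8 * (mdel k)\<^sup>2) * ennreal ((g j x)\<^sup>2) \<partial>lborel)"
    proof (rule nn_integral_mono)
      fix x
      have "ennreal ((pderiv_at j (mol k v) x - g j x)\<^sup>2) \<le> ennreal (18 * (mol k (g j) x - g j x)\<^sup>2 + 8 * (mdel k)\<^sup>2 * (g j x)\<^sup>2)"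
        by (rule ennreal_leI[OF e])
      also have "\<dots> = ennreal (18 * (mol k (g j) x - g j x)\<^sup>2) + ennreal (8 * (mdel k)\<^sup>2 * (g j x)\<^sup>2)"
        by (rule ennreal_plus) simp_all
      also have "\<dots> = ennreal 18 * ennreal ((mol k (g j) x - g j x)\<^sup>2) + ennreal (8 * (mdel k)\<^sup>2) * ennreal ((g j x)\<^sup>2)"
        by (subst ennreal_mult, simp, simp, subst ennreal_mult, simp_all)
      finally show "ennreal ((pderiv_at j (mol k v) x - g j x)\<^sup>2) \<le> ennreal 18 * ennreal ((mol k (g j) x - g j x)\<^sup>2) + ennreal (8 * (mdel k)\<^sup>2) * ennreal ((g j x)\<^sup>2)" .
    qed
    also have "\<dots> = ennreal 18 * ?M k + ennreal (8 * (mdel k)\<^sup>2) * ?G"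
    proof -
      have 1: "(\<lambda>x. ennreal ((mol k (g j) x - g j x)\<^sup>2)) \<in> borel_measurable lborel" using m[OF H(9)] by simp
      have 2: "(\<lambda>x. ennreal ((g j x)\<^sup>2)) \<in> borel_measurable lborel" using H(4) by simp
      note c = borel_measurable_times_ennreal[OF borel_measurable_const]
      show ?thesis by (simp only: nn_integral_add[OF c[OF 1] c[OF 2]] nn_integral_cmult[OF 1] nn_integral_cmult[OF 2])
    qed
    finally show ?thesis .
  qed
  have lim: "(\<lambda>k. ennreal 18 * ?M k + ennreal (8 * (mdel k)\<^sup>2) * ?G) \<longlonglongrightarrow> 0"
  proof -
    have 1: "(\<lambda>k. ennreal 18 * ?M k) \<longlonglongrightarrow> ennreal 18 * 0"
      by (rule ennreal_tendsto_cmult[OF _ mol_L2_tendsto[OF H(4,6,5)]]) simp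
    have "(\<lambda>k. 8 * (mdel k)\<^sup>2 * (\<integral>x. (g j x)\<^sup>2 \<partial>lborel)) \<longlonglongrightarrow> 8 * 0\<^sup>2 * (\<integral>x. (g j x)\<^sup>2 \<partial>lborel)"
      by (intro tendsto_intros mdel_lim)
    then have "(\<lambda>k. ennreal (8 * (mdel k)\<^sup>2 * (\<integral>x. (g j x)\<^sup>2 \<partial>lborel))) \<longlonglongrightarrow> ennreal (8 * 0\<^sup>2 * (\<integral>x. (g j x)\<^sup>2 \<partial>lborel))"
      by (rule tendsto_ennrealI)
    moreover have "ennreal (8 * (mdel k)\<^sup>2 * (\<integral>x. (g j x)\<^sup>2 \<partial>lborel)) = ennreal (8 * (mdel k)\<^sup>2) * ?G" for k
      unfolding G by (rule ennreal_mult) simp_all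
    ultimately have 2: "(\<lambda>k. ennreal (8 * (mdel k)\<^sup>2) * ?G) \<longlonglongrightarrow> 0" by simp
    show ?thesis using tendsto_add[OF 1 2] by simp
  qed
  show "(\<lambda>k. \<integral>\<^sup>+x. ennreal ((pderiv_at j (mol k v) x - g j x)\<^sup>2) \<partial>LB) \<longlonglongrightarrow> 0"
    by (rule tendsto_sandwich[OF _ _ tendsto_const lim]) (use b in \<open>auto intro!: always_eventually\<close>)
qed

text \<open>|f| \<le> \<eta> + f^2 / \<eta>. On a finite measure space the choice \<eta> = e / (2 V)
  makes the constant cost at most e/2, and the square tends to zero.\<close>

lemma L2_imp_L1_tendsto:
  fixes f :: "nat \<Rightarrow> 'a \<Rightarrow> real"
  assumes fin: "finite_measure M" and m: "\<And>k. f k \<in> borel_measurable M"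
    and l: "(\<lambda>k. \<integral>\<^sup>+x. ennreal ((f k x)\<^sup>2) \<partial>M) \<longlonglongrightarrow> 0"
  shows "(\<lambda>k. \<integral>\<^sup>+x. ennreal \<bar>f k x\<bar> \<partial>M) \<longlonglongrightarrow> 0"
proof (rule order_tendstoI)
  interpret finite_measure M by (rule fin)
  fix a :: ennreal assume a: "0 < a"
  obtain e :: real where e: "0 < e" "ennreal e < a"
  proof (cases "a = top")
    case True
    then show thesis using that[of 1] by simp
  next
    case False
    then obtain r where "a = ennreal r" "0 \<le> r" by (cases a) auto
    then show thesis using that[of "r / 2"] a by (simp add: ennreal_less_iff)
  qed
  define V where "V = measure M (space M) + 1"
  have V: "0 < V" "emeasure M (space M) \<le> ennreal V"
    by (simp_all add: V_def emeasure_eq_measure ennreal_leI add_nonneg_pos)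
  define \<eta> where "\<eta> = e / (2 * V)"
  have \<eta>: "0 < \<eta>" using e V by (simp add: \<eta>_def)
  have "0 < ennreal (e * \<eta> / 2)" using e \<eta> by simp
  then have "eventually (\<lambda>k. (\<integral>\<^sup>+x. ennreal ((f k x)\<^sup>2) \<partial>M) < ennreal (e * \<eta> / 2)) sequentially"
    by (rule order_tendstoD(2)[OF l])
  then show "eventually (\<lambda>k. (\<integral>\<^sup>+x. ennreal \<bar>f k x\<bar> \<partial>M) < a) sequentially"
  proof eventually_elim
    case (elim k)
    have "(\<integral>\<^sup>+x. ennreal \<bar>f k x\<bar> \<partial>M) \<le> (\<integral>\<^sup>+x. ennreal \<eta> + ennreal (1 / \<eta>) * ennreal ((f k x)\<^sup>2) \<partial>M)"
    proof (rule nn_integral_mono)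
      fix x
      have "\<bar>f k x\<bar> \<le> \<eta> + 1 / \<eta> * (f k x)\<^sup>2"
      proof (cases "\<bar>f k x\<bar> \<le> \<eta>")
        case True
        then show ?thesis using \<eta> by (simp add: add_increasing2)
      next
        case False
        then have "\<bar>f k x\<bar> * \<eta> \<le> \<bar>f k x\<bar> * \<bar>f k x\<bar>" by (intro mult_left_mono) simp_all
        then have "\<bar>f k x\<bar> \<le> 1 / \<eta> * (f k x)\<^sup>2" using \<eta> by (simp add: le_divide_eq power2_eq_square)
        then show ?thesis using \<eta> by simp
      qed
      then have "ennreal \<bar>f k x\<bar> \<le> ennreal (\<eta> + 1 / \<eta> * (f k x)\<^sup>2)" by (rule ennreal_leI)
      also have "\<dots> = ennreal \<eta> + ennreal (1 / \<eta> * (f k x)\<^sup>2)" using \<eta> by (intro ennreal_plus) simp_all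
      also have "ennreal (1 / \<eta> * (f k x)\<^sup>2) = ennreal (1 / \<eta>) * ennreal ((f k x)\<^sup>2)" using \<eta> by (intro ennreal_mult) simp_all
      finally show "ennreal \<bar>f k x\<bar> \<le> ennreal \<eta> + ennreal (1 / \<eta>) * ennreal ((f k x)\<^sup>2)" .
    qed
    also have "\<dots> = ennreal \<eta> * emeasure M (space M) + ennreal (1 / \<eta>) * (\<integral>\<^sup>+x. ennreal ((f k x)\<^sup>2) \<partial>M)"
    proof -
      have 1: "(\<lambda>x. ennreal ((f k x)\<^sup>2)) \<in> borel_measurable M" using m[of k] by simp
      show ?thesis
        by (simp only: nn_integral_add[OF borel_measurable_const borel_measurable_times_ennreal[OF borel_measurable_const 1]]
            nn_integral_cmult[OF 1] nn_integral_const)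
    qed
    also have "\<dots> \<le> ennreal \<eta> * ennreal V + ennreal (1 / \<eta>) * ennreal (e * \<eta> / 2)"
      using elim V(2) by (intro add_mono mult_left_mono) simp_all
    also have "\<dots> = ennreal (\<eta> * V + 1 / \<eta> * (e * \<eta> / 2))"
    proof -
      have n: "0 \<le> \<eta>" "0 \<le> V" "0 \<le> 1 / \<eta>" "0 \<le> e * \<eta> / 2" using \<eta> V e by simp_all
      show ?thesis
        by (simp only: ennreal_plus[OF mult_nonneg_nonneg[OF n(1,2)] mult_nonneg_nonneg[OF n(3,4)]]
            ennreal_mult[OF n(1,2)] ennreal_mult[OF n(3,4)])
    qed
    also have "\<eta> * V + 1 / \<eta> * (e * \<eta> / 2) = e" using V(1) \<eta> by (simp add: \<eta>_def)
    finally show ?case using e(2) by (rule le_less_trans)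
  qed
qed simp

lemma L1_pairing_tendsto:
  fixes f :: "nat \<Rightarrow> 'a \<Rightarrow> real"
  assumes m: "\<And>k. integrable M (f k)" and l: "(\<lambda>k. \<integral>\<^sup>+x. ennreal \<bar>f k x\<bar> \<partial>M) \<longlonglongrightarrow> 0"
    and p: "p \<in> borel_measurable M" "\<And>x. \<bar>p x\<bar> \<le> B"
  shows "(\<lambda>k. \<integral>x. f k x * p x \<partial>M) \<longlonglongrightarrow> 0"
proof -
  have e: "(\<integral>\<^sup>+x. ennreal \<bar>f k x\<bar> \<partial>M) = ennreal (\<integral>x. \<bar>f k x\<bar> \<partial>M)" for k
    by (rule nn_integral_eq_integral[OF integrable_abs[OF m]]) simp
  have "(\<lambda>k. ennreal (\<integral>x. \<bar>f k x\<bar> \<partial>M)) \<longlonglongrightarrow> ennreal 0" using l unfolding e by simp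
  then have l': "(\<lambda>k. \<integral>x. \<bar>f k x\<bar> \<partial>M) \<longlonglongrightarrow> 0"
    by (rule tendsto_ennrealD) (intro always_eventually allI integral_nonneg_AE AE_I2 abs_ge_zero order_refl)+
  have b: "norm (\<integral>x. f k x * p x \<partial>M) \<le> \<bar>B\<bar> * (\<integral>x. \<bar>f k x\<bar> \<partial>M)" for k
  proof -
    have "\<bar>\<integral>x. f k x * p x \<partial>M\<bar> \<le> (\<integral>x. \<bar>B\<bar> * \<bar>f k x\<bar> \<partial>M)"
    proof (rule order_trans[OF integral_abs_bound integral_mono])
      show "integrable M (\<lambda>x. \<bar>f k x * p x\<bar>)" by (intro integrable_abs bounded_mult_integrable[OF m p])
      fix x
      have "\<bar>p x\<bar> * \<bar>f k x\<bar> \<le> \<bar>B\<bar> * \<bar>f k x\<bar>"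
        by (rule mult_right_mono[OF order_trans[OF p(2) abs_ge_self]]) simp
      then show "\<bar>f k x * p x\<bar> \<le> \<bar>B\<bar> * \<bar>f k x\<bar>" by (simp add: abs_mult mult.commute)
    qed (use m in simp)
    then show ?thesis by simp
  qed
  have "(\<lambda>k. \<bar>B\<bar> * (\<integral>x. \<bar>f k x\<bar> \<partial>M)) \<longlonglongrightarrow> \<bar>B\<bar> * 0" by (intro tendsto_intros l')
  then have "(\<lambda>k. \<bar>B\<bar> * (\<integral>x. \<bar>f k x\<bar> \<partial>M)) \<longlonglongrightarrow> 0" by simp
  then show ?thesis by (rule Lim_null_comparison[OF always_eventually, rotated]) (rule allI, rule b)
qed

lemma L2_LB_integrable:
  fixes f :: "real^'n::finite \<Rightarrow> real"
  assumes m: "f \<in> borel_measurable LB" and i: "integrable LB (\<lambda>x. (f x)\<^sup>2)"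
  shows "integrable LB f"
proof -
  interpret finite_measure "LB :: (real^'n) measure" by (rule finite_measure_LB)
  show ?thesis
  proof (rule Bochner_Integration.integrable_bound[OF _ m])
    show "integrable LB (\<lambda>x. (f x)\<^sup>2 + 1)" using i by simp
    show "AE x in LB. norm (f x) \<le> norm ((f x)\<^sup>2 + 1)"
    proof (rule AE_I2)
      fix x
      have "\<bar>f x\<bar> \<le> (f x)\<^sup>2 + 1"
        using zero_le_power2[of "\<bar>f x\<bar> - 1"] by (simp add: power2_eq_square algebra_simps)
      then show "norm (f x) \<le> norm ((f x)\<^sup>2 + 1)" by simp
    qed
  qed
qed

subsection \<open>The admissible class\<close>

lemma nn_integral_sphere:
  fixes g :: "real^'n::finite \<Rightarrow> ennreal"
  assumes g: "g \<in> borel_measurable borel"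
  shows "(\<integral>\<^sup>+x. g x \<partial>sphere_measure) = of_nat CARD('n) * (\<integral>\<^sup>+x. g (sgn x) \<partial>LB)"
proof -
  have s: "sgn \<in> measurable (LB :: (real^'n) measure) borel"
    by (rule measurable_restrict_space1, rule measurable_completion) simp
  have "(\<integral>\<^sup>+x. g x \<partial>sphere_measure) = (\<integral>\<^sup>+x. g (sgn x) \<partial>scale_measure (of_nat CARD('n)) LB)"
    unfolding sphere_measure_def
  proof (rule nn_integral_distr)
    show "sgn \<in> measurable (scale_measure (of_nat CARD('n)) (LB :: (real^'n) measure)) borel"
      using s by (simp cong: measurable_cong_sets)
    show "g \<in> borel_measurable (distr (scale_measure (of_nat CARD('n)) LB) borel sgn)" using g by simp
  qed
  also have "\<dots> = of_nat CARD('n) * (\<integral>\<^sup>+x. g (sgn x) \<partial>LB)"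
    by (rule nn_integral_scale_measure) (rule measurable_compose[OF s g])
  finally show ?thesis .
qed

lemma norm_sq_vec: "(norm (x :: real^'n::finite))\<^sup>2 = (\<Sum>i\<in>UNIV. (x $ i)\<^sup>2)"
  unfolding power2_norm_eq_inner inner_vec_def by (simp add: power2_eq_square)

lemma norm_sq_matrix: "(norm (G :: real^'n::finite^'n))\<^sup>2 = (\<Sum>i\<in>UNIV. \<Sum>j\<in>UNIV. (G $ i $ j)\<^sup>2)"
  unfolding power2_norm_eq_inner inner_matrix by (simp add: power2_eq_square)

lemma borel_measurable_vecI:
  fixes U :: "'a \<Rightarrow> real^'n::finite"
  assumes "\<And>i. (\<lambda>x. U x $ i) \<in> borel_measurable M"
  shows "U \<in> borel_measurable M"
  unfolding borel_measurable_euclidean_space[of U]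
  using assms by (auto simp: Basis_vec_def inner_axis)

lemma borel_measurable_matrixI:
  fixes G :: "'a \<Rightarrow> real^'n::finite^'n"
  assumes "\<And>i j. (\<lambda>x. G x $ i $ j) \<in> borel_measurable M"
  shows "G \<in> borel_measurable M"
  unfolding borel_measurable_euclidean_space[of G]
  using assms by (auto simp: Basis_vec_def inner_axis)

text \<open>Splits the norm into finitely many scalar integrals, so that convergence in H^1 can be
  read off component by component.\<close>

lemma H1_norm_sq_eq:
  fixes D :: "real^'n::finite \<Rightarrow> real^'n"
  assumes w: "has_weak_jacobian (ball 0 1) D G"
    and d: "\<And>i. (\<lambda>x. D x $ i) \<in> borel_measurable LB" and g: "\<And>i j. (\<lambda>x. G x $ i $ j) \<in> borel_measurable LB"
  shows "H1_norm_sq (ball 0 1) D = (\<Sum>i\<in>UNIV. \<integral>\<^sup>+x. ennreal ((D x $ i)\<^sup>2) \<partial>LB)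
    + (\<Sum>i\<in>UNIV. \<Sum>j\<in>UNIV. \<integral>\<^sup>+x. ennreal ((G x $ i $ j)\<^sup>2) \<partial>LB)"
proof -
  have d2: "(\<lambda>x. ennreal ((D x $ i)\<^sup>2)) \<in> borel_measurable LB" for i using d[of i] by simp
  have g2: "(\<lambda>x. ennreal ((G x $ i $ j)\<^sup>2)) \<in> borel_measurable LB" for i j using g[of i j] by simp
  have "H1_norm_sq (ball 0 1) D = (\<integral>\<^sup>+x. (\<Sum>i\<in>UNIV. ennreal ((D x $ i)\<^sup>2)) + (\<Sum>i\<in>UNIV. \<Sum>j\<in>UNIV. ennreal ((G x $ i $ j)\<^sup>2)) \<partial>LB)"
    unfolding H1_norm_sq_def
  proof (rule nn_integral_cong_AE)
    show "AE x in LB. ennreal ((norm (D x))\<^sup>2 + (norm (weak_jacobian (ball 0 1) D x))\<^sup>2)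
      = (\<Sum>i\<in>UNIV. ennreal ((D x $ i)\<^sup>2)) + (\<Sum>i\<in>UNIV. \<Sum>j\<in>UNIV. ennreal ((G x $ i $ j)\<^sup>2))"
      using weak_jacobian_AE(2)[OF w]
    proof eventually_elim
      case (elim x)
      have "(\<Sum>i\<in>UNIV. ennreal ((D x $ i)\<^sup>2)) + (\<Sum>i\<in>UNIV. \<Sum>j\<in>UNIV. ennreal ((G x $ i $ j)\<^sup>2))
        = ennreal (\<Sum>i\<in>UNIV. (D x $ i)\<^sup>2) + ennreal (\<Sum>i\<in>UNIV. \<Sum>j\<in>UNIV. (G x $ i $ j)\<^sup>2)"
        by (simp add: sum_ennreal sum_nonneg)
      also have "\<dots> = ennreal ((norm (D x))\<^sup>2 + (norm (G x))\<^sup>2)"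
        unfolding norm_sq_vec[of "D x"] norm_sq_matrix[of "G x"] by (rule ennreal_plus[symmetric]) (simp_all add: sum_nonneg)
      finally show ?case by (simp add: elim)
    qed
  qed
  also have "\<dots> = (\<integral>\<^sup>+x. (\<Sum>i\<in>UNIV. ennreal ((D x $ i)\<^sup>2)) \<partial>LB) + (\<integral>\<^sup>+x. (\<Sum>i\<in>UNIV. \<Sum>j\<in>UNIV. ennreal ((G x $ i $ j)\<^sup>2)) \<partial>LB)"
    by (rule nn_integral_add) (intro borel_measurable_sum d2 g2)+
  also have "(\<integral>\<^sup>+x. (\<Sum>i\<in>UNIV. ennreal ((D x $ i)\<^sup>2)) \<partial>LB) = (\<Sum>i\<in>UNIV. \<integral>\<^sup>+x. ennreal ((D x $ i)\<^sup>2) \<partial>LB)"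
    by (rule nn_integral_sum) (rule d2)
  also have "(\<integral>\<^sup>+x. (\<Sum>i\<in>UNIV. \<Sum>j\<in>UNIV. ennreal ((G x $ i $ j)\<^sup>2)) \<partial>LB) = (\<Sum>i\<in>UNIV. \<Sum>j\<in>UNIV. \<integral>\<^sup>+x. ennreal ((G x $ i $ j)\<^sup>2) \<partial>LB)"
    by (subst nn_integral_sum, intro borel_measurable_sum g2, subst nn_integral_sum, rule g2, rule refl)
  finally show ?thesis .
qed

text \<open>Provides the Borel representatives, zero outside the ball, that \<open>h10\<close> and
  convolution work with.\<close>

lemma LB_borel_rep:
  fixes f :: "real^'n::finite \<Rightarrow> real"
  assumes "f \<in> borel_measurable LB"
  obtains f' where "f' \<in> borel_measurable borel" "\<And>x. 1 \<le> norm x \<Longrightarrow> f' x = 0" "AE x in LB. f x = f' x"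
proof -
  have "(\<lambda>x. if x \<in> ball 0 1 then f x else 0) \<in> borel_measurable lebesgue"
    using assms by (subst borel_measurable_if) simp_all
  then obtain g where g: "g \<in> borel_measurable lborel" "AE x in lborel. (if x \<in> ball 0 1 then f x else 0) = g x"
    using completion_ex_borel_measurable_real by blast
  show thesis
  proof
    show "(\<lambda>x. indicator (ball 0 1) x *\<^sub>R g x) \<in> borel_measurable borel"
      by (rule borel_measurable_scaleR[OF borel_measurable_indicator]) (use g in simp_all)
    show "indicator (ball 0 1) x *\<^sub>R g x = 0" if "1 \<le> norm x" for x using that by simp
    show "AE x in LB. f x = indicator (ball 0 1) x *\<^sub>R g x"
      using ae_LB_lborel[OF g(2)] AE_space by eventually_elim simp
  qed
qed

lemma weak_pderiv_cong:
  fixes u v g h :: "real^'n::finite \<Rightarrow> real"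
  assumes w: "has_weak_pderiv (ball 0 1) j u g" and u: "\<And>x. x \<in> ball 0 1 \<Longrightarrow> u x = v x" and g: "\<And>x. x \<in> ball 0 1 \<Longrightarrow> g x = h x"
  shows "has_weak_pderiv (ball 0 1) j v h"
proof -
  have l: "locally_integrable (ball 0 1) b" if "locally_integrable (ball 0 1) a" "\<And>x. x \<in> ball 0 1 \<Longrightarrow> a x = b x" for a b :: "real^'n \<Rightarrow> real"
    unfolding locally_integrable_def
  proof (intro allI impI)
    fix K :: "(real^'n) set" assume K: "compact K \<and> K \<subseteq> ball 0 1"
    have "set_integrable lebesgue K a" using that(1) K unfolding locally_integrable_def by blast
    moreover have "(\<lambda>x. indicator K x *\<^sub>R a x) = (\<lambda>x. indicator K x *\<^sub>R b x)"
      using K that(2) by (auto simp: fun_eq_iff indicator_def)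
    ultimately show "set_integrable lebesgue K b" unfolding set_integrable_def by simp
  qed
  have i: "(\<integral>x. u x * p x \<partial>LB) = (\<integral>x. v x * p x \<partial>LB)" "(\<integral>x. g x * p x \<partial>LB) = (\<integral>x. h x * p x \<partial>LB)" for p :: "real^'n \<Rightarrow> real"
    by (rule Bochner_Integration.integral_cong, simp_all add: u g)+
  have w': "locally_integrable (ball 0 1) u" "locally_integrable (ball 0 1) g"
    "\<And>\<phi>. test_function (ball 0 1) \<phi> \<Longrightarrow> (\<integral>x. u x * pderiv_at j \<phi> x \<partial>LB) = - (\<integral>x. g x * \<phi> x \<partial>LB)"
    using w unfolding weak_pderiv_iff by blast+
  show ?thesis
    unfolding weak_pderiv_iff
  proof (intro conjI allI impI)
    show "locally_integrable (ball 0 1) v" by (rule l[OF w'(1) u])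
    show "locally_integrable (ball 0 1) h" by (rule l[OF w'(2) g])
    show "(\<integral>x. v x * pderiv_at j \<phi> x \<partial>LB) = - (\<integral>x. h x * \<phi> x \<partial>LB)" if "test_function (ball 0 1) \<phi>" for \<phi>
      using w'(3)[OF that] by (simp only: i(1)[of "pderiv_at j \<phi>"] i(2)[of \<phi>])
  qed
qed

lemma weak_pderiv_add:
  fixes u v g h :: "real^'n::finite \<Rightarrow> real"
  assumes u: "has_weak_pderiv (ball 0 1) j u g" and v: "has_weak_pderiv (ball 0 1) j v h"
  shows "has_weak_pderiv (ball 0 1) j (\<lambda>x. u x + v x) (\<lambda>x. g x + h x)"
proof -
  have "has_weak_pderiv (ball 0 1) j (\<lambda>x. u x - (u x - u x - v x)) (\<lambda>x. g x - (g x - g x - h x))"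
    by (intro weak_pderiv_diff assms)
  then show ?thesis by simp
qed

lemma weak_pderiv_smooth:
  fixes \<phi> :: "real^'n::finite \<Rightarrow> real"
  assumes N: "3 \<le> CARD('n)" and s: "smooth \<phi>"
  shows "has_weak_pderiv (ball 0 1) j \<phi> (pderiv_at j \<phi>)" "integrable LB \<phi>"
  using weak_pderiv_sing[OF N sing_smooth[OF s] smooth_cont[OF s]] by (simp_all add: sum_axis)

lemma weak_pderiv_h10:
  fixes v :: "real^'n::finite \<Rightarrow> real"
  assumes "h10 v g"
  shows "has_weak_pderiv (ball 0 1) j v (g j)"
proof -
  note H = h10D[OF assms]
  have i: "integrable LB v" "integrable LB (g j)"
    using LB_zero_ext(2)[OF H(1,2)] LB_zero_ext(2)[OF H(4,5)] H(8,9) by simp_all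
  show ?thesis
    unfolding weak_pderiv_iff
  proof (intro conjI allI impI locally_integrable_LB i)
    fix \<phi> :: "real^'n \<Rightarrow> real" assume "test_function (ball 0 1) \<phi>"
    then have C: "Cc \<phi>" by (rule test_ballE)
    have m: "\<phi> \<in> borel_measurable borel" "pderiv_at j \<phi> \<in> borel_measurable borel"
      using smooth_borel[OF Cc_smooth[OF C]] smooth_borel[OF Cc_smooth[OF Cc_pderiv[OF C]]] by simp_all
    have "(\<integral>x. v x * pderiv_at j \<phi> x \<partial>LB) = (\<integral>x. v x * pderiv_at j \<phi> x \<partial>lborel)"
      by (rule LB_zero_ext(1)) (use H m in simp_all)
    moreover have "(\<integral>x. g j x * \<phi> x \<partial>LB) = (\<integral>x. g j x * \<phi> x \<partial>lborel)"
      by (rule LB_zero_ext(1)) (use H m in simp_all)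
    ultimately show "(\<integral>x. v x * pderiv_at j \<phi> x \<partial>LB) = - (\<integral>x. g j x * \<phi> x \<partial>LB)"
      using H(7)[of j] C unfolding weak_pd_def by simp
  qed
qed

section \<open>Admissible fields as the identity plus a field with zero boundary values\<close>

lemma L2_component:
  fixes U :: "real^'n::finite \<Rightarrow> real^'n"
  assumes "L2 (ball 0 1) U"
  shows "(\<lambda>x. U x $ i) \<in> borel_measurable LB" "integrable LB (\<lambda>x. (U x $ i)\<^sup>2)"
proof -
  have U: "U \<in> borel_measurable LB" "integrable LB (\<lambda>x. (norm (U x))\<^sup>2)" using assms by (simp_all add: L2_def)
  show m: "(\<lambda>x. U x $ i) \<in> borel_measurable LB"
    by (rule measurable_compose[OF U(1) smooth_borel[OF smooth_coord]])
  show "integrable LB (\<lambda>x. (U x $ i)\<^sup>2)"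
    by (rule Bochner_Integration.integrable_bound[OF U(2)])
       (use m in \<open>auto intro!: component_le_norm_cart power_mono simp: abs_le_square_iff[symmetric]\<close>)
qed

lemma L2_matrix_component:
  fixes G :: "real^'n::finite \<Rightarrow> real^'n^'n"
  assumes "L2 (ball 0 1) G"
  shows "(\<lambda>x. G x $ i $ j) \<in> borel_measurable LB" "integrable LB (\<lambda>x. (G x $ i $ j)\<^sup>2)"
proof -
  have U: "G \<in> borel_measurable LB" "integrable LB (\<lambda>x. (norm (G x))\<^sup>2)" using assms by (simp_all add: L2_def)
  have c: "continuous_on UNIV (\<lambda>A::real^'n^'n. A $ i $ j)" by (intro continuous_intros)
  show m: "(\<lambda>x. G x $ i $ j) \<in> borel_measurable LB"
    using measurable_compose[OF U(1) borel_measurable_continuous_onI[OF c]] by simp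
  show "integrable LB (\<lambda>x. (G x $ i $ j)\<^sup>2)"
  proof (rule Bochner_Integration.integrable_bound[OF U(2)])
    have "\<bar>A $ i $ j\<bar> \<le> norm A" for A :: "real^'n^'n"
      using component_le_norm_cart[of "A $ i" j] Finite_Cartesian_Product.norm_nth_le[of A i] by linarith
    then show "AE x in LB. norm ((G x $ i $ j)\<^sup>2) \<le> norm ((norm (G x))\<^sup>2)"
      by (auto simp: abs_le_square_iff[symmetric])
  qed (use m in simp)
qed

text \<open>The approximating fields for \<open>has_trace\<close> are x plus the mollifications of
  \<open>v\<close>. The dilation makes them equal to x on the sphere, so the boundary integral is
  zero for each of them.\<close>

lemma A_GL_I:
  fixes U :: "real^'n::finite \<Rightarrow> real^'n"
  assumes N: "3 \<le> CARD('n)" and h: "\<And>i. h10 (v i) (g i)"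
    and U: "\<And>x i. x \<in> ball 0 1 \<Longrightarrow> U x $ i = x $ i + v i x"
  shows "U \<in> A_GL" "has_weak_jacobian (ball 0 1) U (\<lambda>x. \<chi> i j. (if i = j then 1 else 0) + g i j x)"
proof -
  define G where "G x = (\<chi> i j. (if i = j then 1 else 0) + g i j x)" for x
  note H = h10D[OF h]
  have hLB: "(\<lambda>x. x $ i) \<in> borel_measurable LB" "v i \<in> borel_measurable LB" "g i j \<in> borel_measurable LB" for i j
    using smooth_LB[OF smooth_coord[of i]] borel_LB[OF H(1)] borel_LB[OF H(4)] by simp_all
  have sq: "integrable LB (\<lambda>x. (x $ i)\<^sup>2)" "integrable LB (\<lambda>x. (v i x)\<^sup>2)" "integrable LB (\<lambda>x. (g i j x)\<^sup>2)" for i j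
  proof -
    show "integrable LB (\<lambda>x::real^'n. (x $ i)\<^sup>2)"
      using weak_pderiv_smooth(2)[OF N smooth_mult[OF smooth_coord[of i] smooth_coord[of i]]] by (simp add: power2_eq_square)
    show "integrable LB (\<lambda>x. (v i x)\<^sup>2)" by (subst LB_zero_ext(2)) (use H in simp_all)
    show "integrable LB (\<lambda>x. (g i j x)\<^sup>2)" by (subst LB_zero_ext(2)) (use H in simp_all)
  qed
  show w: "has_weak_jacobian (ball 0 1) U (\<lambda>x. \<chi> i j. (if i = j then 1 else 0) + g i j x)"
    unfolding has_weak_jacobian_def has_weak_gradient_def
  proof (intro allI)
    fix i j
    show "has_weak_pderiv (ball 0 1) j (\<lambda>x. U x $ i) (\<lambda>x. (\<chi> i j. (if i = j then 1 else 0) + g i j x) $ i $ j)"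
      by (rule weak_pderiv_cong[OF weak_pderiv_add[OF weak_pderiv_smooth(1)[OF N smooth_coord[of i]] weak_pderiv_h10[OF h[of i]]]])
         (simp_all add: U pderiv_coord)
  qed
  have Um: "(\<lambda>x. U x $ i) \<in> borel_measurable LB" for i
  proof -
    have "(\<lambda>x. x $ i + v i x) \<in> borel_measurable LB" using hLB by simp
    then show ?thesis by (rule measurable_cong[THEN iffD1, rotated]) (simp add: U)
  qed
  have Gm: "(\<lambda>x. G x $ i $ j) \<in> borel_measurable LB" for i j unfolding G_def using hLB by simp
  have U2: "integrable LB (\<lambda>x. (U x $ i)\<^sup>2)" for i
  proof -
    have "integrable LB (\<lambda>x. (x $ i - - v i x)\<^sup>2)"
      by (rule integrable_sq_diff) (use hLB sq in simp_all)
    then show ?thesis by (rule Bochner_Integration.integrable_cong[THEN iffD1, rotated -1]) (simp_all add: U)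
  qed
  have G2: "integrable LB (\<lambda>x. (G x $ i $ j)\<^sup>2)" for i j
  proof -
    interpret finite_measure "LB :: (real^'n) measure" by (rule finite_measure_LB)
    have "integrable LB (\<lambda>x. ((if i = j then 1 else 0) - - g i j x)\<^sup>2)"
      by (rule integrable_sq_diff) (use hLB sq in simp_all)
    then show ?thesis by (simp add: G_def)
  qed
  have L: "L2 (ball 0 1) U" "L2 (ball 0 1) G"
    unfolding L2_def norm_sq_vec norm_sq_matrix
    using borel_measurable_vecI[OF Um] borel_measurable_matrixI[OF Gm] U2 G2 by simp_all
  have H1: "H1 (ball 0 1) U" unfolding H1_def using L w unfolding G_def by blast
  define P where "P k x = (\<chi> i. x $ i + mol k (v i) x)" for k x
  have Ps: "smooth (\<lambda>x. P k x $ i)" for k i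
    unfolding P_def using smooth_add[OF smooth_coord[of i] Cc_smooth[OF mol_Cc[OF H(8,2)]]] by simp
  have D: "has_weak_jacobian (ball 0 1) (\<lambda>x. P k x - U x) (\<lambda>x. \<chi> i j. pderiv_at j (mol k (v i)) x - g i j x)" for k
    unfolding has_weak_jacobian_def has_weak_gradient_def
  proof (intro allI)
    fix i j
    show "has_weak_pderiv (ball 0 1) j (\<lambda>x. (P k x - U x) $ i) (\<lambda>x. (\<chi> i j. pderiv_at j (mol k (v i)) x - g i j x) $ i $ j)"
      by (rule weak_pderiv_cong[OF weak_pderiv_diff[OF weak_pderiv_smooth(1)[OF N Cc_smooth[OF mol_Cc[OF H(8,2)]]] weak_pderiv_h10[OF h[of i]]]])
         (simp_all add: U P_def)
  qed
  have e: "H1_norm_sq (ball 0 1) (\<lambda>x. P k x - U x) = (\<Sum>i\<in>UNIV. \<integral>\<^sup>+x. ennreal ((mol k (v i) x - v i x)\<^sup>2) \<partial>LB)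
    + (\<Sum>i\<in>UNIV. \<Sum>j\<in>UNIV. \<integral>\<^sup>+x. ennreal ((pderiv_at j (mol k (v i)) x - g i j x)\<^sup>2) \<partial>LB)" for k
  proof -
    have "(\<lambda>x. (P k x - U x) $ i) \<in> borel_measurable LB" for i
      using borel_measurable_diff[OF smooth_LB[OF Ps[of k i]] Um[of i]] by simp
    moreover have "(\<lambda>x. (\<chi> i j. pderiv_at j (mol k (v i)) x - g i j x) $ i $ j) \<in> borel_measurable LB" for i j
      using borel_measurable_diff[OF smooth_LB[OF smooth_pderiv[OF Cc_smooth[OF mol_Cc[OF H(8,2)]]]] hLB(3)[of i j], of j k i] by simp
    moreover have "(\<integral>\<^sup>+x. ennreal (((P k x - U x) $ i)\<^sup>2) \<partial>LB) = (\<integral>\<^sup>+x. ennreal ((mol k (v i) x - v i x)\<^sup>2) \<partial>LB)" for i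
      by (rule nn_integral_cong) (simp add: P_def U)
    ultimately show ?thesis by (subst H1_norm_sq_eq[OF D]) simp_all
  qed
  have l1: "(\<lambda>k. H1_norm_sq (ball 0 1) (\<lambda>x. P k x - U x)) \<longlonglongrightarrow> 0"
  proof -
    have "(\<lambda>k. (\<Sum>i\<in>UNIV. \<integral>\<^sup>+x. ennreal ((mol k (v i) x - v i x)\<^sup>2) \<partial>LB)
      + (\<Sum>i\<in>UNIV. \<Sum>j\<in>UNIV. \<integral>\<^sup>+x. ennreal ((pderiv_at j (mol k (v i)) x - g i j x)\<^sup>2) \<partial>LB))
      \<longlonglongrightarrow> (\<Sum>i\<in>(UNIV::'n set). 0) + (\<Sum>i\<in>(UNIV::'n set). \<Sum>j\<in>(UNIV::'n set). 0)"
      by (intro tendsto_add tendsto_sum mol_pderiv_tendsto[OF h])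
    then show ?thesis unfolding e by simp
  qed
  have l2: "(\<integral>\<^sup>+x. ennreal ((norm (P k x - x))\<^sup>2) \<partial>sphere_measure) = 0" for k
  proof -
    have "P k \<in> borel_measurable borel" by (rule borel_measurable_vecI[OF smooth_borel[OF Ps]])
    then have m: "(\<lambda>x. ennreal ((norm (P k x - x))\<^sup>2)) \<in> borel_measurable borel" by measurable
    have "(\<integral>\<^sup>+x. ennreal ((norm (P k (sgn x) - sgn x))\<^sup>2) \<partial>LB) = (\<integral>\<^sup>+x. 0 \<partial>(LB :: (real^'n) measure))"
    proof (rule nn_integral_cong_AE, rule LB_I)
      fix x :: "real^'n" assume "x \<noteq> 0"
      then have "mrho k \<le> norm (sgn x)" using mrho(2)[of k] by (simp add: norm_sgn)
      then have "mol k (v i) (sgn x) = 0" for i by (intro mol_zero H(2))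
      then have "P k (sgn x) = sgn x" by (simp add: P_def vec_eq_iff)
      then show "ennreal ((norm (P k (sgn x) - sgn x))\<^sup>2) = 0" by simp
    qed
    then show ?thesis unfolding nn_integral_sphere[OF m] by simp
  qed
  have "has_trace U (\<lambda>x. x)" unfolding has_trace_def
    using H1 Ps l1 l2 by (intro conjI exI[of _ P]) simp_all
  then show "U \<in> A_GL" using H1 by (simp add: A_GL_def)
qed

lemma nn_tendsto_le:
  fixes a b :: "nat \<Rightarrow> ennreal"
  assumes "\<And>k. a k \<le> b k" "b \<longlonglongrightarrow> 0" shows "a \<longlonglongrightarrow> 0"
  by (rule tendsto_sandwich[OF _ _ tendsto_const assms(2)]) (use assms(1) in \<open>auto intro!: always_eventually\<close>)

text \<open>The trace condition becomes a weak derivative of the zero extension. For the smooth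
  approximations \<open>P k\<close> of \<open>U\<close>, the divergence bound for a component of P -
  x times \<phi> is a multiple of the L1 distance of \<open>P k\<close> and x on the sphere. In the
  limit no boundary term is left, although \<phi> need not vanish there.\<close>

lemma A_GL_E:
  fixes U :: "real^'n::finite \<Rightarrow> real^'n"
  assumes N: "3 \<le> CARD('n)" and U: "U \<in> A_GL"
  obtains v g where "\<And>i. h10 (v i) (g i)" "AE x in LB. \<forall>i. U x $ i = x $ i + v i x"
    "AE x in LB. \<forall>i j. weak_jacobian (ball 0 1) U x $ i $ j = (if i = j then 1 else 0) + g i j x"
    "has_weak_jacobian (ball 0 1) U (weak_jacobian (ball 0 1) U)" "U \<in> borel_measurable LB"
proof -
  have T: "H1 (ball 0 1) U" "has_trace U (\<lambda>x. x)" using U by (simp_all add: A_GL_def)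
  then obtain G where G: "has_weak_jacobian (ball 0 1) U G" "L2 (ball 0 1) G" and UL: "L2 (ball 0 1) U"
    by (auto simp: H1_def)
  obtain P where Ps: "\<And>k i. smooth (\<lambda>x. P k x $ i)"
    and P1: "(\<lambda>k. H1_norm_sq (ball 0 1) (\<lambda>x. P k x - U x)) \<longlonglongrightarrow> 0"
    and P2: "(\<lambda>k. \<integral>\<^sup>+x. ennreal ((norm (P k x - x))\<^sup>2) \<partial>sphere_measure) \<longlonglongrightarrow> 0"
    using T(2) unfolding has_trace_def by blast
  interpret finite_measure "LB :: (real^'n) measure" by (rule finite_measure_LB)
  note Uc = L2_component[OF UL] and Gc = L2_matrix_component[OF G(2)]
  let ?d = "\<lambda>i j. if i = j then 1 else 0 :: real"
  have xm: "(\<lambda>x::real^'n. x $ i) \<in> borel_measurable LB" for i by (rule smooth_LB[OF smooth_coord])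
  have x2: "integrable LB (\<lambda>x::real^'n. (x $ i)\<^sup>2)" for i
    using weak_pderiv_smooth(2)[OF N smooth_mult[OF smooth_coord[of i] smooth_coord[of i]]] by (simp add: power2_eq_square)
  have am: "(\<lambda>x. U x $ i - x $ i) \<in> borel_measurable LB" "(\<lambda>x. G x $ i $ j - ?d i j) \<in> borel_measurable LB" for i j
    using Uc(1) xm Gc(1) by simp_all
  have a2: "integrable LB (\<lambda>x. (U x $ i - x $ i)\<^sup>2)" for i
    by (rule integrable_sq_diff[OF Uc(1) xm Uc(2) x2])
  have b2: "integrable LB (\<lambda>x. (G x $ i $ j - ?d i j)\<^sup>2)" for i j
    by (rule integrable_sq_diff[OF Gc(1) _ Gc(2)]) simp_all
  have "\<forall>i. \<exists>f'. f' \<in> borel_measurable borel \<and> (\<forall>x. 1 \<le> norm x \<longrightarrow> f' x = 0) \<and> (AE x in LB. U x $ i - x $ i = f' x)"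
  proof
    fix i show "\<exists>f'. f' \<in> borel_measurable borel \<and> (\<forall>x. 1 \<le> norm x \<longrightarrow> f' x = 0) \<and> (AE x in LB. U x $ i - x $ i = f' x)"
      by (rule LB_borel_rep[OF am(1)[of i]]) blast
  qed
  from choice[OF this] obtain v where vv: "\<forall>i. v i \<in> borel_measurable borel \<and> (\<forall>x. 1 \<le> norm x \<longrightarrow> v i x = 0) \<and> (AE x in LB. U x $ i - x $ i = v i x)" ..
  have v: "v i \<in> borel_measurable borel" "1 \<le> norm x \<Longrightarrow> v i x = 0" "AE x in LB. U x $ i - x $ i = v i x" for i x
    using spec[OF vv, of i] by blast+
  have "\<forall>p. \<exists>f'. f' \<in> borel_measurable borel \<and> (\<forall>x. 1 \<le> norm x \<longrightarrow> f' x = 0) \<and>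
      (AE x in LB. G x $ fst p $ snd p - ?d (fst p) (snd p) = f' x)"
  proof
    fix p :: "'n \<times> 'n"
    show "\<exists>f'. f' \<in> borel_measurable borel \<and> (\<forall>x. 1 \<le> norm x \<longrightarrow> f' x = 0) \<and>
      (AE x in LB. G x $ fst p $ snd p - ?d (fst p) (snd p) = f' x)"
      by (rule LB_borel_rep[OF am(2)[of "fst p" "snd p"]]) blast
  qed
  from choice[OF this] obtain g' where gg: "\<forall>p. g' p \<in> borel_measurable borel \<and> (\<forall>x. 1 \<le> norm x \<longrightarrow> g' p x = 0) \<and>
      (AE x in LB. G x $ fst p $ snd p - ?d (fst p) (snd p) = g' p x)" ..
  define g where "g i j = g' (i, j)" for i j
  have g: "g i j \<in> borel_measurable borel" "1 \<le> norm x \<Longrightarrow> g i j x = 0" "AE x in LB. G x $ i $ j - ?d i j = g i j x" for i j x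
    using spec[OF gg, of "(i, j)"] unfolding g_def fst_conv snd_conv by blast+
  have vLB: "v i \<in> borel_measurable LB" "g i j \<in> borel_measurable LB" for i j
    using borel_LB v(1) g(1) by blast+
  have v2: "integrable LB (\<lambda>x. (v i x)\<^sup>2)" for i
    by (rule Bochner_Integration.integrable_cong_AE_imp[OF a2[of i]]) (use vLB(1)[of i] v(3)[of i] in \<open>auto elim: eventually_mono\<close>)
  have g2: "integrable LB (\<lambda>x. (g i j x)\<^sup>2)" for i j
    by (rule Bochner_Integration.integrable_cong_AE_imp[OF b2[of i j]]) (use vLB(2)[of i j] g(3)[of i j] in \<open>auto elim: eventually_mono\<close>)
  have e: "H1_norm_sq (ball 0 1) (\<lambda>x. P k x - U x) = (\<Sum>i\<in>UNIV. \<integral>\<^sup>+x. ennreal ((P k x $ i - U x $ i)\<^sup>2) \<partial>LB)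
    + (\<Sum>i\<in>UNIV. \<Sum>j\<in>UNIV. \<integral>\<^sup>+x. ennreal ((pderiv_at j (\<lambda>x. P k x $ i) x - G x $ i $ j)\<^sup>2) \<partial>LB)" for k
  proof -
    have D: "has_weak_jacobian (ball 0 1) (\<lambda>x. P k x - U x) (\<lambda>x. \<chi> i j. pderiv_at j (\<lambda>x. P k x $ i) x - G x $ i $ j)"
      unfolding has_weak_jacobian_def has_weak_gradient_def
    proof (intro allI)
      fix i j
      have "has_weak_pderiv (ball 0 1) j (\<lambda>x. U x $ i) (\<lambda>x. G x $ i $ j)"
        using G(1) by (simp add: has_weak_jacobian_def has_weak_gradient_def)
      from weak_pderiv_diff[OF weak_pderiv_smooth(1)[OF N Ps] this]
      show "has_weak_pderiv (ball 0 1) j (\<lambda>x. (P k x - U x) $ i) (\<lambda>x. (\<chi> i j. pderiv_at j (\<lambda>x. P k x $ i) x - G x $ i $ j) $ i $ j)"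
        by simp
    qed
    have "(\<lambda>x. (P k x - U x) $ i) \<in> borel_measurable LB" for i
      using borel_measurable_diff[OF smooth_LB[OF Ps[of k i]] Uc(1)[of i]] by simp
    moreover have "(\<lambda>x. (\<chi> i j. pderiv_at j (\<lambda>x. P k x $ i) x - G x $ i $ j) $ i $ j) \<in> borel_measurable LB" for i j
      using borel_measurable_diff[OF smooth_LB[OF smooth_pderiv[OF Ps[of k i]]] Gc(1)[of i j], of j] by simp
    ultimately show ?thesis by (subst H1_norm_sq_eq[OF D]) simp_all
  qed
  have lU: "(\<lambda>k. \<integral>\<^sup>+x. ennreal ((P k x $ i - U x $ i)\<^sup>2) \<partial>LB) \<longlonglongrightarrow> 0" for i
  proof (rule nn_tendsto_le[OF _ P1])
    fix k
    have "(\<integral>\<^sup>+x. ennreal ((P k x $ i - U x $ i)\<^sup>2) \<partial>LB) \<le> (\<Sum>i\<in>UNIV. \<integral>\<^sup>+x. ennreal ((P k x $ i - U x $ i)\<^sup>2) \<partial>LB)"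
      by (rule member_le_sum) simp_all
    then show "(\<integral>\<^sup>+x. ennreal ((P k x $ i - U x $ i)\<^sup>2) \<partial>LB) \<le> H1_norm_sq (ball 0 1) (\<lambda>x. P k x - U x)"
      unfolding e by (rule order_trans) simp
  qed
  have lG: "(\<lambda>k. \<integral>\<^sup>+x. ennreal ((pderiv_at j (\<lambda>x. P k x $ i) x - G x $ i $ j)\<^sup>2) \<partial>LB) \<longlonglongrightarrow> 0" for i j
  proof (rule nn_tendsto_le[OF _ P1])
    fix k
    let ?I = "\<lambda>i j. \<integral>\<^sup>+x. ennreal ((pderiv_at j (\<lambda>x. P k x $ i) x - G x $ i $ j)\<^sup>2) \<partial>LB"
    have "?I i j \<le> (\<Sum>j\<in>UNIV. ?I i j)" by (rule member_le_sum) simp_all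
    also have "\<dots> \<le> (\<Sum>i\<in>UNIV. \<Sum>j\<in>UNIV. ?I i j)" by (rule member_le_sum[of i UNIV "\<lambda>i. \<Sum>j\<in>UNIV. ?I i j"]) simp_all
    finally show "?I i j \<le> H1_norm_sq (ball 0 1) (\<lambda>x. P k x - U x)"
      unfolding e by (rule order_trans) simp
  qed
  \<comment> \<open>By \<open>nn_integral_sphere\<close> the sphere integral of
    \<open>has_trace\<close> is a cone integral; its L1 form is the one that the divergence bound
    produces.\<close>
  have lS: "(\<lambda>k. \<integral>x. \<bar>P k (sgn x) $ i - sgn x $ i\<bar> \<partial>LB) \<longlonglongrightarrow> 0" (is ?A)
    and iS: "integrable LB (\<lambda>x. \<bar>P k (sgn x) $ i - sgn x $ i\<bar>)" (is ?B) for i k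
  proof -
    have Pb: "P k \<in> borel_measurable borel" for k by (rule borel_measurable_vecI[OF smooth_borel[OF Ps]])
    let ?p = "\<lambda>k x. P k (sgn x) $ i - sgn x $ i"
    have pm: "?p k \<in> borel_measurable LB" for k
    proof (rule borel_LB)
      have "(\<lambda>x. P k x $ i - x $ i) \<in> borel_measurable borel" by (rule smooth_borel[OF smooth_diff[OF Ps smooth_coord]])
      then show "?p k \<in> borel_measurable borel" by (rule measurable_compose[OF borel_measurable_sgn])
    qed
    have pi: "integrable LB (?p k)" for k
    proof -
      have "bounded ((\<lambda>x. P k x $ i - x $ i) ` cball 0 1)"
        by (intro compact_imp_bounded compact_continuous_image smooth_cont[OF smooth_diff[OF Ps smooth_coord]]) simp
      from this[unfolded bounded_iff]
      obtain B where B: "\<forall>y\<in>(\<lambda>x. P k x $ i - x $ i) ` cball 0 1. norm y \<le> B" ..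
      have sx: "sgn x \<in> cball 0 1" for x :: "real^'n" by (simp add: norm_sgn)
      have B': "norm (?p k x) \<le> B" for x using bspec[OF B imageI[OF sx[of x]]] .
      show ?thesis by (rule integrable_const_bound[where B = B, OF AE_I2 pm]) (rule B')
    qed
    show ?B using pi[of k] by (rule integrable_abs)
    have l2: "(\<lambda>k. \<integral>\<^sup>+x. ennreal ((?p k x)\<^sup>2) \<partial>LB) \<longlonglongrightarrow> 0"
    proof (rule nn_tendsto_le[OF _ P2])
      fix k
      have m: "(\<lambda>x. ennreal ((norm (P k x - x))\<^sup>2)) \<in> borel_measurable borel" using Pb[of k] by measurable
      have "(\<integral>\<^sup>+x. ennreal ((?p k x)\<^sup>2) \<partial>LB) \<le> (\<integral>\<^sup>+x. ennreal ((norm (P k (sgn x) - sgn x))\<^sup>2) \<partial>LB)"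
      proof (intro nn_integral_mono ennreal_leI)
        fix x :: "real^'n"
        have "\<bar>(P k (sgn x) - sgn x) $ i\<bar> \<le> norm (P k (sgn x) - sgn x)" by (rule component_le_norm_cart)
        then show "(?p k x)\<^sup>2 \<le> (norm (P k (sgn x) - sgn x))\<^sup>2" by (simp add: abs_le_square_iff[symmetric])
      qed
      also have "\<dots> \<le> of_nat CARD('n) * (\<integral>\<^sup>+x. ennreal ((norm (P k (sgn x) - sgn x))\<^sup>2) \<partial>LB)"
      proof -
        have "(1::ennreal) \<le> of_nat CARD('n)" using N by (metis le_trans numeral_le_iff of_nat_1 of_nat_mono one_le_numeral)
        then show ?thesis using mult_right_mono[of 1 "of_nat CARD('n) :: ennreal"] by fastforce
      qed
      finally show "(\<integral>\<^sup>+x. ennreal ((?p k x)\<^sup>2) \<partial>LB) \<le> (\<integral>\<^sup>+x. ennreal ((norm (P k x - x))\<^sup>2) \<partial>sphere_measure)"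
        unfolding nn_integral_sphere[OF m] .
    qed
    have l1: "(\<lambda>k. \<integral>\<^sup>+x. ennreal \<bar>?p k x\<bar> \<partial>LB) \<longlonglongrightarrow> 0" by (rule L2_imp_L1_tendsto[OF finite_measure_LB pm l2])
    have l1': "(\<lambda>k. \<integral>\<^sup>+x. ennreal \<bar>\<bar>?p k x\<bar>\<bar> \<partial>LB) \<longlonglongrightarrow> 0" using l1 by simp
    have "(\<lambda>k. \<integral>x. \<bar>?p k x\<bar> * 1 \<partial>LB) \<longlonglongrightarrow> 0"
      by (rule L1_pairing_tendsto[where B = 1, OF integrable_abs[OF pi] l1']) simp_all
    then show ?A by simp
  qed
  have wpd: "weak_pd j (v i) (g i j)" for i j
    unfolding weak_pd_def
  proof (intro allI impI)
    fix \<phi> :: "real^'n \<Rightarrow> real" assume C: "Cc \<phi>"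
    note s = Cc_smooth[OF C] and s' = Cc_smooth[OF Cc_pderiv[OF C]]
    obtain B where B: "\<And>x. \<bar>\<phi> x\<bar> \<le> B" by (rule Cc_bounded[OF C]) blast
    obtain B' where B': "\<And>x. \<bar>pderiv_at j \<phi> x\<bar> \<le> B'" by (rule Cc_bounded[OF Cc_pderiv[OF C]]) blast
    define p where "p k x = P k x $ i - x $ i" for k x
    have ps: "smooth (p k)" for k unfolding p_def[abs_def] by (rule smooth_diff[OF Ps smooth_coord])
    define R where "R k x = p k x * pderiv_at j \<phi> x + pderiv_at j (p k) x * \<phi> x" for k x
    have pd: "pderiv_at j (p k) x = pderiv_at j (\<lambda>x. P k x $ i) x - ?d i j" for k x
      unfolding p_def[abs_def]
      by (subst pderiv_diff[OF smooth_differentiable[OF Ps] smooth_differentiable[OF smooth_coord]]) (simp add: pderiv_coord)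
    have div: "\<bar>\<integral>x. R k x \<partial>LB\<bar> \<le> 2 * CARD('n) * B * (\<integral>x. \<bar>P k (sgn x) $ i - sgn x $ i\<bar> \<partial>LB)" for k
    proof -
      have f: "(\<lambda>x h. p k x * (\<Sum>j\<in>UNIV. h $ j * pderiv_at j \<phi> x) + (\<Sum>j\<in>UNIV. h $ j * pderiv_at j (p k) x) * \<phi> x) x (axis j 1) = R k x" for x
        by (simp add: sum_axis R_def)
      have "sing (0 + 0) (\<lambda>x. p k x * \<phi> x) (\<lambda>x h. p k x * (\<Sum>j\<in>UNIV. h $ j * pderiv_at j \<phi> x) + (\<Sum>j\<in>UNIV. h $ j * pderiv_at j (p k) x) * \<phi> x)"
        by (rule sing_mult[OF sing_smooth[OF ps] sing_smooth[OF s]])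
      then have S: "sing 1 (\<lambda>x. p k x * \<phi> x) (\<lambda>x h. p k x * (\<Sum>j\<in>UNIV. h $ j * pderiv_at j \<phi> x) + (\<Sum>j\<in>UNIV. h $ j * pderiv_at j (p k) x) * \<phi> x)"
        by (rule sing_mono) simp
      have "\<bar>\<integral>x. R k x \<partial>LB\<bar> \<le> 2 * CARD('n) * (\<integral>x. \<bar>p k (sgn x) * \<phi> (sgn x)\<bar> \<partial>LB)"
        using sing_ball_divergence(2)[OF N S continuous_on_mult[OF smooth_cont[OF ps] smooth_cont[OF s]], of j] unfolding f .
      also have "(\<integral>x. \<bar>p k (sgn x) * \<phi> (sgn x)\<bar> \<partial>LB) \<le> (\<integral>x. B * \<bar>P k (sgn x) $ i - sgn x $ i\<bar> \<partial>LB)"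
      proof (rule integral_mono)
        have "integrable LB (\<lambda>x. \<bar>P k (sgn x) $ i - sgn x $ i\<bar> * \<bar>\<phi> (sgn x)\<bar>)"
          by (rule bounded_mult_integrable[OF iS, where B = B])
             (use B in \<open>auto intro!: borel_measurable_abs borel_LB measurable_compose[OF borel_measurable_sgn smooth_borel[OF s]]\<close>)
        then show "integrable LB (\<lambda>x. \<bar>p k (sgn x) * \<phi> (sgn x)\<bar>)" by (simp add: p_def abs_mult)
        show "integrable LB (\<lambda>x. B * \<bar>P k (sgn x) $ i - sgn x $ i\<bar>)" by (rule integrable_mult_right[OF iS])
        fix x :: "real^'n"
        show "\<bar>p k (sgn x) * \<phi> (sgn x)\<bar> \<le> B * \<bar>P k (sgn x) $ i - sgn x $ i\<bar>"
          using mult_right_mono[OF B[of "sgn x"], of "\<bar>p k (sgn x)\<bar>"] by (simp add: p_def abs_mult mult.commute)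
      qed
      finally show ?thesis by simp
    qed
    have l0: "(\<lambda>k. \<integral>x. R k x \<partial>LB) \<longlonglongrightarrow> 0"
    proof (rule Lim_null_comparison[OF always_eventually])
      show "\<forall>k. norm (\<integral>x. R k x \<partial>LB) \<le> 2 * CARD('n) * B * (\<integral>x. \<bar>P k (sgn x) $ i - sgn x $ i\<bar> \<partial>LB)" using div by simp
      have "(\<lambda>k. 2 * CARD('n) * B * (\<integral>x. \<bar>P k (sgn x) $ i - sgn x $ i\<bar> \<partial>LB)) \<longlonglongrightarrow> 2 * CARD('n) * B * 0"
        by (intro tendsto_intros lS)
      then show "(\<lambda>k. 2 * CARD('n) * B * (\<integral>x. \<bar>P k (sgn x) $ i - sgn x $ i\<bar> \<partial>LB)) \<longlonglongrightarrow> 0" by simp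
    qed
    have UI: "integrable LB (\<lambda>x. U x $ i)" "integrable LB (\<lambda>x. G x $ i $ j)" "integrable LB (\<lambda>x. x $ i)"
      by (rule L2_LB_integrable[OF Uc] L2_LB_integrable[OF Gc] weak_pderiv_smooth(2)[OF N smooth_coord])+
    note PI = weak_pderiv_smooth(2)[OF N Ps] and PD = weak_pderiv_smooth(2)[OF N smooth_pderiv[OF Ps]]
    note d1 = Bochner_Integration.integrable_diff[OF PI UI(1)]
    note d2 = Bochner_Integration.integrable_diff[OF PD UI(2)]
    have t1: "(\<lambda>k. \<integral>x. (P k x $ i - U x $ i) * pderiv_at j \<phi> x \<partial>LB) \<longlonglongrightarrow> 0"
      by (rule L1_pairing_tendsto[OF d1 L2_imp_L1_tendsto[OF finite_measure_LB borel_measurable_integrable[OF d1] lU] smooth_LB[OF s'] B'])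
    have t2: "(\<lambda>k. \<integral>x. (pderiv_at j (\<lambda>x. P k x $ i) x - G x $ i $ j) * \<phi> x \<partial>LB) \<longlonglongrightarrow> 0"
      by (rule L1_pairing_tendsto[OF d2 L2_imp_L1_tendsto[OF finite_measure_LB borel_measurable_integrable[OF d2] lG] smooth_LB[OF s] B])
    have c1: "integrable LB (\<lambda>x::real^'n. ?d i j)" by (rule integrable_const)
    define T1 where "T1 = (\<integral>x. (U x $ i - x $ i) * pderiv_at j \<phi> x \<partial>LB)"
    define T2 where "T2 = (\<integral>x. (G x $ i $ j - ?d i j) * \<phi> x \<partial>LB)"
    note i1 = bounded_mult_integrable[OF d1 smooth_LB[OF s'] B']
    note i2 = bounded_mult_integrable[OF d2 smooth_LB[OF s] B]
    note i3 = bounded_mult_integrable[OF Bochner_Integration.integrable_diff[OF UI(1,3)] smooth_LB[OF s'] B']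
    note i4 = bounded_mult_integrable[OF Bochner_Integration.integrable_diff[OF UI(2) c1] smooth_LB[OF s] B]
    \<comment> \<open>Splits the integral of \<open>R k\<close> into two parts that vanish in the
      limit and the fixed part T1 + T2, which is therefore zero.\<close>
    have ring: "(P - X) * a + (D - d) * b = ((P - Y) * a + (D - H) * b) + ((Y - X) * a + (H - d) * b)"
      for P X Y D H d a b :: real by (simp add: algebra_simps)
    have R: "(\<integral>x. R k x \<partial>LB) = (\<integral>x. (P k x $ i - U x $ i) * pderiv_at j \<phi> x \<partial>LB)
      + (\<integral>x. (pderiv_at j (\<lambda>x. P k x $ i) x - G x $ i $ j) * \<phi> x \<partial>LB) + (T1 + T2)" for k
    proof -
      have "R k x = ((P k x $ i - U x $ i) * pderiv_at j \<phi> x + (pderiv_at j (\<lambda>x. P k x $ i) x - G x $ i $ j) * \<phi> x)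
        + ((U x $ i - x $ i) * pderiv_at j \<phi> x + (G x $ i $ j - ?d i j) * \<phi> x)" for x
        unfolding R_def pd p_def by (rule ring)
      then show ?thesis unfolding T1_def T2_def
        by (simp only: Bochner_Integration.integral_add[OF Bochner_Integration.integrable_add[OF i1 i2] Bochner_Integration.integrable_add[OF i3 i4]]
            Bochner_Integration.integral_add[OF i1 i2] Bochner_Integration.integral_add[OF i3 i4])
    qed
    have "(\<lambda>k. \<integral>x. R k x \<partial>LB) \<longlonglongrightarrow> 0 + 0 + (T1 + T2)"
      unfolding R by (intro tendsto_add t1 t2 tendsto_const)
    then have T0: "T1 + T2 = 0" using LIMSEQ_unique[OF _ l0] by simp
    have m: "\<phi> \<in> borel_measurable borel" "pderiv_at j \<phi> \<in> borel_measurable borel"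
      using smooth_borel[OF s] smooth_borel[OF s'] by simp_all
    have "T1 = (\<integral>x. v i x * pderiv_at j \<phi> x \<partial>LB)"
      unfolding T1_def by (rule integral_cong_AE) (use v(3)[of i] am(1)[of i] vLB(1)[of i] smooth_LB[OF s'] in \<open>auto elim: eventually_mono\<close>)
    also have "\<dots> = (\<integral>x. v i x * pderiv_at j \<phi> x \<partial>lborel)"
      by (rule LB_zero_ext(1)) (use v m in simp_all)
    finally have 1: "T1 = (\<integral>x. v i x * pderiv_at j \<phi> x \<partial>lborel)" .
    have "T2 = (\<integral>x. g i j x * \<phi> x \<partial>LB)"
      unfolding T2_def by (rule integral_cong_AE) (use g(3)[of i j] am(2)[of i j] vLB(2)[of i j] smooth_LB[OF s] in \<open>auto elim: eventually_mono\<close>)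
    also have "\<dots> = (\<integral>x. g i j x * \<phi> x \<partial>lborel)"
      by (rule LB_zero_ext(1)) (use g m in simp_all)
    finally have 2: "T2 = (\<integral>x. g i j x * \<phi> x \<partial>lborel)" .
    show "(\<integral>x. v i x * pderiv_at j \<phi> x \<partial>lborel) = - (\<integral>x. g i j x * \<phi> x \<partial>lborel)"
      using T0 1 2 by linarith
  qed
  have h: "h10 (v i) (g i)" for i
    unfolding h10_def
  proof (intro conjI allI impI v g wpd)
    have "(\<lambda>x. (v i x)\<^sup>2) \<in> borel_measurable borel" using v(1)[of i] by simp
    from LB_zero_ext(2)[OF this] v2[of i] v(2) show "integrable lborel (\<lambda>x. (v i x)\<^sup>2)" by simp
    fix j
    have "(\<lambda>x. (g i j x)\<^sup>2) \<in> borel_measurable borel" using g(1)[of i j] by simp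
    from LB_zero_ext(2)[OF this] g2[of i j] g(2) show "integrable lborel (\<lambda>x. (g i j x)\<^sup>2)" by simp
  qed
  have A: "AE x in LB. \<forall>i. U x $ i = x $ i + v i x"
  proof (rule eventually_all_finite)
    fix i show "AE x in LB. U x $ i = x $ i + v i x" using v(3)[of i] by eventually_elim simp
  qed
  have A': "AE x in LB. \<forall>i j. weak_jacobian (ball 0 1) U x $ i $ j = ?d i j + g i j x"
  proof -
    have "AE x in LB. \<forall>i j. G x $ i $ j = ?d i j + g i j x"
    proof (intro eventually_all_finite)
      fix i j show "AE x in LB. G x $ i $ j = ?d i j + g i j x" using g(3)[of i j] by eventually_elim simp
    qed
    with weak_jacobian_AE(2)[OF G(1)] show ?thesis by eventually_elim simp
  qed
  show thesis
    by (rule that[OF h A A' weak_jacobian_AE(1)[OF G(1)]]) (use UL in \<open>simp add: L2_def\<close>)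
qed

subsection \<open>Passage to the limit\<close>

lemma young:
  fixes x y :: real
  assumes "0 < \<eta>" shows "\<bar>x * y\<bar> \<le> \<eta> * x\<^sup>2 + 1 / \<eta> * y\<^sup>2"
proof -
  have "2 * (\<eta> * \<bar>x\<bar>) * \<bar>y\<bar> \<le> (\<eta> * \<bar>x\<bar>)\<^sup>2 + \<bar>y\<bar>\<^sup>2" by (rule sum_squares_bound)
  moreover have "0 \<le> (\<eta> * \<bar>x\<bar>) * \<bar>y\<bar>" using assms by simp
  ultimately have "\<eta> * \<bar>x * y\<bar> \<le> (\<eta> * x)\<^sup>2 + y\<^sup>2" by (simp add: abs_mult power_mult_distrib)
  also have "\<dots> = \<eta> * (\<eta> * x\<^sup>2 + 1 / \<eta> * y\<^sup>2)" using assms by (simp add: power2_eq_square algebra_simps)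
  finally show ?thesis using assms by (simp only: mult_le_cancel_left_pos)
qed

lemma L2_mult_integrable:
  fixes a b w :: "'a \<Rightarrow> real"
  assumes m: "a \<in> borel_measurable M" "b \<in> borel_measurable M" "w \<in> borel_measurable M"
    and i: "integrable M (\<lambda>x. (a x)\<^sup>2)" "integrable M (\<lambda>x. (b x)\<^sup>2)"
    and w: "\<And>x. x \<in> space M \<Longrightarrow> \<bar>w x\<bar> \<le> B"
  shows "integrable M (\<lambda>x. w x * (a x * b x))"
proof (rule Bochner_Integration.integrable_bound)
  show "integrable M (\<lambda>x. B * ((a x)\<^sup>2 + (b x)\<^sup>2))" using i by simp
  show "(\<lambda>x. w x * (a x * b x)) \<in> borel_measurable M" by (intro borel_measurable_times m)
  show "AE x in M. norm (w x * (a x * b x)) \<le> norm (B * ((a x)\<^sup>2 + (b x)\<^sup>2))"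
  proof (rule AE_I2)
    fix x assume x: "x \<in> space M"
    have "\<bar>a x * b x\<bar> \<le> (a x)\<^sup>2 + (b x)\<^sup>2" using young[of 1 "a x" "b x"] by simp
    then have "\<bar>w x\<bar> * \<bar>a x * b x\<bar> \<le> \<bar>B\<bar> * \<bar>(a x)\<^sup>2 + (b x)\<^sup>2\<bar>" using w[OF x] by (intro mult_mono; linarith)
    then show "norm (w x * (a x * b x)) \<le> norm (B * ((a x)\<^sup>2 + (b x)\<^sup>2))" by (simp only: real_norm_def abs_mult)
  qed
qed

lemma L2_prod_tendsto:
  fixes u v w :: "'a \<Rightarrow> real" and U V :: "nat \<Rightarrow> 'a \<Rightarrow> real"
  assumes mU: "\<And>k. U k \<in> borel_measurable M" and mV: "\<And>k. V k \<in> borel_measurable M"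
    and m: "u \<in> borel_measurable M" "v \<in> borel_measurable M" "w \<in> borel_measurable M"
    and w: "\<And>x. x \<in> space M \<Longrightarrow> \<bar>w x\<bar> \<le> B" and B: "0 \<le> B"
    and iU: "\<And>k. integrable M (\<lambda>x. (U k x)\<^sup>2)" and iV: "\<And>k. integrable M (\<lambda>x. (V k x)\<^sup>2)"
    and i: "integrable M (\<lambda>x. (u x)\<^sup>2)" "integrable M (\<lambda>x. (v x)\<^sup>2)"
    and lU: "(\<lambda>k. \<integral>\<^sup>+x. ennreal ((U k x - u x)\<^sup>2) \<partial>M) \<longlonglongrightarrow> 0"
    and lV: "(\<lambda>k. \<integral>\<^sup>+x. ennreal ((V k x - v x)\<^sup>2) \<partial>M) \<longlonglongrightarrow> 0"
  shows "(\<lambda>k. \<integral>x. w x * (U k x * V k x) \<partial>M) \<longlonglongrightarrow> (\<integral>x. w x * (u x * v x) \<partial>M)"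
proof -
  have iA: "integrable M (\<lambda>x. (U k x - u x)\<^sup>2)" and iB: "integrable M (\<lambda>x. (V k x - v x)\<^sup>2)" for k
    by (rule integrable_sq_diff[OF mU m(1) iU i(1)], rule integrable_sq_diff[OF mV m(2) iV i(2)])
  define S where "S k = (\<integral>x. (U k x - u x)\<^sup>2 \<partial>M) + (\<integral>x. (V k x - v x)\<^sup>2 \<partial>M)" for k
  have r: "(\<lambda>k. \<integral>x. (a k x)\<^sup>2 \<partial>M) \<longlonglongrightarrow> 0"
    if ia: "\<And>k. integrable M (\<lambda>x. (a k x)\<^sup>2)" and la: "(\<lambda>k. \<integral>\<^sup>+x. ennreal ((a k x)\<^sup>2) \<partial>M) \<longlonglongrightarrow> 0" for a :: "nat \<Rightarrow> 'a \<Rightarrow> real"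
  proof -
    have "(\<integral>\<^sup>+x. ennreal ((a k x)\<^sup>2) \<partial>M) = ennreal (\<integral>x. (a k x)\<^sup>2 \<partial>M)" for k
      by (rule nn_integral_eq_integral[OF ia]) simp
    then have "(\<lambda>k. ennreal (\<integral>x. (a k x)\<^sup>2 \<partial>M)) \<longlonglongrightarrow> ennreal 0" using la by simp
    then show ?thesis
      by (rule tendsto_ennrealD) (intro always_eventually allI integral_nonneg_AE AE_I2 zero_le_power2 order_refl)+
  qed
  have S0: "S \<longlonglongrightarrow> 0" unfolding S_def[abs_def] using tendsto_add[OF r[OF iA lU] r[OF iB lV]] by simp
  have Sn: "0 \<le> S k" for k unfolding S_def by (intro add_nonneg_nonneg integral_nonneg_AE AE_I2 zero_le_power2)
  define I where "I = (\<integral>x. (u x)\<^sup>2 \<partial>M) + (\<integral>x. (v x)\<^sup>2 \<partial>M)"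
  \<comment> \<open>The Young parameter is the size of the error, so that both \<eta> and S / \<eta>
    tend to zero; \<open>mdel k\<close> keeps it positive when the error is zero.\<close>
  define \<eta> where "\<eta> k = sqrt (S k) + mdel k" for k
  have \<eta>: "0 < \<eta> k" for k unfolding \<eta>_def using Sn mdel(1)[of k] by (simp add: add_nonneg_pos)
  note pU = L2_mult_integrable[OF mU mV m(3) iU iV w] and pu = L2_mult_integrable[OF m i w]
  have bound: "norm ((\<integral>x. w x * (U k x * V k x) \<partial>M) - (\<integral>x. w x * (u x * v x) \<partial>M)) \<le> B * (\<eta> k * I + (sqrt (S k) + S k))" for k
  proof -
    let ?R = "\<lambda>x. B * (\<eta> k * ((u x)\<^sup>2 + (v x)\<^sup>2) + (1 / \<eta> k + 1) * ((U k x - u x)\<^sup>2 + (V k x - v x)\<^sup>2))"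
    have "(\<integral>x. w x * (U k x * V k x) \<partial>M) - (\<integral>x. w x * (u x * v x) \<partial>M) = (\<integral>x. w x * (U k x * V k x) - w x * (u x * v x) \<partial>M)"
      by (rule Bochner_Integration.integral_diff[OF pU pu, symmetric])
    also have "norm \<dots> \<le> (\<integral>x. ?R x \<partial>M)"
      unfolding real_norm_def
    proof (rule order_trans[OF integral_abs_bound integral_mono])
      show "integrable M (\<lambda>x. \<bar>w x * (U k x * V k x) - w x * (u x * v x)\<bar>)"
        by (rule integrable_abs[OF Bochner_Integration.integrable_diff[OF pU pu]])
      show "integrable M ?R" using i iA[of k] iB[of k] by simp
      fix x assume x: "x \<in> space M"
      define a where "a = U k x - u x"
      define b where "b = V k x - v x"
      have e: "w x * (U k x * V k x) - w x * (u x * v x) = w x * (a * b + u x * b + v x * a)"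
        by (simp add: a_def b_def algebra_simps)
      have "\<bar>a * b + u x * b + v x * a\<bar> \<le> \<bar>a * b\<bar> + \<bar>u x * b\<bar> + \<bar>v x * a\<bar>" by linarith
      also have "\<dots> \<le> (a\<^sup>2 + b\<^sup>2) + (\<eta> k * (u x)\<^sup>2 + 1 / \<eta> k * b\<^sup>2) + (\<eta> k * (v x)\<^sup>2 + 1 / \<eta> k * a\<^sup>2)"
        using young[of 1 a b] young[OF \<eta>[of k], of "u x" b] young[OF \<eta>[of k], of "v x" a] by simp
      also have "\<dots> = \<eta> k * ((u x)\<^sup>2 + (v x)\<^sup>2) + (1 / \<eta> k + 1) * (a\<^sup>2 + b\<^sup>2)" by (simp add: algebra_simps)
      finally have "\<bar>w x\<bar> * \<bar>a * b + u x * b + v x * a\<bar> \<le> B * (\<eta> k * ((u x)\<^sup>2 + (v x)\<^sup>2) + (1 / \<eta> k + 1) * (a\<^sup>2 + b\<^sup>2))"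
        using w[OF x] B by (intro mult_mono) simp_all
      then show "\<bar>w x * (U k x * V k x) - w x * (u x * v x)\<bar> \<le> ?R x" unfolding e abs_mult a_def b_def .
    qed
    also have "\<dots> = B * (\<eta> k * I + (1 / \<eta> k + 1) * S k)"
      unfolding I_def S_def using i iA[of k] iB[of k] by simp
    also have "\<dots> \<le> B * (\<eta> k * I + (sqrt (S k) + S k))"
    proof -
      have "sqrt (S k) * sqrt (S k) \<le> sqrt (S k) * \<eta> k"
        using Sn[of k] mdel(1)[of k] by (intro mult_left_mono) (simp_all add: \<eta>_def)
      then have "1 / \<eta> k * S k \<le> sqrt (S k)" using Sn[of k] \<eta>[of k] by (simp add: divide_le_eq)
      then show ?thesis using B by (intro mult_left_mono) (simp_all add: distrib_right)
    qed
    finally show ?thesis .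
  qed
  have "(\<lambda>k. B * (\<eta> k * I + (sqrt (S k) + S k))) \<longlonglongrightarrow> B * ((sqrt 0 + 0) * I + (sqrt 0 + 0))"
    unfolding \<eta>_def by (intro tendsto_intros S0 mdel_lim)
  then have "(\<lambda>k. B * (\<eta> k * I + (sqrt (S k) + S k))) \<longlonglongrightarrow> 0" by simp
  then have "(\<lambda>k. (\<integral>x. w x * (U k x * V k x) \<partial>M) - (\<integral>x. w x * (u x * v x) \<partial>M)) \<longlonglongrightarrow> 0"
    by (intro Lim_null_comparison[OF always_eventually[OF allI[OF bound]]])
  then show ?thesis by (rule LIM_zero_cancel)
qed

definition L2_lim :: "'a measure \<Rightarrow> (nat \<Rightarrow> 'a \<Rightarrow> real) \<Rightarrow> ('a \<Rightarrow> real) \<Rightarrow> bool" where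
  "L2_lim M F f \<longleftrightarrow> (\<forall>k. F k \<in> borel_measurable M \<and> integrable M (\<lambda>x. (F k x)\<^sup>2)) \<and> f \<in> borel_measurable M \<and>
     integrable M (\<lambda>x. (f x)\<^sup>2) \<and> (\<lambda>k. \<integral>\<^sup>+x. ennreal ((F k x - f x)\<^sup>2) \<partial>M) \<longlonglongrightarrow> 0"

lemma L2_lim_const: "f \<in> borel_measurable M \<Longrightarrow> integrable M (\<lambda>x. (f x)\<^sup>2) \<Longrightarrow> L2_lim M (\<lambda>k. f) f"
  by (simp add: L2_lim_def)

lemma L2_lim_prod:
  assumes F: "L2_lim M F f" and G: "L2_lim M G g"
    and w: "w \<in> borel_measurable M" "\<And>x. x \<in> space M \<Longrightarrow> \<bar>w x\<bar> \<le> B" "0 \<le> B"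
  shows "integrable M (\<lambda>x. w x * (f x * g x))" "\<And>k. integrable M (\<lambda>x. w x * (F k x * G k x))"
    "(\<lambda>k. \<integral>x. w x * (F k x * G k x) \<partial>M) \<longlonglongrightarrow> (\<integral>x. w x * (f x * g x) \<partial>M)"
proof -
  have FD: "F k \<in> borel_measurable M" "integrable M (\<lambda>x. (F k x)\<^sup>2)" "f \<in> borel_measurable M" "integrable M (\<lambda>x. (f x)\<^sup>2)"
    "(\<lambda>k. \<integral>\<^sup>+x. ennreal ((F k x - f x)\<^sup>2) \<partial>M) \<longlonglongrightarrow> 0" for k using F unfolding L2_lim_def by blast+
  have GD: "G k \<in> borel_measurable M" "integrable M (\<lambda>x. (G k x)\<^sup>2)" "g \<in> borel_measurable M" "integrable M (\<lambda>x. (g x)\<^sup>2)"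
    "(\<lambda>k. \<integral>\<^sup>+x. ennreal ((G k x - g x)\<^sup>2) \<partial>M) \<longlonglongrightarrow> 0" for k using G unfolding L2_lim_def by blast+
  show "integrable M (\<lambda>x. w x * (f x * g x))" by (rule L2_mult_integrable[OF FD(3) GD(3) w(1) FD(4) GD(4) w(2)])
  show "integrable M (\<lambda>x. w x * (F k x * G k x))" for k by (rule L2_mult_integrable[OF FD(1) GD(1) w(1) FD(2) GD(2) w(2)])
  show "(\<lambda>k. \<integral>x. w x * (F k x * G k x) \<partial>M) \<longlonglongrightarrow> (\<integral>x. w x * (f x * g x) \<partial>M)"
    by (rule L2_prod_tendsto[OF FD(1) GD(1) FD(3) GD(3) w FD(2) GD(2) FD(4) GD(4) FD(5) GD(5)])
qed

lemma integral_form: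
  fixes a :: "'i::finite \<Rightarrow> 'i \<Rightarrow> 'a \<Rightarrow> real"
  assumes a: "\<And>i j. integrable M (a i j)" and b: "\<And>i. integrable M (b i)"
  shows "integrable M (\<lambda>x. (\<Sum>i\<in>UNIV. \<Sum>j\<in>UNIV. a i j x) - (\<Sum>i\<in>UNIV. b i x))"
    "(\<integral>x. (\<Sum>i\<in>UNIV. \<Sum>j\<in>UNIV. a i j x) - (\<Sum>i\<in>UNIV. b i x) \<partial>M)
       = (\<Sum>i\<in>UNIV. \<Sum>j\<in>UNIV. \<integral>x. a i j x \<partial>M) - (\<Sum>i\<in>UNIV. \<integral>x. b i x \<partial>M)"
  using a b by (simp_all add: Bochner_Integration.integral_diff Bochner_Integration.integral_sum)

text \<open>The common shape of the two integrals that are passed to the limit below, the weak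
  Euler-Lagrange equation and the quadratic form of stability.\<close>

lemma L2_lim_form:
  fixes p q :: "'i::finite \<Rightarrow> 'i \<Rightarrow> 'a \<Rightarrow> real"
  assumes P: "\<And>i j. L2_lim M (\<lambda>k. P k i j) (p i j)" and Q: "\<And>i j. L2_lim M (\<lambda>k. Q k i j) (q i j)"
    and R: "\<And>i. L2_lim M (\<lambda>k. R k i) (r i)" and S: "\<And>i. L2_lim M (\<lambda>k. S k i) (s i)"
    and w: "w \<in> borel_measurable M" "\<And>x. x \<in> space M \<Longrightarrow> \<bar>w x\<bar> \<le> B" "0 \<le> B"
  shows "integrable M (\<lambda>x. (\<Sum>i\<in>UNIV. \<Sum>j\<in>UNIV. p i j x * q i j x) - (\<Sum>i\<in>UNIV. w x * (r i x * s i x)))"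
    "(\<lambda>k. \<integral>x. (\<Sum>i\<in>UNIV. \<Sum>j\<in>UNIV. P k i j x * Q k i j x) - (\<Sum>i\<in>UNIV. w x * (R k i x * S k i x)) \<partial>M)
      \<longlonglongrightarrow> (\<integral>x. (\<Sum>i\<in>UNIV. \<Sum>j\<in>UNIV. p i j x * q i j x) - (\<Sum>i\<in>UNIV. w x * (r i x * s i x)) \<partial>M)"
proof -
  have 1: "(\<lambda>_. 1::real) \<in> borel_measurable M" "\<And>x. x \<in> space M \<Longrightarrow> \<bar>1::real\<bar> \<le> 1" "(0::real) \<le> 1" by simp_all
  note a = L2_lim_prod[OF P Q 1, unfolded mult_1] and b = L2_lim_prod[OF R S w]
  show "integrable M (\<lambda>x. (\<Sum>i\<in>UNIV. \<Sum>j\<in>UNIV. p i j x * q i j x) - (\<Sum>i\<in>UNIV. w x * (r i x * s i x)))"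
    by (rule integral_form(1)[OF a(1) b(1)])
  have e1: "(\<integral>x. (\<Sum>i\<in>UNIV. \<Sum>j\<in>UNIV. p i j x * q i j x) - (\<Sum>i\<in>UNIV. w x * (r i x * s i x)) \<partial>M)
    = (\<Sum>i\<in>UNIV. \<Sum>j\<in>UNIV. \<integral>x. p i j x * q i j x \<partial>M) - (\<Sum>i\<in>UNIV. \<integral>x. w x * (r i x * s i x) \<partial>M)"
    by (rule integral_form(2)[OF a(1) b(1)])
  have e2: "(\<integral>x. (\<Sum>i\<in>UNIV. \<Sum>j\<in>UNIV. P k i j x * Q k i j x) - (\<Sum>i\<in>UNIV. w x * (R k i x * S k i x)) \<partial>M)
    = (\<Sum>i\<in>UNIV. \<Sum>j\<in>UNIV. \<integral>x. P k i j x * Q k i j x \<partial>M) - (\<Sum>i\<in>UNIV. \<integral>x. w x * (R k i x * S k i x) \<partial>M)" for k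
    by (rule integral_form(2)[OF a(2) b(2)])
  show "(\<lambda>k. \<integral>x. (\<Sum>i\<in>UNIV. \<Sum>j\<in>UNIV. P k i j x * Q k i j x) - (\<Sum>i\<in>UNIV. w x * (R k i x * S k i x)) \<partial>M)
      \<longlonglongrightarrow> (\<integral>x. (\<Sum>i\<in>UNIV. \<Sum>j\<in>UNIV. p i j x * q i j x) - (\<Sum>i\<in>UNIV. w x * (r i x * s i x)) \<partial>M)"
    unfolding e1 e2 by (intro tendsto_diff tendsto_sum a(3) b(3))
qed

subsection \<open>Singular fields as Sobolev functions\<close>

lemma sing1_square_integrable:
  fixes G :: "real^'n::finite \<Rightarrow> real"
  assumes N: "3 \<le> CARD('n)" and G: "sing 1 G G'"
  shows "G \<in> borel_measurable LB" "integrable LB (\<lambda>x. (G x)\<^sup>2)"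
proof -
  show m: "G \<in> borel_measurable LB" by (rule LB_measurable_continuous[OF sing_cont[OF G]])
  from G obtain C where C: "C \<ge> 0" "\<And>x. x \<in> ball 0 1 - {0} \<Longrightarrow> norm (G x) \<le> C / norm x ^ 1" by (rule singE) blast
  show "integrable LB (\<lambda>x. (G x)\<^sup>2)"
  proof (rule Bochner_Integration.integrable_bound[OF LB_integrable_inverse_square[OF N, of "C\<^sup>2"]])
    show "(\<lambda>x. (G x)\<^sup>2) \<in> borel_measurable LB" using m by simp
    show "AE x in LB. norm ((G x)\<^sup>2) \<le> norm (C\<^sup>2 / (norm x)\<^sup>2)"
    proof (rule LB_I)
      fix x :: "real^'n" assume "x \<in> ball 0 1" "x \<noteq> 0"
      then have "\<bar>G x\<bar> \<le> C / norm x" using C(2)[of x] by simp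
      then have "\<bar>G x\<bar>\<^sup>2 \<le> (C / norm x)\<^sup>2" by (rule power_mono) simp
      then show "norm ((G x)\<^sup>2) \<le> norm (C\<^sup>2 / (norm x)\<^sup>2)" by (simp add: power_divide)
    qed
  qed
qed

text \<open>Vanishing on the sphere removes the boundary term even against test functions that do
  not vanish there, and a derivative with a singularity of order 1 is square integrable because N
  \<ge> 3.\<close>

lemma h10_sing:
  fixes F :: "real^'n::finite \<Rightarrow> real"
  assumes N: "3 \<le> CARD('n)" and F: "sing 0 F F'" and c: "continuous_on (cball 0 1 - {0}) F"
    and z: "\<And>x. norm x = 1 \<Longrightarrow> F x = 0" and G: "\<And>j. \<exists>G'. sing 1 (\<lambda>x. F' x (axis j 1)) G'"
  shows "h10 (\<lambda>x. indicator (ball 0 1 - {0}) x *\<^sub>R F x) (\<lambda>j x. indicator (ball 0 1 - {0}) x *\<^sub>R F' x (axis j 1))"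
proof -
  let ?I = "indicator (ball 0 1 - {0}) :: real^'n \<Rightarrow> real"
  let ?g = "\<lambda>j x. F' x (axis j 1)"
  have Gc: "continuous_on (ball 0 1 - {0}) (?g j)" for j using G[of j] sing_cont by blast
  have vb: "(\<lambda>x. ?I x *\<^sub>R F x) \<in> borel_measurable borel" by (rule borel_continuous_off_0[OF sing_cont[OF F]])
  have gb: "(\<lambda>x. ?I x *\<^sub>R ?g j x) \<in> borel_measurable borel" for j by (rule borel_continuous_off_0[OF Gc])
  have z0: "?I x *\<^sub>R H x = 0" if "1 \<le> norm x" for x and H :: "real^'n \<Rightarrow> real" using that by (simp add: indicator_def)
  have ae: "AE x in LB. ?I x = 1" by (rule LB_I) simp
  have sq: "integrable lborel (\<lambda>x. (?I x *\<^sub>R H x)\<^sup>2)"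
    if b: "(\<lambda>x. ?I x *\<^sub>R H x) \<in> borel_measurable borel" and i: "integrable LB (\<lambda>x. (H x)\<^sup>2)" for H :: "real^'n \<Rightarrow> real"
  proof -
    have m: "(\<lambda>x. (?I x *\<^sub>R H x)\<^sup>2) \<in> borel_measurable borel" using b by (rule borel_measurable_power)
    have a: "AE x in LB. (H x)\<^sup>2 = (?I x *\<^sub>R H x)\<^sup>2" using ae by eventually_elim simp
    have "integrable LB (\<lambda>x. (?I x *\<^sub>R H x)\<^sup>2)"
      by (rule Bochner_Integration.integrable_cong_AE_imp[OF i borel_LB[OF m] a])
    then show ?thesis using LB_zero_ext(2)[OF m] z0[of _ H] by simp
  qed
  have conv: "(\<integral>x. (?I x *\<^sub>R H x) * q x \<partial>lborel) = (\<integral>x. H x * q x \<partial>LB)"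
    if b: "(\<lambda>x. ?I x *\<^sub>R H x) \<in> borel_measurable borel" and q: "q \<in> borel_measurable borel" and Hm: "H \<in> borel_measurable LB" for H q :: "real^'n \<Rightarrow> real"
  proof -
    have m: "(\<lambda>x. (?I x *\<^sub>R H x) * q x) \<in> borel_measurable borel" by (rule borel_measurable_times[OF b q])
    have "(\<integral>x. (?I x *\<^sub>R H x) * q x \<partial>lborel) = (\<integral>x. (?I x *\<^sub>R H x) * q x \<partial>LB)"
      by (rule LB_zero_ext(1)[OF m, symmetric]) (simp add: indicator_def)
    also have "\<dots> = (\<integral>x. H x * q x \<partial>LB)"
    proof (rule integral_cong_AE[OF borel_LB[OF m] borel_measurable_times[OF Hm borel_LB[OF q]]])
      show "AE x in LB. (?I x *\<^sub>R H x) * q x = H x * q x" using ae by eventually_elim simp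
    qed
    finally show ?thesis .
  qed
  have FF: "integrable LB (\<lambda>x. (F x)\<^sup>2)"
    using weak_pderiv_sing(2)[OF N sing_mult[OF F F, unfolded add_0] continuous_on_mult[OF c c]] by (simp add: power2_eq_square)
  have gg: "integrable LB (\<lambda>x. (?g j x)\<^sup>2)" for j using G[of j] sing1_square_integrable(2)[OF N] by blast
  have wpd: "weak_pd j (\<lambda>x. ?I x *\<^sub>R F x) (\<lambda>x. ?I x *\<^sub>R ?g j x)" for j
    unfolding weak_pd_def
  proof (intro allI impI)
    fix \<phi> :: "real^'n \<Rightarrow> real" assume C: "Cc \<phi>"
    note s = Cc_smooth[OF C] and s' = Cc_smooth[OF Cc_pderiv[OF C]]
    obtain B where B: "\<And>x. \<bar>\<phi> x\<bar> \<le> B" by (rule Cc_bounded[OF C]) blast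
    obtain B' where B': "\<And>x. \<bar>pderiv_at j \<phi> x\<bar> \<le> B'" by (rule Cc_bounded[OF Cc_pderiv[OF C]]) blast
    let ?P = "\<lambda>x h. F x * (\<Sum>j\<in>UNIV. h $ j * pderiv_at j \<phi> x) + F' x h * \<phi> x"
    have "sing 0 (\<lambda>x. F x * \<phi> x) ?P" using sing_mult[OF F sing_smooth[OF s]] by (simp only: add_0)
    then have S: "sing 1 (\<lambda>x. F x * \<phi> x) ?P" by (rule sing_mono) simp
    have e: "?P x (axis j 1) = F x * pderiv_at j \<phi> x + ?g j x * \<phi> x" for x by (simp add: sum_axis)
    have "(\<integral>x. \<bar>F (sgn x) * \<phi> (sgn x)\<bar> \<partial>(LB :: (real^'n) measure)) = 0"
      by (rule integral_eq_zero_AE, rule LB_I) (simp add: z norm_sgn)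
    then have t: "(\<integral>x. F x * pderiv_at j \<phi> x + ?g j x * \<phi> x \<partial>LB) = 0"
      using sing_ball_divergence(2)[OF N S continuous_on_mult[OF c smooth_cont[OF s]], of j, unfolded e] by simp
    note w = weak_pderiv_sing[OF N F c]
    have "(\<integral>x. F x * pderiv_at j \<phi> x \<partial>LB) + (\<integral>x. ?g j x * \<phi> x \<partial>LB) = 0"
      using t Bochner_Integration.integral_add[OF bounded_mult_integrable[OF w(2) smooth_LB[OF s'] B'] bounded_mult_integrable[OF w(3) smooth_LB[OF s] B]]
      by simp
    moreover note conv[OF vb smooth_borel[OF s'] borel_measurable_integrable[OF w(2)], of j]
      conv[OF gb smooth_borel[OF s] borel_measurable_integrable[OF w(3)], of j]
    ultimately show "(\<integral>x. (?I x *\<^sub>R F x) * pderiv_at j \<phi> x \<partial>lborel) = - (\<integral>x. (?I x *\<^sub>R ?g j x) * \<phi> x \<partial>lborel)"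
      by linarith
  qed
  show ?thesis
    unfolding h10_def
    by (intro conjI allI impI vb gb wpd sq FF gg; rule z0)
qed

text \<open>Integrating by parts twice moves both derivatives from the potential \<open>u\<close> to
  the test function, where they commute.\<close>

lemma gradient_sym:
  fixes U :: "real^'n::finite \<Rightarrow> real^'n"
  assumes g: "gradient_field (ball 0 1) U" and G: "has_weak_jacobian (ball 0 1) U G"
  shows "AE x in LB. G x $ i $ j = G x $ j $ i"
proof -
  obtain u where u: "\<And>j. has_weak_pderiv (ball 0 1) j u (\<lambda>x. U x $ j)"
    using g by (auto simp: gradient_field_def has_weak_gradient_def)
  have w: "has_weak_pderiv (ball 0 1) j (\<lambda>x. U x $ i) (\<lambda>x. G x $ i $ j)" for i j
    using G by (simp add: has_weak_jacobian_def has_weak_gradient_def)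
  have E: "(\<integral>x. a x * pderiv_at j \<phi> x \<partial>LB) = - (\<integral>x. b x * \<phi> x \<partial>LB)"
    if "has_weak_pderiv (ball 0 1) j a b" "test_function (ball 0 1) \<phi>" for a b \<phi> :: "real^'n \<Rightarrow> real" and j
    using that unfolding weak_pderiv_iff by blast
  have li: "locally_integrable (ball 0 1) (\<lambda>x. G x $ i $ j)" for i j using w[of j i] unfolding weak_pderiv_iff by blast
  have "AE x in LB. G x $ i $ j - G x $ j $ i = 0"
  proof (rule fundamental_lemma)
    show "locally_integrable (ball 0 1) (\<lambda>x. G x $ i $ j - G x $ j $ i)" by (intro locally_integrable_diff li)
    fix \<phi> :: "real^'n \<Rightarrow> real" assume p: "test_function (ball 0 1) \<phi>"
    have e: "(\<integral>x. G x $ i $ j * \<phi> x \<partial>LB) = (\<integral>x. u x * pderiv_at i (pderiv_at j \<phi>) x \<partial>LB)" for i j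
    proof -
      have "(\<integral>x. U x $ i * pderiv_at j \<phi> x \<partial>LB) = - (\<integral>x. G x $ i $ j * \<phi> x \<partial>LB)" by (rule E[OF w p])
      moreover have "(\<integral>x. u x * pderiv_at i (pderiv_at j \<phi>) x \<partial>LB) = - (\<integral>x. U x $ i * pderiv_at j \<phi> x \<partial>LB)"
        by (rule E[OF u test_pderiv[OF p]])
      ultimately show ?thesis by linarith
    qed
    have "smooth \<phi>" using p by (simp add: test_function_def)
    then have "(\<lambda>x. u x * pderiv_at i (pderiv_at j \<phi>) x) = (\<lambda>x. u x * pderiv_at j (pderiv_at i \<phi>) x)"
      by (simp add: pderiv_commute fun_eq_iff)
    then have "(\<integral>x. G x $ i $ j * \<phi> x \<partial>LB) = (\<integral>x. G x $ j $ i * \<phi> x \<partial>LB)" unfolding e by simp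
    moreover have "integrable LB (\<lambda>x. G x $ i $ j * \<phi> x)" for i j
      by (rule locally_integrable_test[OF li p])
    ultimately show "(\<integral>x. (G x $ i $ j - G x $ j $ i) * \<phi> x \<partial>LB) = 0"
      by (simp add: left_diff_distrib Bochner_Integration.integral_diff)
  qed
  then show ?thesis by eventually_elim simp
qed

subsection \<open>The vortex\<close>

text \<open>The argument \<open>ty\<close> ties the type of the dimension to the locale, while
  \<open>vortex_ode\<close> speaks of the number only.\<close>

locale vortex_field = vortex_ode "CARD('n)" W W' W'' f f' f'' \<epsilon>
  for W W' W'' f f' f'' :: "real \<Rightarrow> real" and \<epsilon> :: real and ty :: "'n::finite itself"
begin

definition pr :: "real \<Rightarrow> real" where "pr r = f r * inverse r"
definition pr' :: "real \<Rightarrow> real" where "pr' r = f' r * inverse r - f r * (inverse r)\<^sup>2"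
definition qr :: "real \<Rightarrow> real" where "qr r = f' r - pr r"
definition qr' :: "real \<Rightarrow> real" where "qr' r = f'' r - pr' r"

text \<open>The Jacobian of the vortex: eigenvalue f/r on directions tangent to the sphere, and f' =
  \<open>pr\<close> + \<open>qr\<close> in the radial direction.\<close>

definition J :: "real^'n \<Rightarrow> real^'n^'n" where
  "J x = pr (norm x) *\<^sub>R mat 1 + qr (norm x) *\<^sub>R outer (sgn x) (sgn x)"

definition U :: "real^'n \<Rightarrow> real^'n" where "U x = f (norm x) *\<^sub>R sgn x"

lemma N3: "3 \<le> CARD('n)" using N by simp

lemma J_nth: "J x $ i $ j = pr (norm x) * (if i = j then 1 else 0) + qr (norm x) * (sgn x $ i * sgn x $ j)"
  by (simp add: J_def mat_def outer_def)

lemma J_sym: "J x $ i $ j = J x $ j $ i" by (simp add: J_nth mult.commute)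

context
  fixes r :: real assumes r: "0 < r" "r < 1"
begin

lemma i1: "1 \<le> inverse r" using r by (simp add: one_le_inverse)

lemma f'_le_pr: "f' r \<le> pr r"
  using r_f'_le_f[OF r] r by (simp add: pr_def field_simps)

lemma pr_bound: "0 \<le> pr r" "pr r \<le> inverse r"
  using f_nonneg[of r] f_le_1[of r] r mult_right_mono[of "f r" 1 "inverse r"] by (simp_all add: pr_def)

lemma qr_bound: "\<bar>qr r\<bar> \<le> inverse r"
  using f'_le_pr f'_nonneg[OF r] pr_bound by (simp add: qr_def)

lemma pr'_eq: "pr' r = qr r * inverse r" by (simp add: pr'_def qr_def pr_def power2_eq_square algebra_simps)

lemma pr'_bound: "\<bar>pr' r\<bar> \<le> (inverse r)\<^sup>2"
  unfolding pr'_eq abs_mult power2_eq_square using qr_bound r by (intro mult_mono) simp_all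

lemma pr_deriv: "(pr has_real_derivative pr' r) (at r)"
  unfolding pr_def[abs_def]
  by (rule DERIV_cong[OF DERIV_mult[OF f_deriv[OF r] DERIV_inverse]]) (use r in \<open>simp_all add: pr'_def power2_eq_square\<close>)

lemma qr_deriv: "(qr has_real_derivative qr' r) (at r)"
  unfolding qr_def[abs_def] qr'_def by (rule DERIV_diff[OF f'_deriv[OF r] pr_deriv])

lemma f''_inverse: "f'' r = (real CARD('n) - 1) * inverse r * (pr r - f' r) - c r * f r"
  unfolding f''_eq[OF r] by (simp add: pr_def divide_inverse power2_eq_square algebra_simps)

text \<open>The profile equation once more: the left side is the radial component of the row
  divergence of \<open>J\<close>.\<close>

lemma qr'_eq: "pr' r + qr' r + qr r * ((real CARD('n) - 1) / r) = - (c r * f r)"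
  unfolding qr'_def f''_inverse by (simp add: qr_def divide_inverse algebra_simps)

lemma qr'_bound:
  assumes C: "\<bar>c r\<bar> \<le> C"
  shows "\<bar>qr' r\<bar> \<le> (real CARD('n) + C) * (inverse r)\<^sup>2"
proof -
  have C0: "0 \<le> C" using C by linarith
  have i2: "1 \<le> (inverse r)\<^sup>2" using power_mono[OF i1, of 2] by simp
  have "\<bar>pr r - f' r\<bar> \<le> inverse r" using qr_bound unfolding qr_def by linarith
  then have "(real CARD('n) - 1) * inverse r * \<bar>pr r - f' r\<bar> \<le> (real CARD('n) - 1) * inverse r * inverse r"
    using N r by (intro mult_left_mono) simp_all
  then have 1: "\<bar>(real CARD('n) - 1) * inverse r * (pr r - f' r)\<bar> \<le> (real CARD('n) - 1) * (inverse r)\<^sup>2"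
    using N r by (simp add: abs_mult power2_eq_square)
  have "\<bar>c r\<bar> * \<bar>f r\<bar> \<le> C * 1" using C f_nonneg[of r] f_le_1[of r] r by (intro mult_mono) simp_all
  then have 2: "\<bar>c r * f r\<bar> \<le> C * (inverse r)\<^sup>2" using mult_left_mono[OF i2 C0] by (simp add: abs_mult)
  have "\<bar>qr' r\<bar> \<le> (real CARD('n) - 1) * (inverse r)\<^sup>2 + C * (inverse r)\<^sup>2 + (inverse r)\<^sup>2"
    unfolding qr'_def f''_inverse using 1 2 pr'_bound by linarith
  then show ?thesis by (simp add: algebra_simps)
qed

end

lemma inverse_pow: "C / r ^ Suc 1 = C * (inverse r)\<^sup>2" "C / r ^ 1 = C * inverse r" "C / r ^ Suc 0 = C * inverse r" for C r :: real
  by (simp_all add: divide_inverse power2_eq_square)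

lemma sing_pr: "sing 1 (\<lambda>x::real^'n. pr (norm x)) (\<lambda>x h. pr' (norm x) * (sgn x \<bullet> h))"
  by (rule sing_radial[where C = 1, OF pr_deriv]) (use pr_bound pr'_bound in \<open>simp_all only: inverse_pow mult_1 abs_of_nonneg zero_le_one\<close>)

lemma sing_qr: "sing 1 (\<lambda>x::real^'n. qr (norm x)) (\<lambda>x h. qr' (norm x) * (sgn x \<bullet> h))"
proof -
  obtain C where C: "C \<ge> 0" "\<And>r. 0 \<le> r \<Longrightarrow> r \<le> 1 \<Longrightarrow> \<bar>c r\<bar> \<le> C" by (rule c_bounded) blast
  show ?thesis
  proof (rule sing_radial[where C = "real CARD('n) + C", OF qr_deriv])
    fix r :: real assume r: "0 < r" "r < 1"
    have "1 * inverse r \<le> (real CARD('n) + C) * inverse r" using N C(1) r by (intro mult_right_mono) simp_all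
    then show "\<bar>qr r\<bar> \<le> (real CARD('n) + C) / r ^ 1" unfolding inverse_pow using qr_bound[OF r] by linarith
    show "\<bar>qr' r\<bar> \<le> (real CARD('n) + C) / r ^ Suc 1" unfolding inverse_pow using qr'_bound[OF r C(2)] r by simp
  qed (use C in simp_all)
qed

lemma sing_U: "sing 0 U (\<lambda>x h. f (norm x) *\<^sub>R dsgn x h + (f' (norm x) * (sgn x \<bullet> h)) *\<^sub>R sgn x)"
proof -
  have "sing 0 (\<lambda>x::real^'n. f (norm x)) (\<lambda>x h. f' (norm x) * (sgn x \<bullet> h))"
  proof (rule sing_radial[where C = 1, OF f_deriv])
    fix r :: real assume r: "0 < r" "r < 1"
    show "\<bar>f r\<bar> \<le> 1 / r ^ 0" using f_nonneg[of r] f_le_1[of r] r by simp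
    show "\<bar>f' r\<bar> \<le> 1 / r ^ Suc 0" using f'_nonneg[OF r] f'_le[OF r] by simp
  qed simp_all
  from sing_scaleR[OF this sing_sgn] show ?thesis unfolding U_def[abs_def] by (simp only: add_0)
qed

lemma DU: "(f (norm x) *\<^sub>R dsgn x (axis j 1) + (f' (norm x) * (sgn x \<bullet> axis j 1)) *\<^sub>R sgn x) $ i = J x $ i $ j"
proof -
  have 1: "sgn x \<bullet> axis j 1 = sgn x $ j" by (simp add: inner_axis)
  have 2: "axis j (1::real) $ i = (if i = j then 1 else 0)" by (simp add: axis_def)
  show ?thesis by (simp add: dsgn_def J_nth pr_def qr_def 1 2 algebra_simps)
qed

lemma sing_J: "\<exists>J'. sing 1 (\<lambda>x. J x $ i $ j - d) J'"
proof -
  have s: "sing 0 (\<lambda>x. sgn x $ i) (\<lambda>x h. dsgn x h $ i)" for i :: 'n by (rule sing_linear[OF bounded_linear_vec_nth sing_sgn])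
  have k: "sing 0 (\<lambda>x::real^'n. d) (\<lambda>x h. \<Sum>j\<in>UNIV. h $ j * pderiv_at j (\<lambda>x. d) x)" for d by (rule sing_smooth[OF smooth_const])
  note 1 = sing_mult[OF sing_pr k[of "if i = j then 1 else 0"], unfolded add_0_right]
  note 2 = sing_mult[OF sing_qr sing_mult[OF s[of i] s[of j]], unfolded add_0_right]
  show ?thesis unfolding J_nth using sing_diff[OF sing_add[OF 1 2] sing_mono[OF k[of d], of 1]] by auto
qed

lemma U_cont: "continuous_on (cball 0 1 - {0}) U"
  unfolding U_def
  by (intro continuous_on_scaleR continuous_on_sgn continuous_on_id continuous_on_compose2[OF f_cont continuous_on_norm_id]) auto

definition v1 :: "'n \<Rightarrow> real^'n \<Rightarrow> real" where "v1 i x = indicator (ball 0 1 - {0}) x *\<^sub>R (U x $ i - x $ i)"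
definition g1 :: "'n \<Rightarrow> 'n \<Rightarrow> real^'n \<Rightarrow> real" where
  "g1 i j x = indicator (ball 0 1 - {0}) x *\<^sub>R (J x $ i $ j - (if i = j then 1 else 0))"

text \<open>f(1) = 1 makes U - x vanish on the sphere; through \<open>A_GL_I\<close> this puts the
  vortex into the admissible class.\<close>

lemma h10_vortex: "h10 (v1 i) (g1 i)"
proof -
  let ?F' = "\<lambda>x h. (f (norm x) *\<^sub>R dsgn x h + (f' (norm x) * (sgn x \<bullet> h)) *\<^sub>R sgn x) $ i
    - (\<Sum>j\<in>UNIV. h $ j * pderiv_at j (\<lambda>x. x $ i) x)"
  have s: "sing 0 (\<lambda>x. U x $ i - x $ i) ?F'"
    by (rule sing_diff[OF sing_linear[OF bounded_linear_vec_nth sing_U] sing_smooth[OF smooth_coord]])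
  have e: "?F' x (axis j 1) = J x $ i $ j - (if i = j then 1 else 0)" for x j
    unfolding DU sum_axis pderiv_coord ..
  have c: "continuous_on (cball 0 1 - {0}) (\<lambda>x. U x $ i - x $ i)" by (intro continuous_intros U_cont)
  have "h10 (\<lambda>x. indicator (ball 0 1 - {0}) x *\<^sub>R (U x $ i - x $ i)) (\<lambda>j x. indicator (ball 0 1 - {0}) x *\<^sub>R ?F' x (axis j 1))"
  proof (rule h10_sing[OF N3 s c])
    show "U x $ i - x $ i = 0" if "norm x = 1" for x using that f_1 by (simp add: U_def sgn_div_norm)
    show "\<exists>G'. sing 1 (\<lambda>x. ?F' x (axis j 1)) G'" for j unfolding e by (rule sing_J)
  qed
  then show ?thesis unfolding e v1_def[abs_def] g1_def[abs_def] .
qed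

lemma U_eq: "x \<in> ball 0 1 \<Longrightarrow> U x $ i = x $ i + v1 i x"
  by (cases "x = 0") (simp_all add: v1_def U_def)

lemma U_A_GL: "U \<in> A_GL" by (rule A_GL_I(1)[OF N3 h10_vortex U_eq])

lemma U_jacobian: "has_weak_jacobian (ball 0 1) U (\<lambda>x. \<chi> i j. (if i = j then 1 else 0) + g1 i j x)"
  by (rule A_GL_I(2)[OF N3 h10_vortex U_eq])

lemma U_jacobian_AE: "AE x in LB. weak_jacobian (ball 0 1) U x = J x"
  using weak_jacobian_AE(2)[OF U_jacobian] LB_nonzero AE_space
  by eventually_elim (simp add: vec_eq_iff g1_def)

text \<open>The potential is the primitive \<Phi> of the profile, evaluated at the norm.\<close>

lemma U_gradient: "gradient_field (ball 0 1) U"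
proof -
  define \<Phi> where "\<Phi> r = integral {0..r} f" for r
  have fi: "f integrable_on {0..1}" by (rule integrable_continuous_real[OF f_cont])
  have \<Phi>c: "continuous_on {0..1} \<Phi>" unfolding \<Phi>_def by (rule indefinite_integral_continuous_1[OF fi])
  have "bounded (\<Phi> ` {0..1})" by (intro compact_imp_bounded compact_continuous_image \<Phi>c) simp
  from this[unfolded bounded_iff] obtain B where B: "\<forall>y\<in>\<Phi> ` {0..1}. norm y \<le> B" ..
  have s: "sing 0 (\<lambda>x::real^'n. \<Phi> (norm x)) (\<lambda>x h. f (norm x) * (sgn x \<bullet> h))"
  proof (rule sing_radial[where C = "max B 1"])
    fix r :: real assume r: "0 < r" "r < 1"
    have "(\<Phi> has_real_derivative f r) (at r within {0..1})"
      unfolding \<Phi>_def[abs_def] by (rule integral_has_real_derivative[OF f_cont]) (use r in simp)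
    moreover have "at r within {0..1} = at r" by (rule at_within_interior) (use r in simp)
    ultimately show "(\<Phi> has_real_derivative f r) (at r)" by simp
    have "\<bar>\<Phi> r\<bar> \<le> B" using B r by simp
    then show "\<bar>\<Phi> r\<bar> \<le> max B 1 / r ^ 0" by simp
    have "\<bar>f r\<bar> \<le> 1" "1 * 1 \<le> max B 1 * inverse r"
      using f_nonneg[of r] f_le_1[of r] r i1[OF r] by (simp, intro mult_mono) simp_all
    then show "\<bar>f r\<bar> \<le> max B 1 / r ^ Suc 0" unfolding inverse_pow by linarith
  qed simp
  have c: "continuous_on (cball 0 1 - {0}) (\<lambda>x::real^'n. \<Phi> (norm x))"
    by (rule continuous_on_compose2[OF \<Phi>c continuous_on_norm_id]) auto
  have "has_weak_pderiv (ball 0 1) j (\<lambda>x. \<Phi> (norm x)) (\<lambda>x. U x $ j)" for j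
    using weak_pderiv_sing(1)[OF N3 s c, of j] by (simp add: U_def inner_axis)
  then show ?thesis unfolding gradient_field_def has_weak_gradient_def by blast
qed

section \<open>The Euler-Lagrange equation of the vortex for smooth fields\<close>

lemma inner_J: "J x \<bullet> A = pr (norm x) * trace A + qr (norm x) * (sgn x \<bullet> (A *v sgn x))"
  by (simp add: J_def inner_add_left inner_mat_1 inner_outer)

text \<open>The field \<open>X\<close> is \<open>J\<close> applied to \<open>V\<close>. Its
  divergence is the integrand, because the row divergence of \<open>J\<close> is - c U by
  \<open>qr'_eq\<close>.\<close>

lemma euler_lagrange_smooth:
  assumes cf: "curl_free V A \<rho>"
  shows "(\<integral>x. J x \<bullet> A x - c (norm x) * (U x \<bullet> V x) \<partial>LB) = 0"
proof -
  interpret F: curl_free V A \<rho> by (rule cf)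
  define X where "X x = pr (norm x) *\<^sub>R V x + (qr (norm x) * F.a x) *\<^sub>R sgn x" for x
  define L where "L x h = qr (norm x) * F.da x h + (qr' (norm x) * (sgn x \<bullet> h)) * F.a x" for x h
  define X' where "X' x h = (pr (norm x) *\<^sub>R (A x *v h) + (pr' (norm x) * (sgn x \<bullet> h)) *\<^sub>R V x)
    + ((qr (norm x) * F.a x) *\<^sub>R dsgn x h + L x h *\<^sub>R sgn x)" for x h
  have s: "sing 1 X X'"
    using sing_add[OF sing_scaleR[OF sing_pr F.sing_V, unfolded add_0_right]
        sing_scaleR[OF sing_mult[OF sing_qr F.sing_a, unfolded add_0_right] sing_sgn, unfolded add_0_right]]
    unfolding X_def[abs_def] X'_def[abs_def] L_def[abs_def] .
  have z: "X x = 0" if "\<rho> < norm x" for x using F.V_zero[OF that] by (simp add: X_def F.a_def)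
  have dvX: "dv (X' x) = J x \<bullet> A x - c (norm x) * (U x \<bullet> V x)" if x: "x \<in> ball 0 1 - {0}" for x
  proof -
    have x0: "x \<noteq> 0" "0 < norm x" "norm x < 1" using x by auto
    have linL: "linear (L x)"
      unfolding L_def[abs_def]
      by (rule linearI) (simp_all add: linear_add[OF F.linear_da[OF x]] linear_cmul[OF F.linear_da[OF x]] inner_add_right algebra_simps)
    have l2: "linear (\<lambda>h. pr' (norm x) * (sgn x \<bullet> h))" by (rule linearI) (simp_all add: inner_add_right algebra_simps)
    have a: "F.a x = sgn x \<bullet> V x" by (simp add: F.a_def inner_commute)
    have "dv (X' x) = (pr (norm x) * trace (A x) + pr' (norm x) * (sgn x \<bullet> V x)) + ((qr (norm x) * F.a x) * dv (dsgn x) + L x (sgn x))"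
      unfolding X'_def[abs_def] dv_add[of "\<lambda>h. pr (norm x) *\<^sub>R (A x *v h) + (pr' (norm x) * (sgn x \<bullet> h)) *\<^sub>R V x"]
        F.dv_product[OF l2] F.dv_product[OF linL] dv_matrix ..
    also have "L x (sgn x) = qr (norm x) * (sgn x \<bullet> (A x *v sgn x)) + qr' (norm x) * F.a x"
      by (simp add: L_def F.da_n[OF x] F.n1[OF x] F.w_def)
    also have "dv (dsgn x) = (real CARD('n) - 1) / norm x" by (rule dv_dsgn[OF x0(1)])
    also have "(pr (norm x) * trace (A x) + pr' (norm x) * (sgn x \<bullet> V x)) + ((qr (norm x) * F.a x) * ((real CARD('n) - 1) / norm x)
        + (qr (norm x) * (sgn x \<bullet> (A x *v sgn x)) + qr' (norm x) * F.a x))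
      = J x \<bullet> A x + (pr' (norm x) + qr' (norm x) + qr (norm x) * ((real CARD('n) - 1) / norm x)) * F.a x"
      unfolding inner_J a by (simp add: algebra_simps)
    also have "\<dots> = J x \<bullet> A x - c (norm x) * (U x \<bullet> V x)" unfolding qr'_eq[OF x0(2,3)] a by (simp add: U_def)
    finally show ?thesis .
  qed
  note d = sing_divergence_zero[OF N3 s F.rho z, folded dv_def]
  have ae: "AE x in LB. dv (X' x) = J x \<bullet> A x - c (norm x) * (U x \<bullet> V x)" by (rule LB_I) (rule dvX, simp)
  have cc: "continuous_on (ball 0 1 - {0}) (\<lambda>x::real^'n. c (norm x))"
    by (rule continuous_on_compose2[OF c_cont continuous_on_norm_id]) auto
  have Jc: "continuous_on (ball 0 1 - {0}) (\<lambda>x. J x $ i $ j)" for i j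
    using sing_J[of i j 0] sing_cont unfolding diff_zero by blast
  have Ac: "continuous_on (ball 0 1 - {0}) (\<lambda>x. A x $ i $ j)" for i j
    by (intro continuous_intros sing_cont[OF F.sing_A])
  have JA: "continuous_on (ball 0 1 - {0}) (\<lambda>x. J x \<bullet> A x)"
    unfolding inner_matrix by (intro continuous_on_sum continuous_on_mult Jc Ac)
  note m = LB_measurable_continuous[OF continuous_on_diff[OF JA
        continuous_on_mult[OF cc continuous_on_inner[OF sing_cont[OF sing_U] sing_cont[OF F.sing_V]]]]]
  have "(\<integral>x. J x \<bullet> A x - c (norm x) * (U x \<bullet> V x) \<partial>LB) = (\<integral>x. dv (X' x) \<partial>LB)"
    by (rule integral_cong_AE[OF m borel_measurable_integrable[OF d(1)]]) (use ae in \<open>auto elim: eventually_mono\<close>)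
  then show ?thesis using d(2) by simp
qed

section \<open>Logarithmic derivatives and Riccati inequalities\<close>

definition al :: real where "al = (real CARD('n) - 2) / 2"
definition lq :: "real \<Rightarrow> real" where "lq r = f' r / f r"
definition lq' :: "real \<Rightarrow> real" where "lq' r = (f'' r * f r - f' r * f' r) / (f r * f r)"

lemma al: "1 \<le> al" "real CARD('n) = 2 * al + 2" using N by (simp_all add: al_def diff_divide_distrib)

context
  fixes r :: real assumes r: "0 < r" "r < 1"
begin

lemma f0: "0 < f r" using f_pos r by simp

lemma lq_deriv: "(lq has_real_derivative lq' r) (at r)"
  unfolding lq_def[abs_def] lq'_def by (rule DERIV_divide[OF f'_deriv[OF r] f_deriv[OF r]]) (use f0 in simp)

lemma lq_bound: "0 \<le> lq r" "lq r \<le> inverse r"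
  using f0 f'_nonneg[OF r] f'_le_pr[OF r] by (simp_all add: lq_def pr_def divide_le_eq mult.commute)

text \<open>The profile equation as a Riccati equation for f' / f.\<close>

lemma lq'_eq: "lq' r = (real CARD('n) - 1) * inverse r * (inverse r - lq r) - c r - (lq r)\<^sup>2"
proof -
  have "f'' r / f r = (real CARD('n) - 1) * inverse r * (inverse r - lq r) - c r"
    unfolding f''_inverse[OF r] lq_def pr_def using f0 by (simp add: diff_divide_distrib right_diff_distrib)
  moreover have "lq' r = f'' r / f r - (lq r)\<^sup>2"
    unfolding lq'_def lq_def using f0 by (simp add: diff_divide_distrib power2_eq_square)
  ultimately show ?thesis by simp
qed

lemma lq'_bound:
  assumes C: "\<bar>c r\<bar> \<le> C" shows "\<bar>lq' r\<bar> \<le> (real CARD('n) + C) * (inverse r)\<^sup>2"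
proof -
  have C0: "0 \<le> C" using C by linarith
  have i2: "1 \<le> (inverse r)\<^sup>2" using power_mono[OF i1[OF r], of 2] by simp
  have "(real CARD('n) - 1) * inverse r * (inverse r - lq r) \<le> (real CARD('n) - 1) * inverse r * inverse r"
    using N r lq_bound by (intro mult_left_mono) simp_all
  then have 1: "(real CARD('n) - 1) * inverse r * (inverse r - lq r) \<le> (real CARD('n) - 1) * (inverse r)\<^sup>2"
    by (simp add: power2_eq_square)
  have 2: "0 \<le> (real CARD('n) - 1) * inverse r * (inverse r - lq r)" using N r lq_bound by simp
  have 3: "\<bar>c r\<bar> \<le> C * (inverse r)\<^sup>2" using mult_left_mono[OF i2 C0] C by linarith
  have 4: "(lq r)\<^sup>2 \<le> (inverse r)\<^sup>2" using lq_bound by (intro power_mono)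
  have 5: "0 \<le> (real CARD('n) - 1) * (inverse r)\<^sup>2" using N by simp
  have "\<bar>lq' r\<bar> \<le> (real CARD('n) - 1) * (inverse r)\<^sup>2 + C * (inverse r)\<^sup>2 + (inverse r)\<^sup>2"
    unfolding lq'_eq using 1 2 3 4 5 zero_le_power2[of "lq r"] by linarith
  then show ?thesis by (simp add: algebra_simps)
qed

lemma frac_deriv: "((\<lambda>r. 2 * r / (2 - r\<^sup>2)) has_real_derivative (4 + 2 * r\<^sup>2) / (2 - r\<^sup>2)\<^sup>2) (at r)"
proof -
  have "2 - r\<^sup>2 \<noteq> 0" using r power_le_one[of r 2] by simp
  then show ?thesis by (auto intro!: derivative_eq_intros simp: power2_eq_square field_simps)
qed

lemma frac_bound: "1 \<le> 2 - r\<^sup>2" "0 \<le> 2 * r / (2 - r\<^sup>2)" "2 * r / (2 - r\<^sup>2) \<le> 6"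
  "0 \<le> (4 + 2 * r\<^sup>2) / (2 - r\<^sup>2)\<^sup>2" "(4 + 2 * r\<^sup>2) / (2 - r\<^sup>2)\<^sup>2 \<le> 6"
proof -
  have r2: "r\<^sup>2 \<le> 1" using r power_le_one[of r 2] by simp
  show d: "1 \<le> 2 - r\<^sup>2" using r2 by simp
  then have d2: "1 \<le> (2 - r\<^sup>2)\<^sup>2" by (rule one_le_power)
  show "0 \<le> 2 * r / (2 - r\<^sup>2)" using d r by simp
  show "0 \<le> (4 + 2 * r\<^sup>2) / (2 - r\<^sup>2)\<^sup>2" by simp
  have "2 * r / (2 - r\<^sup>2) \<le> 6 / 1" using d r by (intro frac_le) simp_all
  then show "2 * r / (2 - r\<^sup>2) \<le> 6" by simp
  have "(4 + 2 * r\<^sup>2) / (2 - r\<^sup>2)\<^sup>2 \<le> 6 / 1" using d2 r2 by (intro frac_le) simp_all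
  then show "(4 + 2 * r\<^sup>2) / (2 - r\<^sup>2)\<^sup>2 \<le> 6" by simp
qed

text \<open>By the Riccati equation for f' / f the two sides differ by exactly 2 \<alpha> f' / (r f)
  \<ge> 0. Equivalently, r^(-\<alpha>) f is a supersolution: the power produces the Hardy constant
  \<alpha>^2, and \<open>f\<close> produces the potential c - (N - 1) / r^2.\<close>

lemma riccati_1: "((real CARD('n) - 2) / 2)\<^sup>2 * (inverse r)\<^sup>2 + c r - (real CARD('n) - 1) * (inverse r)\<^sup>2
    \<le> (- (al * (inverse r)\<^sup>2) - lq' r) + (real CARD('n) - 1) * (al * inverse r - lq r) * inverse r - (al * inverse r - lq r)\<^sup>2"
proof -
  have gen: "(- (a * i\<^sup>2) - ((M - 1) * i * (i - l) - k - l\<^sup>2)) + (M - 1) * (a * i - l) * i - (a * i - l)\<^sup>2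
    = ((M - 2) / 2)\<^sup>2 * i\<^sup>2 + k - (M - 1) * i\<^sup>2 + 2 * a * (l * i)" if "M = 2 * a + 2" for M a i l k :: real
    unfolding that by (simp add: power2_eq_square algebra_simps)
  have "0 \<le> 2 * al * (lq r * inverse r)" using al(1) lq_bound r by simp
  then show ?thesis unfolding lq'_eq gen[OF al(2)] by simp
qed

text \<open>The right side equals \<alpha>^2 / r^2 + 4 / (2 - r^2), and 2 - r^2 \<le> 2 makes the
  last term at least 2. The function 2 - r^2 is positive on the ball and has the constant
  two-dimensional Laplacian - 4. The surplus 2 over the Hardy term pays for - |V|^2 in the
  tangential part, also when \<alpha> = 1.\<close>

lemma riccati_2: "((real CARD('n) - 2) / 2)\<^sup>2 * (inverse r)\<^sup>2 + 2
    \<le> (- (al * (inverse r)\<^sup>2) + (4 + 2 * r\<^sup>2) / (2 - r\<^sup>2)\<^sup>2)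
      + (real CARD('n) - 1) * (al * inverse r + 2 * r / (2 - r\<^sup>2)) * inverse r - (al * inverse r + 2 * r / (2 - r\<^sup>2))\<^sup>2"
proof -
  define i where "i = inverse r"
  define g where "g = 2 * r / (2 - r\<^sup>2)"
  \<comment> \<open>All rational functions of \<open>r\<close> that occur become polynomials in
    \<open>e\<close>, because r^2 e = 2 e - 1.\<close>
  define e where "e = 1 / (2 - r\<^sup>2)"
  have d: "2 - r\<^sup>2 > 0" using frac_bound(1) by linarith
  have re: "r\<^sup>2 * e = 2 * e - 1" using d by (simp add: e_def field_simps)
  have re2: "r\<^sup>2 * e\<^sup>2 = 2 * e\<^sup>2 - e"
  proof -
    have "r\<^sup>2 * e\<^sup>2 = (r\<^sup>2 * e) * e" by (simp add: power2_eq_square)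
    also have "\<dots> = 2 * e\<^sup>2 - e" unfolding re by (simp add: power2_eq_square algebra_simps)
    finally show ?thesis .
  qed
  have "(4 + 2 * r\<^sup>2) / (2 - r\<^sup>2)\<^sup>2 = 4 * e\<^sup>2 + 2 * (r\<^sup>2 * e\<^sup>2)" by (simp add: e_def power_divide add_divide_distrib)
  then have h1: "(4 + 2 * r\<^sup>2) / (2 - r\<^sup>2)\<^sup>2 = 8 * e\<^sup>2 - 2 * e" unfolding re2 by simp
  have h2: "g * i = 2 * e" using r by (simp add: g_def i_def e_def)
  have "g\<^sup>2 = 4 * (r\<^sup>2 * e\<^sup>2)" by (simp add: g_def e_def power_divide power_mult_distrib)
  then have h3: "g\<^sup>2 = 8 * e\<^sup>2 - 4 * e" unfolding re2 by simp
  have "(al * i + g)\<^sup>2 = al\<^sup>2 * i\<^sup>2 + 2 * al * (g * i) + g\<^sup>2" by (simp add: power2_eq_square algebra_simps)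
  then have 1: "(al * i + g)\<^sup>2 = al\<^sup>2 * i\<^sup>2 + 4 * al * e + 8 * e\<^sup>2 - 4 * e" unfolding h2 h3 by simp
  have "(real CARD('n) - 1) * (al * i + g) * i = (2 * al + 1) * (al * i\<^sup>2 + g * i)"
    unfolding al(2) by (simp add: power2_eq_square algebra_simps)
  then have 2: "(real CARD('n) - 1) * (al * i + g) * i = 2 * al\<^sup>2 * i\<^sup>2 + al * i\<^sup>2 + 4 * al * e + 2 * e"
    unfolding h2 by (simp add: power2_eq_square algebra_simps)
  have 3: "((real CARD('n) - 2) / 2)\<^sup>2 * i\<^sup>2 = al\<^sup>2 * i\<^sup>2" by (simp add: al_def)
  have "1 / 2 \<le> e" unfolding e_def using d by (intro divide_left_mono) simp_all
  then show ?thesis unfolding i_def[symmetric] g_def[symmetric] h1 1 2 3 by simp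
qed

end

text \<open>The functions \<open>s\<close> of the core inequality are the logarithmic derivatives of \<open>r\<^sup>\<alpha> / f\<close> and
  \<open>r\<^sup>\<alpha> / (2 - r\<^sup>2)\<close>, where \<open>\<alpha>\<close> is \<open>al\<close>.\<close>

lemma stability_smooth:
  assumes cf: "curl_free V A \<rho>"
  shows "0 \<le> (\<integral>x. A x \<bullet> A x - c (norm x) * (V x \<bullet> V x) - V x \<bullet> V x \<partial>(LB :: (real^'n) measure))"
proof (rule curl_free.core_inequality(2)[OF cf N c_cont _ _ riccati_1 riccati_2])
  obtain C where C: "C \<ge> 0" "\<And>r. 0 \<le> r \<Longrightarrow> r \<le> 1 \<Longrightarrow> \<bar>c r\<bar> \<le> C" by (rule c_bounded) blast
  have inv: "((\<lambda>r. al * inverse r) has_real_derivative - (al * (inverse r)\<^sup>2)) (at r)" if "0 < r" for r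
    by (rule DERIV_cong[OF DERIV_cmult[OF DERIV_inverse]]) (use that in \<open>simp_all add: power2_eq_square\<close>)
  show "sing 1 (\<lambda>x::real^'n. al * inverse (norm x) - lq (norm x)) (\<lambda>x h. (- (al * (inverse (norm x))\<^sup>2) - lq' (norm x)) * (sgn x \<bullet> h))"
  proof (rule sing_radial[where C = "al + (real CARD('n) + C)"])
    fix r :: real assume r: "0 < r" "r < 1"
    show "((\<lambda>r. al * inverse r - lq r) has_real_derivative - (al * (inverse r)\<^sup>2) - lq' r) (at r)"
      by (rule DERIV_diff[OF inv[OF r(1)] lq_deriv[OF r]])
    have p: "0 \<le> al * inverse r" "0 \<le> al * (inverse r)\<^sup>2" using al(1) r by simp_all
    have "1 * inverse r \<le> (real CARD('n) + C) * inverse r" using N C(1) r by (intro mult_right_mono) simp_all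
    then show "\<bar>al * inverse r - lq r\<bar> \<le> (al + (real CARD('n) + C)) / r ^ 1"
      unfolding inverse_pow distrib_right using lq_bound[OF r] p by linarith
    show "\<bar>- (al * (inverse r)\<^sup>2) - lq' r\<bar> \<le> (al + (real CARD('n) + C)) / r ^ Suc 1"
      unfolding inverse_pow distrib_right[of al] using lq'_bound[OF r C(2)] r p by linarith
  qed (use al C in simp)
  show "sing 1 (\<lambda>x::real^'n. al * inverse (norm x) + 2 * norm x / (2 - (norm x)\<^sup>2))
    (\<lambda>x h. (- (al * (inverse (norm x))\<^sup>2) + (4 + 2 * (norm x)\<^sup>2) / (2 - (norm x)\<^sup>2)\<^sup>2) * (sgn x \<bullet> h))"
  proof (rule sing_radial[where C = "al + 6" and s = "\<lambda>r. al * inverse r + 2 * r / (2 - r\<^sup>2)"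
        and s' = "\<lambda>r. - (al * (inverse r)\<^sup>2) + (4 + 2 * r\<^sup>2) / (2 - r\<^sup>2)\<^sup>2"])
    fix r :: real assume r: "0 < r" "r < 1"
    show "((\<lambda>r. al * inverse r + 2 * r / (2 - r\<^sup>2)) has_real_derivative - (al * (inverse r)\<^sup>2) + (4 + 2 * r\<^sup>2) / (2 - r\<^sup>2)\<^sup>2) (at r)"
      by (rule DERIV_add[OF inv[OF r(1)] frac_deriv[OF r]])
    have p: "0 \<le> al * inverse r" "0 \<le> al * (inverse r)\<^sup>2" using al(1) r by simp_all
    have "1 \<le> inverse r" "1 \<le> (inverse r)\<^sup>2" using i1[OF r] power_mono[OF i1[OF r], of 2] by simp_all
    then show "\<bar>al * inverse r + 2 * r / (2 - r\<^sup>2)\<bar> \<le> (al + 6) / r ^ 1"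
      "\<bar>- (al * (inverse r)\<^sup>2) + (4 + 2 * r\<^sup>2) / (2 - r\<^sup>2)\<^sup>2\<bar> \<le> (al + 6) / r ^ Suc 1"
      unfolding inverse_pow distrib_right[of al] using frac_bound[OF r] p by linarith+
  qed (use al in simp)
qed

section \<open>From smooth fields to the admissible class\<close>

lemma cb: obtains C where "0 \<le> C" "\<And>x::real^'n. x \<in> space LB \<Longrightarrow> \<bar>c (norm x)\<bar> \<le> C"
proof -
  obtain C where C: "C \<ge> 0" "\<And>r. 0 \<le> r \<Longrightarrow> r \<le> 1 \<Longrightarrow> \<bar>c r\<bar> \<le> C" by (rule c_bounded) blast
  show thesis by (rule that[OF C(1)]) (rule C(2), simp_all)
qed

lemma cm: "(\<lambda>x::real^'n. c (norm x)) \<in> borel_measurable LB"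
  by (rule LB_measurable_continuous, rule continuous_on_compose2[OF c_cont continuous_on_norm_id]) auto

lemma J_L2: "(\<lambda>x. J x $ i $ j) \<in> borel_measurable LB" "integrable LB (\<lambda>x. (J x $ i $ j)\<^sup>2)"
  using sing_J[of i j 0] sing1_square_integrable[OF N3] unfolding diff_zero by blast+

lemma U_L2: "(\<lambda>x. U x $ i) \<in> borel_measurable LB" "integrable LB (\<lambda>x. (U x $ i)\<^sup>2)"
  using L2_component[of U i] U_A_GL unfolding A_GL_def H1_def by blast+

lemma h10_LB:
  fixes v :: "real^'n \<Rightarrow> real"
  assumes "h10 v g"
  shows "v \<in> borel_measurable LB" "integrable LB (\<lambda>x. (v x)\<^sup>2)" "g j \<in> borel_measurable LB" "integrable LB (\<lambda>x. (g j x)\<^sup>2)"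
proof -
  note H = h10D[OF assms]
  show "v \<in> borel_measurable LB" "g j \<in> borel_measurable LB" by (rule borel_LB[OF H(1)], rule borel_LB[OF H(4)])
  show "integrable LB (\<lambda>x. (v x)\<^sup>2)" by (subst LB_zero_ext(2)) (use H in simp_all)
  show "integrable LB (\<lambda>x. (g j x)\<^sup>2)" by (subst LB_zero_ext(2)) (use H in simp_all)
qed

lemma L2_lim_mol:
  fixes v :: "real^'n \<Rightarrow> real"
  assumes h: "h10 v g"
  shows "L2_lim LB (\<lambda>k. mol k v) v" "L2_lim LB (\<lambda>k. pderiv_at j (mol k v)) (g j)"
proof -
  note H = h10D[OF h]
  have s: "smooth (mol k v)" for k by (rule Cc_smooth[OF mol_Cc[OF H(8,2)]])
  have i: "integrable LB (\<lambda>x. (\<phi> x)\<^sup>2)" if "smooth \<phi>" for \<phi> :: "real^'n \<Rightarrow> real"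
    using weak_pderiv_smooth(2)[OF N3 smooth_mult[OF that that]] by (simp add: power2_eq_square)
  show "L2_lim LB (\<lambda>k. mol k v) v" "L2_lim LB (\<lambda>k. pderiv_at j (mol k v)) (g j)"
    unfolding L2_lim_def
    by (intro conjI allI smooth_LB i smooth_pderiv s h10_LB[OF h] mol_pderiv_tendsto[OF h])+
qed

text \<open>The locale \<open>curl_free\<close> wants a Jacobian that is symmetric at every point;
  convolution provides this from the almost everywhere symmetry of the weak Jacobian.\<close>

lemma AE_sym_mol:
  fixes g h :: "real^'n \<Rightarrow> real"
  assumes g: "integrable lborel g" "\<And>x. 1 \<le> norm x \<Longrightarrow> g x = 0" and h: "integrable lborel h" "\<And>x. 1 \<le> norm x \<Longrightarrow> h x = 0"
    and ae: "AE x in LB. g x = h x"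
  shows "mol k g x = mol k h x"
proof -
  have "AE x in lebesgue. x \<in> ball 0 1 \<longrightarrow> g x = h x" using ae by (subst (asm) AE_restrict_space_iff) simp_all
  then have "AE x in lborel. x \<in> ball 0 1 \<longrightarrow> g x = h x" by (simp only: AE_completion_iff)
  then have e: "AE x in lborel. g x = h x"
  proof eventually_elim
    case (elim x)
    then show ?case using g(2)[of x] h(2)[of x] by (cases "norm x < 1") simp_all
  qed
  have "(\<integral>y. g y * moll (mdel k) (z - y) \<partial>lborel) = (\<integral>y. h y * moll (mdel k) (z - y) \<partial>lborel)" for z
  proof (rule integral_cong_AE)
    note C = Cc_moll[OF mdel(1)[of k]]
    show "(\<lambda>y. g y * moll (mdel k) (z - y)) \<in> borel_measurable lborel" "(\<lambda>y. h y * moll (mdel k) (z - y)) \<in> borel_measurable lborel"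
      by (rule borel_measurable_integrable[OF Cc_integrable_mult[OF C g(1)]], rule borel_measurable_integrable[OF Cc_integrable_mult[OF C h(1)]])
    show "AE y in lborel. g y * moll (mdel k) (z - y) = h y * moll (mdel k) (z - y)" using e by eventually_elim simp
  qed
  then show ?thesis unfolding mol_def conv_def .
qed

text \<open>Both claims hold for the mollified fields, which satisfy \<open>curl_free\<close>, and
  pass to the limit in L2. The weight c + 1 collects the two terms with |V|^2 of
  \<open>stability_smooth\<close> in one quadratic form.\<close>

lemma
  fixes v :: "'n \<Rightarrow> real^'n \<Rightarrow> real" and g :: "'n \<Rightarrow> 'n \<Rightarrow> real^'n \<Rightarrow> real"
  assumes h: "\<And>i. h10 (v i) (g i)" and sym: "\<And>i j. AE x in LB. g i j x = g j i x"
  shows euler_lagrange: "integrable LB (\<lambda>x. (\<Sum>i\<in>UNIV. \<Sum>j\<in>UNIV. J x $ i $ j * g i j x) - (\<Sum>i\<in>UNIV. c (norm x) * (U x $ i * v i x)))"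
      "(\<integral>x. (\<Sum>i\<in>UNIV. \<Sum>j\<in>UNIV. J x $ i $ j * g i j x) - (\<Sum>i\<in>UNIV. c (norm x) * (U x $ i * v i x)) \<partial>LB) = 0"
    and stability: "integrable LB (\<lambda>x. (\<Sum>i\<in>UNIV. \<Sum>j\<in>UNIV. g i j x * g i j x) - (\<Sum>i\<in>UNIV. (c (norm x) + 1) * (v i x * v i x)))"
      "0 \<le> (\<integral>x. (\<Sum>i\<in>UNIV. \<Sum>j\<in>UNIV. g i j x * g i j x) - (\<Sum>i\<in>UNIV. (c (norm x) + 1) * (v i x * v i x)) \<partial>LB)"
proof -
  note H = h10D[OF h]
  obtain C where C: "0 \<le> C" "\<And>x::real^'n. x \<in> space LB \<Longrightarrow> \<bar>c (norm x)\<bar> \<le> C" by (rule cb) blast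
  have C1: "0 \<le> C + 1" "\<And>x::real^'n. x \<in> space LB \<Longrightarrow> \<bar>c (norm x) + 1\<bar> \<le> C + 1"
    using C(1) by simp (use C(2) in \<open>rule order_trans[OF abs_triangle_ineq add_mono]\<close>, simp_all)
  have cm1: "(\<lambda>x::real^'n. c (norm x) + 1) \<in> borel_measurable LB" using cm by simp
  define V where "V k x = (\<chi> i. mol k (v i) x)" for k x
  define A where "A k x = (\<chi> i j. pderiv_at j (mol k (v i)) x)" for k x
  have cf: "curl_free (V k) (A k) (mrho k)" for k
  proof
    show "Cc (\<lambda>x. V k x $ i)" for i unfolding V_def vec_lambda_beta by (rule mol_Cc[OF H(8,2)])
    show "A k x $ i $ j = pderiv_at j (\<lambda>x. V k x $ i) x" for x i j unfolding A_def V_def vec_lambda_beta ..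
    show "A k x $ i $ j = A k x $ j $ i" for x i j
      unfolding A_def vec_lambda_beta mol_pderiv[OF H(8,7)] by (simp only: AE_sym_mol[OF H(9,5) H(9,5) sym[of i j], of k x])
    show "mrho k < 1" by (rule mrho)
    show "V k x = 0" if "mrho k < norm x" for x
      unfolding V_def vec_eq_iff vec_lambda_beta zero_index by (intro allI mol_zero[OF H(2)]) (use that in simp_all)
  qed
  note LJ = L2_lim_const[OF J_L2] and LU = L2_lim_const[OF U_L2] and Lv = L2_lim_mol(1)[OF h] and Lg = L2_lim_mol(2)[OF h]
  note a = L2_lim_form[OF LJ Lg LU Lv cm C(2,1)] and b = L2_lim_form[OF Lg Lg Lv Lv cm1 C1(2,1)]
  show "integrable LB (\<lambda>x. (\<Sum>i\<in>UNIV. \<Sum>j\<in>UNIV. J x $ i $ j * g i j x) - (\<Sum>i\<in>UNIV. c (norm x) * (U x $ i * v i x)))" by (rule a(1))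
  show "integrable LB (\<lambda>x. (\<Sum>i\<in>UNIV. \<Sum>j\<in>UNIV. g i j x * g i j x) - (\<Sum>i\<in>UNIV. (c (norm x) + 1) * (v i x * v i x)))" by (rule b(1))
  have ea: "(\<Sum>i\<in>UNIV. \<Sum>j\<in>UNIV. J x $ i $ j * pderiv_at j (mol k (v i)) x) - (\<Sum>i\<in>UNIV. c (norm x) * (U x $ i * mol k (v i) x))
      = J x \<bullet> A k x - c (norm x) * (U x \<bullet> V k x)" for k x
    unfolding inner_matrix inner_vec_def A_def V_def vec_lambda_beta sum_distrib_left inner_real_def ..
  have eb: "(\<Sum>i\<in>UNIV. \<Sum>j\<in>UNIV. pderiv_at j (mol k (v i)) x * pderiv_at j (mol k (v i)) x)
        - (\<Sum>i\<in>UNIV. (c (norm x) + 1) * (mol k (v i) x * mol k (v i) x))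
      = A k x \<bullet> A k x - c (norm x) * (V k x \<bullet> V k x) - V k x \<bullet> V k x" for k x
    unfolding inner_matrix inner_vec_def A_def V_def vec_lambda_beta sum_distrib_left[symmetric] inner_real_def by (simp add: distrib_right)
  have la: "(\<lambda>k. \<integral>x. J x \<bullet> A k x - c (norm x) * (U x \<bullet> V k x) \<partial>LB) \<longlonglongrightarrow>
      (\<integral>x. (\<Sum>i\<in>UNIV. \<Sum>j\<in>UNIV. J x $ i $ j * g i j x) - (\<Sum>i\<in>UNIV. c (norm x) * (U x $ i * v i x)) \<partial>LB)"
    unfolding ea[symmetric] by (rule a(2))
  have lb: "(\<lambda>k. \<integral>x. A k x \<bullet> A k x - c (norm x) * (V k x \<bullet> V k x) - V k x \<bullet> V k x \<partial>LB) \<longlonglongrightarrow>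
      (\<integral>x. (\<Sum>i\<in>UNIV. \<Sum>j\<in>UNIV. g i j x * g i j x) - (\<Sum>i\<in>UNIV. (c (norm x) + 1) * (v i x * v i x)) \<partial>LB)"
    unfolding eb[symmetric] by (rule b(2))
  show "(\<integral>x. (\<Sum>i\<in>UNIV. \<Sum>j\<in>UNIV. J x $ i $ j * g i j x) - (\<Sum>i\<in>UNIV. c (norm x) * (U x $ i * v i x)) \<partial>LB) = 0"
    using la unfolding euler_lagrange_smooth[OF cf] LIMSEQ_const_iff by (rule HOL.sym)
  show "0 \<le> (\<integral>x. (\<Sum>i\<in>UNIV. \<Sum>j\<in>UNIV. g i j x * g i j x) - (\<Sum>i\<in>UNIV. (c (norm x) + 1) * (v i x * v i x)) \<partial>LB)"
    by (rule LIMSEQ_le_const[OF lb]) (use stability_smooth[OF cf] in blast)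
qed

section \<open>The comparison of energies\<close>

definition e1 :: "real^'n \<Rightarrow> real" where "e1 x = 1/2 * (norm (J x))\<^sup>2 + 1 / (2 * \<epsilon>\<^sup>2) * W (1 - (f (norm x))\<^sup>2)"

lemma norm_U: "x \<noteq> 0 \<Longrightarrow> (norm (U x))\<^sup>2 = (f (norm x))\<^sup>2" by (simp add: U_def norm_sgn power_mult_distrib)

lemma e1_nonneg: "0 \<le> e1 x"
  unfolding e1_def using W_nonneg[of "1 - (f (norm x))\<^sup>2"] by simp

lemma e1_integrable: "integrable LB e1"
proof -
  have J: "integrable LB (\<lambda>x. (norm (J x))\<^sup>2)" unfolding norm_sq_matrix using J_L2(2) by simp
  have Wc: "continuous_on {0..1} (\<lambda>r. W (1 - (f r)\<^sup>2))"
    by (intro continuous_on_compose2[OF W_cont] continuous_intros f_cont) auto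
  have "bounded ((\<lambda>r. W (1 - (f r)\<^sup>2)) ` {0..1})" by (intro compact_imp_bounded compact_continuous_image Wc) simp
  from this[unfolded bounded_iff] obtain B where B: "\<forall>y\<in>(\<lambda>r. W (1 - (f r)\<^sup>2)) ` {0..1}. norm y \<le> B" ..
  have "integrable LB (\<lambda>x::real^'n. W (1 - (f (norm x))\<^sup>2))"
  proof (rule LB_integrable_bounded)
    show "continuous_on (ball 0 1 - {0}) (\<lambda>x::real^'n. W (1 - (f (norm x))\<^sup>2))"
      by (rule continuous_on_compose2[OF Wc continuous_on_norm_id]) auto
    show "\<bar>W (1 - (f (norm x))\<^sup>2)\<bar> \<le> B" if "x \<in> ball 0 1 - {0}" for x :: "real^'n"
      using B that by simp
  qed
  then show ?thesis unfolding e1_def[abs_def] using J by (intro Bochner_Integration.integrable_add integrable_mult_right)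
qed

lemma energy_U: "E_GL W \<epsilon> U = ennreal (\<integral>x. e1 x \<partial>LB)"
proof -
  have "E_GL W \<epsilon> U = (\<integral>\<^sup>+x. ennreal (e1 x) \<partial>LB)"
    unfolding E_GL_def
  proof (rule nn_integral_cong_AE)
    show "AE x in LB. ennreal (1/2 * (norm (weak_jacobian (ball 0 1) U x))\<^sup>2 + 1 / (2 * \<epsilon>\<^sup>2) * W (1 - (norm (U x))\<^sup>2)) = ennreal (e1 x)"
      using U_jacobian_AE LB_nonzero by eventually_elim (simp add: e1_def norm_U)
  qed
  also have "\<dots> = ennreal (\<integral>x. e1 x \<partial>LB)" by (rule nn_integral_eq_integral[OF e1_integrable]) (simp add: e1_nonneg)
  finally show ?thesis .
qed

text \<open>The energy density of the competitor is at least \<open>e1 x + D x\<close>: expand the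
  square of the Jacobian and use the tangent of \<open>W\<close> at 1 - f^2. In the integral of
  \<open>D\<close> the first-order terms vanish by \<open>euler_lagrange\<close>; the second-order
  terms are half of the form in \<open>stability\<close> plus half of |v|^2, and the latter is the
  gap.\<close>

lemma energy_gap:
  assumes U2: "U2 \<in> A_GL" "gradient_field (ball 0 1) U2"
  obtains v :: "'n \<Rightarrow> real^'n \<Rightarrow> real" where "integrable LB (\<lambda>x. \<Sum>i\<in>UNIV. (v i x)\<^sup>2)" "AE x in LB. \<forall>i. U2 x $ i = U x $ i + v i x"
    "ennreal ((\<integral>x. e1 x \<partial>LB) + 1/2 * (\<integral>x. (\<Sum>i\<in>UNIV. (v i x)\<^sup>2) \<partial>LB)) \<le> E_GL W \<epsilon> U2"
proof -
  obtain v2 g2 where h2: "\<And>i. h10 (v2 i) (g2 i)" and v2: "AE x in LB. \<forall>i. U2 x $ i = x $ i + v2 i x"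
    and g2: "AE x in LB. \<forall>i j. weak_jacobian (ball 0 1) U2 x $ i $ j = (if i = j then 1 else 0) + g2 i j x"
    and w2: "has_weak_jacobian (ball 0 1) U2 (weak_jacobian (ball 0 1) U2)" "U2 \<in> borel_measurable LB"
  proof (rule A_GL_E[OF N3 U2(1)])
    fix v g
    assume "\<And>i. h10 (v i) (g i)" "AE x in LB. \<forall>i. U2 x $ i = x $ i + v i x"
      "AE x in LB. \<forall>i j. weak_jacobian (ball 0 1) U2 x $ i $ j = (if i = j then 1 else 0) + g i j x"
      "has_weak_jacobian (ball 0 1) U2 (weak_jacobian (ball 0 1) U2)" "U2 \<in> borel_measurable LB"
    then show thesis by (rule that)
  qed
  define v where "v i x = v2 i x - v1 i x" for i x
  define g where "g i j x = g2 i j x - g1 i j x" for i j x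
  have h: "h10 (v i) (g i)" for i unfolding v_def[abs_def] g_def[abs_def] by (rule h10_diff[OF h2 h10_vortex])
  have sym: "AE x in LB. g i j x = g j i x" for i j
    using gradient_sym[OF U2(2) w2(1), of i j] g2
  proof eventually_elim
    case (elim x)
    have "(if i = j then 1 else 0) + g2 i j x = (if j = i then 1 else 0) + g2 j i x" using elim by metis
    moreover have "g1 i j x = g1 j i x" by (simp add: g1_def J_sym[of x i j])
    ultimately show ?case by (simp add: g_def split: if_splits)
  qed
  note EL = euler_lagrange[OF h sym] and ST = stability[OF h sym]
  have V2: "integrable LB (\<lambda>x. \<Sum>i\<in>UNIV. (v i x)\<^sup>2)" using h10_LB(2)[OF h] by simp
  have ve: "AE x in LB. \<forall>i. U2 x $ i = U x $ i + v i x"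
    using v2 AE_space by eventually_elim (simp add: U_eq v_def)
  have ge: "AE x in LB. \<forall>i j. weak_jacobian (ball 0 1) U2 x $ i $ j = J x $ i $ j + g i j x"
    using g2 AE_space LB_nonzero by eventually_elim (simp add: g_def g1_def)
  define D where "D x = ((\<Sum>i\<in>UNIV. \<Sum>j\<in>UNIV. J x $ i $ j * g i j x) - (\<Sum>i\<in>UNIV. c (norm x) * (U x $ i * v i x)))
    + (1/2 * ((\<Sum>i\<in>UNIV. \<Sum>j\<in>UNIV. g i j x * g i j x) - (\<Sum>i\<in>UNIV. (c (norm x) + 1) * (v i x * v i x)))
      + 1/2 * (\<Sum>i\<in>UNIV. (v i x)\<^sup>2))" for x
  note iD = Bochner_Integration.integrable_add[OF EL(1) Bochner_Integration.integrable_add[OF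
        integrable_mult_right[OF ST(1), of "1/2"] integrable_mult_right[OF V2, of "1/2"]]]
  have iD': "integrable LB D" using iD unfolding D_def[abs_def] by simp
  have "(\<integral>x. D x \<partial>LB) = 0 + (1/2 * (\<integral>x. (\<Sum>i\<in>UNIV. \<Sum>j\<in>UNIV. g i j x * g i j x) - (\<Sum>i\<in>UNIV. (c (norm x) + 1) * (v i x * v i x)) \<partial>LB)
      + 1/2 * (\<integral>x. (\<Sum>i\<in>UNIV. (v i x)\<^sup>2) \<partial>LB))"
    unfolding D_def
    by (simp only: Bochner_Integration.integral_add[OF EL(1) Bochner_Integration.integrable_add[OF
        integrable_mult_right[OF ST(1), of "1/2"] integrable_mult_right[OF V2, of "1/2"]]]
        Bochner_Integration.integral_add[OF integrable_mult_right[OF ST(1), of "1/2"] integrable_mult_right[OF V2, of "1/2"]]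
        integral_mult_right_zero EL(2))
  then have intD: "1/2 * (\<integral>x. (\<Sum>i\<in>UNIV. (v i x)\<^sup>2) \<partial>LB) \<le> (\<integral>x. D x \<partial>LB)" using ST(2) by linarith
  have pw: "AE x in LB. e1 x + D x \<le> 1/2 * (norm (weak_jacobian (ball 0 1) U2 x))\<^sup>2 + 1 / (2 * \<epsilon>\<^sup>2) * W (1 - (norm (U2 x))\<^sup>2)"
    using ve ge AE_space LB_nonzero
  proof eventually_elim
    case (elim x)
    have x: "0 < norm x" "norm x < 1" "x \<noteq> 0" using elim(3,4) by simp_all
    define a where "a = (\<Sum>i\<in>UNIV. \<Sum>j\<in>UNIV. J x $ i $ j * g i j x)"
    define b where "b = (\<Sum>i\<in>UNIV. \<Sum>j\<in>UNIV. g i j x * g i j x)"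
    define p where "p = (\<Sum>i\<in>UNIV. U x $ i * v i x)"
    define q where "q = (\<Sum>i\<in>UNIV. (v i x)\<^sup>2)"
    define y where "y = 1 - (f (norm x))\<^sup>2"
    have sq: "(s + t)\<^sup>2 = s\<^sup>2 + 2 * (s * t) + t * t" for s t :: real by (simp add: power2_eq_square algebra_simps)
    have 1: "(norm (weak_jacobian (ball 0 1) U2 x))\<^sup>2 = (norm (J x))\<^sup>2 + 2 * a + b"
      unfolding norm_sq_matrix a_def b_def using elim(2) by (simp add: sq sum.distrib sum_distrib_left)
    \<comment> \<open>The increment of |U|^2 is exactly 2 p + q, so a single tangent inequality for
      \<open>W\<close> produces both the first-order term in p and the second-order term in
      q.\<close>
    have "(norm (U2 x))\<^sup>2 = (norm (U x))\<^sup>2 + 2 * p + q"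
      unfolding norm_sq_vec p_def q_def using elim(1) by (simp add: sq sum.distrib sum_distrib_left power2_eq_square[of "v _ _"])
    then have 2: "1 - (norm (U2 x))\<^sup>2 = y - (2 * p + q)" by (simp add: norm_U[OF x(3)] y_def)
    have "y < 1" using f_pos[of "norm x"] x by (simp add: y_def)
    moreover have "1 - (norm (U2 x))\<^sup>2 \<le> 1" by simp
    ultimately have "W y + W' y * (1 - (norm (U2 x))\<^sup>2 - y) \<le> W (1 - (norm (U2 x))\<^sup>2)" by (intro W_tangent)
    then have "W y - W' y * (2 * p + q) \<le> W (1 - (norm (U2 x))\<^sup>2)" unfolding 2 by (simp add: algebra_simps)
    then have "1 / (2 * \<epsilon>\<^sup>2) * (W y - W' y * (2 * p + q)) \<le> 1 / (2 * \<epsilon>\<^sup>2) * W (1 - (norm (U2 x))\<^sup>2)"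
      by (intro mult_left_mono) simp_all
    moreover have "1 / (2 * \<epsilon>\<^sup>2) * (W y - W' y * (2 * p + q)) = 1 / (2 * \<epsilon>\<^sup>2) * W y - c (norm x) * p - 1/2 * (c (norm x) * q)"
      using eps by (simp add: c_def y_def field_simps)
    moreover have "D x = a - c (norm x) * p + (1/2 * (b - (c (norm x) + 1) * q) + 1/2 * q)"
      unfolding D_def a_def b_def p_def q_def by (simp only: sum_distrib_left power2_eq_square)
    ultimately show ?case unfolding 1 e1_def y_def[symmetric] by (simp add: algebra_simps)
  qed
  have "ennreal ((\<integral>x. e1 x \<partial>LB) + 1/2 * (\<integral>x. (\<Sum>i\<in>UNIV. (v i x)\<^sup>2) \<partial>LB)) \<le> ennreal (\<integral>x. e1 x + D x \<partial>LB)"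
    using intD by (intro ennreal_leI) (simp add: Bochner_Integration.integral_add[OF e1_integrable iD'])
  \<comment> \<open>\<open>e1 + D\<close> may be negative somewhere while the competitor's density
    is not. The positive part passes to the integral with values in \<open>ennreal\<close>, which
    also covers competitors of infinite energy.\<close>
  also have "\<dots> \<le> ennreal (\<integral>x. max 0 (e1 x + D x) \<partial>LB)"
    using e1_integrable iD' by (intro ennreal_leI integral_mono integrable_max Bochner_Integration.integrable_add) simp_all
  also have "\<dots> = (\<integral>\<^sup>+x. ennreal (max 0 (e1 x + D x)) \<partial>LB)"
    using e1_integrable iD' by (intro nn_integral_eq_integral[symmetric] integrable_max Bochner_Integration.integrable_add) simp_all
  also have "\<dots> \<le> E_GL W \<epsilon> U2"
    unfolding E_GL_def
  proof (rule nn_integral_mono_AE)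
    show "AE x in LB. ennreal (max 0 (e1 x + D x)) \<le> ennreal (1/2 * (norm (weak_jacobian (ball 0 1) U2 x))\<^sup>2 + 1 / (2 * \<epsilon>\<^sup>2) * W (1 - (norm (U2 x))\<^sup>2))"
      using pw
    proof eventually_elim
      case (elim x)
      have "0 \<le> W (1 - (norm (U2 x))\<^sup>2)" by (rule W_nonneg) simp
      then show ?case using elim by (intro ennreal_leI) simp
    qed
  qed
  finally show thesis by (rule that[OF V2 ve])
qed

text \<open>Equality of the energies forces the integral of |v|^2 to vanish, through the second
  summand in \<open>energy_gap\<close>; the energy of \<open>U\<close> is finite, so it can be
  cancelled.\<close>

lemma U_unique_minimizer: "unique_minimizer (E_GL W \<epsilon>) {U \<in> A_GL. gradient_field (ball 0 1) U} U"
  unfolding unique_minimizer_def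
proof (intro conjI ballI impI)
  show "U \<in> {U \<in> A_GL. gradient_field (ball 0 1) U}" using U_A_GL U_gradient by simp
  fix U2 :: "real^'n \<Rightarrow> real^'n" assume "U2 \<in> {U \<in> A_GL. gradient_field (ball 0 1) U}"
  then have U2: "U2 \<in> A_GL" "gradient_field (ball 0 1) U2" by simp_all
  obtain v :: "'n \<Rightarrow> real^'n \<Rightarrow> real" where v: "integrable LB (\<lambda>x. \<Sum>i\<in>UNIV. (v i x)\<^sup>2)" "AE x in LB. \<forall>i. U2 x $ i = U x $ i + v i x"
    "ennreal ((\<integral>x. e1 x \<partial>LB) + 1/2 * (\<integral>x. (\<Sum>i\<in>UNIV. (v i x)\<^sup>2) \<partial>LB)) \<le> E_GL W \<epsilon> U2"
    by (rule energy_gap[OF U2]) (rule that)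
  have n: "0 \<le> (\<integral>x. (\<Sum>i\<in>UNIV. (v i x)\<^sup>2) \<partial>LB)" "0 \<le> (\<integral>x. e1 x \<partial>LB)"
    by (auto intro!: integral_nonneg_AE AE_I2 sum_nonneg e1_nonneg)
  show "E_GL W \<epsilon> U \<le> E_GL W \<epsilon> U2"
    unfolding energy_U by (rule order_trans[OF ennreal_leI v(3)]) (use n in simp)
  assume "E_GL W \<epsilon> U2 = E_GL W \<epsilon> U"
  then have "ennreal ((\<integral>x. e1 x \<partial>LB) + 1/2 * (\<integral>x. (\<Sum>i\<in>UNIV. (v i x)\<^sup>2) \<partial>LB)) \<le> ennreal (\<integral>x. e1 x \<partial>LB)"
    using v(3) unfolding energy_U by simp
  then have "(\<integral>x. (\<Sum>i\<in>UNIV. (v i x)\<^sup>2) \<partial>LB) = 0"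
    using n by (simp add: ennreal_le_iff)
  then have "AE x in LB. (\<Sum>i\<in>UNIV. (v i x)\<^sup>2) = 0"
    using integral_nonneg_eq_0_iff_AE[OF v(1) AE_I2[OF sum_nonneg[OF zero_le_power2]]] by simp
  with v(2) show "AE x in LB. U2 x = U x"
    by eventually_elim (simp add: sum_nonneg_eq_0_iff vec_eq_iff)
qed

end

theorem theorem1:
  fixes W W' W'' f :: "real \<Rightarrow> real" and \<epsilon> :: real
  assumes dim: "4 \<le> CARD('n::finite)" "CARD('n) \<le> 6"
    and W_nonneg: "\<And>t. t \<le> 1 \<Longrightarrow> 0 \<le> W t"
    and W_0: "W 0 = 0"
    and W_convex: "convex_on {..1} W"
    and W_deriv: "\<And>t. t \<le> 1 \<Longrightarrow> (W has_real_derivative W' t) (at t within {..1})"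
    and W'_deriv: "\<And>t. t \<le> 1 \<Longrightarrow> (W' has_real_derivative W'' t) (at t within {..1})"
    and W''_cont: "continuous_on {..1} W''"
    and eps: "0 < \<epsilon>"
    and profile: "vortex_profile CARD('n) W' \<epsilon> f"
  shows "unique_minimizer (E_GL W \<epsilon>) {U \<in> A_GL. gradient_field (ball 0 1) U}
           (vortex f :: real^'n \<Rightarrow> real^'n)"
proof -
  from profile obtain f' f'' where p: "continuous_on {0..1} f" "f 0 = 0" "f 1 = 1"
    "\<forall>r\<in>{0<..<1}. (f has_real_derivative f' r) (at r) \<and> (f' has_real_derivative f'' r) (at r) \<and>
        - f'' r - (real CARD('n) - 1) / r * f' r + (real CARD('n) - 1) / r\<^sup>2 * f r
          = 1 / \<epsilon>\<^sup>2 * f r * W' (1 - (f r)\<^sup>2)"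
    unfolding vortex_profile_def by blast
  interpret V: vortex_field W W' W'' f f' f'' \<epsilon> "TYPE('n)"
    by unfold_locales (use assms p in \<open>simp_all\<close>)
  have "vortex f = V.U" by (simp add: fun_eq_iff vortex_def V.U_def sgn_div_norm)
  then show ?thesis using V.U_unique_minimizer by simp
qed

end
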